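(* Let $[X,\mathcal B,m,\nu]$ be a reversible random walk space, $p>1$, for each $x$ let $A_x,B_x\subset\mathrm{supp}(m_x)$ be non-null measurable sets with $A_x\cup B_x=\mathrm{supp}(m_x)$, and assume either $\nu(X)<\infty$, or $\nu(X)=+\infty$ and $p\ge2$. Let $T>0$. For any $u_0\in L^2(X,\nu)$ and $f\in L^2(0,T;L^2(X,\nu))$ the problem $$u_t-\Delta_{1,A}^mu-\Delta_{p,B}^mu\ni f\ \text{on }[0,T],\qquad u(0)=u_0,$$ has a unique strong solution $u=u_{u_0,f}$. Moreover, for $u=u_{u_0,f}$, $\tilde u=u_{\tilde u_0,\tilde f}$, all $0\le t\le T$ and $1\le r\le\infty$, $$\|(u(t)-\tilde u(t))^+\|_{L^r(X,\nu)}\le\|(u_0-\tilde u_0)^+\|_{L^r(X,\nu)}+\int_0^t\|(f(s)-\tilde f(s))^+\|_{L^r(X,\nu)}\,ds.$$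
   Context: A random walk space $[X,\mathcal B,m,\nu]$: measurable space with countably generated $\sigma$-algebra, probability measures $m_x$ with $x\mapsto m_x(B)$ measurable, $\sigma$-finite invariant $\nu$ ($\nu(A)=\int m_x(A)\,d\nu(x)$); reversible: $dm_x(y)d\nu(x)=dm_y(x)d\nu(y)$. $\nabla u(x,y)=u(y)-u(x)$. The sets $\{(x,y):y\in A_x\}$, $\{(x,y):y\in B_x\}$ are measurable; $K_A(x,y)=\frac12(\chi_{A_x}(y)+\chi_{A_y}(x))$, $K_B(x,y)=\frac12(\chi_{B_x}(y)+\chi_{B_y}(x))$. $\mathcal F_{A,1,m}(u)=\frac12\int|\nabla u|K_A\,dm_x(y)d\nu(x)$ on $L^2(X,\nu)$ ($+\infty$ if infinite); $(u,v)\in\Delta_{1,A}^m$ iff $(u,-v)\in\partial_{L^2(X,\nu)}\mathcal F_{A,1,m}(u)$ (convex subdifferential). $(u,v)\in\Delta_{p,B}^m$ iff $u,v\in L^2(X,\nu)$, $\int K_B|\nabla u|^p\,dm_x(y)d\nu(x)<\infty$, $v(x)=\int_XK_B(x,y)|\nabla u(x,y)|^{p-2}\nabla u(x,y)\,dm_x(y)$. With $\mathcal A=-\Delta_{1,A}^m-\Delta_{p,B}^m$ (sum of operators), the problem means $u_t+\mathcal Au\ni f$; a strong solution is $u\in C([0,T];L^2(X,\nu))\cap W^{1,2}_{\rm loc}(0,T;L^2(X,\nu))$ with $u(0)=u_0$, $u(t)$ in the domain of $\mathcal A$ and $f(t)-u_t(t)\in\mathcal A(u(t))$ for a.e. $t$.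 *)

theory Defs
  imports "HOL-Probability.Probability"
begin

text \<open>The measurable space (X, B) is (space nu, sets nu); nu is the invariant measure;
  m x is the probability measure m_x.  The kernel condition (m_x probability measures on B
  with x \<mapsto> m_x(B) measurable) is expressed as m \<in> nu \<rightarrow>M prob_algebra nu.\<close>

definition random_walk_space :: "'a measure \<Rightarrow> ('a \<Rightarrow> 'a measure) \<Rightarrow> bool" where
  "random_walk_space nu m \<longleftrightarrow>
     (\<exists>G. countable G \<and> sets nu = sigma_sets (space nu) G) \<and>
     m \<in> nu \<rightarrow>\<^sub>M prob_algebra nu \<and>
     sigma_finite_measure nu \<and>
     (\<forall>C\<in>sets nu. emeasure nu C = (\<integral>\<^sup>+x. emeasure (m x) C \<partial>nu))"

definition reversible :: "'a measure \<Rightarrow> ('a \<Rightarrow> 'a measure) \<Rightarrow> bool" where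
  "reversible nu m \<longleftrightarrow>
     (\<forall>C\<in>sets (nu \<Otimes>\<^sub>M nu).
        (\<integral>\<^sup>+x. \<integral>\<^sup>+y. indicator C (x, y) \<partial>m x \<partial>nu) =
        (\<integral>\<^sup>+x. \<integral>\<^sup>+y. indicator C (y, x) \<partial>m x \<partial>nu))"

definition L2 :: "'a measure \<Rightarrow> ('a \<Rightarrow> real) set" where
  "L2 nu = {u. u \<in> borel_measurable nu \<and> integrable nu (\<lambda>x. (u x)\<^sup>2)}"

definition L2_norm :: "'a measure \<Rightarrow> ('a \<Rightarrow> real) \<Rightarrow> real" where
  "L2_norm nu u = sqrt (\<integral>x. (u x)\<^sup>2 \<partial>nu)"

definition Lr_norm :: "'a measure \<Rightarrow> ereal \<Rightarrow> ('a \<Rightarrow> real) \<Rightarrow> ennreal" where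
  "Lr_norm nu r g =
     (if r = \<infinity> then esssup nu (\<lambda>x. ennreal \<bar>g x\<bar>)
      else (let I = (\<integral>\<^sup>+x. ennreal (\<bar>g x\<bar> powr real_of_ereal r) \<partial>nu)
            in if I = \<infinity> then \<infinity> else ennreal (enn2real I powr (1 / real_of_ereal r))))"

definition pos_part :: "('a \<Rightarrow> real) \<Rightarrow> ('a \<Rightarrow> real)" where
  "pos_part g = (\<lambda>x. max (g x) 0)"

text \<open>L^2(0,T; L^2(X,nu)), represented by jointly measurable functions on [0,T] \<times> X.\<close>

definition L2_time :: "'a measure \<Rightarrow> real \<Rightarrow> (real \<Rightarrow> 'a \<Rightarrow> real) set" where
  "L2_time nu T = {f. (\<lambda>(t, x). f t x) \<in> borel_measurable (restrict_space lborel {0..T} \<Otimes>\<^sub>M nu) \<and>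
        (\<integral>\<^sup>+t\<in>{0..T}. (\<integral>\<^sup>+x. ennreal ((f t x)\<^sup>2) \<partial>nu) \<partial>lborel) < \<infinity>}"

definition Kset :: "('a \<Rightarrow> 'a set) \<Rightarrow> 'a \<Rightarrow> 'a \<Rightarrow> real" where
  "Kset A x y = (indicator (A x) y + indicator (A y) x) / 2"

definition F1 :: "'a measure \<Rightarrow> ('a \<Rightarrow> 'a measure) \<Rightarrow> ('a \<Rightarrow> 'a set) \<Rightarrow> ('a \<Rightarrow> real) \<Rightarrow> ennreal" where
  "F1 nu m A u = (1/2) * (\<integral>\<^sup>+x. \<integral>\<^sup>+y. ennreal (\<bar>u y - u x\<bar> * Kset A x y) \<partial>m x \<partial>nu)"

text \<open>(u,v) \<in> Delta_1A iff (u,-v) \<in> subdifferential of F1 in L^2(X,nu).\<close>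

definition Delta1 :: "'a measure \<Rightarrow> ('a \<Rightarrow> 'a measure) \<Rightarrow> ('a \<Rightarrow> 'a set) \<Rightarrow>
    ('a \<Rightarrow> real) \<Rightarrow> ('a \<Rightarrow> real) \<Rightarrow> bool" where
  "Delta1 nu m A u v \<longleftrightarrow> u \<in> L2 nu \<and> v \<in> L2 nu \<and> F1 nu m A u < \<infinity> \<and>
     (\<forall>w\<in>L2 nu. F1 nu m A w < \<infinity> \<longrightarrow>
        enn2real (F1 nu m A w) - enn2real (F1 nu m A u) \<ge> (\<integral>x. (- v x) * (w x - u x) \<partial>nu))"

definition Deltap :: "'a measure \<Rightarrow> ('a \<Rightarrow> 'a measure) \<Rightarrow> real \<Rightarrow> ('a \<Rightarrow> 'a set) \<Rightarrow>
    ('a \<Rightarrow> real) \<Rightarrow> ('a \<Rightarrow> real) \<Rightarrow> bool" where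
  "Deltap nu m p B u v \<longleftrightarrow> u \<in> L2 nu \<and> v \<in> L2 nu \<and>
     (\<integral>\<^sup>+x. \<integral>\<^sup>+y. ennreal (Kset B x y * \<bar>u y - u x\<bar> powr p) \<partial>m x \<partial>nu) < \<infinity> \<and>
     (AE x in nu. v x = (\<integral>y. Kset B x y * \<bar>u y - u x\<bar> powr (p - 2) * (u y - u x) \<partial>m x))"

definition opA :: "'a measure \<Rightarrow> ('a \<Rightarrow> 'a measure) \<Rightarrow> real \<Rightarrow> ('a \<Rightarrow> 'a set) \<Rightarrow> ('a \<Rightarrow> 'a set) \<Rightarrow>
    ('a \<Rightarrow> real) \<Rightarrow> ('a \<Rightarrow> real) \<Rightarrow> bool" where
  "opA nu m p A B u w \<longleftrightarrow> (\<exists>v1 v2. Delta1 nu m A u v1 \<and> Deltap nu m p B u v2 \<and>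
      (AE x in nu. w x = - v1 x - v2 x))"

text \<open>u \<in> C([0,T]; L^2) \<inter> W^{1,2}_loc(0,T; L^2): the derivative u_t is represented by a
  jointly measurable v, locally square integrable in time with values in L^2, such that
  u(t) = u(a) + \<integral>_a^t v(s) ds in L^2 for 0 < a \<le> t < T.\<close>

definition strong_solution :: "'a measure \<Rightarrow> (('a \<Rightarrow> real) \<Rightarrow> ('a \<Rightarrow> real) \<Rightarrow> bool) \<Rightarrow> real \<Rightarrow>
    ('a \<Rightarrow> real) \<Rightarrow> (real \<Rightarrow> 'a \<Rightarrow> real) \<Rightarrow> (real \<Rightarrow> 'a \<Rightarrow> real) \<Rightarrow> bool" where
  "strong_solution nu Aop T u0 f u \<longleftrightarrow>
     (\<forall>t\<in>{0..T}. u t \<in> L2 nu) \<and>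
     (\<forall>t\<in>{0..T}. ((\<lambda>s. L2_norm nu (\<lambda>x. u s x - u t x)) \<longlongrightarrow> 0) (at t within {0..T})) \<and>
     (AE x in nu. u 0 x = u0 x) \<and>
     (\<exists>v. (\<lambda>(t, x). v t x) \<in> borel_measurable (restrict_space lborel {0<..<T} \<Otimes>\<^sub>M nu) \<and>
        (\<forall>a b. 0 < a \<and> a \<le> b \<and> b < T \<longrightarrow>
           (\<integral>\<^sup>+t\<in>{a..b}. (\<integral>\<^sup>+x. ennreal ((v t x)\<^sup>2) \<partial>nu) \<partial>lborel) < \<infinity>) \<and>
        (\<forall>a t. 0 < a \<and> a \<le> t \<and> t < T \<longrightarrow>
           (AE x in nu. u t x = u a x + (LBINT s=a..t. v s x))) \<and>
        (AE t in lborel. t \<in> {0<..<T} \<longrightarrow> v t \<in> L2 nu \<and> Aop (u t) (\<lambda>x. f t x - v t x)))"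

end

theory Submission
  imports Defs
begin

text \<open>The energy \<open>\<Phi>\<close>, the sum of the total variation type functional over \<open>K\<^sub>A\<close> and of
  \<open>1 / (2 p)\<close> times the integral of \<open>K\<^sub>B |\<nabla>u|\<^sup>p\<close>, is convex, lower semicontinuous and densely defined
  on \<open>L\<^sup>2\<close>.  A subgradient of \<open>\<Phi>\<close> belongs to \<open>\<A>\<close>: differentiating the smooth part along bounded
  directions leaves a subgradient of the total variation part, which is bounded by \<open>1\<close>.
  Hence it suffices to solve the gradient flow of \<open>\<Phi>\<close>.  The implicit Euler scheme does this for
  initial values of finite energy, with an error that is controlled by monotonicity; general initial
  values are reached in the limit because \<open>\<surd>t u\<^sub>t\<close> is bounded in \<open>L\<^sup>2\<close> in terms of \<open>\<parallel>u\<^sub>0\<parallel>\<close> and \<open>f\<close> alone.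

  Both summands of \<open>\<A>\<close> are completely accretive.  For a convex \<open>J\<close> with bounded Lipschitz slope
  and for \<open>G(t) = \<parallel>(u\<^sub>0 - u'\<^sub>0)\<^sup>+\<parallel> + \<integral>\<^sub>0\<^sup>t \<parallel>(f - f')\<^sup>+\<parallel>\<close>, the inequality
  \<open>\<integral> J((u(t) - u'(t)) / G(t)) d\<nu> \<le> 1\<close> is preserved in time.  The \<open>L\<^sup>r\<close> norm of a positive part is the
  Luxemburg norm of a countable family of such \<open>J\<close>, which gives the contraction estimate for all
  \<open>r\<close> at once; uniqueness is the case of equal data.\<close>

section \<open>Square integrable functions\<close>

text \<open>The factor 1 / (2 p) is dictated by symmetry: \<open>ker B\<close> is symmetric and
  \<open>psi p\<close> is odd, so under the swap-invariant measure on pairs the derivative of the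
  p-part in a direction \<theta> is half a double integral that folds into minus the integral of
  \<theta> times the p-Laplacian \<open>v2 u\<close>. The obstacle is that \<open>v2 u\<close> is
  not known to lie in L2 when u merely has finite energy, so no sum rule for subdifferentials is at
  hand; the alternative on nu(X) and p makes \<open>v2 u\<close> a sum of an L2 and an L1 function.
  Only the inclusion of the subdifferential in the operator is proved: uniqueness and the estimate
  rest on accretivity of the operator itself. Dividing by G(t) turns an additive bound on a norm
  into invariance of a convex sublevel set, so a norm that may be infinite or not differentiable on
  L2 is never differentiated. The bound on sqrt t times the derivative arises by multiplying each
  discrete energy inequality by its time: summation by parts trades the initial energy for the time
  integral of the energy, which testing with 0 bounds through the L2 norm of u0 and f.\<close>

lemma L2D:
  assumes "u \<in> L2 M"
  shows "u \<in> borel_measurable M" "integrable M (\<lambda>x. (u x)\<^sup>2)"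
  using assms by (auto simp: L2_def)

lemma L2I: "u \<in> borel_measurable M \<Longrightarrow> integrable M (\<lambda>x. (u x)\<^sup>2) \<Longrightarrow> u \<in> L2 M"
  by (auto simp: L2_def)

lemma L2_bound:
  assumes [measurable]: "u \<in> borel_measurable M" and g: "integrable M g"
    and le: "AE x in M. (u x)\<^sup>2 \<le> g x"
  shows "u \<in> L2 M"
proof (rule L2I)
  show "integrable M (\<lambda>x. (u x)\<^sup>2)"
    by (rule Bochner_Integration.integrable_bound[OF g]) (use le in auto)
qed simp

lemma L2_zero [simp]: "(\<lambda>_. 0) \<in> L2 M"
  by (auto simp: L2_def)

lemma L2_scale: "u \<in> L2 M \<Longrightarrow> (\<lambda>x. c * u x) \<in> L2 M"
  by (auto simp: L2_def power_mult_distrib)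

lemma L2_uminus: "u \<in> L2 M \<Longrightarrow> (\<lambda>x. - u x) \<in> L2 M"
  by (auto simp: L2_def)

lemma L2_add:
  assumes "u \<in> L2 M" "v \<in> L2 M"
  shows "(\<lambda>x. u x + v x) \<in> L2 M"
proof -
  note [measurable] = L2D(1)[OF assms(1)] L2D(1)[OF assms(2)]
  have "(a + b)\<^sup>2 \<le> 2 * a\<^sup>2 + 2 * b\<^sup>2" for a b :: real
    using zero_le_power2[of "a - b"] by (simp add: power2_eq_square algebra_simps)
  then show ?thesis
    by (intro L2_bound[where g="\<lambda>x. 2 * (u x)\<^sup>2 + 2 * (v x)\<^sup>2"])
      (use L2D(2)[OF assms(1)] L2D(2)[OF assms(2)] in auto)
qed

lemma L2_diff: "u \<in> L2 M \<Longrightarrow> v \<in> L2 M \<Longrightarrow> (\<lambda>x. u x - v x) \<in> L2 M"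
  using L2_add[of u M "\<lambda>x. - v x"] L2_uminus[of v M] by simp

lemma L2_sum: "(\<And>i. i \<in> I \<Longrightarrow> u i \<in> L2 M) \<Longrightarrow> (\<lambda>x. \<Sum>i\<in>I. u i x) \<in> L2 M"
  by (induction I rule: infinite_finite_induct) (auto intro: L2_add)

lemma L2_dominated:
  assumes "u \<in> L2 M" "v \<in> borel_measurable M" "AE x in M. \<bar>v x\<bar> \<le> \<bar>u x\<bar>"
  shows "v \<in> L2 M"
  by (rule L2_bound[OF assms(2) L2D(2)[OF assms(1)]]) (use assms(3) in \<open>auto simp: abs_le_square_iff\<close>)

lemma L2_abs: "u \<in> L2 M \<Longrightarrow> (\<lambda>x. \<bar>u x\<bar>) \<in> L2 M"
  by (auto simp: L2_def)

lemma L2_mult_integrable: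
  assumes "u \<in> L2 M" "v \<in> L2 M"
  shows "integrable M (\<lambda>x. u x * v x)"
proof -
  note [measurable] = L2D(1)[OF assms(1)] L2D(1)[OF assms(2)]
  have "\<bar>a * b\<bar> \<le> a\<^sup>2 + b\<^sup>2" for a b :: real
    using zero_le_power2[of "\<bar>a\<bar> - \<bar>b\<bar>"] zero_le_power2[of a] zero_le_power2[of b]
    unfolding abs_mult using mult_nonneg_nonneg[OF abs_ge_zero[of a] abs_ge_zero[of b]]
    unfolding power2_diff power2_abs by linarith
  then have le: "norm (u x * v x) \<le> norm ((u x)\<^sup>2 + (v x)\<^sup>2)" for x
    by (metis abs_of_nonneg real_norm_def sum_power2_ge_zero)
  show ?thesis
    by (rule Bochner_Integration.integrable_bound[OF Bochner_Integration.integrable_add[OF L2D(2)[OF assms(1)] L2D(2)[OF assms(2)]]])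
      (use le in simp_all)
qed

lemma L2_norm_nonneg [simp]: "0 \<le> L2_norm M u"
  by (simp add: L2_norm_def)

lemma L2_norm_sq: "(L2_norm M u)\<^sup>2 = (\<integral>x. (u x)\<^sup>2 \<partial>M)"
  by (simp add: L2_norm_def)

lemma L2_norm_zero [simp]: "L2_norm M (\<lambda>_. 0) = 0"
  by (simp add: L2_norm_def)

lemma L2_norm_scale: "L2_norm M (\<lambda>x. c * u x) = \<bar>c\<bar> * L2_norm M u"
  by (simp add: L2_norm_def power_mult_distrib real_sqrt_mult)

lemma L2_norm_uminus [simp]: "L2_norm M (\<lambda>x. - u x) = L2_norm M u"
  by (simp add: L2_norm_def)

lemma L2_norm_minus_commute: "L2_norm M (\<lambda>x. u x - v x) = L2_norm M (\<lambda>x. v x - u x)"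
  by (simp add: L2_norm_def power2_commute)

lemma L2_norm_cong_AE:
  assumes "AE x in M. u x = v x" "u \<in> borel_measurable M" "v \<in> borel_measurable M"
  shows "L2_norm M u = L2_norm M v"
  unfolding L2_norm_def using assms by (auto intro!: arg_cong[where f=sqrt] integral_cong_AE)

lemma L2_norm_sq_nn:
  assumes "u \<in> L2 M"
  shows "(\<integral>\<^sup>+x. ennreal ((u x)\<^sup>2) \<partial>M) = ennreal ((L2_norm M u)\<^sup>2)"
  by (simp add: L2_norm_sq nn_integral_eq_integral L2D(2)[OF assms])

lemma L2_norm_add_sq:
  assumes "u \<in> L2 M" "v \<in> L2 M"
  shows "(L2_norm M (\<lambda>x. u x + v x))\<^sup>2 = (L2_norm M u)\<^sup>2 + 2 * (\<integral>x. u x * v x \<partial>M) + (L2_norm M v)\<^sup>2"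
proof -
  note L2D(2)[OF assms(1), simp] L2D(2)[OF assms(2), simp] L2_mult_integrable[OF assms, simp]
  have "(\<integral>x. (u x + v x)\<^sup>2 \<partial>M) = (\<integral>x. (u x)\<^sup>2 + 2 * (u x * v x) + (v x)\<^sup>2 \<partial>M)"
    by (simp add: power2_sum algebra_simps)
  also have "\<dots> = (\<integral>x. (u x)\<^sup>2 \<partial>M) + 2 * (\<integral>x. u x * v x \<partial>M) + (\<integral>x. (v x)\<^sup>2 \<partial>M)"
    by simp
  finally show ?thesis by (simp add: L2_norm_sq)
qed

lemma L2_norm_diff_sq:
  assumes "u \<in> L2 M" "v \<in> L2 M"
  shows "(L2_norm M (\<lambda>x. u x - v x))\<^sup>2 = (L2_norm M u)\<^sup>2 - 2 * (\<integral>x. u x * v x \<partial>M) + (L2_norm M v)\<^sup>2"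
  using L2_norm_add_sq[OF assms(1) L2_uminus[OF assms(2)]] by simp

text \<open>At t = - (A + 1) / (2 c) a nonconstant affine function takes the value -1. This serves
  the degenerate case of the Cauchy-Schwarz inequality, where one norm is zero and the quadratic
  form becomes affine.\<close>

lemma affine_nonneg_slope:
  assumes "\<And>t::real. 0 \<le> A + t * (2 * c)"
  shows "c = 0"
proof (rule ccontr)
  assume c: "c \<noteq> 0"
  have "0 \<le> A + (- (A + 1) / (2 * c)) * (2 * c)" by (rule assms)
  also have "(- (A + 1) / (2 * c)) * (2 * c) = - (A + 1)" using c by simp
  finally show False by simp
qed

text \<open>The squared norm of t u + s v is a nonnegative quadratic form; at t = ||v||^2, s = - <u,
  v> it equals ||v||^2 times ||u||^2 ||v||^2 - <u, v>^2. If ||v|| = 0 this says nothing, and then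
  affine dependence on s at t = 1 forces <u, v> = 0.\<close>

lemma L2_Cauchy_Schwarz:
  assumes "u \<in> L2 M" "v \<in> L2 M"
  shows "\<bar>\<integral>x. u x * v x \<partial>M\<bar> \<le> L2_norm M u * L2_norm M v"
proof -
  let ?a = "L2_norm M u" and ?b = "L2_norm M v" and ?c = "\<integral>x. u x * v x \<partial>M"
  have q: "0 \<le> t\<^sup>2 * ?a\<^sup>2 + 2 * t * s * ?c + s\<^sup>2 * ?b\<^sup>2" for t s
    using L2_norm_add_sq[OF L2_scale[OF assms(1), of t] L2_scale[OF assms(2), of s]]
      zero_le_power2[of "L2_norm M (\<lambda>x. t * u x + s * v x)"]
    by (simp add: L2_norm_scale power_mult_distrib mult.assoc mult.left_commute)
  have le: "?c\<^sup>2 \<le> ?a\<^sup>2 * ?b\<^sup>2"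
  proof (cases "?b = 0")
    case True
    have "?c = 0"
    proof (rule affine_nonneg_slope[of "?a\<^sup>2"])
      show "0 \<le> ?a\<^sup>2 + t * (2 * ?c)" for t
        using q[of 1 t] unfolding True by (simp add: mult.commute mult.left_commute)
    qed
    then show ?thesis by simp
  next
    case False
    have "0 \<le> ?b\<^sup>2 * (?a\<^sup>2 * ?b\<^sup>2 - ?c\<^sup>2)"
      using q[of "?b\<^sup>2" "- ?c"] by (simp add: power2_eq_square algebra_simps)
    then show ?thesis using False by (simp add: zero_le_mult_iff)
  qed
  have "\<bar>?c\<bar> \<le> \<bar>?a * ?b\<bar>"
    using le by (simp only: abs_le_square_iff power_mult_distrib)
  then show ?thesis by (simp add: abs_mult)
qed

lemma L2_norm_triangle:
  assumes "u \<in> L2 M" "v \<in> L2 M"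
  shows "L2_norm M (\<lambda>x. u x + v x) \<le> L2_norm M u + L2_norm M v"
proof (rule power2_le_imp_le)
  show "(L2_norm M (\<lambda>x. u x + v x))\<^sup>2 \<le> (L2_norm M u + L2_norm M v)\<^sup>2"
    using L2_Cauchy_Schwarz[OF assms] unfolding L2_norm_add_sq[OF assms] power2_sum by simp
qed simp

lemma L2_norm_triangle_diff:
  assumes "u \<in> L2 M" "v \<in> L2 M"
  shows "L2_norm M (\<lambda>x. u x - v x) \<le> L2_norm M u + L2_norm M v"
  using L2_norm_triangle[OF assms(1) L2_uminus[OF assms(2)]] by simp

lemma L2_norm_triangle3:
  assumes "u \<in> L2 M" "v \<in> L2 M" "w \<in> L2 M"
  shows "L2_norm M (\<lambda>x. u x - w x) \<le> L2_norm M (\<lambda>x. u x - v x) + L2_norm M (\<lambda>x. v x - w x)"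
  using L2_norm_triangle[OF L2_diff[OF assms(1,2)] L2_diff[OF assms(2,3)]] by simp

lemma L2_norm_reverse:
  assumes "u \<in> L2 M" "v \<in> L2 M"
  shows "\<bar>L2_norm M u - L2_norm M v\<bar> \<le> L2_norm M (\<lambda>x. u x - v x)"
  using L2_norm_triangle[OF L2_diff[OF assms] assms(2)] L2_norm_triangle[OF L2_diff[OF assms(2,1)] assms(1)]
  by (simp add: L2_norm_minus_commute[of M v u])

lemma L2_norm_sum_le:
  assumes "\<And>i. i \<in> I \<Longrightarrow> u i \<in> L2 M"
  shows "L2_norm M (\<lambda>x. \<Sum>i\<in>I. u i x) \<le> (\<Sum>i\<in>I. L2_norm M (u i))"
  using assms
proof (induction I rule: infinite_finite_induct)
  case (insert a I)
  then have "L2_norm M (\<lambda>x. u a x + (\<Sum>i\<in>I. u i x)) \<le> L2_norm M (u a) + L2_norm M (\<lambda>x. \<Sum>i\<in>I. u i x)"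
    by (intro L2_norm_triangle L2_sum) auto
  with insert show ?case by simp
qed simp_all

lemma L2_norm_mono:
  assumes "v \<in> L2 M" "u \<in> borel_measurable M" "AE x in M. \<bar>u x\<bar> \<le> \<bar>v x\<bar>"
  shows "L2_norm M u \<le> L2_norm M v"
  unfolding L2_norm_def
  using L2D(2)[OF L2_dominated[OF assms]] L2D(2)[OF assms(1)] assms(3)
  by (intro real_sqrt_le_mono integral_mono_AE) (auto simp: abs_le_square_iff)

text \<open>Norm convergence is L1 convergence of the squared differences to 0, to which the
  subsequence theorem for L1 applies.\<close>

lemma L2_AE_subseq:
  assumes "\<And>n. u n \<in> L2 M" "v \<in> L2 M" "(\<lambda>n. L2_norm M (\<lambda>x. u n x - v x)) \<longlonglongrightarrow> 0"
  shows "\<exists>r::nat\<Rightarrow>nat. strict_mono r \<and> (AE x in M. (\<lambda>n. u (r n) x) \<longlonglongrightarrow> v x)"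
proof -
  have "(\<lambda>n. (L2_norm M (\<lambda>x. u n x - v x))\<^sup>2) \<longlonglongrightarrow> 0\<^sup>2"
    by (intro tendsto_power assms)
  then have "\<exists>r::nat\<Rightarrow>nat. strict_mono r \<and> (AE x in M. (\<lambda>n. (u (r n) x - v x)\<^sup>2) \<longlonglongrightarrow> 0)"
    using L2D(2)[OF L2_diff[OF assms(1,2)]]
    by (intro tendsto_L1_AE_subseq) (auto simp: L2_norm_sq)
  then obtain r :: "nat \<Rightarrow> nat" where r: "strict_mono r" "AE x in M. (\<lambda>n. (u (r n) x - v x)\<^sup>2) \<longlonglongrightarrow> 0"
    by blast
  have "(\<lambda>n. u (r n) x) \<longlonglongrightarrow> v x" if "(\<lambda>n. (u (r n) x - v x)\<^sup>2) \<longlonglongrightarrow> 0" for x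
  proof -
    have "(\<lambda>n. sqrt ((u (r n) x - v x)\<^sup>2)) \<longlonglongrightarrow> sqrt 0"
      by (intro tendsto_intros that)
    then have "(\<lambda>n. u (r n) x - v x) \<longlonglongrightarrow> 0" by (simp add: tendsto_rabs_zero_iff)
    then show ?thesis by (simp add: LIM_zero_iff)
  qed
  with r show ?thesis by auto
qed

text \<open>Along a subsequence with successive distances below \<open>8\<^sup>-\<^sup>n\<close>, the series of the squared
  increments weighted by \<open>2\<^sup>n\<close> is finite almost everywhere, so the subsequence is Cauchy pointwise.\<close>

lemma L2_complete:
  assumes u: "\<And>n. u n \<in> L2 M"
    and cauchy: "\<And>e. 0 < e \<Longrightarrow> \<exists>N. \<forall>m\<ge>N. \<forall>n\<ge>N. L2_norm M (\<lambda>x. u m x - u n x) < e"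
  shows "\<exists>v\<in>L2 M. (\<lambda>n. L2_norm M (\<lambda>x. u n x - v x)) \<longlonglongrightarrow> 0"
proof -
  note [measurable] = L2D(1)[OF u]
  have "\<exists>N. \<forall>k. (\<forall>m\<ge>N k. \<forall>n\<ge>N k. L2_norm M (\<lambda>x. u m x - u n x) < (1/8::real)^k) \<and> N k < N (Suc k)"
  proof (rule dependent_nat_choice)
    show "\<exists>N. \<forall>m\<ge>N. \<forall>n\<ge>N. L2_norm M (\<lambda>x. u m x - u n x) < (1/8::real)^0"
      using cauchy[of 1] by simp
  next
    fix N :: nat and k
    obtain N' where "\<forall>m\<ge>N'. \<forall>n\<ge>N'. L2_norm M (\<lambda>x. u m x - u n x) < (1/8::real)^Suc k"
      using cauchy[of "(1/8)^Suc k"] by auto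
    then show "\<exists>y. (\<forall>m\<ge>y. \<forall>n\<ge>y. L2_norm M (\<lambda>x. u m x - u n x) < (1/8::real)^Suc k) \<and> N < y"
      by (intro exI[of _ "max N' (Suc N)"]) auto
  qed
  then obtain r where r: "\<And>k m n. m \<ge> r k \<Longrightarrow> n \<ge> r k \<Longrightarrow> L2_norm M (\<lambda>x. u m x - u n x) < (1/8::real)^k"
    and mono: "\<And>k. r k < r (Suc k)" by blast
  define d where "d = (\<lambda>k x. (u (r (Suc k)) x - u (r k) x)\<^sup>2)"
  have [measurable]: "d k \<in> borel_measurable M" for k unfolding d_def by simp
  \<comment> \<open>The increment is below (1/8)^k, which is at most 1, so its square obeys the same
    bound; after the weight 2^k the summable (1/4)^k remains.\<close>
  have dint: "(\<integral>\<^sup>+x. ennreal (d k x) \<partial>M) \<le> ennreal ((1/8)^k)" for k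
  proof -
    have "(\<integral>\<^sup>+x. ennreal (d k x) \<partial>M) = ennreal ((L2_norm M (\<lambda>x. u (r (Suc k)) x - u (r k) x))\<^sup>2)"
      unfolding d_def by (rule L2_norm_sq_nn[OF L2_diff[OF u u]])
    also have "\<dots> \<le> ennreal ((1/8)^k)"
    proof (rule ennreal_leI)
      let ?a = "L2_norm M (\<lambda>x. u (r (Suc k)) x - u (r k) x)"
      have "?a \<le> (1/8)^k" using r[of k "r (Suc k)" "r k"] mono[of k] by simp
      moreover have "(1/8::real)^k \<le> 1" by (simp add: power_le_one)
      ultimately have "?a * ?a \<le> (1/8)^k * 1" by (intro mult_mono) auto
      then show "?a\<^sup>2 \<le> (1/8)^k" by (simp add: power2_eq_square)
    qed
    finally show ?thesis .
  qed
  have "(\<integral>\<^sup>+x. (\<Sum>k. ennreal (2^k * d k x)) \<partial>M) = (\<Sum>k. \<integral>\<^sup>+x. ennreal (2^k * d k x) \<partial>M)"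
    by (rule nn_integral_suminf) simp
  also have "\<dots> \<le> (\<Sum>k. ennreal ((1/4)^k))"
  proof (intro suminf_le allI)
    fix k
    have "(\<integral>\<^sup>+x. ennreal (2^k * d k x) \<partial>M) = ennreal (2^k) * (\<integral>\<^sup>+x. ennreal (d k x) \<partial>M)"
      by (subst nn_integral_cmult[symmetric]) (auto simp: ennreal_mult' d_def)
    also have "\<dots> \<le> ennreal (2^k) * ennreal ((1/8)^k)" by (intro mult_left_mono dint) auto
    also have "\<dots> = ennreal ((1/4)^k)"
      by (simp add: ennreal_mult[symmetric] power_mult_distrib[symmetric])
    finally show "(\<integral>\<^sup>+x. ennreal (2^k * d k x) \<partial>M) \<le> ennreal ((1/4)^k)" .
  qed auto
  also have "\<dots> = ennreal (\<Sum>k. (1/4)^k)"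
    by (rule suminf_ennreal2) (auto intro: summable_geometric)
  finally have "(\<integral>\<^sup>+x. (\<Sum>k. ennreal (2^k * d k x)) \<partial>M) < \<infinity>"
    by (rule order.strict_trans1) (simp add: ennreal_less_top)
  then have "AE x in M. (\<Sum>k. ennreal (2^k * d k x)) \<noteq> \<infinity>"
    by (intro nn_integral_PInf_AE) auto
  then have "AE x in M. Cauchy (\<lambda>k. u (r k) x)"
  proof eventually_elim
    case (elim x)
    then obtain C where C: "(\<Sum>k. ennreal (2^k * d k x)) = ennreal C" "C \<ge> 0"
      by (metis ennreal_cases infinity_ennreal_def)
    have le: "2^k * d k x \<le> C" for k
    proof -
      have "ennreal (2^k * d k x) \<le> ennreal C"
        unfolding C(1)[symmetric]
        using sum_le_suminf[of "\<lambda>k. ennreal (2^k * d k x)" "{k}"] by simp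
      then show ?thesis using C(2) by simp
    qed
    have bd: "norm (u (r (Suc k)) x - u (r k) x) \<le> sqrt C * (sqrt (1/2))^k" for k
    proof -
      have "d k x \<le> C * (1/2)^k" using le[of k] by (simp add: field_simps)
      then have "sqrt (d k x) \<le> sqrt (C * (1/2)^k)" by simp
      moreover have "sqrt (d k x) = norm (u (r (Suc k)) x - u (r k) x)"
        by (simp add: d_def)
      ultimately show ?thesis by (simp add: real_sqrt_mult real_sqrt_power)
    qed
    have "sqrt (1/2) < 1" by (simp add: real_sqrt_divide)
    then have "summable (\<lambda>k. sqrt C * (sqrt (1/2))^k)"
      by (intro summable_mult summable_geometric) (simp)
    then have "summable (\<lambda>k. u (r (Suc k)) x - u (r k) x)"
      by (rule summable_comparison_test'[where N=0]) (use bd in auto)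
    then have "convergent (\<lambda>n. \<Sum>k<n. u (r (Suc k)) x - u (r k) x)"
      by (simp add: summable_iff_convergent)
    then have "convergent (\<lambda>n. u (r n) x - u (r 0) x)"
      unfolding sum_lessThan_telescope[of "\<lambda>k. u (r k) x"] .
    then have "convergent (\<lambda>n. (u (r n) x - u (r 0) x) + u (r 0) x)"
      by (intro convergent_add convergent_const)
    then show ?case by (simp add: Cauchy_convergent_iff)
  qed
  then have lim: "AE x in M. (\<lambda>k. u (r k) x) \<longlonglongrightarrow> lim (\<lambda>k. u (r k) x)"
    by eventually_elim (simp add: Cauchy_convergent_iff convergent_LIMSEQ_iff)
  define v where "v x = lim (\<lambda>k. u (r k) x)" for x
  have [measurable]: "v \<in> borel_measurable M" unfolding v_def by measurable
  \<comment> \<open>Fatou in \<open>k\<close>: the Cauchy bound along the subsequence passes to the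
    distance from the pointwise limit. Finiteness of this integral is also what puts
    \<open>u m - v\<close>, and hence \<open>v\<close>, into L2.\<close>
  have fatou: "(\<integral>\<^sup>+x. ennreal ((u m x - v x)\<^sup>2) \<partial>M) \<le> ennreal (e\<^sup>2)"
    if e: "e > 0" and m: "\<And>k. k \<ge> K \<Longrightarrow> L2_norm M (\<lambda>x. u m x - u (r k) x) \<le> e" for m e K
  proof -
    have "(\<integral>\<^sup>+x. ennreal ((u m x - v x)\<^sup>2) \<partial>M) = (\<integral>\<^sup>+x. liminf (\<lambda>k. ennreal ((u m x - u (r k) x)\<^sup>2)) \<partial>M)"
    proof (rule nn_integral_cong_AE)
      show "AE x in M. ennreal ((u m x - v x)\<^sup>2) = liminf (\<lambda>k. ennreal ((u m x - u (r k) x)\<^sup>2))"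
        using lim
      proof eventually_elim
        case (elim x)
        then have "(\<lambda>k. ennreal ((u m x - u (r k) x)\<^sup>2)) \<longlonglongrightarrow> ennreal ((u m x - v x)\<^sup>2)"
          unfolding v_def by (intro tendsto_intros)
        then show ?case by (rule lim_imp_Liminf[OF sequentially_bot, symmetric])
      qed
    qed
    also have "\<dots> \<le> liminf (\<lambda>k. \<integral>\<^sup>+x. ennreal ((u m x - u (r k) x)\<^sup>2) \<partial>M)"
      by (rule nn_integral_liminf) simp
    also have "\<dots> \<le> ennreal (e\<^sup>2)"
    proof (rule Liminf_le)
      show "\<forall>\<^sub>F k in sequentially. (\<integral>\<^sup>+x. ennreal ((u m x - u (r k) x)\<^sup>2) \<partial>M) \<le> ennreal (e\<^sup>2)"
        unfolding eventually_sequentially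
        by (intro exI[of _ K])
          (auto simp: L2_norm_sq_nn[OF L2_diff[OF u u]] intro!: power_mono m ennreal_leI)
    qed simp
    finally show ?thesis .
  qed
  have rk: "k \<le> r k" for k
    by (induction k) (auto intro: Suc_leI le_less_trans[OF _ mono])
  have L: "(\<lambda>x. u m x - v x) \<in> L2 M \<and> L2_norm M (\<lambda>x. u m x - v x) \<le> e"
    if e: "e > 0" and m: "\<And>k. k \<ge> K \<Longrightarrow> L2_norm M (\<lambda>x. u m x - u (r k) x) \<le> e" for m e K
  proof
    have fin: "(\<integral>\<^sup>+x. ennreal ((u m x - v x)\<^sup>2) \<partial>M) \<le> ennreal (e\<^sup>2)"
      using fatou[OF that] by simp
    show "(\<lambda>x. u m x - v x) \<in> L2 M"
    proof (rule L2I)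
      show "integrable M (\<lambda>x. (u m x - v x)\<^sup>2)"
        using fin by (intro integrableI_nonneg) (auto intro: le_less_trans)
    qed simp
    then have "ennreal ((L2_norm M (\<lambda>x. u m x - v x))\<^sup>2) \<le> ennreal (e\<^sup>2)"
      using fin by (simp add: L2_norm_sq_nn)
    then show "L2_norm M (\<lambda>x. u m x - v x) \<le> e"
      using e by (simp add: power_mono_iff)
  qed
  have "\<exists>N. \<forall>m\<ge>N. (\<lambda>x. u m x - v x) \<in> L2 M \<and> L2_norm M (\<lambda>x. u m x - v x) \<le> e" if e: "e > 0" for e
  proof -
    obtain N where N: "\<forall>m\<ge>N. \<forall>n\<ge>N. L2_norm M (\<lambda>x. u m x - u n x) < e" using cauchy[OF e] by auto
    show ?thesis
      by (intro exI[of _ N] allI impI L[OF e, of N])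
        (use N order_trans[OF _ rk] in \<open>auto intro!: less_imp_le\<close>)
  qed
  note main = this
  obtain N where "(\<lambda>x. u N x - v x) \<in> L2 M" using main[of 1] by auto
  then have "v \<in> L2 M" using L2_diff[OF u[of N]] by fastforce
  moreover have "(\<lambda>n. L2_norm M (\<lambda>x. u n x - v x)) \<longlonglongrightarrow> 0"
  proof (rule LIMSEQ_I)
    fix e :: real assume "0 < e"
    then obtain N where "\<forall>m\<ge>N. L2_norm M (\<lambda>x. u m x - v x) \<le> e/2" using main[of "e/2"] by auto
    with \<open>0 < e\<close> show "\<exists>no. \<forall>n\<ge>no. norm (L2_norm M (\<lambda>x. u n x - v x) - 0) < e"
      by (intro exI[of _ N]) force
  qed
  ultimately show ?thesis by blast
qed

section \<open>Strong limits of convex combinations\<close>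

lemma L2_norm_tendsto:
  assumes "\<And>n. u n \<in> L2 M" "v \<in> L2 M" "(\<lambda>n. L2_norm M (\<lambda>x. u n x - v x)) \<longlonglongrightarrow> 0"
  shows "(\<lambda>n. L2_norm M (u n)) \<longlonglongrightarrow> L2_norm M v"
proof (rule Lim_null_comparison[THEN LIM_zero_cancel, OF _ assms(3)])
  show "\<forall>\<^sub>F n in sequentially. norm (L2_norm M (u n) - L2_norm M v) \<le> L2_norm M (\<lambda>x. u n x - v x)"
    using L2_norm_reverse[OF assms(1) assms(2)] by (auto intro!: always_eventually)
qed

text \<open>Written with the midpoint because both minimization arguments, in
  \<open>L2_Mazur\<close> and in \<open>resolvent_exists\<close>, use the midpoint of two
  almost-minimizers as competitor.\<close>

lemma L2_parallelogram:
  assumes "u \<in> L2 M" "v \<in> L2 M"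
  shows "(L2_norm M (\<lambda>x. u x - v x))\<^sup>2 =
    2 * (L2_norm M u)\<^sup>2 + 2 * (L2_norm M v)\<^sup>2 - 4 * (L2_norm M (\<lambda>x. (u x + v x) / 2))\<^sup>2"
proof -
  have eq: "L2_norm M (\<lambda>x. (u x + v x) / 2) = L2_norm M (\<lambda>x. u x + v x) / 2"
    using L2_norm_scale[of M "1/2" "\<lambda>x. u x + v x"] by simp
  show ?thesis
    unfolding L2_norm_diff_sq[OF assms] eq power_divide L2_norm_add_sq[OF assms] by (simp add: field_simps)
qed

text \<open>Weights are total functions vanishing off \<open>{n..N}\<close>, so that combinations
  over different ranges can be averaged pointwise and regarded as combinations over a larger
  range.\<close>

definition cvx_weights :: "nat \<Rightarrow> nat \<Rightarrow> (nat \<Rightarrow> real) \<Rightarrow> bool" where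
  "cvx_weights n N l \<longleftrightarrow> (\<forall>k. 0 \<le> l k) \<and> (\<forall>k. k \<notin> {n..N} \<longrightarrow> l k = 0) \<and> (\<Sum>k=n..N. l k) = 1"

lemma cvx_weights_sum_superset:
  assumes "cvx_weights n N l" "n' \<le> n" "N \<le> N'"
  shows "(\<Sum>k=n'..N'. l k * (x k::real)) = (\<Sum>k=n..N. l k * x k)"
  by (rule sum.mono_neutral_right) (use assms in \<open>auto simp: cvx_weights_def\<close>)

lemma cvx_weights_le:
  assumes "cvx_weights n N l" "\<And>k. n \<le> k \<Longrightarrow> x k \<le> (c::real)"
  shows "(\<Sum>k=n..N. l k * x k) \<le> c"
proof -
  have "(\<Sum>k=n..N. l k * x k) \<le> (\<Sum>k=n..N. l k * c)"
    by (intro sum_mono mult_left_mono) (use assms in \<open>auto simp: cvx_weights_def\<close>)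
  also have "\<dots> = c" using assms(1) by (simp add: cvx_weights_def sum_distrib_right[symmetric])
  finally show ?thesis .
qed

text \<open>Almost norm-minimal elements of the convex hulls of the tails form a Cauchy sequence, by the
  parallelogram law; this replaces weak compactness.\<close>

lemma L2_Mazur:
  assumes v: "\<And>k. v k \<in> L2 M" and C: "\<And>k. L2_norm M (v k) \<le> C"
  shows "\<exists>l N w. w \<in> L2 M \<and> (\<forall>n. cvx_weights n (N n) (l n)) \<and>
    (\<lambda>n. L2_norm M (\<lambda>x. (\<Sum>k=n..N n. l n k * v k x) - w x)) \<longlonglongrightarrow> 0"
proof -
  define cmb where "cmb n N l x = (\<Sum>k=n..N. l k * v k x)" for n N :: nat and l x
  have cmb: "cmb n N l \<in> L2 M" for n N l
    unfolding cmb_def by (intro L2_sum L2_scale v)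
  define H where "H n = {(L2_norm M (cmb n N l))\<^sup>2 | N l. cvx_weights n N l}" for n
  define d where "d n = Inf (H n)" for n
  have bdd: "bdd_below (H n)" for n unfolding H_def by (rule bdd_belowI[of _ 0]) auto
  have w0: "cvx_weights n n (\<lambda>k. if k = n then 1 else 0)" for n by (auto simp: cvx_weights_def)
  have cmb0: "cmb n n (\<lambda>k. if k = n then 1 else 0) = v n" for n by (auto simp: cmb_def)
  have inH: "(L2_norm M (v n))\<^sup>2 \<in> H n" for n
    unfolding H_def mem_Collect_eq
    by (intro exI[of _ n] exI[of _ "\<lambda>k. if k = n then 1 else 0"]) (simp add: w0 cmb0)
  have dC: "d n \<le> C\<^sup>2" for n
    unfolding d_def by (rule cInf_lower2[OF inH _ bdd]) (intro power_mono C, simp)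
  have dle: "d n \<le> (L2_norm M (cmb n N l))\<^sup>2" if "cvx_weights n N l" for n N l
    unfolding d_def by (rule cInf_lower[OF _ bdd]) (use that in \<open>auto simp: H_def\<close>)
  have sup: "cvx_weights n N' l \<and> cmb n N' l = cmb m N l" if "cvx_weights m N l" "n \<le> m" "N \<le> N'" for n m N N' l
  proof
    show "cmb n N' l = cmb m N l" unfolding cmb_def
      by (rule ext) (rule cvx_weights_sum_superset[OF that])
    show "cvx_weights n N' l" using that cvx_weights_sum_superset[OF that, of "\<lambda>_. 1"]
      by (auto simp: cvx_weights_def)
  qed
  have dmono: "d n \<le> d m" if "n \<le> m" for n m
    unfolding d_def
  proof (rule cInf_mono)
    show "H m \<noteq> {}" using inH by blast
    show "\<exists>a\<in>H n. a \<le> b" if "b \<in> H m" for b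
      using that sup[OF _ \<open>n \<le> m\<close>] unfolding H_def by (smt (verit) mem_Collect_eq order_refl)
  qed (rule bdd)
  have "\<exists>N l. cvx_weights n N l \<and> (L2_norm M (cmb n N l))\<^sup>2 < d n + 1 / Suc n" for n
  proof -
    have "\<exists>a\<in>H n. a < d n + 1 / Suc n"
      unfolding d_def by (subst cInf_less_iff[symmetric]) (use inH bdd in auto)
    then show ?thesis unfolding H_def by auto
  qed
  then obtain N l where w: "\<And>n. cvx_weights n (N n) (l n)"
    and near: "\<And>n. (L2_norm M (cmb n (N n) (l n)))\<^sup>2 < d n + 1 / Suc n" by metis
  let ?c = "\<lambda>n. cmb n (N n) (l n)"
  obtain d' where "d \<longlonglongrightarrow> d'"
    by (rule incseq_convergent[of d "C\<^sup>2"]) (use dC dmono in \<open>auto simp: incseq_def\<close>)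
  then have cd: "Cauchy d" by (rule LIMSEQ_imp_Cauchy)
  \<comment> \<open>The hulls shrink with n, so the infima \<open>d\<close> increase and, being
    bounded by C^2, converge. The midpoint of the m-th and the n-th combination lies in the larger
    hull, so its squared norm is at least \<open>d n\<close>; the parallelogram law turns this into
    a bound by the gap \<open>d m - d n\<close> and two errors.\<close>
  have dist: "(L2_norm M (\<lambda>x. ?c m x - ?c n x))\<^sup>2 \<le> 2 * (d m - d n) + 2 / Suc m + 2 / Suc n" if "n \<le> m" for m n
  proof -
    let ?N = "max (N m) (N n)" and ?l = "\<lambda>k. (l m k + l n k) / 2"
    have 1: "cvx_weights n ?N (l m)" "cmb n ?N (l m) = ?c m" using sup[OF w[of m] that, of ?N] by auto
    have 2: "cvx_weights n ?N (l n)" "cmb n ?N (l n) = ?c n" using sup[OF w[of n], of n ?N] by auto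
    have half: "cmb n ?N ?l x = (cmb n ?N (l m) x + cmb n ?N (l n) x) / 2" for x
      unfolding cmb_def sum.distrib[symmetric] sum_divide_distrib
      by (intro sum.cong) (simp_all add: field_simps)
    have "cvx_weights n ?N ?l" using 1(1) 2(1)
      by (auto simp: cvx_weights_def sum.distrib sum_divide_distrib[symmetric])
    from dle[OF this] have "d n \<le> (L2_norm M (\<lambda>x. (?c m x + ?c n x) / 2))\<^sup>2"
      unfolding half[abs_def] 1(2) 2(2) .
    moreover have "2 / real (Suc m) = 2 * (1 / real (Suc m))" "2 / real (Suc n) = 2 * (1 / real (Suc n))"
      by simp_all
    ultimately show ?thesis
      using near[of m] near[of n] unfolding L2_parallelogram[OF cmb cmb] by argo
  qed
  have "\<exists>K. \<forall>m\<ge>K. \<forall>n\<ge>K. L2_norm M (\<lambda>x. ?c m x - ?c n x) < e" if e: "0 < e" for e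
  proof -
    obtain K1 where K1: "\<forall>m\<ge>K1. \<forall>n\<ge>K1. \<bar>d m - d n\<bar> < e\<^sup>2 / 8"
      using cd e unfolding Cauchy_def dist_real_def by (metis zero_less_power zero_less_divide_iff zero_less_numeral)
    obtain K2 :: nat where K2: "8 / e\<^sup>2 < K2" using reals_Archimedean2 by blast
    have small: "2 / Suc m < e\<^sup>2 / 4" if "m \<ge> K2" for m
    proof -
      have "8 / e\<^sup>2 < real (Suc m)" using K2 that by linarith
      then show ?thesis using e by (simp add: field_simps)
    qed
    have *: "L2_norm M (\<lambda>x. ?c m x - ?c n x) < e" if "n \<le> m" "max K1 K2 \<le> n" for m n
    proof (rule power2_less_imp_less)
      have "\<bar>d m - d n\<bar> < e\<^sup>2 / 8" using K1 that by auto
      then have "d m - d n < e\<^sup>2 / 8" by linarith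
      with dist[OF that(1)] small[of m] small[of n] that
      have "(L2_norm M (\<lambda>x. ?c m x - ?c n x))\<^sup>2 < 2 * (e\<^sup>2 / 8) + e\<^sup>2 / 4 + e\<^sup>2 / 4" by simp
      then show "(L2_norm M (\<lambda>x. ?c m x - ?c n x))\<^sup>2 < e\<^sup>2"
        using zero_less_power[OF e, of 2] by linarith
    qed (use e in simp)
    show ?thesis
    proof (intro exI[of _ "max K1 K2"] allI impI)
      fix m n assume "max K1 K2 \<le> m" "max K1 K2 \<le> n"
      then show "L2_norm M (\<lambda>x. ?c m x - ?c n x) < e"
        using *[of n m] *[of m n] L2_norm_minus_commute[of M "?c m" "?c n"] by (cases "n \<le> m") auto
    qed
  qed
  from L2_complete[OF cmb this] obtain w where "w \<in> L2 M" "(\<lambda>n. L2_norm M (\<lambda>x. ?c n x - w x)) \<longlonglongrightarrow> 0"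
    by blast
  with w show ?thesis unfolding cmb_def by blast
qed

section \<open>Square integrable functions of time and space\<close>

lemma integrable_indicator_Ioc: "integrable lborel (indicat_real {s<..t::real})"
  by (cases "s \<le> t") (auto intro!: integrable_real_indicator)

lemma indicator_L2_lborel: "indicat_real {s<..t::real} \<in> L2 lborel"
proof (rule L2I)
  have "(\<lambda>x. (indicat_real {s<..t} x)\<^sup>2) = indicat_real {s<..t}"
    by (auto simp: indicator_def)
  then show "integrable lborel (\<lambda>x. (indicat_real {s<..t} x)\<^sup>2)"
    using integrable_indicator_Ioc[of s t] by simp
qed simp

lemma L2_indicator_integrable:
  "h \<in> L2 lborel \<Longrightarrow> integrable lborel (\<lambda>\<tau>. indicat_real {s<..t::real} \<tau> * h \<tau>)"
  by (intro L2_mult_integrable indicator_L2_lborel)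

lemma L2_integral_sq_le:
  assumes "h \<in> L2 lborel" "s \<le> t"
  shows "(\<integral>\<tau>. indicator {s<..t} \<tau> * h \<tau> \<partial>lborel)\<^sup>2 \<le> (t - s) * (\<integral>\<tau>. indicator {s<..t} \<tau> * (h \<tau>)\<^sup>2 \<partial>lborel)"
proof -
  let ?i = "indicat_real {s<..t}"
  have [measurable]: "h \<in> borel_measurable lborel" using assms(1) by (rule L2D)
  have ih: "(\<lambda>\<tau>. ?i \<tau> * h \<tau>) \<in> L2 lborel"
    by (rule L2_dominated[OF assms(1)]) (auto simp: indicator_def)
  have sq: "(?i \<tau> * h \<tau>)\<^sup>2 = ?i \<tau> * (h \<tau>)\<^sup>2" "(?i \<tau>)\<^sup>2 = ?i \<tau>" "?i \<tau> * (?i \<tau> * h \<tau>) = ?i \<tau> * h \<tau>" for \<tau>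
    by (auto simp: indicator_def)
  have "\<bar>\<integral>\<tau>. ?i \<tau> * (?i \<tau> * h \<tau>) \<partial>lborel\<bar> \<le> L2_norm lborel ?i * L2_norm lborel (\<lambda>\<tau>. ?i \<tau> * h \<tau>)"
    by (rule L2_Cauchy_Schwarz[OF indicator_L2_lborel ih])
  then have "\<bar>\<integral>\<tau>. ?i \<tau> * (?i \<tau> * h \<tau>) \<partial>lborel\<bar>\<^sup>2 \<le> (L2_norm lborel ?i * L2_norm lborel (\<lambda>\<tau>. ?i \<tau> * h \<tau>))\<^sup>2"
    by (rule power_mono) simp
  then show ?thesis
    using assms(2) by (simp add: power_mult_distrib L2_norm_sq sq)
qed

locale time_space = sigma_finite_measure nu for nu :: "'a measure"
begin

lemmas sigma_finite_nu = sigma_finite_measure_axioms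

sublocale pair_sigma_finite lborel nu
  by (intro pair_sigma_finite.intro sigma_finite_lborel sigma_finite_measure_axioms)

abbreviation "Q \<equiv> lborel \<Otimes>\<^sub>M nu"

text \<open>The space L2(R; L2(X)) in the form of L2 of the product measure, which avoids
  vector-valued integration. Time runs over the whole line; data given on an interval are extended
  by zero.\<close>

definition LQ :: "(real \<Rightarrow> 'a \<Rightarrow> real) set" where
  "LQ = {g. case_prod g \<in> L2 Q}"

text \<open>The time integral is taken separately for each x. Half-open intervals make adjacent ones
  disjoint, as \<open>tint_add\<close> and the grid of the Euler scheme require.\<close>

definition tint :: "(real \<Rightarrow> 'a \<Rightarrow> real) \<Rightarrow> real \<Rightarrow> real \<Rightarrow> 'a \<Rightarrow> real" where
  "tint g s t x = (\<integral>\<tau>. indicator {s<..t} \<tau> * g \<tau> x \<partial>lborel)"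

lemma LQ_meas: "g \<in> LQ \<Longrightarrow> case_prod g \<in> borel_measurable Q"
  by (auto simp: LQ_def L2_def)

lemma joint_meas_swap:
  assumes "case_prod g \<in> borel_measurable Q"
  shows "(\<lambda>w. g (snd w) (fst w)) \<in> borel_measurable (nu \<Otimes>\<^sub>M lborel)"
  using measurable_compose[OF measurable_pair_swap' assms] by (simp add: split_beta')

lemma joint_meas_section:
  assumes "case_prod g \<in> borel_measurable Q"
  shows "g \<tau> \<in> borel_measurable nu"
  using measurable_compose_Pair1[OF _ assms, of \<tau>] by simp

lemma joint_meas_slice:
  assumes "case_prod g \<in> borel_measurable Q" "x \<in> space nu"
  shows "(\<lambda>\<tau>. g \<tau> x) \<in> borel_measurable lborel"
  using measurable_compose[OF measurable_Pair2'[OF assms(2)] assms(1)] by simp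

lemma LQ_section_meas: "g \<in> LQ \<Longrightarrow> g \<tau> \<in> borel_measurable nu"
  by (intro joint_meas_section LQ_meas)

lemma LQ_diff: "g \<in> LQ \<Longrightarrow> h \<in> LQ \<Longrightarrow> (\<lambda>\<tau> x. g \<tau> x - h \<tau> x) \<in> LQ"
  using L2_diff[of "case_prod g" Q "case_prod h"] by (simp add: LQ_def split_beta')

lemma LQ_scale: "g \<in> LQ \<Longrightarrow> (\<lambda>\<tau> x. c * g \<tau> x) \<in> LQ"
  using L2_scale[of "case_prod g" Q c] by (simp add: LQ_def split_beta')

lemma LQ_sum: "(\<And>i. i \<in> I \<Longrightarrow> g i \<in> LQ) \<Longrightarrow> (\<lambda>\<tau> x. \<Sum>i\<in>I. g i \<tau> x) \<in> LQ"
  using L2_sum[of I "\<lambda>i. case_prod (g i)" Q] by (simp add: LQ_def split_beta')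

lemma joint_meas_times:
  fixes g :: "real \<Rightarrow> 'a \<Rightarrow> real"
  assumes "case_prod g \<in> borel_measurable Q" "c \<in> borel_measurable lborel"
  shows "(\<lambda>(\<tau>, x). c \<tau> * g \<tau> x) \<in> borel_measurable Q"
proof -
  have "(\<lambda>w. c (fst w) * case_prod g w) \<in> borel_measurable Q"
    using assms by measurable
  then show ?thesis by (simp add: split_beta')
qed

lemma LQ_times:
  assumes "g \<in> LQ" "c \<in> borel_measurable lborel" "\<And>\<tau>. \<bar>c \<tau>\<bar> \<le> C"
  shows "(\<lambda>\<tau> x. c \<tau> * g \<tau> x) \<in> LQ"
  unfolding LQ_def mem_Collect_eq
proof (rule L2_dominated[OF L2_scale[of "case_prod g" Q C]])
  show "case_prod g \<in> L2 Q" using assms(1) by (simp add: LQ_def)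
  show "(\<lambda>(\<tau>, x). c \<tau> * g \<tau> x) \<in> borel_measurable Q"
    by (rule joint_meas_times[OF LQ_meas[OF assms(1)] assms(2)])
  have "\<bar>c \<tau> * g \<tau> x\<bar> \<le> \<bar>C * g \<tau> x\<bar>" for \<tau> x
    unfolding abs_mult by (intro mult_right_mono order_trans[OF assms(3)[of \<tau>] abs_ge_self]) simp
  then show "AE w in Q. \<bar>case w of (\<tau>, x) \<Rightarrow> c \<tau> * g \<tau> x\<bar> \<le> \<bar>C * case_prod g w\<bar>"
    by (simp add: split_beta')
qed

lemma LQ_restrict: "g \<in> LQ \<Longrightarrow> A \<in> sets lborel \<Longrightarrow> (\<lambda>\<tau> x. indicator A \<tau> * g \<tau> x) \<in> LQ"
  by (rule LQ_times[where C=1]) (auto simp: indicator_def)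

lemma LQ_sq_integrable: "g \<in> LQ \<Longrightarrow> integrable Q (\<lambda>(\<tau>, x). (g \<tau> x)\<^sup>2)"
  using L2D(2)[of "case_prod g" Q] by (simp add: LQ_def split_beta')

lemma LQ_section: "g \<in> LQ \<Longrightarrow> AE \<tau> in lborel. g \<tau> \<in> L2 nu"
  using AE_integrable_fst[OF LQ_sq_integrable, of g]
  by (auto intro!: L2I LQ_section_meas elim!: eventually_mono)

lemma LQ_slice: "g \<in> LQ \<Longrightarrow> AE x in nu. (\<lambda>\<tau>. g \<tau> x) \<in> L2 lborel"
  using AE_integrable_snd[OF LQ_sq_integrable, of g] AE_space[of nu]
  by (auto intro!: L2I joint_meas_slice LQ_meas elim: eventually_elim2)

lemma LQ_norm_sq_integrable: "g \<in> LQ \<Longrightarrow> integrable lborel (\<lambda>\<tau>. (L2_norm nu (g \<tau>))\<^sup>2)"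
  unfolding L2_norm_sq using integrable_fst[OF LQ_sq_integrable] .

lemma joint_meas_norm:
  assumes "case_prod g \<in> borel_measurable Q"
  shows "(\<lambda>\<tau>. L2_norm nu (g \<tau>)) \<in> borel_measurable lborel"
proof -
  have "(\<lambda>(\<tau>, x). (g \<tau> x)\<^sup>2) \<in> borel_measurable Q"
    using borel_measurable_power[OF assms, of 2] by (simp add: split_beta')
  from sigma_finite_measure.borel_measurable_lebesgue_integral[OF sigma_finite_nu this] show ?thesis
    unfolding L2_norm_def by simp
qed

lemma LQ_norm_meas: "g \<in> LQ \<Longrightarrow> (\<lambda>\<tau>. L2_norm nu (g \<tau>)) \<in> borel_measurable lborel"
  by (intro joint_meas_norm LQ_meas)

lemma LQ_norm_L2: "g \<in> LQ \<Longrightarrow> (\<lambda>\<tau>. L2_norm nu (g \<tau>)) \<in> L2 lborel"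
  by (intro L2I LQ_norm_meas LQ_norm_sq_integrable)

lemma LQ_norm_sq: "g \<in> LQ \<Longrightarrow> (\<integral>\<tau>. (L2_norm nu (g \<tau>))\<^sup>2 \<partial>lborel) = (L2_norm Q (case_prod g))\<^sup>2"
  unfolding L2_norm_sq using integral_fst[OF LQ_sq_integrable] by (simp add: split_beta')

lemma LQ_I:
  assumes "case_prod g \<in> borel_measurable Q" "AE \<tau> in lborel. g \<tau> \<in> L2 nu"
    "integrable lborel (\<lambda>\<tau>. (L2_norm nu (g \<tau>))\<^sup>2)"
  shows "g \<in> LQ"
  unfolding LQ_def mem_Collect_eq
proof (rule L2I[OF assms(1)], rule Fubini_integrable)
  show "(\<lambda>w. (case_prod g w)\<^sup>2) \<in> borel_measurable Q" using assms(1) by simp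
  show "integrable lborel (\<lambda>\<tau>. \<integral>x. norm ((case_prod g (\<tau>, x))\<^sup>2) \<partial>nu)"
    using assms(3) by (simp add: L2_norm_sq)
  show "AE \<tau> in lborel. integrable nu (\<lambda>x. (case_prod g (\<tau>, x))\<^sup>2)"
    using assms(2) by (auto simp: L2_def elim!: eventually_mono)
qed

lemma LQ_I_nn:
  assumes "case_prod g \<in> borel_measurable Q"
    "(\<integral>\<^sup>+\<tau>. (\<integral>\<^sup>+x. ennreal ((g \<tau> x)\<^sup>2) \<partial>nu) \<partial>lborel) < \<infinity>"
  shows "g \<in> LQ"
  unfolding LQ_def mem_Collect_eq
proof (rule L2I[OF assms(1)])
  have "(\<lambda>w. ennreal ((case_prod g w)\<^sup>2)) \<in> borel_measurable Q" using assms(1) by simp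
  from sigma_finite_measure.nn_integral_fst[OF sigma_finite_nu this] assms(2)
  show "integrable Q (\<lambda>w. (case_prod g w)\<^sup>2)"
    by (intro integrableI_nonneg) (use assms(1) in auto)
qed

lemma tint_meas:
  assumes "case_prod g \<in> borel_measurable Q"
  shows "tint g s t \<in> borel_measurable nu"
proof -
  have "(\<lambda>w. indicator {s<..t} (snd w) * g (snd w) (fst w)) \<in> borel_measurable (nu \<Otimes>\<^sub>M lborel)"
    by (intro borel_measurable_times joint_meas_swap[OF assms]) measurable
  then have "(\<lambda>(x, \<tau>). indicator {s<..t} \<tau> * g \<tau> x) \<in> borel_measurable (nu \<Otimes>\<^sub>M lborel)"
    by (simp add: split_beta')
  from sigma_finite_measure.borel_measurable_lebesgue_integral[OF sigma_finite_lborel this]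
  show ?thesis unfolding tint_def[abs_def] .
qed

lemma LQ_indicator_sq: "g \<in> LQ \<Longrightarrow> integrable Q (\<lambda>(\<tau>, x). indicator A \<tau> * (g \<tau> x)\<^sup>2)" if "A \<in> sets lborel"
  using LQ_sq_integrable[OF LQ_restrict[OF _ that, of g]]
  by (rule Bochner_Integration.integrable_cong[THEN iffD1, OF refl, rotated]) (auto simp: indicator_def)

text \<open>Cauchy-Schwarz in time for almost every fixed x, then integration over x with the order
  of integration exchanged. The factor t - s is the source of the Hoelder-1/2 continuity in time of
  the curves built from \<open>tint\<close>.\<close>

lemma tint_L2:
  assumes g: "g \<in> LQ" and st: "s \<le> t"
  shows "tint g s t \<in> L2 nu"
    and "(L2_norm nu (tint g s t))\<^sup>2 \<le> (t - s) * (\<integral>\<tau>. indicator {s<..t} \<tau> * (L2_norm nu (g \<tau>))\<^sup>2 \<partial>lborel)"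
proof -
  let ?G = "\<lambda>x. (t - s) * (\<integral>\<tau>. indicator {s<..t} \<tau> * (g \<tau> x)\<^sup>2 \<partial>lborel)"
  have I: "integrable Q (\<lambda>(\<tau>, x). indicator {s<..t} \<tau> * (g \<tau> x)\<^sup>2)"
    by (rule LQ_indicator_sq[OF _ g]) simp
  have int: "integrable nu ?G" using integrable_snd[OF I] by simp
  have le: "AE x in nu. (tint g s t x)\<^sup>2 \<le> ?G x"
    using LQ_slice[OF g] by eventually_elim (simp add: tint_def L2_integral_sq_le[OF _ st])
  show L: "tint g s t \<in> L2 nu"
    by (rule L2_bound[OF tint_meas[OF LQ_meas[OF g]] int le])
  have "(L2_norm nu (tint g s t))\<^sup>2 \<le> (\<integral>x. ?G x \<partial>nu)"
    unfolding L2_norm_sq by (rule integral_mono_AE[OF L2D(2)[OF L] int le])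
  also have "\<dots> = (t - s) * (\<integral>\<tau>. \<integral>x. indicator {s<..t} \<tau> * (g \<tau> x)\<^sup>2 \<partial>nu \<partial>lborel)"
    using Fubini_integral[OF I] by simp
  also have "\<dots> = (t - s) * (\<integral>\<tau>. indicator {s<..t} \<tau> * (L2_norm nu (g \<tau>))\<^sup>2 \<partial>lborel)"
    by (simp add: L2_norm_sq)
  finally show "(L2_norm nu (tint g s t))\<^sup>2 \<le> (t - s) * (\<integral>\<tau>. indicator {s<..t} \<tau> * (L2_norm nu (g \<tau>))\<^sup>2 \<partial>lborel)" .
qed

lemma tint_norm_le:
  assumes g: "g \<in> LQ" and st: "s \<le> t"
  shows "L2_norm nu (tint g s t) \<le> sqrt (t - s) * L2_norm Q (case_prod g)"
proof -
  have "(\<integral>\<tau>. indicator {s<..t} \<tau> * (L2_norm nu (g \<tau>))\<^sup>2 \<partial>lborel) \<le> (L2_norm Q (case_prod g))\<^sup>2"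
    unfolding LQ_norm_sq[OF g, symmetric]
  proof (rule integral_mono[OF _ LQ_norm_sq_integrable[OF g]])
    show "integrable lborel (\<lambda>\<tau>. indicat_real {s<..t} \<tau> * (L2_norm nu (g \<tau>))\<^sup>2)"
      using integrable_real_mult_indicator[OF _ LQ_norm_sq_integrable[OF g], of "{s<..t}"]
      by (simp add: mult.commute)
  qed (auto simp: indicator_def)
  then have "(L2_norm nu (tint g s t))\<^sup>2 \<le> (t - s) * (L2_norm Q (case_prod g))\<^sup>2"
    using tint_L2(2)[OF assms] st by (meson diff_ge_0_iff_ge mult_left_mono order_trans)
  also have "\<dots> = (sqrt (t - s) * L2_norm Q (case_prod g))\<^sup>2" using st by (simp add: power_mult_distrib)
  finally show ?thesis by (rule power2_le_imp_le) (use st in simp)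
qed

lemma LQ_rectangle:
  assumes "\<theta> \<in> L2 nu"
  shows "(\<lambda>\<tau> x. indicat_real {s<..t} \<tau> * \<theta> x) \<in> LQ"
proof (rule LQ_I)
  have "(\<lambda>w. indicat_real {s<..t} (fst w) * \<theta> (snd w)) \<in> borel_measurable Q"
    by (intro borel_measurable_times measurable_compose[OF measurable_snd L2D(1)[OF assms]]) measurable
  then show "(\<lambda>(\<tau>, x). indicat_real {s<..t} \<tau> * \<theta> x) \<in> borel_measurable Q"
    by (simp add: split_beta')
  have "(L2_norm nu (\<lambda>x. indicator {s<..t} \<tau> * \<theta> x))\<^sup>2 = indicator {s<..t} \<tau> * (L2_norm nu \<theta>)\<^sup>2" for \<tau>
    by (auto simp: L2_norm_scale indicator_def)
  then show "integrable lborel (\<lambda>\<tau>. (L2_norm nu (\<lambda>x. indicator {s<..t} \<tau> * \<theta> x))\<^sup>2)"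
    using integrable_indicator_Ioc[of s t] by simp
qed (use L2_scale[OF assms] in auto)

lemma LQ_inner_integrable:
  assumes "g \<in> LQ" "\<theta> \<in> L2 nu"
  shows "integrable Q (\<lambda>(\<tau>, x). indicator {s<..t} \<tau> * (\<theta> x * g \<tau> x))"
proof -
  have "integrable Q (\<lambda>w. (case w of (\<tau>, x) \<Rightarrow> indicator {s<..t} \<tau> * \<theta> x) * case_prod g w)"
    using assms(1) LQ_rectangle[OF assms(2)] by (intro L2_mult_integrable) (auto simp: LQ_def)
  then show ?thesis by (simp add: split_beta' mult.assoc)
qed

text \<open>Fubini against the product of an indicator in time and \<theta>. It lets the chain
  inequality compare a spatial pairing taken at one time with an integral over nearby times.\<close>

lemma tint_inner:
  assumes "g \<in> LQ" "\<theta> \<in> L2 nu"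
  shows "integrable lborel (\<lambda>\<tau>. indicator {s<..t} \<tau> * (\<integral>x. \<theta> x * g \<tau> x \<partial>nu))"
    and "(\<integral>x. \<theta> x * tint g s t x \<partial>nu) = (\<integral>\<tau>. indicator {s<..t} \<tau> * (\<integral>x. \<theta> x * g \<tau> x \<partial>nu) \<partial>lborel)"
proof -
  note I = LQ_inner_integrable[OF assms, of s t]
  show "integrable lborel (\<lambda>\<tau>. indicator {s<..t} \<tau> * (\<integral>x. \<theta> x * g \<tau> x \<partial>nu))"
    using integrable_fst[OF I] by simp
  have "(\<integral>x. \<theta> x * tint g s t x \<partial>nu) = (\<integral>x. (\<integral>\<tau>. indicator {s<..t} \<tau> * (\<theta> x * g \<tau> x) \<partial>lborel) \<partial>nu)"
    unfolding tint_def by (simp add: mult.left_commute flip: integral_mult_right_zero)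
  also have "\<dots> = (\<integral>\<tau>. \<integral>x. indicator {s<..t} \<tau> * (\<theta> x * g \<tau> x) \<partial>nu \<partial>lborel)"
    by (rule Fubini_integral[OF I])
  finally show "(\<integral>x. \<theta> x * tint g s t x \<partial>nu) = (\<integral>\<tau>. indicator {s<..t} \<tau> * (\<integral>x. \<theta> x * g \<tau> x \<partial>nu) \<partial>lborel)"
    by simp
qed

lemma tint_add:
  assumes "g \<in> LQ" "s \<le> t" "t \<le> r"
  shows "AE x in nu. tint g s r x = tint g s t x + tint g t r x"
  using LQ_slice[OF assms(1)]
proof eventually_elim
  case (elim x)
  have "(\<integral>\<tau>. indicator {s<..t} \<tau> * g \<tau> x + indicator {t<..r} \<tau> * g \<tau> x \<partial>lborel) = tint g s t x + tint g t r x"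
    unfolding tint_def by (intro Bochner_Integration.integral_add L2_indicator_integrable elim)
  moreover have "indicator {s<..t} \<tau> * g \<tau> x + indicator {t<..r} \<tau> * g \<tau> x = indicator {s<..r} \<tau> * g \<tau> x" for \<tau>
    using assms by (auto simp: indicator_def)
  ultimately show ?case by (simp add: tint_def)
qed

lemma tint_diff:
  assumes "g \<in> LQ" "h \<in> LQ"
  shows "AE x in nu. tint (\<lambda>\<tau> x. g \<tau> x - h \<tau> x) s t x = tint g s t x - tint h s t x"
  using LQ_slice[OF assms(1)] LQ_slice[OF assms(2)]
proof eventually_elim
  case (elim x)
  show ?case unfolding tint_def right_diff_distrib
    by (intro Bochner_Integration.integral_diff L2_indicator_integrable elim)
qed

lemma tint_sum:
  assumes "\<And>i. i \<in> I \<Longrightarrow> g i \<in> LQ" "finite I"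
  shows "AE x in nu. tint (\<lambda>\<tau> x. \<Sum>i\<in>I. c i * g i \<tau> x) s t x = (\<Sum>i\<in>I. c i * tint (g i) s t x)"
proof -
  have "AE x in nu. \<forall>i\<in>I. (\<lambda>\<tau>. g i \<tau> x) \<in> L2 lborel"
    using assms by (intro AE_finite_allI LQ_slice)
  then show ?thesis
  proof eventually_elim
    case (elim x)
    have "tint (\<lambda>\<tau> x. \<Sum>i\<in>I. c i * g i \<tau> x) s t x = (\<integral>\<tau>. (\<Sum>i\<in>I. c i * (indicator {s<..t} \<tau> * g i \<tau> x)) \<partial>lborel)"
      unfolding tint_def by (simp add: sum_distrib_left mult.left_commute)
    also have "\<dots> = (\<Sum>i\<in>I. \<integral>\<tau>. c i * (indicator {s<..t} \<tau> * g i \<tau> x) \<partial>lborel)"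
      by (rule Bochner_Integration.integral_sum) (use elim in \<open>auto intro!: L2_indicator_integrable\<close>)
    finally show ?case by (simp add: tint_def)
  qed
qed

lemma tint_cong: "(\<And>\<tau>. s < \<tau> \<Longrightarrow> \<tau> \<le> t \<Longrightarrow> g \<tau> x = h \<tau> x) \<Longrightarrow> tint g s t x = tint h s t x"
  unfolding tint_def by (intro Bochner_Integration.integral_cong refl) (auto simp: indicator_def)

lemma tint_refl [simp]: "tint g s s x = 0"
  by (simp add: tint_def)

lemma tint_const: "s \<le> t \<Longrightarrow> (\<And>\<tau>. s < \<tau> \<Longrightarrow> \<tau> \<le> t \<Longrightarrow> g \<tau> x = c) \<Longrightarrow> tint g s t x = (t - s) * c"
  using tint_cong[of s t g x "\<lambda>_ _. c"] by (simp add: tint_def)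

lemma tint_LBINT: "s \<le> t \<Longrightarrow> (LBINT \<tau>=s..t. g \<tau> x) = tint g s t x"
  by (subst interval_integral_Ioc) (simp_all add: tint_def set_lebesgue_integral_def)

end

section \<open>A chain rule inequality\<close>

text \<open>\<delta> is uniform, so finitely many short steps of equal length cover the interval. In
  \<open>chain_inequality\<close> the decrease is first known only over steps short enough for the
  subgradient to be nearly constant.\<close>

lemma locally_nonincreasing:
  fixes D :: "real \<Rightarrow> real"
  assumes "0 < \<delta>" "a \<le> b"
    and loc: "\<And>s t. a \<le> s \<Longrightarrow> s \<le> t \<Longrightarrow> t \<le> b \<Longrightarrow> t - s < \<delta> \<Longrightarrow> D t \<le> D s"
  shows "D b \<le> D a"
proof -
  obtain n :: nat where n: "(b - a) / \<delta> < n" using reals_Archimedean2 by blast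
  have n0: "0 < real n" using n assms(1,2) by (smt (verit) divide_nonneg_pos)
  define h where "h = (b - a) / n"
  have h: "0 \<le> h" "h < \<delta>" "n * h = b - a"
    using n n0 assms by (auto simp: h_def field_simps)
  have "k \<le> n \<Longrightarrow> D (a + k * h) \<le> D a" for k :: nat
  proof (induction k)
    case (Suc k)
    have "real (Suc k) * h \<le> n * h" using Suc.prems h(1) by (intro mult_right_mono) auto
    then have "D (a + Suc k * h) \<le> D (a + k * h)"
      using h by (intro loc) (auto simp: algebra_simps)
    with Suc show ?case by simp
  qed simp
  from this[of n] show ?thesis using h by simp
qed

lemma lipschitz_borel:
  fixes q :: "real \<Rightarrow> real"
  assumes "\<And>r s. \<bar>q r - q s\<bar> \<le> L * \<bar>r - s\<bar>"
  shows "q \<in> borel_measurable borel"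
proof (rule borel_measurable_continuous_onI)
  have "L-lipschitz_on UNIV q"
  proof (rule lipschitz_onI)
    show "0 \<le> L" using assms[of 1 0] by simp
  qed (use assms in \<open>auto simp: dist_real_def\<close>)
  then show "continuous_on UNIV q" by (rule lipschitz_on_continuous_on)
qed

lemma L2_lipschitz:
  assumes "\<And>r s. \<bar>q r - q s\<bar> \<le> L * \<bar>r - s\<bar>" "q 0 = 0" "u \<in> L2 M"
  shows "(\<lambda>x. q (u x)) \<in> L2 M" "L2_norm M (\<lambda>x. q (u x)) \<le> L * L2_norm M u"
proof -
  have L: "0 \<le> L" using assms(1)[of 1 0] by simp
  have m: "(\<lambda>x. q (u x)) \<in> borel_measurable M"
    by (rule measurable_compose[OF L2D(1)[OF assms(3)] lipschitz_borel[OF assms(1)]])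
  have le: "AE x in M. \<bar>q (u x)\<bar> \<le> \<bar>L * u x\<bar>"
    using assms(1)[of _ 0] L by (simp add: assms(2) abs_mult)
  show "(\<lambda>x. q (u x)) \<in> L2 M" by (rule L2_dominated[OF L2_scale[OF assms(3)] m le])
  show "L2_norm M (\<lambda>x. q (u x)) \<le> L * L2_norm M u"
    using L2_norm_mono[OF L2_scale[OF assms(3)] m le] L by (simp add: L2_norm_scale)
qed

lemma L2_norm_lipschitz_diff:
  assumes "\<And>r s. \<bar>q r - q s\<bar> \<le> L * \<bar>r - s\<bar>" "u \<in> L2 M" "v \<in> L2 M"
  shows "L2_norm M (\<lambda>x. q (u x) - q (v x)) \<le> L * L2_norm M (\<lambda>x. u x - v x)"
proof -
  have L: "0 \<le> L" using assms(1)[of 1 0] by simp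
  note [measurable] = L2D(1)[OF assms(2)] L2D(1)[OF assms(3)] lipschitz_borel[OF assms(1)]
  have "L2_norm M (\<lambda>x. q (u x) - q (v x)) \<le> L2_norm M (\<lambda>x. L * (u x - v x))"
    by (rule L2_norm_mono[OF L2_scale[OF L2_diff[OF assms(2,3)]]])
      (use assms(1) L in \<open>auto simp: abs_mult\<close>)
  then show ?thesis using L by (simp add: L2_norm_scale)
qed

text \<open>The subgradient inequality between r and 0, used in both orders, gives 0 \<le> J r \<le>
  q r * r \<le> L * r^2, so \<open>J (u x)\<close> is dominated by a multiple of the square.\<close>

lemma convex_subgradient_integrable:
  assumes J: "\<And>r s. J r - J s \<le> q r * (r - s)" and "J 0 = 0" "q 0 = 0"
    and J_meas: "J \<in> borel_measurable borel"
    and q: "\<And>r s. \<bar>q r - q s\<bar> \<le> L * \<bar>r - s\<bar>"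
    and u: "u \<in> L2 M"
  shows "integrable M (\<lambda>x. J (u x))" "0 \<le> J r"
proof -
  have J0: "0 \<le> J r" for r using J[of 0 r] assms(2,3) by simp
  then show "0 \<le> J r" .
  have le: "\<bar>J r\<bar> \<le> L * r\<^sup>2" for r
  proof -
    have "J r \<le> q r * r" using J[of r 0] assms(2) by simp
    also have "\<dots> \<le> \<bar>q r\<bar> * \<bar>r\<bar>" by (metis abs_ge_self abs_mult)
    also have "\<dots> \<le> (L * \<bar>r\<bar>) * \<bar>r\<bar>" using q[of r 0] assms(3) by (intro mult_right_mono) auto
    finally show ?thesis using J0[of r] by (simp add: power2_eq_square mult.assoc)
  qed
  show "integrable M (\<lambda>x. J (u x))"
  proof (rule Bochner_Integration.integrable_bound)
    show "integrable M (\<lambda>x. L * (u x)\<^sup>2)" using L2D(2)[OF u] by simp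
    show "(\<lambda>x. J (u x)) \<in> borel_measurable M" by (rule measurable_compose[OF L2D(1)[OF u] J_meas])
    show "AE x in M. norm (J (u x)) \<le> norm (L * (u x)\<^sup>2)"
      unfolding real_norm_def by (intro AE_I2 order_trans[OF le abs_ge_self])
  qed
qed

context time_space
begin

lemma tint_norm_increment:
  assumes "\<zeta> \<in> LQ" "s \<le> t" "z s \<in> L2 nu" "z t \<in> L2 nu" "AE x in nu. z t x = z s x + tint \<zeta> s t x"
  shows "L2_norm nu (\<lambda>x. z t x - z s x) \<le> sqrt (t - s) * L2_norm Q (case_prod \<zeta>)"
proof -
  have "L2_norm nu (\<lambda>x. z t x - z s x) = L2_norm nu (tint \<zeta> s t)"
    using assms(5) L2D(1)[OF L2_diff[OF assms(4,3)]] L2D(1)[OF tint_L2(1)[OF assms(1,2)]]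
    by (intro L2_norm_cong_AE) auto
  with tint_norm_le[OF assms(1,2)] show ?thesis by simp
qed

text \<open>On short intervals the convexity of \<open>J\<close> bounds the increment by the subgradient at the right end
  point, which is uniformly close to the subgradient at the intermediate times.\<close>

lemma chain_inequality:
  fixes z :: "real \<Rightarrow> 'a \<Rightarrow> real" and q J G \<gamma> B :: "real \<Rightarrow> real"
  assumes ab: "a \<le> b"
    and z: "\<And>t. a \<le> t \<Longrightarrow> t \<le> b \<Longrightarrow> z t \<in> L2 nu"
    and \<zeta>: "\<zeta> \<in> LQ"
    and inc: "\<And>s t. a \<le> s \<Longrightarrow> s \<le> t \<Longrightarrow> t \<le> b \<Longrightarrow> AE x in nu. z t x = z s x + tint \<zeta> s t x"
    and q: "\<And>r s. \<bar>q r - q s\<bar> \<le> L * \<bar>r - s\<bar>" and q0: "q 0 = 0"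
    and J: "\<And>r s. J r - J s \<le> q r * (r - s)" and J0: "J 0 = 0"
    and J_meas: "J \<in> borel_measurable borel"
    and \<gamma>: "integrable lborel \<gamma>" "\<And>\<tau>. 0 \<le> \<gamma> \<tau>"
    and G: "\<And>s t. a \<le> s \<Longrightarrow> s \<le> t \<Longrightarrow> t \<le> b \<Longrightarrow> G t - G s = (\<integral>\<tau>. indicator {s<..t} \<tau> * \<gamma> \<tau> \<partial>lborel)"
    and G_cont: "continuous_on {a..b} G" and G_pos: "0 < G a"
    and B: "integrable lborel B"
    and ineq: "AE \<tau> in lborel. a < \<tau> \<longrightarrow> \<tau> \<le> b \<longrightarrow>
      (\<integral>x. q (z \<tau> x / G \<tau>) * \<zeta> \<tau> x \<partial>nu) - \<gamma> \<tau> * (\<integral>x. q (z \<tau> x / G \<tau>) * (z \<tau> x / G \<tau>) \<partial>nu) \<le> G \<tau> * B \<tau>"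
  shows "(\<integral>x. J (z b x / G b) \<partial>nu) \<le> (\<integral>x. J (z a x / G a) \<partial>nu) + (\<integral>\<tau>. indicator {a<..b} \<tau> * B \<tau> \<partial>lborel)"
proof -
  define c where "c = G a"
  have c: "0 < c" using G_pos by (simp add: c_def)
  have L: "0 \<le> L" using q[of 1 0] by simp
  have G_mono: "G s \<le> G t" if "a \<le> s" "s \<le> t" "t \<le> b" for s t
  proof -
    have "0 \<le> G t - G s" unfolding G[OF that] using \<gamma>(2) by (intro integral_nonneg_AE) auto
    then show ?thesis by simp
  qed
  have Gc: "c \<le> G t" if "a \<le> t" "t \<le> b" for t unfolding c_def using G_mono[of a t] that by simp
  define y where "y t x = z t x / G t" for t x
  have y: "y t \<in> L2 nu" if "a \<le> t" "t \<le> b" for t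
    using L2_scale[OF z[OF that], of "1 / G t"] by (simp add: y_def[abs_def])
  have qy: "(\<lambda>x. q (y t x)) \<in> L2 nu" if "a \<le> t" "t \<le> b" for t
    by (rule L2_lipschitz(1)[OF q q0 y[OF that]])
  define Z where "Z = L2_norm Q (case_prod \<zeta>)"
  have Z: "0 \<le> Z" by (simp add: Z_def)
  have zinc: "L2_norm nu (\<lambda>x. z t x - z s x) \<le> sqrt (t - s) * Z" if "a \<le> s" "s \<le> t" "t \<le> b" for s t
    unfolding Z_def by (rule tint_norm_increment[OF \<zeta>]) (use that z inc in auto)
  define M where "M = (L2_norm nu (z a) + sqrt (b - a) * Z) / c"
  have M: "0 \<le> M" using c Z ab by (simp add: M_def)
  have yM: "L2_norm nu (y t) \<le> M" if "a \<le> t" "t \<le> b" for t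
  proof -
    have "L2_norm nu (z t) \<le> L2_norm nu (\<lambda>x. z t x - z a x) + L2_norm nu (z a)"
      using L2_norm_triangle[OF L2_diff[OF z[of t] z[of a]] z[of a]] that by simp
    also have "\<dots> \<le> sqrt (t - a) * Z + L2_norm nu (z a)" using zinc[of a t] that by simp
    also have "\<dots> \<le> sqrt (b - a) * Z + L2_norm nu (z a)" using that Z by (intro add_right_mono mult_right_mono) auto
    finally have "L2_norm nu (z t) \<le> M * c" using c by (simp add: M_def)
    also have "\<dots> \<le> M * G t" using M Gc[OF that] by (intro mult_left_mono)
    finally have "L2_norm nu (z t) \<le> M * G t" .
    moreover have "L2_norm nu (y t) = L2_norm nu (z t) / G t"
      using L2_norm_scale[of nu "1 / G t" "z t"] Gc[OF that] c by (simp add: y_def[abs_def])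
    ultimately show ?thesis using Gc[OF that] c by (simp add: divide_le_eq)
  qed
  \<comment> \<open>A discrete quotient rule. The factor \<open>y t\<close> is kept at the right end
    point, where the subgradient is taken; only the denominator \<open>G s\<close> refers to the
    left one.\<close>
  have ydecomp: "y t x - y s x = (1 / G s) * (z t x - z s x) - ((G t - G s) / G s) * y t x"
    if "a \<le> s" "s \<le> t" "t \<le> b" for s t x
    using Gc[of s] Gc[of t] that c by (simp add: y_def field_simps)
  have yinc: "L2_norm nu (\<lambda>x. y t x - y s x) \<le> (sqrt (t - s) * Z + (G t - G s) * M) / c"
    if "a \<le> s" "s \<le> t" "t \<le> b" for s t
  proof -
    have Gs: "c \<le> G s" "G s \<le> G t" "0 < G s" using Gc[of s] G_mono[OF that] that c by auto
    have "L2_norm nu (\<lambda>x. y t x - y s x) \<le>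
      L2_norm nu (\<lambda>x. (1 / G s) * (z t x - z s x)) + L2_norm nu (\<lambda>x. ((G t - G s) / G s) * y t x)"
      unfolding ydecomp[OF that]
      by (intro L2_norm_triangle_diff L2_scale L2_diff z y) (use that in auto)
    also have "\<dots> = (L2_norm nu (\<lambda>x. z t x - z s x) + (G t - G s) * L2_norm nu (y t)) / G s"
      using Gs unfolding L2_norm_scale by (simp add: add_divide_distrib)
    also have "\<dots> \<le> (sqrt (t - s) * Z + (G t - G s) * M) / G s"
      using zinc[OF that] yM[of t] that Gs by (intro divide_right_mono add_mono mult_left_mono) auto
    also have "\<dots> \<le> (sqrt (t - s) * Z + (G t - G s) * M) / c"
      using Gs Z M c that by (intro divide_left_mono) auto
    finally show ?thesis .
  qed
  have Jy: "integrable nu (\<lambda>x. J (y t x))" if "a \<le> t" "t \<le> b" for t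
    by (rule convex_subgradient_integrable(1)[OF J J0 q0 J_meas q y[OF that]])
  \<comment> \<open>Integrable weight of the three errors made by freezing time at an end point: in
    the pairing with \<zeta>, in the term with \<gamma>, and in the factor \<open>G \<tau>\<close>
    of \<open>B\<close>. Over the whole interval they cost a multiple of \<open>K\<close>.\<close>
  define E where "E \<tau> = indicator {a<..b} \<tau> * L2_norm nu (\<zeta> \<tau>) + \<gamma> \<tau> + \<bar>B \<tau>\<bar>" for \<tau>
  have E: "integrable lborel E" unfolding E_def
    using \<gamma>(1) B L2_indicator_integrable[OF LQ_norm_L2[OF \<zeta>]] by auto
  have E0: "0 \<le> E \<tau>" for \<tau> using \<gamma>(2)[of \<tau>] by (auto simp: E_def indicator_def)
  define K where "K = (\<integral>\<tau>. indicator {a<..b} \<tau> * E \<tau> \<partial>lborel)"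
  have K: "0 \<le> K" unfolding K_def using E0 by (intro integral_nonneg_AE) auto
  have ind: "integrable lborel (\<lambda>\<tau>. indicator {s<..t} \<tau> * h \<tau>)" if "integrable lborel h" for s t and h :: "real \<Rightarrow> real"
    using integrable_real_mult_indicator[OF _ that, of "{s<..t}"] by (simp add: mult.commute)
  have key: "(\<integral>x. J (y b x) \<partial>nu) - (\<integral>x. J (y a x) \<partial>nu) \<le> (\<integral>\<tau>. indicator {a<..b} \<tau> * (B \<tau> + e * E \<tau>) \<partial>lborel)"
    if e: "0 < e" for e
  proof -
    \<comment> \<open>Tolerance for the variation of \<open>G\<close> and of \<open>y\<close> on
      short intervals. The three summands of the denominator belong to the errors estimated in
      \<open>A3\<close>, \<open>A1\<close> and \<open>A2\<close>, each of which may cost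
      \<open>e * c\<close> times its weight.\<close>
    define \<eta> where "\<eta> = e * c / (1 + L + 2 * L * M)"
    have den: "1 \<le> 1 + L + 2 * L * M" using L M by simp
    then have \<eta>: "0 < \<eta>" unfolding \<eta>_def using e c by (intro divide_pos_pos mult_pos_pos) auto
    have \<eta>1: "\<eta> * (1 + L + 2 * L * M) = e * c" using den by (simp add: \<eta>_def)
    have \<eta>2: "\<eta> \<le> e * c" "\<eta> * L \<le> e * c" "\<eta> * (2 * L * M) \<le> e * c"
    proof -
      have "0 \<le> \<eta> * L" "0 \<le> \<eta> * (2 * L * M)" using \<eta> L M by auto
      moreover have "\<eta> + \<eta> * L + \<eta> * (2 * L * M) = e * c"
        using \<eta>1 by (simp only: distrib_left mult_1_right)
      ultimately show "\<eta> \<le> e * c" "\<eta> * L \<le> e * c" "\<eta> * (2 * L * M) \<le> e * c"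
        using \<eta> by linarith+
    qed
    \<comment> \<open>Half of the allowance \<open>\<eta> * c\<close> for the increment of
      \<open>y\<close> goes to the growth of \<open>G\<close>, through \<kappa>; the other half goes
      to the increment of \<open>z\<close>, through \<open>\<delta>2\<close> and the square-root
      modulus.\<close>
    define \<kappa> where "\<kappa> = min \<eta> (\<eta> * c / (2 * (M + 1)))"
    have \<kappa>: "0 < \<kappa>" "\<kappa> \<le> \<eta>" "\<kappa> * M \<le> \<eta> * c / 2"
    proof -
      have "0 < \<eta> * c / (2 * (M + 1))" using \<eta> c M by (intro divide_pos_pos mult_pos_pos) auto
      then show "0 < \<kappa>" "\<kappa> \<le> \<eta>" using \<eta> unfolding \<kappa>_def by simp_all
      have "\<kappa> * M \<le> \<eta> * c / (2 * (M + 1)) * M" using M unfolding \<kappa>_def by (intro mult_right_mono min.cobounded2)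
      also have "\<dots> \<le> \<eta> * c / 2" using M \<eta> c by (simp add: field_simps)
      finally show "\<kappa> * M \<le> \<eta> * c / 2" .
    qed
    have "uniformly_continuous_on {a..b} G" by (intro compact_uniformly_continuous G_cont) auto
    then obtain \<delta>1 where \<delta>1: "0 < \<delta>1" "\<And>s t. s \<in> {a..b} \<Longrightarrow> t \<in> {a..b} \<Longrightarrow> \<bar>t - s\<bar> < \<delta>1 \<Longrightarrow> \<bar>G t - G s\<bar> < \<kappa>"
      unfolding uniformly_continuous_on_def dist_real_def using \<kappa>(1) by blast
    define \<delta>2 where "\<delta>2 = (\<eta> * c / (2 * (Z + 1)))\<^sup>2"
    have \<delta>2: "0 < \<delta>2" using \<eta> c Z by (simp add: \<delta>2_def)
    define \<delta> where "\<delta> = min \<delta>1 \<delta>2"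
    have \<delta>: "0 < \<delta>" using \<delta>1 \<delta>2 by (simp add: \<delta>_def)
    have Gsm: "G t - G s \<le> \<eta>" and ysm: "L2_norm nu (\<lambda>x. y t x - y s x) \<le> \<eta>"
      if st: "a \<le> s" "s \<le> t" "t \<le> b" "t - s < \<delta>" for s t
    proof -
      have g: "G t - G s \<le> \<kappa>" using \<delta>1(2)[of s t] st by (auto simp: \<delta>_def)
      then show "G t - G s \<le> \<eta>" using \<kappa> by simp
      have "sqrt (t - s) \<le> sqrt \<delta>2" using st by (simp add: \<delta>_def)
      also have "\<dots> = \<eta> * c / (2 * (Z + 1))" using \<eta> c Z by (simp add: \<delta>2_def)
      finally have "sqrt (t - s) * Z \<le> \<eta> * c / (2 * (Z + 1)) * Z" using Z by (intro mult_right_mono)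
      also have "\<dots> \<le> \<eta> * c / 2" using Z \<eta> c by (simp add: field_simps)
      finally have 1: "sqrt (t - s) * Z \<le> \<eta> * c / 2" .
      have 2: "(G t - G s) * M \<le> \<eta> * c / 2" using mult_right_mono[OF g M] \<kappa>(3) by simp
      have "(sqrt (t - s) * Z + (G t - G s) * M) / c \<le> (\<eta> * c) / c"
        using 1 2 c by (intro divide_right_mono) auto
      then show "L2_norm nu (\<lambda>x. y t x - y s x) \<le> \<eta>" using yinc[OF st(1-3)] c by simp
    qed
    let ?D = "\<lambda>t. (\<integral>x. J (y t x) \<partial>nu) - (\<integral>\<tau>. indicator {a<..t} \<tau> * (B \<tau> + e * E \<tau>) \<partial>lborel)"
    have BE: "integrable lborel (\<lambda>\<tau>. B \<tau> + e * E \<tau>)" using B E by auto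
    have "?D b \<le> ?D a"
    proof (rule locally_nonincreasing[OF \<delta> ab])
      fix s t assume st: "a \<le> s" "s \<le> t" "t \<le> b" "t - s < \<delta>"
      then have t: "a \<le> t" "t \<le> b" and s: "a \<le> s" "s \<le> b" by auto
      have Gs: "c \<le> G s" "0 < G s" using Gc[OF s] c by auto
      let ?q = "\<lambda>x. q (y t x)"
      have i1: "integrable nu (\<lambda>x. ?q x * (z t x - z s x))" by (intro L2_mult_integrable qy t L2_diff z s)
      have i2: "integrable nu (\<lambda>x. ?q x * y t x)" by (intro L2_mult_integrable qy t y)
      have "(\<integral>x. J (y t x) \<partial>nu) - (\<integral>x. J (y s x) \<partial>nu) = (\<integral>x. J (y t x) - J (y s x) \<partial>nu)"
        using Jy[OF t] Jy[OF s] by simp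
      also have "\<dots> \<le> (\<integral>x. ?q x * (y t x - y s x) \<partial>nu)"
        by (intro integral_mono Bochner_Integration.integrable_diff Jy t s L2_mult_integrable qy L2_diff y J)
      also have "\<dots> = (\<integral>x. (1 / G s) * (?q x * (z t x - z s x)) - ((G t - G s) / G s) * (?q x * y t x) \<partial>nu)"
        unfolding ydecomp[OF st(1-3)] by (simp add: algebra_simps)
      also have "\<dots> = (1 / G s) * (\<integral>x. ?q x * (z t x - z s x) \<partial>nu) - ((G t - G s) / G s) * (\<integral>x. ?q x * y t x \<partial>nu)"
        using i1 i2 by (subst Bochner_Integration.integral_diff) simp_all
      also have "(\<integral>x. ?q x * (z t x - z s x) \<partial>nu) = (\<integral>x. ?q x * tint \<zeta> s t x \<partial>nu)"
        using inc[OF st(1-3)] L2D(1)[OF qy[OF t]] L2D(1)[OF z[OF t]] L2D(1)[OF z[OF s]] L2D(1)[OF tint_L2(1)[OF \<zeta> st(2)]]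
        by (intro integral_cong_AE) auto
      also have "\<dots> = (\<integral>\<tau>. indicator {s<..t} \<tau> * (\<integral>x. ?q x * \<zeta> \<tau> x \<partial>nu) \<partial>lborel)"
        by (rule tint_inner(2)[OF \<zeta> qy[OF t]])
      also have "(1 / G s) * (\<integral>\<tau>. indicator {s<..t} \<tau> * (\<integral>x. ?q x * \<zeta> \<tau> x \<partial>nu) \<partial>lborel)
          - ((G t - G s) / G s) * (\<integral>x. ?q x * y t x \<partial>nu)
        = (\<integral>\<tau>. (1 / G s) * (indicator {s<..t} \<tau> * (\<integral>x. ?q x * \<zeta> \<tau> x \<partial>nu))
          - ((\<integral>x. ?q x * y t x \<partial>nu) / G s) * (indicator {s<..t} \<tau> * \<gamma> \<tau>) \<partial>lborel)"
        unfolding G[OF st(1-3)] using tint_inner(1)[OF \<zeta> qy[OF t], of s t] ind[OF \<gamma>(1), of s t]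
        by (subst Bochner_Integration.integral_diff) simp_all
      also have "\<dots> \<le> (\<integral>\<tau>. indicator {s<..t} \<tau> * (B \<tau> + e * E \<tau>) \<partial>lborel)"
      proof (rule integral_mono_AE)
        show "integrable lborel (\<lambda>\<tau>. (1 / G s) * (indicator {s<..t} \<tau> * (\<integral>x. ?q x * \<zeta> \<tau> x \<partial>nu))
          - ((\<integral>x. ?q x * y t x \<partial>nu) / G s) * (indicator {s<..t} \<tau> * \<gamma> \<tau>))"
          using tint_inner(1)[OF \<zeta> qy[OF t], of s t] ind[OF \<gamma>(1), of s t] by simp
        show "integrable lborel (\<lambda>\<tau>. indicator {s<..t} \<tau> * (B \<tau> + e * E \<tau>))" by (rule ind[OF BE])
        show "AE \<tau> in lborel. (1 / G s) * (indicator {s<..t} \<tau> * (\<integral>x. ?q x * \<zeta> \<tau> x \<partial>nu))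
          - ((\<integral>x. ?q x * y t x \<partial>nu) / G s) * (indicator {s<..t} \<tau> * \<gamma> \<tau>) \<le> indicator {s<..t} \<tau> * (B \<tau> + e * E \<tau>)"
          using ineq LQ_section[OF \<zeta>]
        proof eventually_elim
          case (elim \<tau>)
          show ?case
          proof (cases "\<tau> \<in> {s<..t}")
            case True
            then have \<tau>: "a \<le> \<tau>" "\<tau> \<le> b" "a < \<tau>" "\<tau> \<le> t" "t - \<tau> < \<delta>" "s \<le> \<tau>" "\<tau> - s < \<delta>" using st by auto
            let ?r = "\<lambda>x. q (y \<tau> x)"
            have yd: "L2_norm nu (\<lambda>x. y t x - y \<tau> x) \<le> \<eta>" using ysm[of \<tau> t] \<tau> t by auto
            have qd: "L2_norm nu (\<lambda>x. ?q x - ?r x) \<le> L * \<eta>"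
              using L2_norm_lipschitz_diff[OF q y[OF t] y[OF \<tau>(1,2)]] mult_left_mono[OF yd L] by linarith
            have qr: "(\<lambda>x. ?q x - ?r x) \<in> L2 nu" by (intro L2_diff qy t \<tau>)
            have "(\<integral>x. ?q x * \<zeta> \<tau> x \<partial>nu) - (\<integral>x. ?r x * \<zeta> \<tau> x \<partial>nu) = (\<integral>x. (?q x - ?r x) * \<zeta> \<tau> x \<partial>nu)"
              using L2_mult_integrable[OF qy[OF t] elim(2)] L2_mult_integrable[OF qy[OF \<tau>(1,2)] elim(2)]
              by (simp add: left_diff_distrib)
            also have "\<dots> \<le> L2_norm nu (\<lambda>x. ?q x - ?r x) * L2_norm nu (\<zeta> \<tau>)"
              using L2_Cauchy_Schwarz[OF qr elim(2)] by simp
            also have "\<dots> \<le> (L * \<eta>) * L2_norm nu (\<zeta> \<tau>)" by (intro mult_right_mono qd) simp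
            also have "\<dots> \<le> (e * c) * L2_norm nu (\<zeta> \<tau>)" using \<eta>2(2) by (intro mult_right_mono) (simp_all add: mult.commute)
            finally have A1: "(\<integral>x. ?q x * \<zeta> \<tau> x \<partial>nu) \<le> (\<integral>x. ?r x * \<zeta> \<tau> x \<partial>nu) + (e * c) * L2_norm nu (\<zeta> \<tau>)" by simp
            have "(\<integral>x. ?r x * y \<tau> x \<partial>nu) - (\<integral>x. ?q x * y t x \<partial>nu)
                = - (\<integral>x. (?q x - ?r x) * y t x \<partial>nu) - (\<integral>x. ?r x * (y t x - y \<tau> x) \<partial>nu)"
              using L2_mult_integrable[OF qy[OF t] y[OF t]] L2_mult_integrable[OF qy[OF \<tau>(1,2)] y[OF \<tau>(1,2)]]
                L2_mult_integrable[OF qy[OF \<tau>(1,2)] y[OF t]]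
              by (simp add: left_diff_distrib right_diff_distrib)
            also have "\<dots> \<le> L2_norm nu (\<lambda>x. ?q x - ?r x) * L2_norm nu (y t) + L2_norm nu ?r * L2_norm nu (\<lambda>x. y t x - y \<tau> x)"
              using L2_Cauchy_Schwarz[OF qr y[OF t]] L2_Cauchy_Schwarz[OF qy[OF \<tau>(1,2)] L2_diff[OF y[OF t] y[OF \<tau>(1,2)]]]
              by linarith
            also have "\<dots> \<le> (L * \<eta>) * M + (L * M) * \<eta>"
            proof (intro add_mono mult_mono qd yM t yd)
              show "L2_norm nu ?r \<le> L * M"
                using L2_lipschitz(2)[OF q q0 y[OF \<tau>(1,2)]] mult_left_mono[OF yM[OF \<tau>(1,2)] L] by linarith
            qed (use L M \<eta> in auto)
            also have "\<dots> \<le> e * c" using \<eta>2(3) by (simp add: algebra_simps)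
            finally have A2: "\<gamma> \<tau> * ((\<integral>x. ?r x * y \<tau> x \<partial>nu) - (\<integral>x. ?q x * y t x \<partial>nu)) \<le> \<gamma> \<tau> * (e * c)"
              using \<gamma>(2) by (intro mult_left_mono)
            have A3: "G \<tau> * B \<tau> \<le> G s * B \<tau> + (e * c) * \<bar>B \<tau>\<bar>"
            proof -
              have "(G \<tau> - G s) * B \<tau> \<le> (G \<tau> - G s) * \<bar>B \<tau>\<bar>"
                using G_mono[of s \<tau>] \<tau> s by (intro mult_left_mono) auto
              also have "\<dots> \<le> (e * c) * \<bar>B \<tau>\<bar>" using Gsm[of s \<tau>] \<tau> s \<eta>2(1) by (intro mult_right_mono) auto
              finally show ?thesis by (simp add: algebra_simps)
            qed
            have "(\<integral>x. ?q x * \<zeta> \<tau> x \<partial>nu) - \<gamma> \<tau> * (\<integral>x. ?q x * y t x \<partial>nu)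
              \<le> G s * B \<tau> + (e * c) * (L2_norm nu (\<zeta> \<tau>) + \<gamma> \<tau> + \<bar>B \<tau>\<bar>)"
              using A1 A2 A3 elim(1) \<tau> unfolding y_def[symmetric] by (simp add: algebra_simps)
            also have "\<dots> = G s * B \<tau> + (e * c) * E \<tau>" using \<tau> by (simp add: E_def)
            also have "\<dots> \<le> G s * B \<tau> + (e * G s) * E \<tau>"
              using Gs e E0[of \<tau>] by (intro add_left_mono mult_right_mono mult_left_mono) auto
            finally have "((\<integral>x. ?q x * \<zeta> \<tau> x \<partial>nu) - \<gamma> \<tau> * (\<integral>x. ?q x * y t x \<partial>nu)) / G s \<le> B \<tau> + e * E \<tau>"
              using Gs by (simp add: divide_le_eq algebra_simps)
            then show ?thesis using True by (simp add: diff_divide_distrib mult.commute)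
          qed simp
        qed
      qed
      also have "\<dots> = (\<integral>\<tau>. indicator {a<..t} \<tau> * (B \<tau> + e * E \<tau>) - indicator {a<..s} \<tau> * (B \<tau> + e * E \<tau>) \<partial>lborel)"
        by (intro Bochner_Integration.integral_cong refl) (use st in \<open>auto simp: indicator_def\<close>)
      also have "\<dots> = (\<integral>\<tau>. indicator {a<..t} \<tau> * (B \<tau> + e * E \<tau>) \<partial>lborel) - (\<integral>\<tau>. indicator {a<..s} \<tau> * (B \<tau> + e * E \<tau>) \<partial>lborel)"
        by (intro Bochner_Integration.integral_diff ind BE)
      finally show "?D t \<le> ?D s" by simp
    qed
    then show ?thesis by simp
  qed
  have "(\<integral>x. J (y b x) \<partial>nu) \<le> (\<integral>x. J (y a x) \<partial>nu) + (\<integral>\<tau>. indicator {a<..b} \<tau> * B \<tau> \<partial>lborel)"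
  proof (rule field_le_epsilon)
    fix e :: real assume e: "0 < e"
    define e' where "e' = e / (K + 1)"
    have e': "0 < e'" "e' * K \<le> e" using e K by (auto simp: e'_def field_simps)
    have "(\<integral>\<tau>. indicator {a<..b} \<tau> * (B \<tau> + e' * E \<tau>) \<partial>lborel)
      = (\<integral>\<tau>. indicator {a<..b} \<tau> * B \<tau> + e' * (indicator {a<..b} \<tau> * E \<tau>) \<partial>lborel)"
      by (simp add: algebra_simps)
    also have "\<dots> = (\<integral>\<tau>. indicator {a<..b} \<tau> * B \<tau> \<partial>lborel) + e' * K"
      unfolding K_def using ind[OF B, of a b] ind[OF E, of a b] by (subst Bochner_Integration.integral_add) simp_all
    finally show "(\<integral>x. J (y b x) \<partial>nu) \<le> (\<integral>x. J (y a x) \<partial>nu) + (\<integral>\<tau>. indicator {a<..b} \<tau> * B \<tau> \<partial>lborel) + e"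
      using key[OF e'(1)] e'(2) by linarith
  qed
  then show ?thesis by (simp add: y_def)
qed

end

section \<open>Completely accretive operators and Luxemburg norms\<close>

text \<open>Convexity bounds the difference of the integrals from both sides, by the slope at one
  function or at the other times their distance; the linear growth of \<open>q\<close> makes this a
  modulus in the L2 distance.\<close>

lemma L2_convex_functional_continuous:
  assumes J: "\<And>r s. J r - J s \<le> q r * (r - s)" and "J 0 = 0" "q 0 = 0"
    and J_meas: "J \<in> borel_measurable borel"
    and q: "\<And>r s. \<bar>q r - q s\<bar> \<le> L * \<bar>r - s\<bar>"
    and u: "\<forall>\<^sub>F t in F. u t \<in> L2 M" and v: "v \<in> L2 M"
    and lim: "((\<lambda>t. L2_norm M (\<lambda>x. u t x - v x)) \<longlongrightarrow> 0) F"
  shows "((\<lambda>t. \<integral>x. J (u t x) \<partial>M) \<longlongrightarrow> (\<integral>x. J (v x) \<partial>M)) F"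
proof (rule Lim_null_comparison[THEN LIM_zero_cancel])
  let ?d = "\<lambda>t. L2_norm M (\<lambda>x. u t x - v x)"
  show "\<forall>\<^sub>F t in F. norm ((\<integral>x. J (u t x) \<partial>M) - (\<integral>x. J (v x) \<partial>M)) \<le> L * (?d t + L2_norm M v) * ?d t"
    using u
  proof eventually_elim
    case (elim t)
    note int = convex_subgradient_integrable(1)[OF J assms(2,3) J_meas q]
    note qL = L2_lipschitz[OF q assms(3)]
    have L: "0 \<le> L" using q[of 1 0] by simp
    have d: "(\<lambda>x. u t x - v x) \<in> L2 M" by (rule L2_diff[OF elim v])
    have "(\<integral>x. J (u t x) \<partial>M) - (\<integral>x. J (v x) \<partial>M) = (\<integral>x. J (u t x) - J (v x) \<partial>M)"
      using int[OF elim] int[OF v] by simp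
    also have "\<dots> \<le> (\<integral>x. q (u t x) * (u t x - v x) \<partial>M)"
      by (intro integral_mono Bochner_Integration.integrable_diff int elim v L2_mult_integrable qL(1) d J)
    also have "\<dots> \<le> L2_norm M (\<lambda>x. q (u t x)) * ?d t"
      using L2_Cauchy_Schwarz[OF qL(1)[OF elim] d] by simp
    also have "\<dots> \<le> (L * (?d t + L2_norm M v)) * ?d t"
    proof (intro mult_right_mono order_trans[OF qL(2)[OF elim]] mult_left_mono L)
      show "L2_norm M (u t) \<le> ?d t + L2_norm M v" using L2_norm_triangle[OF d v] by simp
    qed simp
    finally have 1: "(\<integral>x. J (u t x) \<partial>M) - (\<integral>x. J (v x) \<partial>M) \<le> L * (?d t + L2_norm M v) * ?d t" .
    have "(\<integral>x. J (v x) \<partial>M) - (\<integral>x. J (u t x) \<partial>M) = (\<integral>x. J (v x) - J (u t x) \<partial>M)"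
      using int[OF elim] int[OF v] by simp
    also have "\<dots> \<le> (\<integral>x. q (v x) * (v x - u t x) \<partial>M)"
      by (intro integral_mono Bochner_Integration.integrable_diff int elim v L2_mult_integrable qL(1) L2_diff J)
    also have "\<dots> \<le> L2_norm M (\<lambda>x. q (v x)) * ?d t"
      using L2_Cauchy_Schwarz[OF qL(1)[OF v] L2_diff[OF v elim]] by (simp add: L2_norm_minus_commute[of M v])
    also have "\<dots> \<le> (L * (?d t + L2_norm M v)) * ?d t"
      by (intro mult_right_mono order_trans[OF qL(2)[OF v]] mult_left_mono L) simp_all
    finally show ?case using 1 by (simp add: abs_le_iff)
  qed
  have "((\<lambda>t. L * (?d t + L2_norm M v) * ?d t) \<longlongrightarrow> L * (0 + L2_norm M v) * 0) F"
    by (intro tendsto_intros lim)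
  then show "((\<lambda>t. L * (?d t + L2_norm M v) * ?d t) \<longlongrightarrow> 0) F" by simp
qed

lemma indefinite_integral_increment:
  assumes "integrable lborel (\<gamma> :: real \<Rightarrow> real)" "a \<le> s" "s \<le> t"
  shows "(\<integral>\<tau>. indicator {a<..t} \<tau> * \<gamma> \<tau> \<partial>lborel) - (\<integral>\<tau>. indicator {a<..s} \<tau> * \<gamma> \<tau> \<partial>lborel)
    = (\<integral>\<tau>. indicator {s<..t} \<tau> * \<gamma> \<tau> \<partial>lborel)"
proof -
  have ind: "integrable lborel (\<lambda>\<tau>. indicator {s<..t} \<tau> * \<gamma> \<tau>)" for s t
    using integrable_real_mult_indicator[OF _ assms(1), of "{s<..t}"] by (simp add: mult.commute)
  have "(\<integral>\<tau>. indicator {a<..t} \<tau> * \<gamma> \<tau> \<partial>lborel) - (\<integral>\<tau>. indicator {a<..s} \<tau> * \<gamma> \<tau> \<partial>lborel)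
    = (\<integral>\<tau>. indicator {a<..t} \<tau> * \<gamma> \<tau> - indicator {a<..s} \<tau> * \<gamma> \<tau> \<partial>lborel)"
    using ind by simp
  also have "\<dots> = (\<integral>\<tau>. indicator {s<..t} \<tau> * \<gamma> \<tau> \<partial>lborel)"
    by (intro Bochner_Integration.integral_cong refl) (use assms in \<open>auto simp: indicator_def\<close>)
  finally show ?thesis .
qed

text \<open>Dominated convergence: the indicators converge except possibly at \<tau> = t, a null
  set.\<close>

lemma indefinite_integral_continuous_lborel:
  assumes \<gamma>: "integrable lborel (\<gamma> :: real \<Rightarrow> real)"
  shows "continuous_on A (\<lambda>t. \<integral>\<tau>. indicator {a<..t} \<tau> * \<gamma> \<tau> \<partial>lborel)"
proof (rule continuous_on_sequentiallyI)
  fix u :: "nat \<Rightarrow> real" and t assume u: "u \<longlonglongrightarrow> t"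
  have [measurable]: "\<gamma> \<in> borel_measurable borel" using \<gamma> by auto
  show "(\<lambda>n. \<integral>\<tau>. indicator {a<..u n} \<tau> * \<gamma> \<tau> \<partial>lborel) \<longlonglongrightarrow> (\<integral>\<tau>. indicator {a<..t} \<tau> * \<gamma> \<tau> \<partial>lborel)"
  proof (rule integral_dominated_convergence[where w="\<lambda>\<tau>. \<bar>\<gamma> \<tau>\<bar>"])
    show "integrable lborel (\<lambda>\<tau>. \<bar>\<gamma> \<tau>\<bar>)" using \<gamma> by simp
    show "AE \<tau> in lborel. (\<lambda>n. indicator {a<..u n} \<tau> * \<gamma> \<tau>) \<longlonglongrightarrow> indicator {a<..t} \<tau> * \<gamma> \<tau>"
      using AE_lborel_singleton[of t]
    proof eventually_elim
      case (elim \<tau>)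
      have "\<forall>\<^sub>F n in sequentially. indicat_real {a<..u n} \<tau> = indicator {a<..t} \<tau>"
      proof (cases "\<tau> < t")
        case True
        from order_tendstoD(1)[OF u this] show ?thesis
          by eventually_elim (use True in \<open>auto simp: indicator_def\<close>)
      next
        case False
        then have "t < \<tau>" using elim by simp
        from order_tendstoD(2)[OF u this] show ?thesis
          by eventually_elim (use \<open>t < \<tau>\<close> in \<open>auto simp: indicator_def\<close>)
      qed
      then have "(\<lambda>n. indicat_real {a<..u n} \<tau>) \<longlonglongrightarrow> indicator {a<..t} \<tau>" by (rule tendsto_eventually)
      then show ?case by (rule tendsto_mult_right)
    qed
  qed (auto simp: indicator_def)
qed

text \<open>Lipschitz test functions with \<open>q 0 = 0\<close> keep \<open>q (u x - u' x)\<close>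
  in L2. Boundedness is there because the pairing with the p-Laplacian is rewritten as a double
  integral for bounded functions (\<open>Psi_pairing\<close>).\<close>

definition completely_accretive :: "'a measure \<Rightarrow> (('a \<Rightarrow> real) \<Rightarrow> ('a \<Rightarrow> real) \<Rightarrow> bool) \<Rightarrow> bool" where
  "completely_accretive M A \<longleftrightarrow> (\<forall>u w u' w' q L C. A u w \<longrightarrow> A u' w' \<longrightarrow>
     (\<forall>r s. \<bar>q r - q s\<bar> \<le> L * \<bar>r - s\<bar>) \<longrightarrow> mono q \<longrightarrow> (\<forall>r. \<bar>q r\<bar> \<le> C) \<longrightarrow> q 0 = (0::real) \<longrightarrow>
     0 \<le> (\<integral>x. q (u x - u' x) * (w x - w' x) \<partial>M))"

section \<open>Invariance of a modular bound along a pair of strong solutions\<close>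

context time_space
begin

text \<open>The definitions of data and of solutions ask for measurability over a time interval
  only; extension by zero moves it to the product \<open>Q\<close> with the whole line.\<close>

lemma extend_zero_meas:
  fixes g :: "real \<Rightarrow> 'a \<Rightarrow> real"
  assumes "A \<in> sets lborel" "case_prod g \<in> borel_measurable (restrict_space lborel A \<Otimes>\<^sub>M nu)"
  shows "(\<lambda>(\<tau>, x). indicator A \<tau> * g \<tau> x) \<in> borel_measurable Q"
proof -
  have A: "(A \<times> UNIV) \<inter> space Q \<in> sets Q"
  proof -
    have "(A \<times> UNIV) \<inter> space Q = A \<times> space nu"
      by (auto simp: space_pair_measure)
    then show ?thesis using assms(1) by auto
  qed
  have "(\<lambda>w. (fst w, snd w)) \<in> measurable (restrict_space Q (A \<times> UNIV)) (restrict_space lborel A \<Otimes>\<^sub>M nu)"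
    by (intro measurable_Pair measurable_restrict_space2 measurable_restrict_space1 measurable_fst measurable_snd)
      (auto simp: space_restrict_space)
  from measurable_compose[OF this assms(2)]
  have "case_prod g \<in> borel_measurable (restrict_space Q (A \<times> UNIV))" by (simp add: split_beta')
  then have "(\<lambda>w. indicator (A \<times> UNIV) w *\<^sub>R case_prod g w) \<in> borel_measurable Q"
    using borel_measurable_restrict_space_iff[OF A] by blast
  moreover have "(\<lambda>w. indicator (A \<times> UNIV) w *\<^sub>R case_prod g w) = (\<lambda>(\<tau>, x). indicator A \<tau> * g \<tau> x)"
    by (auto simp: indicator_def)
  ultimately show ?thesis by simp
qed

lemma restrict_meas:
  fixes g :: "real \<Rightarrow> 'a \<Rightarrow> real"
  assumes "case_prod g \<in> borel_measurable Q"
  shows "case_prod g \<in> borel_measurable (restrict_space lborel A \<Otimes>\<^sub>M nu)"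
proof -
  have "(\<lambda>w. (fst w, snd w)) \<in> measurable (restrict_space lborel A \<Otimes>\<^sub>M nu) Q"
    by (intro measurable_Pair measurable_snd measurable_compose[OF measurable_fst measurable_restrict_space1]) simp
  from measurable_compose[OF this assms] show ?thesis by simp
qed

lemma L2_time_LQ:
  assumes "f \<in> L2_time nu T"
  shows "(\<lambda>\<tau> x. indicator {0<..<T} \<tau> * f \<tau> x) \<in> LQ"
proof -
  have m: "(\<lambda>(\<tau>, x). indicator {0..T} \<tau> * f \<tau> x) \<in> borel_measurable Q"
    by (rule extend_zero_meas) (use assms in \<open>auto simp: L2_time_def\<close>)
  have L: "(\<lambda>\<tau> x. indicator {0..T} \<tau> * f \<tau> x) \<in> LQ"
  proof (rule LQ_I_nn[OF m])
    have "(\<integral>\<^sup>+\<tau>. (\<integral>\<^sup>+x. ennreal ((indicator {0..T} \<tau> * f \<tau> x)\<^sup>2) \<partial>nu) \<partial>lborel) = (\<integral>\<^sup>+\<tau>\<in>{0..T}. (\<integral>\<^sup>+x. ennreal ((f \<tau> x)\<^sup>2) \<partial>nu) \<partial>lborel)"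
      by (intro nn_integral_cong) (auto simp: indicator_def)
    then show "(\<integral>\<^sup>+\<tau>. (\<integral>\<^sup>+x. ennreal ((indicator {0..T} \<tau> * f \<tau> x)\<^sup>2) \<partial>nu) \<partial>lborel) < \<infinity>"
      using assms by (simp add: L2_time_def)
  qed
  have eq: "indicator {0<..<T} \<tau> * (indicator {0..T} \<tau> * f \<tau> x) = indicator {0<..<T} \<tau> * f \<tau> x" for \<tau> x
    by (auto simp: indicator_def)
  show ?thesis using LQ_restrict[OF L, of "{0<..<T}"] by (simp add: eq)
qed

text \<open>Only cut-offs of the derivative to compact parts of (0, T) belong to \<open>LQ\<close>,
  since it may fail to be square integrable at both ends. Hence the increments are stated for 0 < a
  and t < T.\<close>

lemma strong_solutionE:
  assumes "strong_solution nu Aop T u0 f u"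
  obtains v where
    "\<And>a b. 0 < a \<Longrightarrow> a \<le> b \<Longrightarrow> b < T \<Longrightarrow> (\<lambda>\<tau> x. indicator {a<..b} \<tau> * v \<tau> x) \<in> LQ"
    "\<And>a t. 0 < a \<Longrightarrow> a \<le> t \<Longrightarrow> t < T \<Longrightarrow> AE x in nu. u t x = u a x + tint v a t x"
    "AE \<tau> in lborel. 0 < \<tau> \<longrightarrow> \<tau> < T \<longrightarrow> v \<tau> \<in> L2 nu \<and> Aop (u \<tau>) (\<lambda>x. f \<tau> x - v \<tau> x)"
proof -
  from assms obtain v where
    m: "case_prod v \<in> borel_measurable (restrict_space lborel {0<..<T} \<Otimes>\<^sub>M nu)" and
    fin: "\<And>a b. 0 < a \<Longrightarrow> a \<le> b \<Longrightarrow> b < T \<Longrightarrow>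
           (\<integral>\<^sup>+t\<in>{a..b}. (\<integral>\<^sup>+x. ennreal ((v t x)\<^sup>2) \<partial>nu) \<partial>lborel) < \<infinity>" and
    inc: "\<And>a t. 0 < a \<Longrightarrow> a \<le> t \<Longrightarrow> t < T \<Longrightarrow> AE x in nu. u t x = u a x + (LBINT s=a..t. v s x)" and
    ae: "AE t in lborel. t \<in> {0<..<T} \<longrightarrow> v t \<in> L2 nu \<and> Aop (u t) (\<lambda>x. f t x - v t x)"
    unfolding strong_solution_def by auto
  have m': "(\<lambda>(\<tau>, x). indicator {0<..<T} \<tau> * v \<tau> x) \<in> borel_measurable Q"
    by (rule extend_zero_meas) (use m in auto)
  show thesis
  proof (rule that[of v])
    fix a b assume ab: "0 < a" "a \<le> b" "b < T"
    have eq: "indicator {a<..b} \<tau> * (indicator {0<..<T} \<tau> * v \<tau> x) = indicator {a<..b} \<tau> * v \<tau> x" for \<tau> x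
      using ab by (auto simp: indicator_def)
    have "(\<lambda>(\<tau>, x). indicator {a<..b} \<tau> * v \<tau> x) \<in> borel_measurable Q"
      using joint_meas_times[OF m', of "indicator {a<..b}"] by (simp add: eq)
    then show "(\<lambda>\<tau> x. indicator {a<..b} \<tau> * v \<tau> x) \<in> LQ"
    proof (rule LQ_I_nn)
      have "(\<integral>\<^sup>+\<tau>. (\<integral>\<^sup>+x. ennreal ((indicator {a<..b} \<tau> * v \<tau> x)\<^sup>2) \<partial>nu) \<partial>lborel) \<le> (\<integral>\<^sup>+\<tau>\<in>{a..b}. (\<integral>\<^sup>+x. ennreal ((v \<tau> x)\<^sup>2) \<partial>nu) \<partial>lborel)"
        by (intro nn_integral_mono) (auto simp: indicator_def)
      then show "(\<integral>\<^sup>+\<tau>. (\<integral>\<^sup>+x. ennreal ((indicator {a<..b} \<tau> * v \<tau> x)\<^sup>2) \<partial>nu) \<partial>lborel) < \<infinity>"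
        using fin[OF ab] by (rule le_less_trans)
    qed
  next
    fix a t assume at: "0 < a" "a \<le> t" "t < T"
    show "AE x in nu. u t x = u a x + tint v a t x" using inc[OF at] tint_LBINT[OF at(2)] by simp
  qed (use ae in auto)
qed

text \<open>The quantity \<open>Y\<close> starts at or below 1, is continuous, and cannot increase
  while it exceeds 1; so it never exceeds 1. As the derivative is controlled inside (0, T) only, the
  end times are reached by continuity.\<close>

theorem orlicz_contraction:
  fixes q J \<gamma> :: "real \<Rightarrow> real"
  assumes acc: "completely_accretive nu Aop"
    and sol: "strong_solution nu Aop T u0 f u" and sol': "strong_solution nu Aop T u0' f' u'"
    and f: "f \<in> L2_time nu T" "f' \<in> L2_time nu T"
    and q: "\<And>r s. \<bar>q r - q s\<bar> \<le> L * \<bar>r - s\<bar>" and q0: "q 0 = 0" and q_mono: "mono q" and q_bdd: "\<And>r. \<bar>q r\<bar> \<le> C"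
    and J: "\<And>r s. J r - J s \<le> q r * (r - s)" and J0: "J 0 = 0"
    and J_meas: "J \<in> borel_measurable borel"
    and \<gamma>: "integrable lborel \<gamma>" "\<And>\<tau>. 0 \<le> \<gamma> \<tau>" and G0: "0 < G0"
    and t0: "0 \<le> t0" "t0 \<le> T"
    and init: "(\<integral>x. J ((u0 x - u0' x) / G0) \<partial>nu) \<le> 1" and u0: "u0 \<in> L2 nu" "u0' \<in> L2 nu"
    and force: "AE \<tau> in lborel. 0 < \<tau> \<longrightarrow> \<tau> < t0 \<longrightarrow> 0 < \<gamma> \<tau> \<and> (\<integral>x. J ((f \<tau> x - f' \<tau> x) / \<gamma> \<tau>) \<partial>nu) \<le> 1"
  shows "(\<integral>x. J ((u t0 x - u' t0 x) / (G0 + (\<integral>\<tau>. indicator {0<..t0} \<tau> * \<gamma> \<tau> \<partial>lborel))) \<partial>nu) \<le> 1"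
proof -
  obtain v where v: "\<And>a b. 0 < a \<Longrightarrow> a \<le> b \<Longrightarrow> b < T \<Longrightarrow> (\<lambda>\<tau> x. indicator {a<..b} \<tau> * v \<tau> x) \<in> LQ"
    and uv: "\<And>a t. 0 < a \<Longrightarrow> a \<le> t \<Longrightarrow> t < T \<Longrightarrow> AE x in nu. u t x = u a x + tint v a t x"
    and Av: "AE \<tau> in lborel. 0 < \<tau> \<longrightarrow> \<tau> < T \<longrightarrow> v \<tau> \<in> L2 nu \<and> Aop (u \<tau>) (\<lambda>x. f \<tau> x - v \<tau> x)"
    by (rule strong_solutionE[OF sol]) blast
  obtain v' where v': "\<And>a b. 0 < a \<Longrightarrow> a \<le> b \<Longrightarrow> b < T \<Longrightarrow> (\<lambda>\<tau> x. indicator {a<..b} \<tau> * v' \<tau> x) \<in> LQ"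
    and uv': "\<And>a t. 0 < a \<Longrightarrow> a \<le> t \<Longrightarrow> t < T \<Longrightarrow> AE x in nu. u' t x = u' a x + tint v' a t x"
    and Av': "AE \<tau> in lborel. 0 < \<tau> \<longrightarrow> \<tau> < T \<longrightarrow> v' \<tau> \<in> L2 nu \<and> Aop (u' \<tau>) (\<lambda>x. f' \<tau> x - v' \<tau> x)"
    by (rule strong_solutionE[OF sol']) blast
  have uL: "u t \<in> L2 nu" "u' t \<in> L2 nu" if "0 \<le> t" "t \<le> T" for t
    using sol sol' that unfolding strong_solution_def by auto
  define z where "z t x = u t x - u' t x" for t x
  have z: "z t \<in> L2 nu" if "0 \<le> t" "t \<le> T" for t
    unfolding z_def[abs_def] by (intro L2_diff uL that)
  have zcont: "((\<lambda>s. L2_norm nu (\<lambda>x. z s x - z t x)) \<longlongrightarrow> 0) (at t within {0..T})" if t: "0 \<le> t" "t \<le> T" for t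
  proof (rule Lim_null_comparison)
    let ?b = "\<lambda>s. L2_norm nu (\<lambda>x. u s x - u t x) + L2_norm nu (\<lambda>x. u' s x - u' t x)"
    have "s \<in> {0..T} \<Longrightarrow> norm (L2_norm nu (\<lambda>x. z s x - z t x)) \<le> ?b s" for s
      using L2_norm_triangle_diff[OF L2_diff[OF uL(1)[of s] uL(1)[OF t]] L2_diff[OF uL(2)[of s] uL(2)[OF t]]]
      by (simp add: z_def algebra_simps)
    then show "\<forall>\<^sub>F s in at t within {0..T}. norm (L2_norm nu (\<lambda>x. z s x - z t x)) \<le> ?b s"
      unfolding eventually_at_filter by (intro always_eventually) blast
    have "(?b \<longlongrightarrow> 0 + 0) (at t within {0..T})"
      by (intro tendsto_add) (use sol sol' t in \<open>auto simp: strong_solution_def\<close>)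
    then show "(?b \<longlongrightarrow> 0) (at t within {0..T})" by simp
  qed
  define G where "G t = G0 + (\<integral>\<tau>. indicator {0<..t} \<tau> * \<gamma> \<tau> \<partial>lborel)" for t
  have G_cont: "continuous_on A G" for A
    unfolding G_def[abs_def] by (intro continuous_intros indefinite_integral_continuous_lborel \<gamma>)
  have G_pos: "0 < G t" for t
  proof -
    have "0 \<le> (\<integral>\<tau>. indicator {0<..t} \<tau> * \<gamma> \<tau> \<partial>lborel)" using \<gamma>(2) by (intro integral_nonneg_AE) auto
    then show ?thesis using G0 by (simp add: G_def)
  qed
  have G_inc: "G t - G s = (\<integral>\<tau>. indicator {s<..t} \<tau> * \<gamma> \<tau> \<partial>lborel)" if "0 \<le> s" "s \<le> t" for s t
    using indefinite_integral_increment[OF \<gamma>(1) that] by (simp add: G_def)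
  define Y where "Y t = (\<integral>x. J (z t x / G t) \<partial>nu)" for t
  have y: "(\<lambda>x. z t x / G t) \<in> L2 nu" if "0 \<le> t" "t \<le> T" for t
    using L2_scale[OF z[OF that], of "1 / G t"] by simp
  have Y_cont: "(Y \<longlongrightarrow> Y t) (at t within {0..T})" if t: "0 \<le> t" "t \<le> T" for t
    unfolding Y_def
  proof (rule L2_convex_functional_continuous[OF J J0 q0 J_meas q _ y[OF t]])
    show "\<forall>\<^sub>F s in at t within {0..T}. (\<lambda>x. z s x / G s) \<in> L2 nu"
      unfolding eventually_at_filter by (intro always_eventually) (use y in auto)
    show "((\<lambda>s. L2_norm nu (\<lambda>x. z s x / G s - z t x / G t)) \<longlongrightarrow> 0) (at t within {0..T})"
    proof (rule Lim_null_comparison)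
      let ?b = "\<lambda>s. L2_norm nu (\<lambda>x. z s x - z t x) / G s + \<bar>1 / G s - 1 / G t\<bar> * L2_norm nu (z t)"
      have "norm (L2_norm nu (\<lambda>x. z s x / G s - z t x / G t)) \<le> ?b s" if "s \<in> {0..T}" for s
      proof -
        have "L2_norm nu (\<lambda>x. z s x / G s - z t x / G t)
          = L2_norm nu (\<lambda>x. (1 / G s) * (z s x - z t x) + (1 / G s - 1 / G t) * z t x)"
          by (simp add: algebra_simps diff_divide_distrib)
        also have "\<dots> \<le> L2_norm nu (\<lambda>x. (1 / G s) * (z s x - z t x)) + L2_norm nu (\<lambda>x. (1 / G s - 1 / G t) * z t x)"
          by (intro L2_norm_triangle L2_scale L2_diff z) (use that t in auto)
        also have "\<dots> = ?b s" unfolding L2_norm_scale using G_pos[of s] by simp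
        finally show ?thesis by simp
      qed
      then show "\<forall>\<^sub>F s in at t within {0..T}. norm (L2_norm nu (\<lambda>x. z s x / G s - z t x / G t)) \<le> ?b s"
        unfolding eventually_at_filter by (intro always_eventually) blast
      have "(G \<longlongrightarrow> G t) (at t within {0..T})"
        using G_cont[of "{0..T}"] t unfolding continuous_on_def by auto
      then have "(?b \<longlongrightarrow> 0 / G t + \<bar>1 / G t - 1 / G t\<bar> * L2_norm nu (z t)) (at t within {0..T})"
        using G_pos[of t] by (intro tendsto_intros zcont t) auto
      then show "(?b \<longlongrightarrow> 0) (at t within {0..T})" by simp
    qed
  qed
  have Y0: "Y 0 \<le> 1"
  proof -
    have "AE x in nu. u 0 x = u0 x" "AE x in nu. u' 0 x = u0' x"
      using sol sol' unfolding strong_solution_def by auto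
    then have "AE x in nu. J (z 0 x / G 0) = J ((u0 x - u0' x) / G0)"
      by eventually_elim (simp add: z_def G_def)
    then have "Y 0 = (\<integral>x. J ((u0 x - u0' x) / G0) \<partial>nu)"
      unfolding Y_def using t0 L2D(1)[OF y[of 0]] L2D(1)[OF u0(1)] L2D(1)[OF u0(2)]
      by (intro integral_cong_AE measurable_compose[OF _ J_meas]) auto
    then show ?thesis using init by simp
  qed
  have fL: "AE \<tau> in lborel. 0 < \<tau> \<longrightarrow> \<tau> < T \<longrightarrow> f \<tau> \<in> L2 nu \<and> f' \<tau> \<in> L2 nu"
    using LQ_section[OF L2_time_LQ[OF f(1)]] LQ_section[OF L2_time_LQ[OF f(2)]]
    by eventually_elim (auto simp: indicator_def)
  text \<open>While \<open>Y > 1\<close>, the convexity inequality \<open>q(y) (g / \<gamma> - y) \<le> J(g / \<gamma>) - J(y)\<close> makes the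
    right-hand side of the chain inequality nonpositive.\<close>
  have decr: "Y t \<le> Y s" if st: "0 < s" "s \<le> t" "t < T" "t \<le> t0" and Y1: "\<And>\<tau>. s < \<tau> \<Longrightarrow> \<tau> \<le> t \<Longrightarrow> 1 < Y \<tau>" for s t
  proof -
    define \<zeta> where "\<zeta> \<tau> x = indicator {s<..t} \<tau> * v \<tau> x - indicator {s<..t} \<tau> * v' \<tau> x" for \<tau> x
    have \<zeta>: "\<zeta> \<in> LQ" unfolding \<zeta>_def by (intro LQ_diff v v' st)
    have "(\<integral>x. J (z t x / G t) \<partial>nu) \<le> (\<integral>x. J (z s x / G s) \<partial>nu) + (\<integral>\<tau>. indicator {s<..t} \<tau> * 0 \<partial>lborel)"
    proof (rule chain_inequality[where z=z and B="\<lambda>_. 0", OF st(2) _ \<zeta> _ q q0 J J0 J_meas \<gamma> _ G_cont G_pos])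
      show "z \<tau> \<in> L2 nu" if "s \<le> \<tau>" "\<tau> \<le> t" for \<tau> using that st by (intro z) auto
      show "G t' - G s' = (\<integral>\<tau>. indicator {s'<..t'} \<tau> * \<gamma> \<tau> \<partial>lborel)" if "s \<le> s'" "s' \<le> t'" "t' \<le> t" for s' t'
        using that st by (intro G_inc) auto
      show "AE x in nu. z t' x = z s' x + tint \<zeta> s' t' x" if that: "s \<le> s'" "s' \<le> t'" "t' \<le> t" for s' t'
      proof -
        have eq: "tint (\<lambda>\<tau> x. indicator {s<..t} \<tau> * w \<tau> x) s' t' x = tint w s' t' x" for w x
          by (rule tint_cong) (use that in auto)
        show ?thesis
          using uv[of s' t'] uv'[of s' t'] tint_diff[OF v[OF st(1-3)] v'[OF st(1-3)], of s' t'] that st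
          unfolding \<zeta>_def[symmetric, abs_def] eq by (auto simp: z_def elim: eventually_elim2)
      qed
      show "AE \<tau> in lborel. s < \<tau> \<longrightarrow> \<tau> \<le> t \<longrightarrow> (\<integral>x. q (z \<tau> x / G \<tau>) * \<zeta> \<tau> x \<partial>nu)
         - \<gamma> \<tau> * (\<integral>x. q (z \<tau> x / G \<tau>) * (z \<tau> x / G \<tau>) \<partial>nu) \<le> G \<tau> * 0"
        using Av Av' fL force AE_lborel_singleton[of t]
      proof (eventually_elim, intro impI)
        fix \<tau> assume H: "0 < \<tau> \<longrightarrow> \<tau> < T \<longrightarrow> v \<tau> \<in> L2 nu \<and> Aop (u \<tau>) (\<lambda>x. f \<tau> x - v \<tau> x)"
          "0 < \<tau> \<longrightarrow> \<tau> < T \<longrightarrow> v' \<tau> \<in> L2 nu \<and> Aop (u' \<tau>) (\<lambda>x. f' \<tau> x - v' \<tau> x)"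
          "0 < \<tau> \<longrightarrow> \<tau> < T \<longrightarrow> f \<tau> \<in> L2 nu \<and> f' \<tau> \<in> L2 nu"
          "0 < \<tau> \<longrightarrow> \<tau> < t0 \<longrightarrow> 0 < \<gamma> \<tau> \<and> (\<integral>x. J ((f \<tau> x - f' \<tau> x) / \<gamma> \<tau>) \<partial>nu) \<le> 1"
          "\<tau> \<noteq> t" "s < \<tau>" "\<tau> \<le> t"
        then have \<tau>: "0 < \<tau>" "\<tau> < T" "\<tau> < t0" "0 \<le> \<tau>" "\<tau> \<le> T" using st by auto
        with H have L2s: "v \<tau> \<in> L2 nu" "v' \<tau> \<in> L2 nu" "f \<tau> \<in> L2 nu" "f' \<tau> \<in> L2 nu"
          and Aops: "Aop (u \<tau>) (\<lambda>x. f \<tau> x - v \<tau> x)" "Aop (u' \<tau>) (\<lambda>x. f' \<tau> x - v' \<tau> x)"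
          and frc: "0 < \<gamma> \<tau>" "(\<integral>x. J ((f \<tau> x - f' \<tau> x) / \<gamma> \<tau>) \<partial>nu) \<le> 1" by auto
        let ?y = "\<lambda>x. z \<tau> x / G \<tau>" and ?g = "\<lambda>x. (f \<tau> x - f' \<tau> x) / \<gamma> \<tau>"
        have yL: "?y \<in> L2 nu" by (rule y[OF \<tau>(4,5)])
        have qL: "(\<lambda>x. q (?y x)) \<in> L2 nu" by (rule L2_lipschitz(1)[OF q q0 yL])
        have gL: "?g \<in> L2 nu" using L2_scale[OF L2_diff[OF L2s(3,4)], of "1 / \<gamma> \<tau>"] by simp
        \<comment> \<open>Accretivity concerns \<open>u - u'\<close> itself, so the slope is
          composed with the division by \<open>G \<tau>\<close>; the composition inherits the
          properties demanded of a test function.\<close>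
        have lip: "\<bar>q (r / G \<tau>) - q (s / G \<tau>)\<bar> \<le> (L / G \<tau>) * \<bar>r - s\<bar>" for r s
          using q[of "r / G \<tau>" "s / G \<tau>"] G_pos[of \<tau>] by (simp add: diff_divide_distrib[symmetric] abs_divide)
        have mon: "mono (\<lambda>r. q (r / G \<tau>))"
          using G_pos[of \<tau>] by (intro monoI monoD[OF q_mono] divide_right_mono) auto
        have "0 \<le> (\<integral>x. q (?y x) * ((f \<tau> x - v \<tau> x) - (f' \<tau> x - v' \<tau> x)) \<partial>nu)"
          using acc Aops lip mon q_bdd q0 unfolding completely_accretive_def z_def
          by (elim allE[of _ "u \<tau>"] allE[of _ "u' \<tau>"] allE[of _ "\<lambda>x. f \<tau> x - v \<tau> x"] allE[of _ "\<lambda>x. f' \<tau> x - v' \<tau> x"]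
              allE[of _ "\<lambda>r. q (r / G \<tau>)"] allE[of _ "L / G \<tau>"] allE[of _ C]) auto
        also have "\<dots> = (\<integral>x. \<gamma> \<tau> * (q (?y x) * ?g x) - q (?y x) * \<zeta> \<tau> x \<partial>nu)"
          using H(6,7) frc(1) by (intro Bochner_Integration.integral_cong refl) (simp add: \<zeta>_def field_simps)
        also have "\<dots> = \<gamma> \<tau> * (\<integral>x. q (?y x) * ?g x \<partial>nu) - (\<integral>x. q (?y x) * \<zeta> \<tau> x \<partial>nu)"
        proof -
          have "\<zeta> \<tau> \<in> L2 nu" unfolding \<zeta>_def by (intro L2_diff L2_scale L2s)
          from Bochner_Integration.integral_diff[OF integrable_mult_right[OF L2_mult_integrable[OF qL gL]] L2_mult_integrable[OF qL this], of "\<gamma> \<tau>"]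
          show ?thesis by (simp only: integral_mult_right_zero)
        qed
        finally have 1: "(\<integral>x. q (?y x) * \<zeta> \<tau> x \<partial>nu) \<le> \<gamma> \<tau> * (\<integral>x. q (?y x) * ?g x \<partial>nu)" by simp
        have "(\<integral>x. q (?y x) * ?g x \<partial>nu) - (\<integral>x. q (?y x) * ?y x \<partial>nu) = (\<integral>x. q (?y x) * ?g x - q (?y x) * ?y x \<partial>nu)"
          using L2_mult_integrable[OF qL gL] L2_mult_integrable[OF qL yL] by simp
        also have "\<dots> \<le> (\<integral>x. J (?g x) - J (?y x) \<partial>nu)"
        proof (intro integral_mono Bochner_Integration.integrable_diff L2_mult_integrable qL gL yL
            convex_subgradient_integrable(1)[OF J J0 q0 J_meas q])
          show "q (?y x) * ?g x - q (?y x) * ?y x \<le> J (?g x) - J (?y x)" for x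
            using J[of "?y x" "?g x"] unfolding right_diff_distrib by linarith
        qed
        also have "\<dots> = (\<integral>x. J (?g x) \<partial>nu) - Y \<tau>"
          unfolding Y_def using convex_subgradient_integrable(1)[OF J J0 q0 J_meas q gL] convex_subgradient_integrable(1)[OF J J0 q0 J_meas q yL]
          by simp
        also have "\<dots> \<le> 0" using frc(2) Y1[of \<tau>] H by simp
        finally have "\<gamma> \<tau> * ((\<integral>x. q (?y x) * ?g x \<partial>nu) - (\<integral>x. q (?y x) * ?y x \<partial>nu)) \<le> 0"
          using frc(1) by (simp add: mult_le_0_iff)
        with 1 show "(\<integral>x. q (?y x) * \<zeta> \<tau> x \<partial>nu) - \<gamma> \<tau> * (\<integral>x. q (?y x) * ?y x \<partial>nu) \<le> G \<tau> * 0"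
          by (simp add: right_diff_distrib)
      qed
    qed simp_all
    then show ?thesis by (simp add: Y_def)
  qed
  have inner: "Y t \<le> 1" if t: "0 \<le> t" "t < T" "t \<le> t0" for t
  proof (rule ccontr)
    assume "\<not> Y t \<le> 1"
    then have Yt: "1 < Y t" by simp
    have Ycont: "continuous_on {0..t} Y"
      unfolding continuous_on_def
      by (intro ballI tendsto_within_subset[OF Y_cont, of _ "{0..t}"]) (use t in auto)
    \<comment> \<open>The supremum of \<open>S\<close> is the last time up to \<open>t\<close> at
      which \<open>Y\<close> is at most 1; from then on \<open>Y\<close> stays above 1 and must be
      nonincreasing.\<close>
    define S where "S = {s\<in>{0..t}. Y s \<le> 1}"
    have "closed S" unfolding S_def by (intro continuous_on_closed_Collect_le continuous_on_const Ycont closed_atLeastAtMost)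
    moreover have "0 \<in> S" using t Y0 by (simp add: S_def)
    moreover have bdd: "bdd_above S" by (rule bdd_aboveI[of _ t]) (simp add: S_def)
    ultimately have sS: "Sup S \<in> S" by (intro closed_contains_Sup) auto
    define s where "s = Sup S"
    have "0 \<le> s \<and> s \<le> t \<and> Y s \<le> 1" using sS unfolding s_def[symmetric] by (simp add: S_def)
    then have s: "0 \<le> s" "s < t" "Y s \<le> 1" using Yt by (auto simp: less_le)
    have big: "1 < Y \<tau>" if "s < \<tau>" "\<tau> \<le> t" for \<tau>
    proof (rule ccontr)
      assume "\<not> 1 < Y \<tau>"
      then have "\<tau> \<in> S" using that s by (simp add: S_def)
      then have "\<tau> \<le> s" unfolding s_def using bdd by (rule cSup_upper)
      with that show False by simp
    qed
    \<comment> \<open>\<open>decr\<close> starts at positive times only. Comparing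
      \<open>Y t\<close> with \<open>Y \<tau>\<close> for \<tau> right after \<open>s\<close>, and
      letting \<tau> tend to \<open>s\<close>, covers \<open>s = 0\<close> too.\<close>
    have "(Y \<longlongrightarrow> Y s) (at s within {s..t})"
      by (rule tendsto_within_subset[OF Y_cont]) (use s t in auto)
    then have "(Y \<longlongrightarrow> Y s) (at_right s)" by (simp add: at_within_Icc_at_right[OF s(2)])
    moreover have "\<forall>\<^sub>F \<tau> in at_right s. Y t \<le> Y \<tau>"
      unfolding eventually_at_right[OF s(2)] using s t big by (intro exI[of _ t] conjI allI impI decr) auto
    ultimately have "Y t \<le> Y s" by (rule tendsto_lowerbound) simp
    then show False using Yt s by simp
  qed
  have "Y t0 \<le> 1"
  proof (cases "t0 < T")
    case True
    then show ?thesis using inner[of t0] t0 by simp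
  next
    case False
    then have tT: "t0 = T" using t0 by simp
    show ?thesis
    proof (cases "T = 0")
      case True then show ?thesis using Y0 tT by simp
    next
      case False
      then have T: "0 < T" using t0 by simp
      have "(Y \<longlongrightarrow> Y T) (at_left T)"
        using Y_cont[of T] T at_within_Icc_at_left[OF T] by simp
      moreover have "\<forall>\<^sub>F \<tau> in at_left T. Y \<tau> \<le> 1"
        unfolding eventually_at_left[OF T] using tT by (intro exI[of _ 0] conjI T allI impI inner) auto
      ultimately show ?thesis unfolding tT by (rule tendsto_upperbound) simp
    qed
  qed
  then show ?thesis by (simp add: Y_def z_def G_def)
qed

end

section \<open>The contraction estimate\<close>

text \<open>A slope together with its convex primitive, carrying the conditions under which
  \<open>orlicz_contraction\<close> can be applied to them.\<close>

definition modular_kernel :: "(real \<Rightarrow> real) \<Rightarrow> (real \<Rightarrow> real) \<Rightarrow> bool" where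
  "modular_kernel q J \<longleftrightarrow> (\<exists>L. \<forall>r s. \<bar>q r - q s\<bar> \<le> L * \<bar>r - s\<bar>) \<and> mono q \<and> (\<exists>C. \<forall>r. \<bar>q r\<bar> \<le> C) \<and>
     q 0 = 0 \<and> (\<forall>r s. J r - J s \<le> q r * (r - s)) \<and> J 0 = 0 \<and> J \<in> borel_measurable borel"

text \<open>The half-open indicator is empty for s \<le> 0, so the primitive sees positive arguments
  only; this is how the positive part enters the estimate.\<close>

definition prim :: "(real \<Rightarrow> real) \<Rightarrow> real \<Rightarrow> real" where
  "prim q s = (\<integral>\<tau>. indicator {0<..s} \<tau> * q \<tau> \<partial>lborel)"

lemma mono_indicator_integrable:
  fixes q :: "real \<Rightarrow> real"
  assumes "mono q" "\<And>s. 0 \<le> q s"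
  shows "integrable lborel (\<lambda>\<tau>. indicator {a<..s} \<tau> * q \<tau>)"
proof (rule Bochner_Integration.integrable_bound)
  show "integrable lborel (\<lambda>\<tau>. indicator {a<..s} \<tau> * q s)"
    using integrable_indicator_Ioc[of a s] by simp
  note [measurable] = borel_measurable_mono[OF assms(1)]
  show "(\<lambda>\<tau>. indicator {a<..s} \<tau> * q \<tau>) \<in> borel_measurable lborel" by measurable
  show "AE \<tau> in lborel. norm (indicator {a<..s} \<tau> * q \<tau>) \<le> norm (indicator {a<..s} \<tau> * q s)"
    using assms by (auto simp: indicator_def mono_def)
qed

lemma prim_diff:
  assumes q: "mono q" "\<And>s. s \<le> 0 \<Longrightarrow> q s = 0" and "s \<le> r"
  shows "prim q r - prim q s = (\<integral>\<tau>. indicator {s<..r} \<tau> * q \<tau> \<partial>lborel)"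
proof -
  have q0: "0 \<le> q s" for s using q monoD[OF q(1), of "min s 0" s] by simp
  have "prim q r - prim q s = (\<integral>\<tau>. indicator {0<..r} \<tau> * q \<tau> - indicator {0<..s} \<tau> * q \<tau> \<partial>lborel)"
    unfolding prim_def by (simp add: mono_indicator_integrable[OF q(1) q0])
  also have "\<dots> = (\<integral>\<tau>. indicator {s<..r} \<tau> * q \<tau> \<partial>lborel)"
    by (intro Bochner_Integration.integral_cong refl) (use assms in \<open>auto simp: indicator_def not_less\<close>)
  finally show ?thesis .
qed

lemma prim_subgradient:
  assumes q: "mono q" "\<And>s. s \<le> 0 \<Longrightarrow> q s = 0"
  shows "prim q r - prim q s \<le> q r * (r - s)"
proof -
  have q0: "0 \<le> q s" for s using q monoD[OF q(1), of "min s 0" s] by simp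
  note int = mono_indicator_integrable[OF q(1) q0]
  have c: "(\<integral>\<tau>. indicator {a<..b} \<tau> * c \<partial>lborel) = (b - a) * c" if "a \<le> b" for a b c :: real
    using that by simp
  have ci: "integrable lborel (\<lambda>\<tau>. indicator {a<..b} \<tau> * c)" for a b c :: real
    using integrable_indicator_Ioc[of a b] by simp
  show ?thesis
  proof (cases "s \<le> r")
    case True
    have "(\<integral>\<tau>. indicator {s<..r} \<tau> * q \<tau> \<partial>lborel) \<le> (\<integral>\<tau>. indicator {s<..r} \<tau> * q r \<partial>lborel)"
      by (intro integral_mono int ci) (use q in \<open>auto simp: indicator_def mono_def\<close>)
    then show ?thesis using True c[of s r "q r"] by (simp add: prim_diff[OF q] mult.commute)
  next
    case False
    then have rs: "r \<le> s" by simp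
    have "(\<integral>\<tau>. indicator {r<..s} \<tau> * q r \<partial>lborel) \<le> (\<integral>\<tau>. indicator {r<..s} \<tau> * q \<tau> \<partial>lborel)"
      by (intro integral_mono int ci) (use q in \<open>auto simp: indicator_def mono_def\<close>)
    then have "(s - r) * q r \<le> prim q s - prim q r" using c[OF rs, of "q r"] prim_diff[OF q rs] by linarith
    then show ?thesis by (simp add: algebra_simps)
  qed
qed

lemma prim_mono:
  assumes q: "mono q" "\<And>s. s \<le> 0 \<Longrightarrow> q s = 0"
  shows "mono (prim q)"
proof (rule monoI)
  fix r s :: real assume rs: "r \<le> s"
  have q0: "0 \<le> q s" for s using q monoD[OF q(1), of "min s 0" s] by simp
  have "0 \<le> (\<integral>\<tau>. indicator {r<..s} \<tau> * q \<tau> \<partial>lborel)" using q0 by (intro integral_nonneg_AE) auto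
  with prim_diff[OF q rs] show "prim q r \<le> prim q s" by simp
qed

lemma prim_nonpos: "s \<le> 0 \<Longrightarrow> prim q s = 0"
  by (simp add: prim_def)

lemma modular_kernel_prim:
  assumes "\<And>r s. \<bar>q r - q s\<bar> \<le> L * \<bar>r - s\<bar>" "mono q" "\<And>r. q r \<le> C" "\<And>s. s \<le> 0 \<Longrightarrow> q s = 0"
  shows "modular_kernel q (prim q)"
proof -
  have q0: "0 \<le> q s" for s using assms(4) monoD[OF assms(2), of "min s 0" s] by simp
  show ?thesis unfolding modular_kernel_def
  proof (intro conjI)
    show "\<exists>C. \<forall>r. \<bar>q r\<bar> \<le> C" using q0 assms(3) by (intro exI[of _ C]) simp
  qed (use assms in \<open>auto intro!: prim_subgradient prim_nonpos borel_measurable_mono prim_mono\<close>)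
qed

lemma modular_kernel_nonneg: "modular_kernel q J \<Longrightarrow> 0 \<le> J s"
  unfolding modular_kernel_def by (metis diff_0_right diff_le_0_iff_le mult_zero_left diff_0 neg_le_0_iff_le)

lemma modular_kernel_integrable:
  assumes "modular_kernel q J" "u \<in> L2 M"
  shows "integrable M (\<lambda>x. J (u x))"
proof -
  from assms obtain L where "\<And>r s. \<bar>q r - q s\<bar> \<le> L * \<bar>r - s\<bar>" unfolding modular_kernel_def by blast
  then show ?thesis
    using assms by (intro convex_subgradient_integrable(1)[of J q L]) (auto simp: modular_kernel_def)
qed

lemma modular_kernel_nn_integral:
  assumes "modular_kernel q J" "u \<in> L2 M"
  shows "(\<integral>\<^sup>+x. ennreal (J (u x)) \<partial>M) = ennreal (\<integral>x. J (u x) \<partial>M)"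
  by (intro nn_integral_eq_integral modular_kernel_integrable[OF assms]) (simp add: modular_kernel_nonneg[OF assms(1)])

text \<open>Its primitive vanishes precisely for s \<le> 1, so that, after scaling, its integral
  tests the bound u \<le> c. It also switches off \<open>power_slope\<close> near 0.\<close>

definition ramp :: "real \<Rightarrow> real" where "ramp s = max 0 (min 1 (s - 1))"

lemma ramp_lipschitz: "\<bar>ramp r - ramp s\<bar> \<le> \<bar>r - s\<bar>"
  by (auto simp: ramp_def)

lemma ramp_mono: "mono ramp"
  by (intro monoI) (auto simp: ramp_def)

lemma ramp_bounds: "0 \<le> ramp s" "ramp s \<le> 1" "s \<le> 1 \<Longrightarrow> ramp s = 0" "2 \<le> s \<Longrightarrow> ramp s = 1" "1 < s \<Longrightarrow> 0 < ramp s"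
  by (auto simp: ramp_def)

text \<open>A bounded Lipschitz minorant of the derivative of \<open>s\<^sup>p\<close> on the positive half line, exact
  on the interval from \<open>2 / m\<close> to \<open>m\<close>.\<close>

definition power_slope :: "real \<Rightarrow> real \<Rightarrow> real \<Rightarrow> real" where
  "power_slope p m s = ramp (m * s) * (p * (max (1 / m) (min s m)) powr (p - 1))"

text \<open>Mean value theorem; on an interval bounded away from 0 the derivative is controlled by
  s^(a-1) = s^a / s \<le> m^a m, also for a < 1.\<close>

lemma powr_lipschitz_on_compact:
  fixes x y a m :: real
  assumes "0 \<le> a" "1 \<le> m" "x \<in> {1/m..m}" "y \<in> {1/m..m}"
  shows "\<bar>x powr a - y powr a\<bar> \<le> (a * (m powr a * m)) * \<bar>x - y\<bar>"
proof -
  have "norm (x powr a - y powr a) \<le> (a * (m powr a * m)) * norm (x - y)"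
  proof (rule field_differentiable_bound[of "{1/m..m}" _ "\<lambda>s. a * s powr (a - 1)"])
    fix s assume s: "s \<in> {1/m..m}"
    have "0 < 1 / m" using assms by simp
    then have s0: "0 < s" using s by (meson atLeastAtMost_iff less_le_trans)
    show "((\<lambda>s. s powr a) has_field_derivative a * s powr (a - 1)) (at s within {1/m..m})"
      by (rule has_field_derivative_at_within) (rule has_real_derivative_powr[OF s0])
    have "s powr (a - 1) = s powr a * (1 / s)" using s0 by (simp add: powr_diff)
    also have "\<dots> \<le> m powr a * m"
    proof (intro mult_mono powr_mono2)
      show "1 / s \<le> m" using s s0 assms(2) by (simp add: field_simps)
    qed (use s s0 assms in auto)
    finally show "norm (a * s powr (a - 1)) \<le> a * (m powr a * m)"
      using assms by (simp add: abs_mult mult_left_mono)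
  qed (use assms in auto)
  then show ?thesis by simp
qed

text \<open>Both factors are nonnegative, bounded, nondecreasing and Lipschitz, and these properties
  pass to the product. The clamp to [1 / m, m] supplies the Lipschitz bound, also for p < 2, and the
  ramp hides the positive value that the clamped power has near 0.\<close>

lemma power_slope_props:
  assumes p: "1 \<le> p" and m: "1 \<le> m"
  shows "\<exists>L. \<forall>r s. \<bar>power_slope p m r - power_slope p m s\<bar> \<le> L * \<bar>r - s\<bar>"
    and "mono (power_slope p m)" and "power_slope p m s \<le> p * m powr (p - 1)"
    and "s \<le> 1 / m \<Longrightarrow> power_slope p m s = 0"
    and "0 < s \<Longrightarrow> power_slope p m s \<le> p * s powr (p - 1)"
    and "2 / m \<le> s \<Longrightarrow> s \<le> m \<Longrightarrow> power_slope p m s = p * s powr (p - 1)"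
proof -
  define cl where "cl s = max (1/m) (min s m)" for s
  have m1: "0 < 1 / m" "1 / m \<le> m" using m by (auto simp: field_simps intro: order_trans[of 1 m "m * m"])
  have cl: "cl s \<in> {1/m..m}" for s using m1(2) unfolding cl_def by simp
  have cl0: "0 < cl s" for s using less_le_trans[OF m1(1)] by (simp add: cl_def)
  have cl_mono: "mono cl" by (intro monoI) (auto simp: cl_def)
  have cl_lip: "\<bar>cl r - cl s\<bar> \<le> \<bar>r - s\<bar>" for r s by (auto simp: cl_def)
  define b where "b s = p * cl s powr (p - 1)" for s
  have b0: "0 \<le> b s" for s using p by (simp add: b_def)
  have bC: "b s \<le> p * m powr (p - 1)" for s
    unfolding b_def using p cl[of s] cl0[of s] by (intro mult_left_mono powr_mono2) auto
  have b_mono: "b r \<le> b s" if "r \<le> s" for r s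
    unfolding b_def using p cl0[of r] monoD[OF cl_mono that] by (intro mult_left_mono powr_mono2) auto
  define K where "K = p * ((p - 1) * (m powr (p - 1) * m))"
  have K: "0 \<le> K" using p m by (simp add: K_def)
  have b_lip: "\<bar>b r - b s\<bar> \<le> K * \<bar>r - s\<bar>" for r s
  proof -
    have "\<bar>b r - b s\<bar> = p * \<bar>cl r powr (p - 1) - cl s powr (p - 1)\<bar>"
      using p by (simp add: b_def abs_mult flip: right_diff_distrib)
    also have "\<dots> \<le> p * (((p - 1) * (m powr (p - 1) * m)) * \<bar>cl r - cl s\<bar>)"
      using p m cl by (intro mult_left_mono powr_lipschitz_on_compact) auto
    also have "\<dots> = K * \<bar>cl r - cl s\<bar>" by (simp add: K_def)
    also have "\<dots> \<le> K * \<bar>r - s\<bar>" using K cl_lip by (intro mult_left_mono)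
    finally show ?thesis .
  qed
  have ps: "power_slope p m s = ramp (m * s) * b s" for s by (simp add: power_slope_def b_def cl_def)
  show "\<exists>L. \<forall>r s. \<bar>power_slope p m r - power_slope p m s\<bar> \<le> L * \<bar>r - s\<bar>"
  proof (intro exI allI)
    fix r s
    have "\<bar>power_slope p m r - power_slope p m s\<bar> = \<bar>ramp (m * r) * (b r - b s) + (ramp (m * r) - ramp (m * s)) * b s\<bar>"
      by (simp add: ps algebra_simps)
    also have "\<dots> \<le> ramp (m * r) * \<bar>b r - b s\<bar> + \<bar>ramp (m * r) - ramp (m * s)\<bar> * b s"
    proof -
      have "\<bar>ramp (m * r) * (b r - b s)\<bar> = ramp (m * r) * \<bar>b r - b s\<bar>"
        "\<bar>(ramp (m * r) - ramp (m * s)) * b s\<bar> = \<bar>ramp (m * r) - ramp (m * s)\<bar> * b s"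
        unfolding abs_mult using ramp_bounds(1) b0 by simp_all
      then show ?thesis by (metis abs_triangle_ineq)
    qed
    also have "\<dots> \<le> 1 * (K * \<bar>r - s\<bar>) + (m * \<bar>r - s\<bar>) * (p * m powr (p - 1))"
    proof (intro add_mono mult_mono b_lip bC ramp_bounds b0)
      show "\<bar>ramp (m * r) - ramp (m * s)\<bar> \<le> m * \<bar>r - s\<bar>"
        using ramp_lipschitz[of "m * r" "m * s"] m by (simp add: abs_mult flip: right_diff_distrib)
    qed (use m in auto)
    also have "\<dots> = (K + m * (p * m powr (p - 1))) * \<bar>r - s\<bar>" by (simp add: algebra_simps)
    finally show "\<bar>power_slope p m r - power_slope p m s\<bar> \<le> (K + m * (p * m powr (p - 1))) * \<bar>r - s\<bar>" .
  qed
  show "mono (power_slope p m)"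
  proof (rule monoI)
    fix r s :: real assume "r \<le> s"
    then show "power_slope p m r \<le> power_slope p m s"
      unfolding ps using m by (intro mult_mono monoD[OF ramp_mono] mult_left_mono b_mono ramp_bounds b0) auto
  qed
  show "power_slope p m s \<le> p * m powr (p - 1)"
    using mult_mono[OF ramp_bounds(2) bC _ b0, of "m * s" s] unfolding ps by simp
  show z: "power_slope p m s = 0" if "s \<le> 1 / m" for s
    using that m unfolding ps by (subst ramp_bounds(3)) (simp_all add: field_simps)
  show "power_slope p m s \<le> p * s powr (p - 1)" if s: "0 < s"
  proof (cases "s \<le> 1 / m")
    case True then show ?thesis using z[OF True] p by simp
  next
    case False
    then have "cl s \<le> s" by (auto simp: cl_def)
    then have "b s \<le> p * s powr (p - 1)" unfolding b_def using p cl0[of s] by (intro mult_left_mono powr_mono2) auto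
    with mult_right_mono[OF ramp_bounds(2)[of "m * s"] b0[of s]] show ?thesis unfolding ps by simp
  qed
  show "power_slope p m s = p * s powr (p - 1)" if s: "2 / m \<le> s" "s \<le> m"
  proof -
    have "1 / m \<le> 2 / m" using m by (simp add: divide_right_mono)
    then have "cl s = s" using s by (simp add: cl_def)
    moreover have "ramp (m * s) = 1" using s m by (intro ramp_bounds(4)) (simp add: field_simps)
    ultimately show ?thesis by (simp add: ps b_def)
  qed
qed

lemma integral_power_slope:
  fixes a s p :: real
  assumes "0 < a" "a \<le> s"
  shows "integrable lborel (\<lambda>\<tau>. indicator {a<..s} \<tau> * (p * \<tau> powr (p - 1)))"
    "(\<integral>\<tau>. indicator {a<..s} \<tau> * (p * \<tau> powr (p - 1)) \<partial>lborel) = s powr p - a powr p"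
proof -
  have h: "has_bochner_integral lborel (\<lambda>\<tau>. (p * \<tau> powr (p - 1)) * indicator {a..s} \<tau>) (s powr p - a powr p)"
  proof (rule has_bochner_integral_FTC_Icc_real[OF assms(2)])
    fix x assume "a \<le> x" "x \<le> s"
    with assms have "0 < x" by simp
    then show "DERIV (\<lambda>s. s powr p) x :> p * x powr (p - 1)" by (rule has_real_derivative_powr)
    show "isCont (\<lambda>x. p * x powr (p - 1)) x" using \<open>0 < x\<close> by (intro continuous_intros) auto
  qed
  have ae: "AE \<tau> in lborel. (p * \<tau> powr (p - 1)) * indicator {a..s} \<tau> = indicator {a<..s} \<tau> * (p * \<tau> powr (p - 1))"
    using AE_lborel_singleton[of a] by eventually_elim (auto simp: indicator_def)
  have "has_bochner_integral lborel (\<lambda>\<tau>. indicator {a<..s} \<tau> * (p * \<tau> powr (p - 1))) (s powr p - a powr p)"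
    using h by (subst has_bochner_integral_cong_AE[OF _ _ ae, symmetric]) auto
  then show "integrable lborel (\<lambda>\<tau>. indicator {a<..s} \<tau> * (p * \<tau> powr (p - 1)))"
    "(\<integral>\<tau>. indicator {a<..s} \<tau> * (p * \<tau> powr (p - 1)) \<partial>lborel) = s powr p - a powr p"
    by (auto simp: has_bochner_integral_iff)
qed

text \<open>The slopes lie below p s^(p-1) and agree with it on [2 / m, m]. So the primitives stay
  below s^p, and for large m they miss at most (2 / m)^p.\<close>

lemma prim_power_slope:
  assumes p: "1 \<le> p"
  shows "1 \<le> m \<Longrightarrow> prim (power_slope p m) s \<le> (max s 0) powr p"
    and "(\<lambda>n. prim (power_slope p (real n + 2)) s) \<longlonglongrightarrow> (max s 0) powr p"
proof -
  note pr = power_slope_props[OF p]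
  have nz: "power_slope p m s = 0" if "s \<le> 0" "1 \<le> m" for m s
    using that by (intro pr(4)) (auto intro: order_trans)
  have nn: "0 \<le> power_slope p m s" if "1 \<le> m" for m s
    using monoD[OF pr(2)[OF that], of "min s 0" s] nz[of "min s 0" m] that by simp
  have up: "prim (power_slope p m) s \<le> (max s 0) powr p" if m: "1 \<le> m" for m
  proof (cases "s \<le> 1 / m")
    case True
    have "prim (power_slope p m) s = 0" unfolding prim_def
      by (rule integral_eq_zero_AE) (use True pr(4)[OF m] in \<open>auto simp: indicator_def\<close>)
    then show ?thesis by simp
  next
    case False
    have m0: "0 < 1 / m" using m by simp
    have "prim (power_slope p m) s = (\<integral>\<tau>. indicator {1/m<..s} \<tau> * power_slope p m \<tau> \<partial>lborel)" unfolding prim_def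
      by (intro Bochner_Integration.integral_cong refl) (use less_trans[OF m0] pr(4)[OF m] in \<open>auto simp: indicator_def not_less\<close>)
    also have "\<dots> \<le> (\<integral>\<tau>. indicator {1/m<..s} \<tau> * (p * \<tau> powr (p - 1)) \<partial>lborel)"
      using False m0
      by (intro integral_mono mono_indicator_integrable[OF pr(2)[OF m] nn[OF m]] integral_power_slope)
        (auto simp: indicator_def intro!: pr(5)[OF m] less_trans[OF m0])
    also have "\<dots> = s powr p - (1/m) powr p" using False m0 by (intro integral_power_slope) auto
    also have "\<dots> \<le> (max s 0) powr p" using less_trans[OF m0, of s] False by (simp add: max_def)
    finally show ?thesis .
  qed
  then show "1 \<le> m \<Longrightarrow> prim (power_slope p m) s \<le> (max s 0) powr p" .
  show "(\<lambda>n. prim (power_slope p (real n + 2)) s) \<longlonglongrightarrow> (max s 0) powr p"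
  proof (cases "s \<le> 0")
    case True
    then show ?thesis using p by (simp add: prim_nonpos max_def)
  next
    case False
    then have s: "0 < s" by simp
    have "(\<lambda>n. s powr p - (2 / (real n + 2)) powr p) \<longlonglongrightarrow> s powr p - 0 powr p"
    proof (intro tendsto_diff tendsto_const tendsto_powr2)
      show "(\<lambda>n. 2 / (real n + 2)) \<longlonglongrightarrow> 0"
        using LIMSEQ_ignore_initial_segment[OF lim_const_over_n[of "2::real"], of 2] by (simp add: add.commute)
    qed (use p in auto)
    then have lim: "(\<lambda>n. s powr p - (2 / (real n + 2)) powr p) \<longlonglongrightarrow> s powr p" using p by simp
    have ms: "max s 0 = s" using s by simp
    show ?thesis unfolding ms
    proof (rule tendsto_sandwich[OF _ _ lim tendsto_const])
      show "\<forall>\<^sub>F n in sequentially. prim (power_slope p (real n + 2)) s \<le> s powr p"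
        by (intro always_eventually allI up[unfolded ms]) simp
      obtain N1 :: nat where N1: "s \<le> N1" using real_arch_simple by blast
      obtain N2 :: nat where N2: "2 / s \<le> N2" using real_arch_simple by blast
      show "\<forall>\<^sub>F n in sequentially. s powr p - (2 / (real n + 2)) powr p \<le> prim (power_slope p (real n + 2)) s"
        unfolding eventually_sequentially
      proof (intro exI allI impI)
        fix n assume n: "max N1 N2 \<le> n"
        let ?m = "real n + 2"
        have m: "1 \<le> ?m" by simp
        have sm: "s \<le> ?m" using N1 n by simp
        have "2 / s \<le> ?m" using N2 n by simp
        then have ms: "2 / ?m \<le> s" using s by (simp add: field_simps)
        have m0: "0 < 2 / ?m" by simp
        have "s powr p - (2 / ?m) powr p = (\<integral>\<tau>. indicator {2/?m<..s} \<tau> * (p * \<tau> powr (p - 1)) \<partial>lborel)"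
          using integral_power_slope(2)[OF m0 ms] by simp
        also have "\<dots> = (\<integral>\<tau>. indicator {2/?m<..s} \<tau> * power_slope p ?m \<tau> \<partial>lborel)"
          by (intro Bochner_Integration.integral_cong refl) (use sm pr(6)[OF m] in \<open>auto simp: indicator_def\<close>)
        also have "\<dots> \<le> prim (power_slope p ?m) s" unfolding prim_def
          by (intro integral_mono mono_indicator_integrable[OF pr(2)[OF m] nn[OF m]])
            (use nn[OF m] in \<open>auto simp: indicator_def dest: less_trans[OF m0]\<close>)
        finally show "s powr p - (2 / ?m) powr p \<le> prim (power_slope p ?m) s" .
      qed
    qed
  qed
qed

text \<open>A family of kernels is needed to describe the norm: s^p has in general no bounded
  Lipschitz slope, and the essential supremum corresponds to no finite convex function.\<close>

definition modular_family :: "'a measure \<Rightarrow> ereal \<Rightarrow> (nat \<Rightarrow> real \<Rightarrow> real) \<Rightarrow> (nat \<Rightarrow> real \<Rightarrow> real) \<Rightarrow> bool" where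
  "modular_family M r q J \<longleftrightarrow> (\<forall>n. modular_kernel (q n) (J n)) \<and>
    (\<forall>u\<in>L2 M. \<forall>c>0. Lr_norm M r (pos_part u) \<le> ennreal c \<longleftrightarrow> (\<forall>n. (\<integral>x. J n (u x / c) \<partial>M) \<le> 1))"

text \<open>By homogeneity the claim compares the integral of the p-th power of (u / c)^+ with 1.
  The kernels lie below this power, which gives one direction; they converge to it, and Fatou gives
  the other.\<close>

lemma modular_family_finite:
  assumes p: "1 \<le> p"
  shows "modular_family M (ereal p) (\<lambda>n. power_slope p (real n + 2)) (\<lambda>n. prim (power_slope p (real n + 2)))"
  unfolding modular_family_def
proof (intro conjI allI ballI impI)
  fix n
  let ?m = "real n + 2"
  have m: "1 \<le> ?m" by simp
  note pr = power_slope_props[OF p m]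
  have z: "power_slope p ?m s = 0" if "s \<le> 0" for s
    by (rule pr(4)) (rule order_trans[OF that], simp)
  obtain L where "\<And>r s. \<bar>power_slope p ?m r - power_slope p ?m s\<bar> \<le> L * \<bar>r - s\<bar>" using pr(1) by blast
  then show "modular_kernel (power_slope p ?m) (prim (power_slope p ?m))"
    by (rule modular_kernel_prim[OF _ pr(2,3) z])
next
  fix u :: "'a \<Rightarrow> real" and c :: real assume u: "u \<in> L2 M" and c: "0 < c"
  note [measurable] = L2D(1)[OF u]
  let ?J = "\<lambda>n. prim (power_slope p (real n + 2))"
  have uc: "(\<lambda>x. u x / c) \<in> L2 M" using L2_scale[OF u, of "1/c"] by simp
  have mk: "modular_kernel (power_slope p (real n + 2)) (?J n)" for n
  proof -
    have m: "1 \<le> real n + 2" by simp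
    note pr = power_slope_props[OF p m]
    have z: "power_slope p (real n + 2) s = 0" if "s \<le> 0" for s
      by (rule pr(4)) (rule order_trans[OF that], simp)
    obtain L where "\<And>r s. \<bar>power_slope p (real n + 2) r - power_slope p (real n + 2) s\<bar> \<le> L * \<bar>r - s\<bar>" using pr(1) by blast
    then show ?thesis by (rule modular_kernel_prim[OF _ pr(2,3) z])
  qed
  have [measurable]: "?J n \<in> borel_measurable borel" for n using mk by (auto simp: modular_kernel_def)
  define I where "I = (\<integral>\<^sup>+x. ennreal (\<bar>pos_part u x\<bar> powr p) \<partial>M)"
  have Lr: "Lr_norm M (ereal p) (pos_part u) = (if I = \<infinity> then \<infinity> else ennreal (enn2real I powr (1 / p)))"
    by (simp add: Lr_norm_def I_def)
  have le_iff: "Lr_norm M (ereal p) (pos_part u) \<le> ennreal c \<longleftrightarrow> I \<le> ennreal (c powr p)"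
  proof (cases "I = \<infinity>")
    case True
    then show ?thesis by (simp add: Lr top_unique)
  next
    case False
    then obtain i where i: "I = ennreal i" "0 \<le> i" by (metis ennreal_cases infinity_ennreal_def)
    have "i powr (1/p) \<le> c \<longleftrightarrow> i \<le> c powr p"
    proof
      assume "i powr (1/p) \<le> c"
      then have "(i powr (1/p)) powr p \<le> c powr p" using p by (intro powr_mono2) auto
      then show "i \<le> c powr p" using i p by (simp add: powr_powr)
    next
      assume "i \<le> c powr p"
      then have "i powr (1/p) \<le> (c powr p) powr (1/p)" using i p by (intro powr_mono2) auto
      then show "i powr (1/p) \<le> c" using c p by (simp add: powr_powr)
    qed
    then show ?thesis using False i c by (simp add: Lr)
  qed
  have scale: "(\<integral>\<^sup>+x. ennreal ((max (u x / c) 0) powr p) \<partial>M) = I / ennreal (c powr p)"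
  proof -
    have "(max (u x / c) 0) powr p = \<bar>pos_part u x\<bar> powr p / c powr p" for x
      using c by (auto simp: pos_part_def max_def powr_divide divide_le_0_iff)
    then have "(\<integral>\<^sup>+x. ennreal ((max (u x / c) 0) powr p) \<partial>M) = (\<integral>\<^sup>+x. ennreal (\<bar>pos_part u x\<bar> powr p) / ennreal (c powr p) \<partial>M)"
      using c by (simp add: divide_ennreal)
    also have "\<dots> = I / ennreal (c powr p)" unfolding I_def
      by (rule nn_integral_divide) (simp add: pos_part_def)
    finally show ?thesis .
  qed
  have sle: "I / ennreal (c powr p) \<le> 1 \<longleftrightarrow> I \<le> ennreal (c powr p)"
  proof (cases I)
    case (real i)
    then show ?thesis using c by (simp add: divide_ennreal divide_le_eq)
  next
    case top
    then show ?thesis using c by (simp add: ennreal_top_divide top_unique)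
  qed
  have eq: "(\<integral>x. ?J n (u x / c) \<partial>M) \<le> 1 \<longleftrightarrow> (\<integral>\<^sup>+x. ennreal (?J n (u x / c)) \<partial>M) \<le> 1" for n
    unfolding modular_kernel_nn_integral[OF mk uc] by simp
  show "Lr_norm M (ereal p) (pos_part u) \<le> ennreal c \<longleftrightarrow> (\<forall>n. (\<integral>x. ?J n (u x / c) \<partial>M) \<le> 1)"
    unfolding le_iff sle[symmetric] scale[symmetric] eq
  proof (intro iffI allI)
    fix n assume H: "(\<integral>\<^sup>+x. ennreal ((max (u x / c) 0) powr p) \<partial>M) \<le> 1"
    have "(\<integral>\<^sup>+x. ennreal (?J n (u x / c)) \<partial>M) \<le> (\<integral>\<^sup>+x. ennreal ((max (u x / c) 0) powr p) \<partial>M)"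
      by (intro nn_integral_mono ennreal_leI prim_power_slope(1)[OF p]) simp
    with H show "(\<integral>\<^sup>+x. ennreal (?J n (u x / c)) \<partial>M) \<le> 1" by simp
  next
    assume H: "\<forall>n. (\<integral>\<^sup>+x. ennreal (?J n (u x / c)) \<partial>M) \<le> 1"
    have "(\<integral>\<^sup>+x. ennreal ((max (u x / c) 0) powr p) \<partial>M) = (\<integral>\<^sup>+x. liminf (\<lambda>n. ennreal (?J n (u x / c))) \<partial>M)"
    proof (rule nn_integral_cong)
      fix x
      have "(\<lambda>n. ennreal (?J n (u x / c))) \<longlonglongrightarrow> ennreal ((max (u x / c) 0) powr p)"
        by (rule tendsto_ennrealI[OF prim_power_slope(2)[OF p]])
      then show "ennreal ((max (u x / c) 0) powr p) = liminf (\<lambda>n. ennreal (?J n (u x / c)))"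
        by (rule lim_imp_Liminf[OF sequentially_bot, symmetric])
    qed
    also have "\<dots> \<le> liminf (\<lambda>n. \<integral>\<^sup>+x. ennreal (?J n (u x / c)) \<partial>M)"
      by (rule nn_integral_liminf) simp
    also have "\<dots> \<le> 1" using H by (intro Liminf_le) auto
    finally show "(\<integral>\<^sup>+x. ennreal ((max (u x / c) 0) powr p) \<partial>M) \<le> 1" .
  qed
qed

text \<open>Because of the factors n + 1, all the integrals are at most 1 only if the integral of
  \<open>prim ramp (u x / c)\<close> vanishes; as \<open>prim ramp\<close> is zero exactly up to 1,
  this means u \<le> c almost everywhere.\<close>

lemma modular_family_infinite:
  "modular_family M \<infinity> (\<lambda>n s. real (Suc n) * ramp s) (\<lambda>n s. real (Suc n) * prim ramp s)"
  unfolding modular_family_def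
proof (intro conjI allI ballI impI)
  have r: "modular_kernel ramp (prim ramp)"
    by (rule modular_kernel_prim[where L=1 and C=1]) (use ramp_lipschitz ramp_mono ramp_bounds in auto)
  show mk: "modular_kernel (\<lambda>s. real (Suc n) * ramp s) (\<lambda>s. real (Suc n) * prim ramp s)" for n
    unfolding modular_kernel_def
  proof (intro conjI)
    show "\<exists>L. \<forall>r s. \<bar>real (Suc n) * ramp r - real (Suc n) * ramp s\<bar> \<le> L * \<bar>r - s\<bar>"
      using ramp_lipschitz by (intro exI[of _ "real (Suc n)"]) (simp add: abs_mult mult_left_mono flip: right_diff_distrib)
    show "mono (\<lambda>s. real (Suc n) * ramp s)" using ramp_mono by (auto simp: mono_def intro!: mult_left_mono)
    show "\<exists>C. \<forall>r. \<bar>real (Suc n) * ramp r\<bar> \<le> C"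
      using ramp_bounds by (intro exI[of _ "real (Suc n)"]) (simp add: abs_mult mult_left_le)
    show "\<forall>r s. real (Suc n) * prim ramp r - real (Suc n) * prim ramp s \<le> real (Suc n) * ramp r * (r - s)"
      using r unfolding modular_kernel_def right_diff_distrib[symmetric] mult.assoc
      by (intro allI mult_left_mono) auto
    show "(\<lambda>s. real (Suc n) * prim ramp s) \<in> borel_measurable borel"
      using r by (auto simp: modular_kernel_def)
  qed (auto simp: ramp_bounds prim_nonpos)
  fix u :: "'a \<Rightarrow> real" and c :: real assume u: "u \<in> L2 M" and c: "0 < c"
  note [measurable] = L2D(1)[OF u]
  have uc: "(\<lambda>x. u x / c) \<in> L2 M" using L2_scale[OF u, of "1/c"] by simp
  have z: "prim ramp s = 0" if "s \<le> 1" for s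
  proof -
    have "prim ramp s = 0" unfolding prim_def
      by (rule integral_eq_zero_AE) (use that in \<open>auto simp: indicator_def ramp_bounds\<close>)
    then show ?thesis by simp
  qed
  have nn: "0 \<le> prim ramp s" for s by (rule modular_kernel_nonneg[OF r])
  have pos: "0 < prim ramp s" if "1 < s" for s
  proof -
    let ?r = "(1 + s) / 2"
    have "prim ramp ?r - prim ramp s \<le> ramp ?r * (?r - s)"
      using r unfolding modular_kernel_def by blast
    moreover have "ramp ?r * (?r - s) < 0" using that ramp_bounds(5)[of ?r] by (intro mult_pos_neg) auto
    ultimately show ?thesis using nn[of ?r] by linarith
  qed
  have iff: "prim ramp s = 0 \<longleftrightarrow> s \<le> 1" for s using z[of s] pos[of s] by force
  have ess: "Lr_norm M \<infinity> (pos_part u) \<le> ennreal c \<longleftrightarrow> (AE x in M. u x / c \<le> 1)"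
  proof -
    have m: "(\<lambda>x. ennreal \<bar>pos_part u x\<bar>) \<in> borel_measurable M" by (simp add: pos_part_def)
    have pt: "ennreal \<bar>pos_part u x\<bar> \<le> ennreal c \<longleftrightarrow> u x / c \<le> 1" for x
      using c by (auto simp: pos_part_def field_simps)
    have "esssup M (\<lambda>x. ennreal \<bar>pos_part u x\<bar>) \<le> ennreal c \<longleftrightarrow> (AE x in M. ennreal \<bar>pos_part u x\<bar> \<le> ennreal c)"
      using esssup_I[OF m, of "ennreal c"] esssup_AE[of "\<lambda>x. ennreal \<bar>pos_part u x\<bar>" M]
      by (auto elim!: eventually_mono)
    then show ?thesis unfolding pt by (simp add: Lr_norm_def)
  qed
  have int: "integrable M (\<lambda>x. prim ramp (u x / c))" by (rule modular_kernel_integrable[OF r uc])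
  show "Lr_norm M \<infinity> (pos_part u) \<le> ennreal c \<longleftrightarrow> (\<forall>n. (\<integral>x. real (Suc n) * prim ramp (u x / c) \<partial>M) \<le> 1)"
    unfolding ess
  proof
    assume "AE x in M. u x / c \<le> 1"
    then have "AE x in M. prim ramp (u x / c) = 0" by eventually_elim (simp only: iff)
    then have "(\<integral>x. prim ramp (u x / c) \<partial>M) = 0"
      using int by (subst integral_nonneg_eq_0_iff_AE) (auto simp: nn)
    then show "\<forall>n. (\<integral>x. real (Suc n) * prim ramp (u x / c) \<partial>M) \<le> 1" by simp
  next
    assume H: "\<forall>n. (\<integral>x. real (Suc n) * prim ramp (u x / c) \<partial>M) \<le> 1"
    have "(\<integral>x. prim ramp (u x / c) \<partial>M) = 0"
    proof (rule ccontr)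
      assume ne: "(\<integral>x. prim ramp (u x / c) \<partial>M) \<noteq> 0"
      have "0 \<le> (\<integral>x. prim ramp (u x / c) \<partial>M)" by (simp add: nn)
      with ne have p: "0 < (\<integral>x. prim ramp (u x / c) \<partial>M)" by simp
      obtain n :: nat where "1 / (\<integral>x. prim ramp (u x / c) \<partial>M) < n" using reals_Archimedean2 by blast
      then have "1 < n * (\<integral>x. prim ramp (u x / c) \<partial>M)" using p by (simp add: field_simps)
      also have "\<dots> \<le> real (Suc n) * (\<integral>x. prim ramp (u x / c) \<partial>M)" using p by (intro mult_right_mono) auto
      also have "\<dots> \<le> 1" using H by simp
      finally show False by simp
    qed
    then have "AE x in M. prim ramp (u x / c) = 0"
      using int by (subst (asm) integral_nonneg_eq_0_iff_AE) (auto simp: nn)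
    then show "AE x in M. u x / c \<le> 1" by eventually_elim (simp only: iff)
  qed
qed

lemma modular_family_exists:
  assumes "1 \<le> (r::ereal)"
  shows "\<exists>q J. modular_family M r q J"
proof (cases r)
  case (real p)
  then show ?thesis using modular_family_finite[of p M] assms by auto
next
  case PInf
  then show ?thesis using modular_family_infinite[of M] by auto
qed (use assms in auto)

section \<open>Measurability of the norms in time, and the estimate for every r\<close>

context time_space
begin

text \<open>For r = \<infinity> one looks at sublevel sets: the essential supremum is at most c iff
  the section of a fixed measurable set is null, and the measure of a section depends measurably on
  time.\<close>

lemma Lr_norm_meas:
  fixes g :: "real \<Rightarrow> 'a \<Rightarrow> real"
  assumes g: "case_prod g \<in> borel_measurable Q"
  shows "(\<lambda>\<tau>. Lr_norm nu r (pos_part (g \<tau>))) \<in> borel_measurable lborel"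
proof (cases "r = \<infinity>")
  case False
  have "(\<lambda>w. ennreal (\<bar>max (case_prod g w) 0\<bar> powr real_of_ereal r)) \<in> borel_measurable Q"
    using g by measurable
  then have "(\<lambda>(\<tau>, x). ennreal (\<bar>pos_part (g \<tau>) x\<bar> powr real_of_ereal r)) \<in> borel_measurable Q"
    by (simp add: pos_part_def split_beta')
  from sigma_finite_measure.borel_measurable_nn_integral[OF sigma_finite_nu this]
  have [measurable]: "(\<lambda>\<tau>. \<integral>\<^sup>+x. ennreal (\<bar>pos_part (g \<tau>) x\<bar> powr real_of_ereal r) \<partial>nu) \<in> borel_measurable borel"
    by simp
  show ?thesis using False unfolding Lr_norm_def Let_def by simp
next
  case True
  show ?thesis
  proof (rule borel_measurableI_le)
    fix c :: ennreal
    have m: "(\<lambda>x. ennreal \<bar>pos_part (g \<tau>) x\<bar>) \<in> borel_measurable nu" for \<tau>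
      using joint_meas_section[OF g, of \<tau>] by (simp add: pos_part_def)
    let ?C = "{w\<in>space Q. \<not> ennreal \<bar>max (case_prod g w) 0\<bar> \<le> c}"
    have C: "?C \<in> sets Q" using g by measurable
    have "esssup nu (\<lambda>x. ennreal \<bar>pos_part (g \<tau>) x\<bar>) \<le> c \<longleftrightarrow> emeasure nu (Pair \<tau> -` ?C) = 0" for \<tau>
    proof -
      have eq: "Pair \<tau> -` ?C = {x\<in>space nu. \<not> ennreal \<bar>pos_part (g \<tau>) x\<bar> \<le> c}"
        by (auto simp: space_pair_measure pos_part_def)
      have "esssup nu (\<lambda>x. ennreal \<bar>pos_part (g \<tau>) x\<bar>) \<le> c \<longleftrightarrow> (AE x in nu. ennreal \<bar>pos_part (g \<tau>) x\<bar> \<le> c)"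
        using esssup_I[OF m, of \<tau> c] esssup_AE[of "\<lambda>x. ennreal \<bar>pos_part (g \<tau>) x\<bar>" nu]
        by (auto elim!: eventually_mono)
      also have "\<dots> \<longleftrightarrow> emeasure nu (Pair \<tau> -` ?C) = 0"
        unfolding eq by (rule AE_iff_measurable[OF _ refl]) (use m[of \<tau>] in measurable)
      finally show ?thesis .
    qed
    then have "{\<tau>\<in>space lborel. Lr_norm nu r (pos_part (g \<tau>)) \<le> c} = {\<tau>\<in>space lborel. emeasure nu (Pair \<tau> -` ?C) = 0}"
      using True by (simp add: Lr_norm_def)
    also have "\<dots> \<in> sets lborel"
      using sigma_finite_measure.measurable_emeasure_Pair[OF sigma_finite_nu C] by measurable
    finally show "{\<tau>\<in>space lborel. Lr_norm nu r (pos_part (g \<tau>)) \<le> c} \<in> sets lborel" .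
  qed
qed

text \<open>\<open>orlicz_contraction\<close> is applied to every kernel of the family, with
  \<open>G0\<close> just above the norm of the initial difference and \<gamma> just above the norm
  of the force difference; the family then translates all the modular bounds back into one norm
  bound.\<close>

theorem Lr_contraction:
  assumes acc: "completely_accretive nu Aop"
    and sol: "strong_solution nu Aop T u0 f u" and sol': "strong_solution nu Aop T u0' f' u'"
    and f: "f \<in> L2_time nu T" "f' \<in> L2_time nu T" and u0: "u0 \<in> L2 nu" "u0' \<in> L2 nu"
    and t: "0 \<le> t" "t \<le> T" and r: "1 \<le> r"
  shows "Lr_norm nu r (pos_part (\<lambda>x. u t x - u' t x))
    \<le> Lr_norm nu r (pos_part (\<lambda>x. u0 x - u0' x))
      + (\<integral>\<^sup>+s\<in>{0..t}. Lr_norm nu r (pos_part (\<lambda>x. f s x - f' s x)) \<partial>lborel)"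
proof -
  obtain q J where fam: "modular_family nu r q J" using modular_family_exists[OF r] by blast
  have mk: "modular_kernel (q n) (J n)" for n using fam by (simp add: modular_family_def)
  have mf: "Lr_norm nu r (pos_part u) \<le> ennreal c \<longleftrightarrow> (\<forall>n. (\<integral>x. J n (u x / c) \<partial>nu) \<le> 1)"
    if "u \<in> L2 nu" "0 < c" for u c using fam that by (simp add: modular_family_def)
  define g where "g \<tau> x = indicator {0<..<T} \<tau> * f \<tau> x - indicator {0<..<T} \<tau> * f' \<tau> x" for \<tau> x
  have g: "g \<in> LQ" unfolding g_def by (intro LQ_diff L2_time_LQ f)
  define N where "N \<tau> = Lr_norm nu r (pos_part (g \<tau>))" for \<tau>
  have [measurable]: "N \<in> borel_measurable borel"
    using Lr_norm_meas[OF LQ_meas[OF g]] by (simp add: N_def[abs_def])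
  define N0 where "N0 = Lr_norm nu r (pos_part (\<lambda>x. u0 x - u0' x))"
  define S where "S = (\<integral>\<^sup>+s. N s * indicator {0<..<t} s \<partial>lborel)"
  have gf: "g \<tau> = (\<lambda>x. f \<tau> x - f' \<tau> x)" if "0 < \<tau>" "\<tau> < t" for \<tau>
    using that t by (auto simp: g_def)
  have S: "(\<integral>\<^sup>+s\<in>{0..t}. Lr_norm nu r (pos_part (\<lambda>x. f s x - f' s x)) \<partial>lborel) = S"
    unfolding S_def
  proof (rule nn_integral_cong_AE)
    show "AE s in lborel. Lr_norm nu r (pos_part (\<lambda>x. f s x - f' s x)) * indicator {0..t} s = N s * indicator {0<..<t} s"
      using AE_lborel_singleton[of 0] AE_lborel_singleton[of t]
      by eventually_elim (auto simp: indicator_def N_def gf)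
  qed
  have "Lr_norm nu r (pos_part (\<lambda>x. u t x - u' t x)) \<le> N0 + S"
  proof (cases "N0 = \<infinity> \<or> S = \<infinity>")
    case False
    then obtain n0 where n0: "N0 = ennreal n0" "0 \<le> n0" by (metis ennreal_cases infinity_ennreal_def)
    from False obtain s0 where s0: "S = ennreal s0" "0 \<le> s0" by (metis ennreal_cases infinity_ennreal_def)
    have fin: "AE s in lborel. N s * indicator {0<..<t} s \<noteq> \<infinity>"
      using False unfolding S_def by (intro nn_integral_PInf_AE) auto
    define h where "h s = enn2real (N s) * indicator {0<..<t} s" for s
    have hS: "(\<integral>\<^sup>+s. ennreal (h s) \<partial>lborel) = S"
      unfolding S_def
    proof (rule nn_integral_cong_AE)
      show "AE s in lborel. ennreal (h s) = N s * indicator {0<..<t} s"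
        using fin by eventually_elim (auto simp: h_def indicator_def less_top)
    qed
    have [measurable]: "h \<in> borel_measurable borel" unfolding h_def by measurable
    have h: "has_bochner_integral lborel h s0"
      by (rule has_bochner_integral_nn_integral) (use hS s0 in \<open>auto simp: h_def\<close>)
    show ?thesis
    proof (rule ennreal_le_epsilon)
      fix e :: real assume e: "0 < e"
      \<comment> \<open>Both \<open>G0\<close> and \<gamma> have to be positive even where the norms
        vanish. The surplus \<eta> at the start and \<eta> per unit of time add up to
        \<open>e\<close>.\<close>
      define \<eta> where "\<eta> = e / (1 + t)"
      have "\<eta> * (1 + t) = e" using t by (simp add: \<eta>_def)
      then have \<eta>: "0 < \<eta>" "\<eta> + \<eta> * t = e" using e t by (simp_all add: \<eta>_def distrib_left)
      define \<gamma> where "\<gamma> s = h s + \<eta> * indicator {0<..t} s" for s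
      have hint: "integrable lborel h" "integral\<^sup>L lborel h = s0" using h by (auto simp: has_bochner_integral_iff)
      have \<gamma>: "integrable lborel \<gamma>" unfolding \<gamma>_def
        using hint integrable_indicator_Ioc[of 0 t] by (intro Bochner_Integration.integrable_add) auto
      have \<gamma>0: "0 \<le> \<gamma> s" for s using \<eta> by (auto simp: \<gamma>_def h_def)
      have "(\<integral>\<tau>. indicator {0<..t} \<tau> * \<gamma> \<tau> \<partial>lborel) = (\<integral>\<tau>. h \<tau> + \<eta> * indicator {0<..t} \<tau> \<partial>lborel)"
        by (intro Bochner_Integration.integral_cong refl) (auto simp: \<gamma>_def h_def indicator_def)
      also have "\<dots> = s0 + \<eta> * t"
        using hint integrable_indicator_Ioc[of 0 t] t by (subst Bochner_Integration.integral_add) auto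
      finally have \<gamma>int: "(\<integral>\<tau>. indicator {0<..t} \<tau> * \<gamma> \<tau> \<partial>lborel) = s0 + \<eta> * t" .
      have uL: "u t \<in> L2 nu" "u' t \<in> L2 nu" using sol sol' t unfolding strong_solution_def by auto
      have "(\<integral>x. J n ((u t x - u' t x) / ((n0 + \<eta>) + (\<integral>\<tau>. indicator {0<..t} \<tau> * \<gamma> \<tau> \<partial>lborel))) \<partial>nu) \<le> 1" for n
      proof -
        from mk[of n] obtain L C where L: "\<And>r s. \<bar>q n r - q n s\<bar> \<le> L * \<bar>r - s\<bar>" and C: "\<And>r. \<bar>q n r\<bar> \<le> C"
          unfolding modular_kernel_def by blast
        show ?thesis
        proof (rule orlicz_contraction[OF acc sol sol' f L _ _ C _ _ _ \<gamma> \<gamma>0 _ t _ u0])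
          show "(\<integral>x. J n ((u0 x - u0' x) / (n0 + \<eta>)) \<partial>nu) \<le> 1"
          proof -
            have "N0 \<le> ennreal (n0 + \<eta>)" using n0 \<eta> by (simp add: ennreal_leI)
            then show ?thesis using mf[OF L2_diff[OF u0], of "n0 + \<eta>"] n0 \<eta> by (simp add: N0_def)
          qed
          show "AE \<tau> in lborel. 0 < \<tau> \<longrightarrow> \<tau> < t \<longrightarrow> 0 < \<gamma> \<tau> \<and> (\<integral>x. J n ((f \<tau> x - f' \<tau> x) / \<gamma> \<tau>) \<partial>nu) \<le> 1"
            using fin LQ_section[OF g]
          proof (eventually_elim, intro impI)
            fix \<tau> assume H: "N \<tau> * indicator {0<..<t} \<tau> \<noteq> \<infinity>" "g \<tau> \<in> L2 nu" "0 < \<tau>" "\<tau> < t"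
            have \<gamma>\<tau>: "\<gamma> \<tau> = enn2real (N \<tau>) + \<eta>" using H by (simp add: \<gamma>_def h_def)
            have Nf: "N \<tau> = ennreal (enn2real (N \<tau>))" using H by (simp add: less_top)
            have "N \<tau> \<le> ennreal (\<gamma> \<tau>)" unfolding \<gamma>\<tau> by (subst Nf) (use \<eta> in \<open>simp add: ennreal_leI\<close>)
            moreover have "0 < \<gamma> \<tau>" unfolding \<gamma>\<tau> using \<eta> by (simp add: add_nonneg_pos)
            ultimately show "0 < \<gamma> \<tau> \<and> (\<integral>x. J n ((f \<tau> x - f' \<tau> x) / \<gamma> \<tau>) \<partial>nu) \<le> 1"
              using mf[OF H(2), of "\<gamma> \<tau>"] gf[OF H(3,4)] by (simp add: N_def)
          qed
        qed (use mk[of n] n0 \<eta> in \<open>auto simp: modular_kernel_def\<close>)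
      qed
      moreover have "0 < (n0 + \<eta>) + (s0 + \<eta> * t)"
        using n0 s0 \<eta>(1) t by (intro add_pos_nonneg add_nonneg_pos add_nonneg_nonneg mult_nonneg_nonneg) auto
      ultimately have "Lr_norm nu r (pos_part (\<lambda>x. u t x - u' t x)) \<le> ennreal ((n0 + \<eta>) + (s0 + \<eta> * t))"
        unfolding \<gamma>int using mf[OF L2_diff[OF uL]] by blast
      also have "\<dots> = N0 + S + ennreal e"
        using n0 s0 \<eta> e by (simp add: algebra_simps flip: ennreal_plus)
      finally show "Lr_norm nu r (pos_part (\<lambda>x. u t x - u' t x)) \<le> N0 + S + ennreal e" .
    qed
  qed auto
  then show ?thesis unfolding N0_def S .
qed

end

section \<open>Resolvents of convex functionals\<close>

text \<open>The passage to the limit in a first-order optimality condition, with \<open>B\<close>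
  collecting the quadratic remainder.\<close>

lemma affine_limit_nonneg:
  fixes A B :: real
  assumes "\<And>\<theta>. 0 < \<theta> \<Longrightarrow> \<theta> \<le> 1 \<Longrightarrow> 0 \<le> A + \<theta> * B"
  shows "0 \<le> A"
proof (rule tendsto_lowerbound)
  have "((\<lambda>\<theta>. A + \<theta> * B) \<longlongrightarrow> A + 0 * B) (at_right 0)"
    by (intro tendsto_intros)
  then show "((\<lambda>\<theta>. A + \<theta> * B) \<longlongrightarrow> A) (at_right 0)" by simp
  show "\<forall>\<^sub>F \<theta> in at_right 0. 0 \<le> A + \<theta> * B"
    unfolding eventually_at_right[OF zero_less_one] using assms by (intro exI[of _ 1]) auto
qed simp

text \<open>Lower semicontinuity is asked for along sequences converging almost everywhere, as
  Fatou's lemma provides it for integral functionals; \<open>phi_lsc\<close> recovers norm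
  convergence through a subsequence.\<close>

locale convex_functional = time_space nu for nu :: "'a measure" +
  fixes Phi :: "('a \<Rightarrow> real) \<Rightarrow> ennreal"
  assumes Phi_zero: "Phi (\<lambda>_. 0) = 0"
    and Phi_convex: "\<And>u v \<theta>. u \<in> L2 nu \<Longrightarrow> v \<in> L2 nu \<Longrightarrow> 0 \<le> \<theta> \<Longrightarrow> \<theta> \<le> 1 \<Longrightarrow>
      Phi (\<lambda>x. (1 - \<theta>) * u x + \<theta> * v x) \<le> ennreal (1 - \<theta>) * Phi u + ennreal \<theta> * Phi v"
    and Phi_lsc: "\<And>w u. (\<And>n::nat. w n \<in> L2 nu) \<Longrightarrow> u \<in> L2 nu \<Longrightarrow> AE x in nu. (\<lambda>n. w n x) \<longlonglongrightarrow> u x \<Longrightarrow>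
      Phi u \<le> liminf (\<lambda>n. Phi (w n))"
    and Phi_dense: "\<And>u. u \<in> L2 nu \<Longrightarrow>
      \<exists>w. (\<forall>n::nat. w n \<in> L2 nu \<and> Phi (w n) < \<infinity>) \<and> (\<lambda>n. L2_norm nu (\<lambda>x. w n x - u x)) \<longlonglongrightarrow> 0"
begin

definition phi :: "('a \<Rightarrow> real) \<Rightarrow> real" where "phi u = enn2real (Phi u)"

definition dom :: "('a \<Rightarrow> real) set" where "dom = {u \<in> L2 nu. Phi u < \<infinity>}"

definition subdiff :: "('a \<Rightarrow> real) \<Rightarrow> ('a \<Rightarrow> real) \<Rightarrow> bool" where
  "subdiff u w \<longleftrightarrow> u \<in> dom \<and> w \<in> L2 nu \<and> (\<forall>\<xi>\<in>dom. phi u + (\<integral>x. w x * (\<xi> x - u x) \<partial>nu) \<le> phi \<xi>)"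

lemma dom_L2: "u \<in> dom \<Longrightarrow> u \<in> L2 nu" by (simp add: dom_def)

lemma Phi_phi: "u \<in> dom \<Longrightarrow> Phi u = ennreal (phi u)"
  by (simp add: dom_def phi_def less_top)

lemma phi_nonneg [simp]: "0 \<le> phi u" by (simp add: phi_def)

lemma domI: "u \<in> L2 nu \<Longrightarrow> Phi u \<le> ennreal c \<Longrightarrow> 0 \<le> c \<Longrightarrow> u \<in> dom \<and> phi u \<le> c"
  unfolding dom_def phi_def using enn2real_leI[of c "Phi u"] by (auto simp: le_less_trans)

lemma zero_dom: "(\<lambda>_. 0) \<in> dom" and phi_zero: "phi (\<lambda>_. 0) = 0"
  by (auto simp: dom_def phi_def Phi_zero)

lemma phi_convex:
  assumes "u \<in> dom" "v \<in> dom" "0 \<le> \<theta>" "\<theta> \<le> 1"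
  shows "(\<lambda>x. (1 - \<theta>) * u x + \<theta> * v x) \<in> dom" "phi (\<lambda>x. (1 - \<theta>) * u x + \<theta> * v x) \<le> (1 - \<theta>) * phi u + \<theta> * phi v"
proof -
  have "Phi (\<lambda>x. (1 - \<theta>) * u x + \<theta> * v x) \<le> ennreal (1 - \<theta>) * Phi u + ennreal \<theta> * Phi v"
    by (intro Phi_convex dom_L2 assms)
  also have "\<dots> = ennreal ((1 - \<theta>) * phi u + \<theta> * phi v)"
    using assms by (simp add: Phi_phi ennreal_mult)
  finally have "Phi (\<lambda>x. (1 - \<theta>) * u x + \<theta> * v x) \<le> ennreal ((1 - \<theta>) * phi u + \<theta> * phi v)" .
  moreover have "(\<lambda>x. (1 - \<theta>) * u x + \<theta> * v x) \<in> L2 nu"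
    by (intro L2_add L2_scale dom_L2 assms)
  ultimately show "(\<lambda>x. (1 - \<theta>) * u x + \<theta> * v x) \<in> dom" "phi (\<lambda>x. (1 - \<theta>) * u x + \<theta> * v x) \<le> (1 - \<theta>) * phi u + \<theta> * phi v"
    using assms by (auto dest!: domI[where c="(1 - \<theta>) * phi u + \<theta> * phi v"])
qed

lemma phi_lsc:
  assumes w: "\<And>n::nat. w n \<in> dom" and u: "u \<in> L2 nu"
    and lim: "(\<lambda>n. L2_norm nu (\<lambda>x. w n x - u x)) \<longlonglongrightarrow> 0"
    and bd: "\<forall>\<^sub>F n in sequentially. phi (w n) \<le> c"
  shows "u \<in> dom" "phi u \<le> c"
proof -
  obtain r :: "nat \<Rightarrow> nat" where r: "strict_mono r" "AE x in nu. (\<lambda>n. w (r n) x) \<longlonglongrightarrow> u x"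
    using L2_AE_subseq[OF dom_L2[OF w] u lim] by blast
  have "Phi u \<le> liminf (\<lambda>n. Phi (w (r n)))" by (rule Phi_lsc[OF dom_L2[OF w] u r(2)])
  also have "\<dots> \<le> ennreal c"
  proof (rule Liminf_le)
    show "\<forall>\<^sub>F n in sequentially. Phi (w (r n)) \<le> ennreal c"
      using eventually_subseq[OF r(1) bd] by eventually_elim (simp add: Phi_phi[OF w] ennreal_leI)
  qed simp
  finally have "Phi u \<le> ennreal c" .
  moreover have "0 \<le> c" using eventually_happens'[OF sequentially_bot bd] phi_nonneg order_trans by blast
  ultimately show "u \<in> dom" "phi u \<le> c" using domI[OF u] by auto
qed

lemma subdiffD:
  assumes "subdiff u w"
  shows "u \<in> dom" "u \<in> L2 nu" "w \<in> L2 nu" "\<And>\<xi>. \<xi> \<in> dom \<Longrightarrow> phi u + (\<integral>x. w x * (\<xi> x - u x) \<partial>nu) \<le> phi \<xi>"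
  using assms by (auto simp: subdiff_def dom_def)

lemma subdiff_monotone:
  assumes "subdiff u w" "subdiff u' w'"
  shows "0 \<le> (\<integral>x. (w x - w' x) * (u x - u' x) \<partial>nu)"
proof -
  note a = subdiffD[OF assms(1)] and b = subdiffD[OF assms(2)]
  have i: "integrable nu (\<lambda>x. w x * (u' x - u x))" "integrable nu (\<lambda>x. w' x * (u x - u' x))"
    by (intro L2_mult_integrable L2_diff a b)+
  have "(\<integral>x. (w x - w' x) * (u x - u' x) \<partial>nu) = (\<integral>x. - (w x * (u' x - u x)) - w' x * (u x - u' x) \<partial>nu)"
    by (simp add: algebra_simps)
  also have "\<dots> = - (\<integral>x. w x * (u' x - u x) \<partial>nu) - (\<integral>x. w' x * (u x - u' x) \<partial>nu)"
    using i by simp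
  finally show ?thesis using a(4)[OF b(1)] b(4)[OF a(1)] by simp
qed

text \<open>Minimization of phi w + ||w - g||^2 / (2 h). A minimizing sequence is Cauchy because the
  quadratic term is uniformly convex (parallelogram law at midpoints), so lower semicontinuity in
  norm suffices; the minimizer satisfies the inclusion by comparison along segments.\<close>

lemma resolvent_exists:
  assumes g: "g \<in> L2 nu" and h: "0 < h"
  shows "\<exists>w. subdiff w (\<lambda>x. (g x - w x) / h)"
proof -
  define E where "E w = phi w + (L2_norm nu (\<lambda>x. w x - g x))\<^sup>2 / (2 * h)" for w
  have E0: "0 \<le> E w" for w using h by (simp add: E_def)
  define I where "I = Inf (E ` dom)"
  have bdd: "bdd_below (E ` dom)" by (rule bdd_belowI[of _ 0]) (use E0 in auto)
  have IE: "I \<le> E w" if "w \<in> dom" for w unfolding I_def by (rule cInf_lower[OF _ bdd]) (use that in auto)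
  have "\<exists>w\<in>dom. E w < I + 1 / Suc n" for n
  proof -
    have "\<exists>a\<in>E ` dom. a < I + 1 / Suc n"
      unfolding I_def by (subst cInf_less_iff[symmetric]) (use zero_dom bdd in auto)
    then show ?thesis by auto
  qed
  then obtain w where w: "\<And>n. w n \<in> dom" and near: "\<And>n. E (w n) < I + 1 / Suc n" by metis
  have wL: "w n \<in> L2 nu" for n by (rule dom_L2[OF w])
  have en: "2 * h * (E v - phi v) = (L2_norm nu (\<lambda>x. v x - g x))\<^sup>2" for v
    using h by (simp add: E_def)
  have dist: "(L2_norm nu (\<lambda>x. w n x - w m x))\<^sup>2 \<le> 4 * h * (1 / Suc n + 1 / Suc m)" for n m
  proof -
    let ?a = "\<lambda>x. w n x - g x" and ?b = "\<lambda>x. w m x - g x" and ?c = "\<lambda>x. (1 - 1/2) * w n x + 1/2 * w m x"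
    have c: "?c \<in> dom" "phi ?c \<le> (1 - 1/2) * phi (w n) + 1/2 * phi (w m)"
      by (rule phi_convex[OF w w]; simp)+
    have "(L2_norm nu (\<lambda>x. w n x - w m x))\<^sup>2 = (L2_norm nu (\<lambda>x. ?a x - ?b x))\<^sup>2" by simp
    also have "\<dots> = 2 * (L2_norm nu ?a)\<^sup>2 + 2 * (L2_norm nu ?b)\<^sup>2 - 4 * (L2_norm nu (\<lambda>x. (?a x + ?b x) / 2))\<^sup>2"
      by (intro L2_parallelogram L2_diff wL g)
    also have "(\<lambda>x. (?a x + ?b x) / 2) = (\<lambda>x. ?c x - g x)" by (auto simp: field_simps)
    also have "2 * (L2_norm nu ?a)\<^sup>2 + 2 * (L2_norm nu ?b)\<^sup>2 - 4 * (L2_norm nu (\<lambda>x. ?c x - g x))\<^sup>2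
       = 2 * h * (2 * (E (w n) - phi (w n)) + 2 * (E (w m) - phi (w m)) - 4 * (E ?c - phi ?c))"
      unfolding en[symmetric] by (simp add: algebra_simps)
    also have "\<dots> \<le> 2 * h * (2 * (1 / Suc n) + 2 * (1 / Suc m))"
    proof (intro mult_left_mono)
      have "I \<le> E ?c" by (rule IE[OF c(1)])
      then show "2 * (E (w n) - phi (w n)) + 2 * (E (w m) - phi (w m)) - 4 * (E ?c - phi ?c) \<le> 2 * (1 / Suc n) + 2 * (1 / Suc m)"
        using c(2) near[of n] near[of m] by argo
    qed (use h in simp)
    finally show ?thesis by (simp add: algebra_simps)
  qed
  have "\<exists>N. \<forall>m\<ge>N. \<forall>n\<ge>N. L2_norm nu (\<lambda>x. w m x - w n x) < e" if e: "0 < e" for e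
  proof -
    obtain K :: nat where K: "8 * h / e\<^sup>2 < K" using reals_Archimedean2 by blast
    have inv: "1 / real (Suc m) < e\<^sup>2 / (8 * h)" if "m \<ge> K" for m
    proof -
      have "8 * h / e\<^sup>2 < real (Suc m)" using K that by linarith
      then show ?thesis using e h by (simp add: field_simps)
    qed
    show ?thesis
    proof (intro exI[of _ K] allI impI)
      fix m n assume "K \<le> m" "K \<le> n"
      then have "4 * h * (1 / Suc m + 1 / Suc n) < 4 * h * (e\<^sup>2 / (8 * h) + e\<^sup>2 / (8 * h))"
        using inv[of m] inv[of n] h by (intro mult_strict_left_mono add_strict_mono) auto
      also have "\<dots> = e\<^sup>2" using h by simp
      finally have "(L2_norm nu (\<lambda>x. w m x - w n x))\<^sup>2 < e\<^sup>2" using dist[of m n] by linarith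
      then show "L2_norm nu (\<lambda>x. w m x - w n x) < e"
        by (rule power2_less_imp_less) (use e in simp)
    qed
  qed
  from L2_complete[OF wL this] obtain v where v: "v \<in> L2 nu" and lim: "(\<lambda>n. L2_norm nu (\<lambda>x. w n x - v x)) \<longlonglongrightarrow> 0"
    by blast
  let ?d = "(L2_norm nu (\<lambda>x. v x - g x))\<^sup>2 / (2 * h)"
  have dlim: "(\<lambda>n. I + 1 / Suc n - (L2_norm nu (\<lambda>x. w n x - g x))\<^sup>2 / (2 * h)) \<longlonglongrightarrow> I + 0 - ?d"
  proof (intro tendsto_diff tendsto_add tendsto_const tendsto_divide tendsto_power)
    show "(\<lambda>n. 1 / real (Suc n)) \<longlonglongrightarrow> 0" using LIMSEQ_inverse_real_of_nat by (simp add: inverse_eq_divide)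
    show "(\<lambda>n. L2_norm nu (\<lambda>x. w n x - g x)) \<longlonglongrightarrow> L2_norm nu (\<lambda>x. v x - g x)"
      by (rule L2_norm_tendsto[OF L2_diff[OF wL g] L2_diff[OF v g]]) (simp add: lim)
  qed (use h in auto)
  have bd: "v \<in> dom \<and> phi v \<le> I - ?d + e" if "0 < e" for e
  proof -
    have "\<forall>\<^sub>F n in sequentially. I + 1 / Suc n - (L2_norm nu (\<lambda>x. w n x - g x))\<^sup>2 / (2 * h) < I - ?d + e"
      by (rule order_tendstoD(2)[OF dlim]) (use that in simp)
    then have "\<forall>\<^sub>F n in sequentially. phi (w n) \<le> I - ?d + e"
    proof eventually_elim
      case (elim n)
      then show ?case using near[of n] unfolding E_def by linarith
    qed
    from phi_lsc[OF w v lim this] show ?thesis by simp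
  qed
  have vd: "v \<in> dom" using bd[of 1] by simp
  have "phi v \<le> I - ?d" by (rule field_le_epsilon) (use bd in blast)
  then have Ev: "E v \<le> I" by (simp add: E_def)
  have "subdiff v (\<lambda>x. (g x - v x) / h)"
    unfolding subdiff_def
  proof (intro conjI vd ballI)
    show L: "(\<lambda>x. (g x - v x) / h) \<in> L2 nu" using L2_scale[OF L2_diff[OF g v], of "1/h"] by simp
    fix \<xi> assume \<xi>: "\<xi> \<in> dom"
    note \<xi>L = dom_L2[OF \<xi>]
    let ?i = "\<integral>x. (v x - g x) * (\<xi> x - v x) \<partial>nu" and ?n = "(L2_norm nu (\<lambda>x. \<xi> x - v x))\<^sup>2"
    \<comment> \<open>Comparison of \<open>v\<close> with the point at fraction \<theta> on the
      segment to \<xi>, divided by \<theta>; the quadratic term leaves a remainder linear in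
      \<theta> that disappears in the limit.\<close>
    have "0 \<le> (phi \<xi> - phi v + ?i / h) + \<theta> * (?n / (2 * h))" if \<theta>: "0 < \<theta>" "\<theta> \<le> 1" for \<theta>
    proof -
      let ?c = "\<lambda>x. (1 - \<theta>) * v x + \<theta> * \<xi> x"
      have c: "?c \<in> dom" "phi ?c \<le> (1 - \<theta>) * phi v + \<theta> * phi \<xi>" using phi_convex[OF vd \<xi>, of \<theta>] \<theta> by auto
      have "(L2_norm nu (\<lambda>x. ?c x - g x))\<^sup>2 = (L2_norm nu (\<lambda>x. (v x - g x) + \<theta> * (\<xi> x - v x)))\<^sup>2"
        by (simp add: algebra_simps)
      also have "\<dots> = (L2_norm nu (\<lambda>x. v x - g x))\<^sup>2 + 2 * (\<integral>x. (v x - g x) * (\<theta> * (\<xi> x - v x)) \<partial>nu) + (L2_norm nu (\<lambda>x. \<theta> * (\<xi> x - v x)))\<^sup>2"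
        by (intro L2_norm_add_sq L2_diff L2_scale v g \<xi>L)
      also have "\<dots> = (L2_norm nu (\<lambda>x. v x - g x))\<^sup>2 + 2 * \<theta> * ?i + \<theta>\<^sup>2 * ?n"
        unfolding L2_norm_scale power_mult_distrib by (simp add: mult.left_commute)
      finally have n: "(L2_norm nu (\<lambda>x. ?c x - g x))\<^sup>2 = (L2_norm nu (\<lambda>x. v x - g x))\<^sup>2 + 2 * \<theta> * ?i + \<theta>\<^sup>2 * ?n" .
      have "E v \<le> E ?c" using Ev IE[OF c(1)] by simp
      then have "phi v + ?d \<le> ((1 - \<theta>) * phi v + \<theta> * phi \<xi>) + ((L2_norm nu (\<lambda>x. v x - g x))\<^sup>2 + 2 * \<theta> * ?i + \<theta>\<^sup>2 * ?n) / (2 * h)"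
        using c(2) unfolding E_def n by linarith
      then have "0 \<le> \<theta> * ((phi \<xi> - phi v + ?i / h) + \<theta> * (?n / (2 * h)))"
        using h by (simp add: add_divide_distrib algebra_simps power2_eq_square)
      then show ?thesis using \<theta> by (simp add: zero_le_mult_iff)
    qed
    from affine_limit_nonneg[OF this] have "0 \<le> phi \<xi> - phi v + ?i / h" .
    moreover have "(\<integral>x. (g x - v x) / h * (\<xi> x - v x) \<partial>nu) = - (?i / h)"
    proof -
      have "(\<integral>x. (g x - v x) / h * (\<xi> x - v x) \<partial>nu) = (\<integral>x. (- 1 / h) * ((v x - g x) * (\<xi> x - v x)) \<partial>nu)"
        by (intro Bochner_Integration.integral_cong refl) (use h in \<open>simp add: field_simps\<close>)
      then show ?thesis by (simp only: integral_mult_right_zero) simp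
    qed
    ultimately show "phi v + (\<integral>x. (g x - v x) / h * (\<xi> x - v x) \<partial>nu) \<le> phi \<xi>" by simp
  qed
  then show ?thesis by blast
qed

text \<open>\<open>D k\<close> stands for the time integral of the force over the k-th step, instead
  of h times a value at a grid point: a square integrable force has no meaningful value at a single
  time.\<close>

lemma euler_scheme_exists:
  assumes u0: "u0 \<in> L2 nu" and D: "\<And>k. D k \<in> L2 nu" and h: "0 < h"
  shows "\<exists>U W. U 0 = u0 \<and> (\<forall>k. subdiff (U (Suc k)) (W k) \<and> (\<forall>x. U (Suc k) x = U k x + D k x - h * W k x))"
proof -
  have "\<exists>U. \<forall>k. (U k \<in> L2 nu \<and> (k = 0 \<longrightarrow> U k = u0)) \<and> subdiff (U (Suc k)) (\<lambda>x. (U k x + D k x - U (Suc k) x) / h)"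
  proof (rule dependent_nat_choice)
    show "\<exists>x. x \<in> L2 nu \<and> (0 = (0::nat) \<longrightarrow> x = u0)" using u0 by auto
    fix x and n :: nat assume "x \<in> L2 nu \<and> (n = 0 \<longrightarrow> x = u0)"
    then have "(\<lambda>y. x y + D n y) \<in> L2 nu" by (intro L2_add D) simp
    from resolvent_exists[OF this h] obtain w where "subdiff w (\<lambda>y. (x y + D n y - w y) / h)" by blast
    then show "\<exists>y. (y \<in> L2 nu \<and> (Suc n = 0 \<longrightarrow> y = u0)) \<and> subdiff y (\<lambda>xa. (x xa + D n xa - y xa) / h)"
      using subdiffD(2) by auto
  qed
  then obtain U where "U 0 = u0" "\<And>k. subdiff (U (Suc k)) (\<lambda>x. (U k x + D k x - U (Suc k) x) / h)" by blast
  then show ?thesis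
    using h by (intro exI[of _ U] exI[of _ "\<lambda>k x. (U k x + D k x - U (Suc k) x) / h"]) simp
qed

text \<open>The old value \<open>U\<close> tests the subgradient at the new value \<open>V\<close>,
  producing the dissipation h ||W||^2; half of it absorbs the force by Young's inequality. In the
  application \<open>e\<close> is the integral of ||f||^2 over the step.\<close>

lemma euler_energy_step:
  assumes U: "U \<in> dom" and V: "subdiff V W" and step: "\<And>x. V x = U x + D x - h * W x"
    and D: "D \<in> L2 nu" "(L2_norm nu D)\<^sup>2 \<le> h * e" and h: "0 < h"
  shows "h * (L2_norm nu W)\<^sup>2 + 2 * phi V \<le> 2 * phi U + e"
proof -
  note V' = subdiffD[OF V]
  have "(\<integral>x. W x * (U x - V x) \<partial>nu) = (\<integral>x. h * (W x)\<^sup>2 - W x * D x \<partial>nu)"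
    by (intro Bochner_Integration.integral_cong refl) (simp add: step algebra_simps power2_eq_square)
  also have "\<dots> = h * (L2_norm nu W)\<^sup>2 - (\<integral>x. W x * D x \<partial>nu)"
    using L2D(2)[OF V'(3)] L2_mult_integrable[OF V'(3) D(1)] by (simp add: L2_norm_sq)
  finally have 1: "phi V + h * (L2_norm nu W)\<^sup>2 - (\<integral>x. W x * D x \<partial>nu) \<le> phi U" using V'(4)[OF U] by simp
  have 2: "(\<integral>x. W x * D x \<partial>nu) \<le> L2_norm nu W * L2_norm nu D"
    using L2_Cauchy_Schwarz[OF V'(3) D(1)] by simp
  have "0 \<le> (h * L2_norm nu W - L2_norm nu D)\<^sup>2 / h" using h by simp
  also have "\<dots> = h * (L2_norm nu W)\<^sup>2 - 2 * (L2_norm nu W * L2_norm nu D) + (L2_norm nu D)\<^sup>2 / h"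
    using h by (simp add: field_simps power2_eq_square)
  also have "(L2_norm nu D)\<^sup>2 / h \<le> e" using D(2) h by (simp add: divide_le_eq mult.commute)
  finally show ?thesis using 1 2 by linarith
qed

text \<open>Testing with 0, where \<open>phi\<close> vanishes, gives a bound free of the initial
  energy: the energy of the new value is paid for by the decrease of the squared norm.\<close>

lemma euler_norm_step:
  assumes U: "U \<in> L2 nu" and V: "subdiff V W" and step: "\<And>x. V x = U x + D x - h * W x"
    and D: "D \<in> L2 nu" and h: "0 < h"
  shows "2 * h * phi V + (L2_norm nu V)\<^sup>2 \<le> (L2_norm nu U)\<^sup>2 + 2 * L2_norm nu D * L2_norm nu V"
    and "L2_norm nu V \<le> L2_norm nu U + L2_norm nu D"
proof -
  note V' = subdiffD[OF V]
  have "h * (\<integral>x. W x * V x \<partial>nu) = (\<integral>x. U x * V x + D x * V x - (V x)\<^sup>2 \<partial>nu)"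
  proof -
    have "(\<integral>x. h * (W x * V x) \<partial>nu) = (\<integral>x. U x * V x + D x * V x - (V x)\<^sup>2 \<partial>nu)"
    proof (intro Bochner_Integration.integral_cong refl)
      fix x
      have "h * W x = U x + D x - V x" by (simp add: step)
      then show "h * (W x * V x) = U x * V x + D x * V x - (V x)\<^sup>2"
        by (simp add: power2_eq_square left_diff_distrib distrib_right mult.assoc[symmetric])
    qed
    then show ?thesis by simp
  qed
  also have "\<dots> = (\<integral>x. U x * V x \<partial>nu) + (\<integral>x. D x * V x \<partial>nu) - (L2_norm nu V)\<^sup>2"
    using L2_mult_integrable[OF U V'(2)] L2_mult_integrable[OF D V'(2)] L2D(2)[OF V'(2)] by (simp add: L2_norm_sq)
  also have "\<dots> \<le> L2_norm nu U * L2_norm nu V + L2_norm nu D * L2_norm nu V - (L2_norm nu V)\<^sup>2"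
    using L2_Cauchy_Schwarz[OF U V'(2)] L2_Cauchy_Schwarz[OF D V'(2)] by linarith
  finally have 1: "h * (\<integral>x. W x * V x \<partial>nu) \<le> L2_norm nu U * L2_norm nu V + L2_norm nu D * L2_norm nu V - (L2_norm nu V)\<^sup>2" .
  have "phi V \<le> (\<integral>x. W x * V x \<partial>nu)" using V'(4)[OF zero_dom] by (simp add: phi_zero)
  then have 2: "h * phi V \<le> h * (\<integral>x. W x * V x \<partial>nu)" using h by simp
  have 3: "2 * (L2_norm nu U * L2_norm nu V) \<le> (L2_norm nu U)\<^sup>2 + (L2_norm nu V)\<^sup>2"
    using zero_le_power2[of "L2_norm nu U - L2_norm nu V"] by (simp add: power2_diff)
  show "2 * h * phi V + (L2_norm nu V)\<^sup>2 \<le> (L2_norm nu U)\<^sup>2 + 2 * L2_norm nu D * L2_norm nu V"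
    using 1 2 3 by (simp add: mult.assoc)
  have "0 \<le> h * phi V" using h by simp
  then have "(L2_norm nu V) * (L2_norm nu V) \<le> (L2_norm nu U + L2_norm nu D) * L2_norm nu V"
    using 1 2 by (simp add: power2_eq_square distrib_right)
  then show "L2_norm nu V \<le> L2_norm nu U + L2_norm nu D"
    using mult_right_le_imp_le[of "L2_norm nu V" "L2_norm nu V" "L2_norm nu U + L2_norm nu D"]
      L2_norm_nonneg[of nu V] L2_norm_nonneg[of nu U] L2_norm_nonneg[of nu D] by linarith
qed

text \<open>The first bound sums the energy steps. For the second, the k-th energy step is
  multiplied by (k + 1) h; summation by parts leaves 2 h times the sum of the energies, which the
  norm steps control by the norm of \<open>u0\<close>. Of the initial energy only 2 h phi u0
  remains, and this vanishes as h tends to 0.\<close>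

lemma euler_estimates:
  assumes u0: "u0 \<in> dom" and U0: "U 0 = u0"
    and sub: "\<And>k. subdiff (U (Suc k)) (W k)" and step: "\<And>k x. U (Suc k) x = U k x + D k x - h * W k x"
    and D: "\<And>k. D k \<in> L2 nu" "\<And>k. (L2_norm nu (D k))\<^sup>2 \<le> h * e k" and e: "\<And>k. 0 \<le> e k"
    and h: "0 < h" and T: "real N * h = T" and E: "(\<Sum>k<N. e k) \<le> E"
  shows "(\<Sum>k<N. h * (L2_norm nu (W k))\<^sup>2) \<le> 2 * phi u0 + E"
    and "(\<Sum>k<N. real (Suc k) * h * (h * (L2_norm nu (W k))\<^sup>2))
      \<le> 2 * h * phi u0 + (L2_norm nu u0)\<^sup>2 + (L2_norm nu u0 + (T + E) / 2) * (T + E) + T * E"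
proof -
  have Ud: "U k \<in> dom" for k
  proof (cases k)
    case 0 then show ?thesis using u0 U0 by simp
  next
    case (Suc j) then show ?thesis using subdiffD(1)[OF sub[of j]] by simp
  qed
  note en = euler_energy_step[OF Ud sub step D h]
  note no = euler_norm_step[OF dom_L2[OF Ud] sub step D(1) h]
  have "(\<Sum>k<n. h * (L2_norm nu (W k))\<^sup>2) + 2 * phi (U n) \<le> 2 * phi u0 + (\<Sum>k<n. e k)" for n
  proof (induction n)
    case (Suc n) then show ?case using en[of n] by simp
  qed (simp add: U0)
  from this[of N] show "(\<Sum>k<N. h * (L2_norm nu (W k))\<^sup>2) \<le> 2 * phi u0 + E"
    using E phi_nonneg[of "U N"] by linarith
  have w1: "(\<Sum>k<n. real (Suc k) * h * (h * (L2_norm nu (W k))\<^sup>2)) + 2 * (real n * h) * phi (U n)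
      \<le> 2 * h * (\<Sum>k<n. phi (U k)) + (\<Sum>k<n. real (Suc k) * h * e k)" for n
  proof (induction n)
    case (Suc n)
    have "(real (Suc n) * h) * (h * (L2_norm nu (W n))\<^sup>2 + 2 * phi (U (Suc n))) \<le> (real (Suc n) * h) * (2 * phi (U n) + e n)"
      using h by (intro mult_left_mono en) auto
    with Suc show ?case by (simp add: algebra_simps)
  qed simp
  \<comment> \<open>Arithmetic-geometric mean applied to ||D||^2 \<le> h e; the right-hand sides sum
    to at most (T + E) / 2.\<close>
  have dn: "L2_norm nu (D k) \<le> (h + e k) / 2" for k
  proof (rule power2_le_imp_le)
    have "h * e k \<le> ((h + e k) / 2)\<^sup>2"
      using zero_le_power2[of "h - e k"] by (simp add: power_divide power2_sum power2_diff)
    then show "(L2_norm nu (D k))\<^sup>2 \<le> ((h + e k) / 2)\<^sup>2" using D(2)[of k] by linarith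
  qed (use h e[of k] in simp)
  have dsum: "(\<Sum>k<n. L2_norm nu (D k)) \<le> (T + E) / 2" if "n \<le> N" for n
  proof -
    have "(\<Sum>k<n. L2_norm nu (D k)) \<le> (\<Sum>k<N. L2_norm nu (D k))"
      using that by (intro sum_mono2) auto
    also have "\<dots> \<le> (\<Sum>k<N. (h + e k) / 2)" by (intro sum_mono dn)
    also have "\<dots> = (T + (\<Sum>k<N. e k)) / 2" using T by (simp add: sum_divide_distrib[symmetric] sum.distrib)
    finally show ?thesis using E by simp
  qed
  define R where "R = L2_norm nu u0 + (T + E) / 2"
  have Un: "L2_norm nu (U n) \<le> R" if "n \<le> N" for n
  proof -
    have "L2_norm nu (U n) \<le> L2_norm nu u0 + (\<Sum>k<n. L2_norm nu (D k))"
    proof (induction n)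
      case (Suc n) then show ?case using no(2)[of n] by simp
    qed (simp add: U0)
    with dsum[OF that] show ?thesis unfolding R_def by linarith
  qed
  have "n \<le> N \<Longrightarrow> 2 * h * (\<Sum>k<n. phi (U (Suc k))) + (L2_norm nu (U n))\<^sup>2 \<le> (L2_norm nu u0)\<^sup>2 + 2 * R * (\<Sum>k<n. L2_norm nu (D k))" for n
  proof (induction n)
    case (Suc n)
    have "2 * L2_norm nu (D n) * L2_norm nu (U (Suc n)) \<le> 2 * L2_norm nu (D n) * R"
      using Suc.prems by (intro mult_left_mono Un) auto
    then show ?case using Suc no(1)[of n] by (simp add: algebra_simps)
  qed (simp add: U0)
  from this[of N] have "2 * h * (\<Sum>k<N. phi (U (Suc k))) \<le> (L2_norm nu u0)\<^sup>2 + 2 * R * (\<Sum>k<N. L2_norm nu (D k))"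
    using zero_le_power2[of "L2_norm nu (U N)"] by linarith
  also have "\<dots> \<le> (L2_norm nu u0)\<^sup>2 + 2 * R * ((T + E) / 2)"
  proof -
    have "0 \<le> R" using Un[of 0] L2_norm_nonneg order_trans by blast
    then show ?thesis using dsum[of N] by (intro add_left_mono mult_left_mono) auto
  qed
  finally have ps: "2 * h * (\<Sum>k<N. phi (U (Suc k))) \<le> (L2_norm nu u0)\<^sup>2 + R * (T + E)" by simp
  have "(\<Sum>k<N. phi (U k)) \<le> (\<Sum>k<Suc N. phi (U k))" by simp
  also have "\<dots> = phi u0 + (\<Sum>k<N. phi (U (Suc k)))"
    using sum.lessThan_Suc_shift[of "\<lambda>k. phi (U k)" N] by (simp add: U0)
  finally have "2 * h * (\<Sum>k<N. phi (U k)) \<le> 2 * h * (phi u0 + (\<Sum>k<N. phi (U (Suc k))))"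
    using h by (intro mult_left_mono) auto
  then have a: "2 * h * (\<Sum>k<N. phi (U k)) \<le> 2 * h * phi u0 + ((L2_norm nu u0)\<^sup>2 + R * (T + E))"
    using ps by (simp add: distrib_left)
  have T0: "0 \<le> T" using T h by auto
  have b: "(\<Sum>k<N. real (Suc k) * h * e k) \<le> T * E"
  proof -
    have "(\<Sum>k<N. real (Suc k) * h * e k) \<le> (\<Sum>k<N. T * e k)"
    proof (intro sum_mono mult_right_mono e)
      fix k assume "k \<in> {..<N}"
      then have "real (Suc k) * h \<le> real N * h" using h by (intro mult_right_mono) auto
      then show "real (Suc k) * h \<le> T" using T by simp
    qed
    also have "\<dots> \<le> T * E" using E T0 by (simp add: sum_distrib_left[symmetric] mult_left_mono)
    finally show ?thesis .
  qed
  have "0 \<le> 2 * (real N * h) * phi (U N)" using h by simp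
  then show "(\<Sum>k<N. real (Suc k) * h * (h * (L2_norm nu (W k))\<^sup>2))
      \<le> 2 * h * phi u0 + (L2_norm nu u0)\<^sup>2 + (L2_norm nu u0 + (T + E) / 2) * (T + E) + T * E"
    using w1[of N] a b unfolding R_def by linarith
qed

end

section \<open>The implicit Euler scheme\<close>

lemma L2_norm_zero_AE:
  assumes "u \<in> L2 M" "L2_norm M u = 0"
  shows "AE x in M. u x = 0"
proof -
  have "(\<integral>x. (u x)\<^sup>2 \<partial>M) = 0" using assms(2) L2_norm_sq[of M u] by simp
  then have "AE x in M. (u x)\<^sup>2 = 0"
    using integral_nonneg_eq_0_iff_AE[OF L2D(2)[OF assms(1)]] by simp
  then show ?thesis by simp
qed

context time_space
begin

text \<open>For the subgradients of the implicit scheme, each interval receives the one found at its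
  right end point.\<close>

definition step_fun :: "real \<Rightarrow> nat \<Rightarrow> (nat \<Rightarrow> 'a \<Rightarrow> real) \<Rightarrow> real \<Rightarrow> 'a \<Rightarrow> real" where
  "step_fun h N W \<tau> x = (\<Sum>k<N. indicator {real k * h<..real (Suc k) * h} \<tau> * W k x)"

lemma grid_indicator:
  assumes "0 < h" "real k * h < \<tau>" "\<tau> \<le> real (Suc k) * h"
  shows "indicat_real {real j * h<..real (Suc j) * h} \<tau> = (if j = k then 1 else 0)"
proof -
  have "j = k" if "real j * h < \<tau>" "\<tau> \<le> real (Suc j) * h"
  proof -
    have "real j * h < real (Suc k) * h" "real k * h < real (Suc j) * h" using assms that by linarith+
    then have "real j < real (Suc k)" "real k < real (Suc j)" using assms(1) by (simp_all only: mult_less_cancel_right_pos)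
    then show ?thesis by simp
  qed
  then have "j \<noteq> k \<Longrightarrow> \<tau> \<notin> {real j * h<..real (Suc j) * h}" by fastforce
  moreover have "\<tau> \<in> {real k * h<..real (Suc k) * h}" using assms by simp
  ultimately show ?thesis by (metis indicator_simps)
qed

lemma grid_sum:
  assumes "0 < h" "k < N" "real k * h < \<tau>" "\<tau> \<le> real (Suc k) * h"
  shows "(\<Sum>j<N. indicat_real {real j * h<..real (Suc j) * h} \<tau> * c j) = c k"
proof -
  have "(\<Sum>j<N. indicat_real {real j * h<..real (Suc j) * h} \<tau> * c j) = (\<Sum>j<N. if j = k then c j else 0)"
    unfolding grid_indicator[OF assms(1,3,4)] by (intro sum.cong refl) simp
  also have "\<dots> = c k" using assms(2) by simp
  finally show ?thesis .
qed

lemma grid_sum_outside: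
  assumes "\<not> (\<exists>k<N. real k * h < \<tau> \<and> \<tau> \<le> real (Suc k) * h)"
  shows "(\<Sum>j<N. indicat_real {real j * h<..real (Suc j) * h} \<tau> * c j) = 0"
proof (rule sum.neutral, rule ballI)
  fix j assume "j \<in> {..<N}"
  then have "\<tau> \<notin> {real j * h<..real (Suc j) * h}" using assms by fastforce
  then show "indicat_real {real j * h<..real (Suc j) * h} \<tau> * c j = 0" by (metis indicator_simps(2) mult_zero_left)
qed

lemma step_fun_eq:
  assumes "0 < h" "k < N" "real k * h < \<tau>" "\<tau> \<le> real (Suc k) * h"
  shows "step_fun h N W \<tau> = W k"
  unfolding step_fun_def[abs_def] grid_sum[OF assms] ..

lemma step_fun_LQ: "(\<And>k. W k \<in> L2 nu) \<Longrightarrow> step_fun h N W \<in> LQ"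
  unfolding step_fun_def[abs_def] by (intro LQ_sum LQ_rectangle)

lemma step_fun_norm_sq:
  assumes h: "0 < h"
  shows "(L2_norm nu (step_fun h N W \<tau>))\<^sup>2 = (\<Sum>k<N. indicator {real k * h<..real (Suc k) * h} \<tau> * (L2_norm nu (W k))\<^sup>2)"
proof (cases "\<exists>k<N. real k * h < \<tau> \<and> \<tau> \<le> real (Suc k) * h")
  case True
  then obtain k where k: "k < N" "real k * h < \<tau>" "\<tau> \<le> real (Suc k) * h" by blast
  show ?thesis unfolding step_fun_eq[OF h k] grid_sum[OF h k] ..
next
  case False
  show ?thesis unfolding step_fun_def[abs_def] grid_sum_outside[OF False] by simp
qed

text \<open>The weight sqrt \<tau> compensates for the derivative near time 0, whose norm need not
  be square integrable there when the initial value has infinite energy.\<close>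

definition sqw :: "real \<Rightarrow> (real \<Rightarrow> 'a \<Rightarrow> real) \<Rightarrow> real \<Rightarrow> 'a \<Rightarrow> real" where
  "sqw T w \<tau> x = (indicator {0<..T} \<tau> * sqrt \<tau>) * w \<tau> x"

lemma sqw_LQ: "w \<in> LQ \<Longrightarrow> sqw T w \<in> LQ"
  unfolding sqw_def[abs_def]
  by (rule LQ_times[where C="sqrt (max T 0)"]) (auto simp: indicator_def)

lemma sqw_norm_sq: "(L2_norm nu (sqw T w \<tau>))\<^sup>2 = indicator {0<..T} \<tau> * \<tau> * (L2_norm nu (w \<tau>))\<^sup>2"
proof -
  have "L2_norm nu (sqw T w \<tau>) = \<bar>indicator {0<..T} \<tau> * sqrt \<tau>\<bar> * L2_norm nu (w \<tau>)"
    unfolding sqw_def[abs_def] by (rule L2_norm_scale)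
  moreover have "\<bar>indicator {0<..T} \<tau> * sqrt \<tau>\<bar>\<^sup>2 = indicator {0<..T} \<tau> * \<tau>"
    by (cases "\<tau> \<in> {0<..T}") simp_all
  ultimately show ?thesis by (simp only: power_mult_distrib)
qed

text \<open>The weighted part is an inequality: on each interval the weight \<tau> is replaced by
  its value at the right end, matching the weights in \<open>euler_estimates\<close>.\<close>

lemma step_fun_norms:
  assumes h: "0 < h" and W: "\<And>k. W k \<in> L2 nu"
  shows "(L2_norm Q (case_prod (step_fun h N W)))\<^sup>2 = (\<Sum>k<N. h * (L2_norm nu (W k))\<^sup>2)"
    and "(L2_norm Q (case_prod (sqw T (step_fun h N W))))\<^sup>2 \<le> (\<Sum>k<N. real (Suc k) * h * (h * (L2_norm nu (W k))\<^sup>2))"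
proof -
  have i: "integrable lborel (\<lambda>\<tau>. indicator {real k * h<..real (Suc k) * h} \<tau> * c)" for k and c :: real
    using integrable_indicator_Ioc[of "real k * h" "real (Suc k) * h"] by simp
  have I: "(\<integral>\<tau>. indicator {real k * h<..real (Suc k) * h} \<tau> * c \<partial>lborel) = h * c" for k and c :: real
    using h by (simp add: algebra_simps)
  show "(L2_norm Q (case_prod (step_fun h N W)))\<^sup>2 = (\<Sum>k<N. h * (L2_norm nu (W k))\<^sup>2)"
    unfolding LQ_norm_sq[OF step_fun_LQ[of W, OF W], symmetric] step_fun_norm_sq[OF h]
    by (subst Bochner_Integration.integral_sum[OF i]) (simp only: I)
  have "(L2_norm Q (case_prod (sqw T (step_fun h N W))))\<^sup>2 = (\<integral>\<tau>. (L2_norm nu (sqw T (step_fun h N W) \<tau>))\<^sup>2 \<partial>lborel)"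
    by (rule LQ_norm_sq[OF sqw_LQ[OF step_fun_LQ[OF W]], symmetric])
  also have "\<dots> \<le> (\<integral>\<tau>. (\<Sum>k<N. indicator {real k * h<..real (Suc k) * h} \<tau> * (real (Suc k) * h * (L2_norm nu (W k))\<^sup>2)) \<partial>lborel)"
  proof (rule integral_mono[OF LQ_norm_sq_integrable[OF sqw_LQ[OF step_fun_LQ[OF W]]]])
    show "integrable lborel (\<lambda>\<tau>. \<Sum>k<N. indicator {real k * h<..real (Suc k) * h} \<tau> * (real (Suc k) * h * (L2_norm nu (W k))\<^sup>2))"
      by (intro Bochner_Integration.integrable_sum i)
    fix \<tau> :: real
    have "(L2_norm nu (sqw T (step_fun h N W) \<tau>))\<^sup>2 = (\<Sum>k<N. (indicator {0<..T} \<tau> * \<tau>) * (indicator {real k * h<..real (Suc k) * h} \<tau> * (L2_norm nu (W k))\<^sup>2))"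
      unfolding sqw_norm_sq step_fun_norm_sq[OF h] by (rule sum_distrib_left)
    also have "\<dots> \<le> (\<Sum>k<N. indicator {real k * h<..real (Suc k) * h} \<tau> * (real (Suc k) * h * (L2_norm nu (W k))\<^sup>2))"
    proof (rule sum_mono)
      fix k
      show "(indicator {0<..T} \<tau> * \<tau>) * (indicator {real k * h<..real (Suc k) * h} \<tau> * (L2_norm nu (W k))\<^sup>2)
        \<le> indicator {real k * h<..real (Suc k) * h} \<tau> * (real (Suc k) * h * (L2_norm nu (W k))\<^sup>2)"
      proof (cases "\<tau> \<in> {real k * h<..real (Suc k) * h}")
        case True
        have "0 \<le> real (Suc k) * h" using h by simp
        with True have "indicator {0<..T} \<tau> * \<tau> \<le> real (Suc k) * h"
          by (cases "\<tau> \<in> {0<..T}") simp_all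
        then have "(indicator {0<..T} \<tau> * \<tau>) * (L2_norm nu (W k))\<^sup>2 \<le> (real (Suc k) * h) * (L2_norm nu (W k))\<^sup>2"
          by (intro mult_right_mono) auto
        then show ?thesis using True by simp
      qed simp
    qed
    finally show "(L2_norm nu (sqw T (step_fun h N W) \<tau>))\<^sup>2 \<le> (\<Sum>k<N. indicator {real k * h<..real (Suc k) * h} \<tau> * (real (Suc k) * h * (L2_norm nu (W k))\<^sup>2))" .
  qed
  also have "\<dots> = (\<Sum>k<N. h * (real (Suc k) * h * (L2_norm nu (W k))\<^sup>2))"
    by (subst Bochner_Integration.integral_sum[OF i]) (simp only: I)
  finally show "(L2_norm Q (case_prod (sqw T (step_fun h N W))))\<^sup>2 \<le> (\<Sum>k<N. real (Suc k) * h * (h * (L2_norm nu (W k))\<^sup>2))"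
    by (simp add: mult.left_commute mult.assoc)
qed

text \<open>The curve with derivative f - w. The force enters with its true primitive and not with
  step averages, so two approximations with the same force differ, apart from their initial values,
  by the integral of their subgradients only.\<close>

definition cur :: "(real \<Rightarrow> 'a \<Rightarrow> real) \<Rightarrow> ('a \<Rightarrow> real) \<Rightarrow> (real \<Rightarrow> 'a \<Rightarrow> real) \<Rightarrow> real \<Rightarrow> 'a \<Rightarrow> real" where
  "cur f u0 w t x = u0 x + tint f 0 t x - tint w 0 t x"

lemma cur_0 [simp]: "cur f u0 w 0 = u0"
  by (simp add: cur_def[abs_def])

lemma cur_L2: "f \<in> LQ \<Longrightarrow> w \<in> LQ \<Longrightarrow> u0 \<in> L2 nu \<Longrightarrow> 0 \<le> t \<Longrightarrow> cur f u0 w t \<in> L2 nu"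
  unfolding cur_def[abs_def] by (intro L2_diff L2_add tint_L2)

lemma cur_inc:
  assumes "f \<in> LQ" "w \<in> LQ" "0 \<le> s" "s \<le> t"
  shows "AE x in nu. cur f u0 w t x = cur f u0 w s x + tint f s t x - tint w s t x"
  using tint_add[OF assms(1,3,4)] tint_add[OF assms(2,3,4)]
  by eventually_elim (simp add: cur_def)

lemma cur_modulus:
  assumes "f \<in> LQ" "w \<in> LQ" "u0 \<in> L2 nu" "0 \<le> s" "s \<le> t"
  shows "L2_norm nu (\<lambda>x. cur f u0 w t x - cur f u0 w s x) \<le> sqrt (t - s) * (L2_norm Q (case_prod f) + L2_norm Q (case_prod w))"
proof -
  have "L2_norm nu (\<lambda>x. cur f u0 w t x - cur f u0 w s x) = L2_norm nu (\<lambda>x. tint f s t x - tint w s t x)"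
  proof (rule L2_norm_cong_AE)
    show "AE x in nu. cur f u0 w t x - cur f u0 w s x = tint f s t x - tint w s t x"
      using cur_inc[OF assms(1,2,4,5), of u0] by eventually_elim simp
  qed (use assms in \<open>auto intro!: L2D(1) L2_diff cur_L2 tint_L2\<close>)
  also have "\<dots> \<le> L2_norm nu (tint f s t) + L2_norm nu (tint w s t)"
    by (intro L2_norm_triangle_diff tint_L2 assms)
  also have "\<dots> \<le> sqrt (t - s) * L2_norm Q (case_prod f) + sqrt (t - s) * L2_norm Q (case_prod w)"
    by (intro add_mono tint_norm_le assms)
  finally show ?thesis by (simp add: distrib_left)
qed

end

section \<open>Euler curves and the distance between two of them\<close>

context convex_functional
begin

text \<open>The curve \<open>cur\<close> passes through the Euler values at the nodes. In between it
  differs from the value \<open>Ub\<close> at the next node by at most h ||W|| plus the force over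
  the rest of the step, and h ||W|| is sqrt h times the root of one summand of the dissipation
  estimate.\<close>

lemma euler_approximation:
  assumes f: "f \<in> LQ" and u0: "u0 \<in> dom" and T: "0 < T" and N: "0 < (N::nat)"
  defines "E \<equiv> (L2_norm Q (case_prod f))\<^sup>2"
  shows "\<exists>w Ub. w \<in> LQ \<and> (L2_norm Q (case_prod w))\<^sup>2 \<le> 2 * phi u0 + E \<and>
    (L2_norm Q (case_prod (sqw T w)))\<^sup>2 \<le> 2 * (T / N) * phi u0 + (L2_norm nu u0)\<^sup>2 + (L2_norm nu u0 + (T + E) / 2) * (T + E) + T * E \<and>
    (\<forall>\<tau>. 0 < \<tau> \<longrightarrow> \<tau> < T \<longrightarrow> subdiff (Ub \<tau>) (w \<tau>) \<and>
      L2_norm nu (\<lambda>x. cur f u0 w \<tau> x - Ub \<tau> x) \<le> sqrt (T / N) * (sqrt E + sqrt (2 * phi u0 + E)))"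
proof -
  define h where "h = T / N"
  have h: "0 < h" and Nh: "real N * h = T" using T N by (auto simp: h_def)
  define D where "D k = tint f (real k * h) (real (Suc k) * h)" for k
  define e where "e k = (\<integral>\<tau>. indicator {real k * h<..real (Suc k) * h} \<tau> * (L2_norm nu (f \<tau>))\<^sup>2 \<partial>lborel)" for k
  have kh: "real k * h \<le> real (Suc k) * h" "real (Suc k) * h - real k * h = h" "0 \<le> real k * h" for k
    using h by (auto simp: algebra_simps)
  have D: "D k \<in> L2 nu" "(L2_norm nu (D k))\<^sup>2 \<le> h * e k" for k
    using tint_L2[OF f kh(1)[of k]] unfolding D_def e_def kh(2) by auto
  have e0: "0 \<le> e k" for k unfolding e_def by (intro integral_nonneg_AE) auto
  note uL = dom_L2[OF u0]
  obtain U W where U0: "U 0 = u0"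
    and UW: "\<forall>k. subdiff (U (Suc k)) (W k) \<and> (\<forall>x. U (Suc k) x = U k x + D k x - h * W k x)"
    using euler_scheme_exists[of u0 D h, OF uL D(1) h] by (elim exE conjE)
  have sub: "\<And>k. subdiff (U (Suc k)) (W k)" and step: "\<And>k x. U (Suc k) x = U k x + D k x - h * W k x"
    using UW by blast+
  have W: "W k \<in> L2 nu" for k using subdiffD(3)[OF sub] .
  have ind: "integrable lborel (\<lambda>\<tau>. indicator {real k * h<..real (Suc k) * h} \<tau> * (L2_norm nu (f \<tau>))\<^sup>2)" for k
    using integrable_real_mult_indicator[OF _ LQ_norm_sq_integrable[OF f], of "{real k * h<..real (Suc k) * h}"]
    by (simp add: mult.commute)
  have "(\<Sum>k<N. e k) = (\<integral>\<tau>. (\<Sum>k<N. indicator {real k * h<..real (Suc k) * h} \<tau> * (L2_norm nu (f \<tau>))\<^sup>2) \<partial>lborel)"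
    unfolding e_def by (rule Bochner_Integration.integral_sum[OF ind, symmetric])
  also have "\<dots> \<le> (\<integral>\<tau>. (L2_norm nu (f \<tau>))\<^sup>2 \<partial>lborel)"
  proof (rule integral_mono[OF _ LQ_norm_sq_integrable[OF f]])
    show "integrable lborel (\<lambda>\<tau>. \<Sum>k<N. indicator {real k * h<..real (Suc k) * h} \<tau> * (L2_norm nu (f \<tau>))\<^sup>2)"
      by (intro Bochner_Integration.integrable_sum ind)
    fix \<tau> :: real
    show "(\<Sum>k<N. indicator {real k * h<..real (Suc k) * h} \<tau> * (L2_norm nu (f \<tau>))\<^sup>2) \<le> (L2_norm nu (f \<tau>))\<^sup>2"
    proof (cases "\<exists>k<N. real k * h < \<tau> \<and> \<tau> \<le> real (Suc k) * h")
      case True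
      then obtain k where k: "k < N" "real k * h < \<tau>" "\<tau> \<le> real (Suc k) * h" by blast
      show ?thesis unfolding grid_sum[OF h k] by simp
    next
      case False
      show ?thesis unfolding grid_sum_outside[OF False] by simp
    qed
  qed
  also have "\<dots> = E" unfolding E_def by (rule LQ_norm_sq[OF f])
  finally have Esum: "(\<Sum>k<N. e k) \<le> E" .
  note est = euler_estimates[OF u0 U0 sub step D e0 h Nh Esum]
  define w where "w = step_fun h N W"
  have w: "w \<in> LQ" unfolding w_def by (rule step_fun_LQ[OF W])
  \<comment> \<open>Rounding up selects the right node, because \<open>w \<tau>\<close> is a
    subgradient there; a node itself counts for the interval on its left, as in
    \<open>step_fun\<close>.\<close>
  define Ub where "Ub \<tau> = U (nat \<lceil>\<tau> / h\<rceil>)" for \<tau>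
  have node: "AE x in nu. cur f u0 w (real k * h) x = U k x" if "k \<le> N" for k
    using that
  proof (induction k)
    case 0 then show ?case by (simp add: U0)
  next
    case (Suc k)
    then have k: "k < N" and IH: "AE x in nu. cur f u0 w (real k * h) x = U k x" by auto
    have c: "tint w (real k * h) (real (Suc k) * h) x = h * W k x" for x
      using tint_const[OF kh(1), of k w x "W k x"] step_fun_eq[OF h k, of _ W] unfolding w_def kh(2) by simp
    show ?case using IH cur_inc[OF f w kh(3)[of k] kh(1)[of k], of u0]
      by eventually_elim (simp add: c step D_def del: of_nat_Suc)
  qed
  have main: "subdiff (Ub \<tau>) (w \<tau>) \<and>
      L2_norm nu (\<lambda>x. cur f u0 w \<tau> x - Ub \<tau> x) \<le> sqrt h * (sqrt E + sqrt (2 * phi u0 + E))"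
    if \<tau>: "0 < \<tau>" "\<tau> < T" for \<tau>
  proof -
    define k where "k = nat (\<lceil>\<tau> / h\<rceil> - 1)"
    have pos: "0 < \<lceil>\<tau> / h\<rceil>" using \<tau> h by simp
    have kr: "real k = of_int \<lceil>\<tau> / h\<rceil> - 1" using pos by (simp add: k_def)
    have Sk: "nat \<lceil>\<tau> / h\<rceil> = Suc k" using pos unfolding k_def by arith
    have "real k < \<tau> / h" "\<tau> / h \<le> real (Suc k)" using kr by linarith+
    then have k: "real k * h < \<tau>" "\<tau> \<le> real (Suc k) * h" using h by (simp_all add: field_simps)
    have "real k * h < real N * h" using k(1) \<tau>(2) Nh by simp
    then have kN: "k < N" using h by simp
    have wk: "w \<tau> = W k" unfolding w_def by (rule step_fun_eq[OF h kN k])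
    have Uk: "Ub \<tau> = U (Suc k)" by (simp add: Ub_def Sk)
    let ?t = "real (Suc k) * h"
    have th: "?t - \<tau> \<le> h" using k kh(2)[of k] by simp
    have c: "tint w \<tau> ?t x = (?t - \<tau>) * W k x" for x
    proof (rule tint_const[OF k(2)])
      fix \<sigma> assume "\<tau> < \<sigma>" "\<sigma> \<le> ?t"
      then show "w \<sigma> x = W k x" unfolding w_def using step_fun_eq[OF h kN, of \<sigma> W] k by simp
    qed
    have "L2_norm nu (\<lambda>x. cur f u0 w \<tau> x - Ub \<tau> x) = L2_norm nu (\<lambda>x. (?t - \<tau>) * W k x - tint f \<tau> ?t x)"
    proof (rule L2_norm_cong_AE)
      show "AE x in nu. cur f u0 w \<tau> x - Ub \<tau> x = (?t - \<tau>) * W k x - tint f \<tau> ?t x"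
        using node[OF Suc_leI[OF kN]] cur_inc[OF f w less_imp_le[OF \<tau>(1)] k(2), of u0]
        by eventually_elim (simp add: Uk c del: of_nat_Suc)
      show "(\<lambda>x. cur f u0 w \<tau> x - Ub \<tau> x) \<in> borel_measurable nu"
        unfolding Uk by (intro L2D(1) L2_diff cur_L2 f w uL subdiffD(2)[OF sub]) (use \<tau> in simp)
      show "(\<lambda>x. (?t - \<tau>) * W k x - tint f \<tau> ?t x) \<in> borel_measurable nu"
        by (intro L2D(1) L2_diff L2_scale W tint_L2 f k)
    qed
    also have "\<dots> \<le> L2_norm nu (\<lambda>x. (?t - \<tau>) * W k x) + L2_norm nu (tint f \<tau> ?t)"
      by (intro L2_norm_triangle_diff L2_scale W tint_L2 f k)
    also have "\<dots> \<le> h * L2_norm nu (W k) + sqrt h * sqrt E"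
    proof (intro add_mono)
      show "L2_norm nu (\<lambda>x. (?t - \<tau>) * W k x) \<le> h * L2_norm nu (W k)"
        unfolding L2_norm_scale using k th by (intro mult_right_mono) auto
      have "L2_norm nu (tint f \<tau> ?t) \<le> sqrt (?t - \<tau>) * L2_norm Q (case_prod f)" by (rule tint_norm_le[OF f k(2)])
      also have "\<dots> \<le> sqrt h * sqrt E" unfolding E_def using th h by (intro mult_mono) auto
      finally show "L2_norm nu (tint f \<tau> ?t) \<le> sqrt h * sqrt E" .
    qed
    also have "h * L2_norm nu (W k) \<le> sqrt h * sqrt (2 * phi u0 + E)"
    proof -
      have "h * (L2_norm nu (W k))\<^sup>2 \<le> (\<Sum>k<N. h * (L2_norm nu (W k))\<^sup>2)"
        by (rule member_le_sum[of k "{..<N}" "\<lambda>k. h * (L2_norm nu (W k))\<^sup>2"]) (use kN h in auto)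
      then have "sqrt (h * (L2_norm nu (W k))\<^sup>2) \<le> sqrt (2 * phi u0 + E)" using est(1) by simp
      then have "sqrt h * (sqrt h * L2_norm nu (W k)) \<le> sqrt h * sqrt (2 * phi u0 + E)"
        using h by (intro mult_left_mono) (simp_all add: real_sqrt_mult)
      then show ?thesis using h by (simp add: mult.assoc[symmetric])
    qed
    finally show ?thesis using sub[of k] by (simp add: wk Uk algebra_simps)
  qed
  show ?thesis
  proof (rule exI[of _ w], rule exI[of _ Ub], intro conjI w allI impI)
    show "(L2_norm Q (case_prod w))\<^sup>2 \<le> 2 * phi u0 + E"
      using est(1) unfolding w_def step_fun_norms(1)[OF h W] .
    show "(L2_norm Q (case_prod (sqw T w)))\<^sup>2 \<le> 2 * (T / N) * phi u0 + (L2_norm nu u0)\<^sup>2 + (L2_norm nu u0 + (T + E) / 2) * (T + E) + T * E"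
      using order_trans[OF step_fun_norms(2)[OF h W] est(2)] unfolding w_def h_def .
  qed (use main in \<open>auto simp: h_def\<close>)
qed

text \<open>The subgradients are monotone at \<open>Ub\<close> and \<open>Ub'\<close>, not on the
  curves. Shifting from the curves to these points costs the norm of w - w' times \<delta> +
  \<delta>', integrated over time.\<close>

lemma approximation_distance:
  assumes f: "f \<in> LQ" and w: "w \<in> LQ" "w' \<in> LQ" and u0: "u0 \<in> L2 nu" "u0' \<in> L2 nu"
    and ap: "\<And>\<tau>. 0 < \<tau> \<Longrightarrow> \<tau> < T \<Longrightarrow> subdiff (Ub \<tau>) (w \<tau>) \<and> L2_norm nu (\<lambda>x. cur f u0 w \<tau> x - Ub \<tau> x) \<le> \<delta>"
    and ap': "\<And>\<tau>. 0 < \<tau> \<Longrightarrow> \<tau> < T \<Longrightarrow> subdiff (Ub' \<tau>) (w' \<tau>) \<and> L2_norm nu (\<lambda>x. cur f u0' w' \<tau> x - Ub' \<tau> x) \<le> \<delta>'"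
    and \<delta>: "0 \<le> \<delta>" "0 \<le> \<delta>'" and t: "0 \<le> t" "t \<le> T"
  shows "(L2_norm nu (\<lambda>x. cur f u0 w t x - cur f u0' w' t x))\<^sup>2 \<le> (L2_norm nu (\<lambda>x. u0 x - u0' x))\<^sup>2
    + 2 * (sqrt T * (L2_norm Q (case_prod w) + L2_norm Q (case_prod w')) * (\<delta> + \<delta>'))"
proof -
  define z where "z \<tau> x = cur f u0 w \<tau> x - cur f u0' w' \<tau> x" for \<tau> x
  define \<zeta> where "\<zeta> \<tau> x = w' \<tau> x - w \<tau> x" for \<tau> x
  have \<zeta>: "\<zeta> \<in> LQ" unfolding \<zeta>_def by (intro LQ_diff w)
  have z: "z \<tau> \<in> L2 nu" if "0 \<le> \<tau>" for \<tau>
    unfolding z_def[abs_def] by (intro L2_diff cur_L2 f w u0 that)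
  define n where "n \<tau> = L2_norm nu (\<zeta> \<tau>)" for \<tau>
  have n: "n \<in> L2 lborel" unfolding n_def[abs_def] by (rule LQ_norm_L2[OF \<zeta>])
  define B where "B \<tau> = indicator {0<..t} \<tau> * n \<tau> * (\<delta> + \<delta>')" for \<tau>
  have B: "integrable lborel B" unfolding B_def using L2_indicator_integrable[OF n, of 0 t] by simp
  have half: "r\<^sup>2 / 2 - s\<^sup>2 / 2 \<le> r * (r - s)" for r s :: real
    using zero_le_power2[of "r - s"] by (simp add: power2_eq_square algebra_simps)
  \<comment> \<open>The quadratic case of the chain inequality: slope r, primitive r^2 / 2, and no
    normalization (G = 1, \<gamma> = 0).\<close>
  have "(\<integral>x. (z t x / 1)\<^sup>2 / 2 \<partial>nu) \<le> (\<integral>x. (z 0 x / 1)\<^sup>2 / 2 \<partial>nu) + (\<integral>\<tau>. indicator {0<..t} \<tau> * B \<tau> \<partial>lborel)"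
  proof (rule chain_inequality[where q="\<lambda>r. r" and L=1 and J="\<lambda>r. r\<^sup>2 / 2" and \<gamma>="\<lambda>_. 0" and G="\<lambda>_. 1" and z=z, OF t(1) _ \<zeta>])
    show "AE x in nu. z t' x = z s x + tint \<zeta> s t' x" if st: "0 \<le> s" "s \<le> t'" "t' \<le> t" for s t'
      using cur_inc[OF f w(1) st(1,2), of u0] cur_inc[OF f w(2) st(1,2), of u0'] tint_diff[OF w(2,1), of s t']
      unfolding \<zeta>_def[abs_def] by eventually_elim (simp add: z_def)
    show "AE \<tau> in lborel. 0 < \<tau> \<longrightarrow> \<tau> \<le> t \<longrightarrow> (\<integral>x. z \<tau> x / 1 * \<zeta> \<tau> x \<partial>nu) - 0 * (\<integral>x. z \<tau> x / 1 * (z \<tau> x / 1) \<partial>nu) \<le> 1 * B \<tau>"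
      using AE_lborel_singleton[of T]
    proof (eventually_elim, intro impI)
      fix \<tau> assume "\<tau> \<noteq> T" "0 < \<tau>" "\<tau> \<le> t"
      then have \<tau>: "0 < \<tau>" "\<tau> < T" "0 \<le> \<tau>" using t by auto
      note a = ap[OF \<tau>(1,2)] and a' = ap'[OF \<tau>(1,2)]
      note s = subdiffD[OF conjunct1[OF a]] and s' = subdiffD[OF conjunct1[OF a']]
      let ?c = "\<lambda>x. cur f u0 w \<tau> x - Ub \<tau> x" and ?c' = "\<lambda>x. cur f u0' w' \<tau> x - Ub' \<tau> x"
      have cL: "?c \<in> L2 nu" "?c' \<in> L2 nu" by (intro L2_diff cur_L2 f w u0 \<tau> s s')+
      have dw: "(\<lambda>x. w \<tau> x - w' \<tau> x) \<in> L2 nu" by (intro L2_diff s s')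
      have nd: "L2_norm nu (\<lambda>x. w \<tau> x - w' \<tau> x) = n \<tau>" unfolding n_def \<zeta>_def[abs_def] by (rule L2_norm_minus_commute)
      \<comment> \<open>The difference of the curves splits into the difference of the points
        \<open>Ub\<close> and \<open>Ub'\<close>, whose contribution has a sign, and the two
        deviations, which the Cauchy-Schwarz inequality bounds.\<close>
      have "(\<integral>x. z \<tau> x * \<zeta> \<tau> x \<partial>nu) = (\<integral>x. - ((w \<tau> x - w' \<tau> x) * (Ub \<tau> x - Ub' \<tau> x)) - (w \<tau> x - w' \<tau> x) * (?c x - ?c' x) \<partial>nu)"
      proof (intro Bochner_Integration.integral_cong refl)
        show "z \<tau> x * \<zeta> \<tau> x = - ((w \<tau> x - w' \<tau> x) * (Ub \<tau> x - Ub' \<tau> x)) - (w \<tau> x - w' \<tau> x) * (?c x - ?c' x)" for x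
          unfolding z_def \<zeta>_def by (simp add: algebra_simps)
      qed
      also have "\<dots> = - (\<integral>x. (w \<tau> x - w' \<tau> x) * (Ub \<tau> x - Ub' \<tau> x) \<partial>nu) - (\<integral>x. (w \<tau> x - w' \<tau> x) * (?c x - ?c' x) \<partial>nu)"
        using L2_mult_integrable[OF dw L2_diff[OF s(2) s'(2)]] L2_mult_integrable[OF dw L2_diff[OF cL]] by simp
      also have "\<dots> \<le> - (\<integral>x. (w \<tau> x - w' \<tau> x) * (?c x - ?c' x) \<partial>nu)"
        using subdiff_monotone[OF conjunct1[OF a] conjunct1[OF a']] by simp
      also have "\<dots> \<le> n \<tau> * L2_norm nu (\<lambda>x. ?c x - ?c' x)"
        using L2_Cauchy_Schwarz[OF dw L2_diff[OF cL]] unfolding nd by simp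
      also have "\<dots> \<le> n \<tau> * (\<delta> + \<delta>')"
        using L2_norm_triangle_diff[OF cL] a a' by (intro mult_left_mono) (auto simp: n_def)
      finally show "(\<integral>x. z \<tau> x / 1 * \<zeta> \<tau> x \<partial>nu) - 0 * (\<integral>x. z \<tau> x / 1 * (z \<tau> x / 1) \<partial>nu) \<le> 1 * B \<tau>"
        using \<open>0 < \<tau>\<close> \<open>\<tau> \<le> t\<close> by (simp add: B_def)
    qed
  qed (use z B half in \<open>auto intro: continuous_intros\<close>)
  also have "(\<integral>\<tau>. indicator {0<..t} \<tau> * B \<tau> \<partial>lborel) = (\<integral>\<tau>. (indicator {0<..t} \<tau> * n \<tau>) * (\<delta> + \<delta>') \<partial>lborel)"
    by (intro Bochner_Integration.integral_cong refl) (auto simp: B_def indicator_def)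
  also have "\<dots> = (\<integral>\<tau>. indicator {0<..t} \<tau> * n \<tau> \<partial>lborel) * (\<delta> + \<delta>')" by simp
  also have "\<dots> \<le> (sqrt T * (L2_norm Q (case_prod w) + L2_norm Q (case_prod w'))) * (\<delta> + \<delta>')"
  proof (intro mult_right_mono)
    have "(\<integral>\<tau>. indicator {0<..t} \<tau> * n \<tau> \<partial>lborel)\<^sup>2 \<le> (t - 0) * (\<integral>\<tau>. indicator {0<..t} \<tau> * (n \<tau>)\<^sup>2 \<partial>lborel)"
      by (rule L2_integral_sq_le[OF n t(1)])
    also have "\<dots> \<le> T * (L2_norm Q (case_prod \<zeta>))\<^sup>2"
    proof (intro mult_mono)
      show "(\<integral>\<tau>. indicator {0<..t} \<tau> * (n \<tau>)\<^sup>2 \<partial>lborel) \<le> (L2_norm Q (case_prod \<zeta>))\<^sup>2"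
        unfolding LQ_norm_sq[OF \<zeta>, symmetric] n_def
      proof (rule integral_mono[OF _ LQ_norm_sq_integrable[OF \<zeta>]])
        show "integrable lborel (\<lambda>\<tau>. indicat_real {0<..t} \<tau> * (L2_norm nu (\<zeta> \<tau>))\<^sup>2)"
          using integrable_real_mult_indicator[OF _ LQ_norm_sq_integrable[OF \<zeta>], of "{0<..t}"] by (simp add: mult.commute)
      qed (auto simp: indicator_def)
    qed (use t in \<open>auto intro!: integral_nonneg_AE\<close>)
    also have "\<dots> = (sqrt T * L2_norm Q (case_prod \<zeta>))\<^sup>2" using t by (simp add: power_mult_distrib)
    finally have "(\<integral>\<tau>. indicator {0<..t} \<tau> * n \<tau> \<partial>lborel) \<le> sqrt T * L2_norm Q (case_prod \<zeta>)"
      by (rule power2_le_imp_le) (use t in simp)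
    also have "\<dots> \<le> sqrt T * (L2_norm Q (case_prod w) + L2_norm Q (case_prod w'))"
    proof (intro mult_left_mono)
      have "L2_norm Q (\<lambda>p. case_prod w' p - case_prod w p) \<le> L2_norm Q (case_prod w') + L2_norm Q (case_prod w)"
        by (rule L2_norm_triangle_diff) (use w in \<open>auto simp: LQ_def\<close>)
      then show "L2_norm Q (case_prod \<zeta>) \<le> L2_norm Q (case_prod w) + L2_norm Q (case_prod w')"
        by (simp add: \<zeta>_def[abs_def] split_beta' add.commute)
    qed (use t in simp)
    finally show "(\<integral>\<tau>. indicator {0<..t} \<tau> * n \<tau> \<partial>lborel) \<le> sqrt T * (L2_norm Q (case_prod w) + L2_norm Q (case_prod w'))" .
  qed (use \<delta> in simp)
  finally show ?thesis
    by (simp add: L2_norm_sq z_def[symmetric] cur_def[of f _ _ 0, symmetric])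
      (simp add: z_def L2_norm_sq)
qed

end

section \<open>Existence for gradient flows\<close>

lemma L2_cvx_diff_le:
  assumes l: "cvx_weights n N l" and v: "\<And>k. v k \<in> L2 M" and u: "u \<in> L2 M"
    and le: "\<And>k. n \<le> k \<Longrightarrow> L2_norm M (\<lambda>x. v k x - u x) \<le> c"
  shows "L2_norm M (\<lambda>x. (\<Sum>k=n..N. l k * v k x) - u x) \<le> c"
proof -
  have l1: "(\<Sum>k=n..N. l k) = 1" and l0: "0 \<le> l k" for k using l by (auto simp: cvx_weights_def)
  have "(\<Sum>k=n..N. l k * v k x) - u x = (\<Sum>k=n..N. l k * (v k x - u x))" for x
    by (simp add: right_diff_distrib sum_subtractf sum_distrib_right[symmetric] l1)
  then have "L2_norm M (\<lambda>x. (\<Sum>k=n..N. l k * v k x) - u x) = L2_norm M (\<lambda>x. \<Sum>k=n..N. l k * (v k x - u x))" by simp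
  also have "\<dots> \<le> (\<Sum>k=n..N. L2_norm M (\<lambda>x. l k * (v k x - u x)))"
    by (intro L2_norm_sum_le L2_scale L2_diff v u)
  also have "\<dots> = (\<Sum>k=n..N. l k * L2_norm M (\<lambda>x. v k x - u x))"
    by (simp add: L2_norm_scale l0)
  also have "\<dots> \<le> c" by (rule cvx_weights_le[OF l le])
  finally show ?thesis .
qed

text \<open>This undoes the averaging: from an inequality for a convex combination it selects a
  single approximation, to which lower semicontinuity of \<open>phi\<close> can be applied.\<close>

lemma cvx_weights_exists_le:
  assumes "cvx_weights n N l" "(\<Sum>k=n..N. l k * x k) \<le> (c::real)"
  shows "\<exists>k\<ge>n. x k \<le> c"
proof (rule ccontr)
  assume "\<not> ?thesis"
  then have gt: "c < x k" if "n \<le> k" for k using that by force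
  have l1: "(\<Sum>k=n..N. l k) = 1" and l0: "0 \<le> l k" for k using assms(1) by (auto simp: cvx_weights_def)
  then obtain j where j: "j \<in> {n..N}" "l j \<noteq> 0" by (metis sum.neutral zero_neq_one)
  have "(\<Sum>k=n..N. l k * c) < (\<Sum>k=n..N. l k * x k)"
  proof (rule sum_strict_mono_ex1)
    show "\<forall>k\<in>{n..N}. l k * c \<le> l k * x k"
    proof
      fix k assume "k \<in> {n..N}"
      then have "c \<le> x k" using gt[of k] by simp
      then show "l k * c \<le> l k * x k" by (rule mult_left_mono[OF _ l0])
    qed
    have "c < x j" "0 < l j" using j gt[of j] l0[of j] by simp_all
    then have "l j * c < l j * x j" by (rule mult_strict_left_mono)
    then show "\<exists>k\<in>{n..N}. l k * c < l k * x k" using j(1) by (rule bexI)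
  qed simp
  then show False using assms(2) l1 by (simp add: sum_distrib_right[symmetric])
qed

context time_space
begin

lemma LQ_nn_integral_finite:
  assumes "g \<in> LQ"
  shows "(\<integral>\<^sup>+\<tau>. (\<integral>\<^sup>+x. ennreal ((g \<tau> x)\<^sup>2) \<partial>nu) \<partial>lborel) < \<infinity>"
proof -
  have g: "case_prod g \<in> L2 Q" using assms by (simp add: LQ_def)
  have "(\<integral>\<^sup>+\<tau>. (\<integral>\<^sup>+x. ennreal ((case_prod g (\<tau>, x))\<^sup>2) \<partial>nu) \<partial>lborel) = (\<integral>\<^sup>+w. ennreal ((case_prod g w)\<^sup>2) \<partial>Q)"
    by (rule sigma_finite_measure.nn_integral_fst[OF sigma_finite_nu]) (use L2D(1)[OF g] in simp)
  then show ?thesis unfolding L2_norm_sq_nn[OF g] by simp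
qed

end

context convex_functional
begin

text \<open>Weak limits of the derivatives are replaced by strong limits of convex combinations.  These
  converge in \<open>L\<^sup>2(X)\<close> for almost every time along a subsequence, so the subgradient inequality
  passes to the limit at such a time for all test functions simultaneously.\<close>

lemma approximation_limit:
  assumes F: "F \<in> LQ" and T: "0 < T" and u0: "u0 \<in> L2 nu"
    and w: "\<And>j::nat. w j \<in> LQ" and a: "\<And>j. a j \<in> L2 nu" and a_lim: "(\<lambda>j. L2_norm nu (\<lambda>x. a j x - u0 x)) \<longlonglongrightarrow> 0"
    and sub: "\<And>j \<tau>. 0 < \<tau> \<Longrightarrow> \<tau> < T \<Longrightarrow> subdiff (Ub j \<tau>) (w j \<tau>)"
    and Ub: "\<And>j \<tau>. 0 < \<tau> \<Longrightarrow> \<tau> < T \<Longrightarrow> L2_norm nu (\<lambda>x. cur F (a j) (w j) \<tau> x - Ub j \<tau> x) \<le> \<rho> j"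
    and dist: "\<And>i j t. 0 \<le> t \<Longrightarrow> t \<le> T \<Longrightarrow> L2_norm nu (\<lambda>x. cur F (a i) (w i) t x - cur F (a j) (w j) t x) \<le> \<rho> i + \<rho> j"
    and \<rho>: "\<rho> \<longlonglongrightarrow> 0" "decseq \<rho>"
    and C: "\<And>j. L2_norm Q (case_prod (sqw T (w j))) \<le> C"
    and f: "\<And>\<tau>. 0 < \<tau> \<Longrightarrow> \<tau> < T \<Longrightarrow> F \<tau> = f \<tau>"
  shows "\<exists>u. strong_solution nu subdiff T u0 f u"
proof -
  let ?u = "\<lambda>j. cur F (a j) (w j)"
  have \<rho>0: "0 \<le> \<rho> j" for j using decseq_ge[OF \<rho>(2,1)] .
  have uL: "?u j t \<in> L2 nu" if "0 \<le> t" for j t by (intro cur_L2 F w a that)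
  have \<rho>small: "\<exists>K. \<forall>k\<ge>K. \<rho> k < e" if "0 < e" for e
    using order_tendstoD(2)[OF \<rho>(1) that] by (simp add: eventually_sequentially)
  have "\<exists>v\<in>L2 nu. (\<lambda>j. L2_norm nu (\<lambda>x. ?u j t x - v x)) \<longlonglongrightarrow> 0" if t: "0 \<le> t" "t \<le> T" for t
  proof (rule L2_complete[OF uL[OF t(1)]])
    fix e :: real assume "0 < e"
    then obtain K where K: "\<forall>k\<ge>K. \<rho> k < e / 2" using \<rho>small[of "e/2"] by auto
    show "\<exists>N. \<forall>m\<ge>N. \<forall>n\<ge>N. L2_norm nu (\<lambda>x. ?u m t x - ?u n t x) < e"
    proof (intro exI[of _ K] allI impI)
      fix m n assume "K \<le> m" "K \<le> n"
      then show "L2_norm nu (\<lambda>x. ?u m t x - ?u n t x) < e"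
        using K[rule_format, of m] K[rule_format, of n] dist[OF t, of m n] by linarith
    qed
  qed
  then have "\<forall>t\<in>{0..T}. \<exists>v. v \<in> L2 nu \<and> (\<lambda>j. L2_norm nu (\<lambda>x. ?u j t x - v x)) \<longlonglongrightarrow> 0" by fastforce
  from bchoice[OF this] obtain u
    where u': "\<forall>t\<in>{0..T}. u t \<in> L2 nu \<and> (\<lambda>j. L2_norm nu (\<lambda>x. ?u j t x - u t x)) \<longlonglongrightarrow> 0" by blast
  have u: "u t \<in> L2 nu" and ulim: "(\<lambda>j. L2_norm nu (\<lambda>x. ?u j t x - u t x)) \<longlonglongrightarrow> 0" if "0 \<le> t" "t \<le> T" for t
    using u'[THEN bspec, of t] that by simp_all
  \<comment> \<open>The second index tends to infinity in \<open>dist\<close>, so the convergence is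
    uniform in time with the rate \<open>\<rho> j\<close>.\<close>
  have unif: "L2_norm nu (\<lambda>x. ?u j t x - u t x) \<le> \<rho> j" if t: "0 \<le> t" "t \<le> T" for j t
  proof (rule tendsto_lowerbound)
    show "(\<lambda>i. \<rho> j + \<rho> i + L2_norm nu (\<lambda>x. ?u i t x - u t x)) \<longlonglongrightarrow> \<rho> j"
      using tendsto_add[OF tendsto_add[OF tendsto_const[of "\<rho> j"] \<rho>(1)] ulim[OF t]] by simp
    show "\<forall>\<^sub>F i in sequentially. L2_norm nu (\<lambda>x. ?u j t x - u t x) \<le> \<rho> j + \<rho> i + L2_norm nu (\<lambda>x. ?u i t x - u t x)"
    proof (intro always_eventually allI)
      fix i
      show "L2_norm nu (\<lambda>x. ?u j t x - u t x) \<le> \<rho> j + \<rho> i + L2_norm nu (\<lambda>x. ?u i t x - u t x)"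
        using L2_norm_triangle3[OF uL[OF t(1)] uL[OF t(1)] u[OF t], of j i] dist[OF t, of j i] by linarith
    qed
  qed simp
  have V: "case_prod (sqw T (w k)) \<in> L2 Q" for k using sqw_LQ[OF w] by (simp add: LQ_def)
  obtain l N c where c: "c \<in> L2 Q" and l: "\<And>n. cvx_weights n (N n) (l n)"
    and clim: "(\<lambda>n. L2_norm Q (\<lambda>p. (\<Sum>k=n..N n. l n k * case_prod (sqw T (w k)) p) - c p)) \<longlonglongrightarrow> 0"
    using L2_Mazur[of "\<lambda>k. case_prod (sqw T (w k))", OF V C] by blast
  have l0: "0 \<le> l n k" and l1: "(\<Sum>k=n..N n. l n k) = 1" for n k using l by (auto simp: cvx_weights_def)
  define g where "g \<tau> x = c (\<tau>, x)" for \<tau> x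
  have g: "g \<in> LQ" using c by (simp add: LQ_def g_def split_beta')
  define comb where "comb n \<tau> x = (\<Sum>k=n..N n. l n k * sqw T (w k) \<tau> x)" for n \<tau> x
  have comb: "comb n \<in> LQ" for n unfolding comb_def by (intro LQ_sum LQ_scale sqw_LQ w)
  define A where "A n \<tau> x = comb n \<tau> x - g \<tau> x" for n \<tau> x
  have A: "A n \<in> LQ" for n unfolding A_def by (intro LQ_diff comb g)
  have Alim: "(\<lambda>n. L2_norm Q (case_prod (A n))) \<longlonglongrightarrow> 0"
    using clim by (simp add: A_def comb_def g_def split_beta')
  \<comment> \<open>\<open>g\<close> is the limit of combinations carrying the weight sqrt \<tau>;
    dividing by the weight recovers the subgradient. Square integrability is kept only away from 0,
    hence the cut-offs in \<open>wcut\<close>.\<close>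
  define wi where "wi \<tau> x = (indicator {0<..T} \<tau> / sqrt \<tau>) * g \<tau> x" for \<tau> x
  have wi_meas: "case_prod wi \<in> borel_measurable Q"
  proof -
    have "(\<lambda>(\<tau>, x). (indicator {0<..T} \<tau> / sqrt \<tau>) * g \<tau> x) \<in> borel_measurable Q"
      by (rule joint_meas_times[OF LQ_meas[OF g]]) measurable
    then show ?thesis by (simp add: wi_def split_beta')
  qed
  define v where "v \<tau> x = F \<tau> x - wi \<tau> x" for \<tau> x
  have v_meas: "case_prod v \<in> borel_measurable Q"
    using borel_measurable_diff[OF LQ_meas[OF F] wi_meas] by (simp add: v_def split_beta')
  have wcut: "(\<lambda>\<tau> x. (indicator {s..t} \<tau> / sqrt \<tau>) * h \<tau> x) \<in> LQ" if "h \<in> LQ" "0 < s" for s t h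
  proof (rule LQ_times[OF that(1), where C="1 / sqrt s"])
    show "\<bar>indicator {s..t} \<tau> / sqrt \<tau>\<bar> \<le> 1 / sqrt s" for \<tau>
      using that(2) by (auto simp: indicator_def intro!: divide_left_mono)
  qed measurable
  have wi_LQ: "(\<lambda>\<tau> x. indicator {s..t} \<tau> * wi \<tau> x) \<in> LQ" if "0 < s" "t < T" for s t
  proof -
    have "(\<lambda>\<tau> x. indicator {s..t} \<tau> * wi \<tau> x) = (\<lambda>\<tau> x. (indicator {s..t} \<tau> / sqrt \<tau>) * g \<tau> x)"
      using that by (auto simp: wi_def indicator_def)
    then show ?thesis using wcut[OF g that(1), of t] by simp
  qed
  have v_LQ: "(\<lambda>\<tau> x. indicator {s..t} \<tau> * v \<tau> x) \<in> LQ" if "0 < s" "t < T" for s t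
    using LQ_diff[OF LQ_restrict[OF F, of "{s..t}"] wi_LQ[OF that]] by (simp add: v_def right_diff_distrib)
  \<comment> \<open>Convex combinations of the curves have increments given by the force and the
    combined subgradients. The weighted combinations converge strongly, and on [s, t] the weight is
    at least sqrt s, so the identity passes to the limit.\<close>
  have incr: "AE x in nu. u t x = u s x + tint v s t x" if st: "0 < s" "s \<le> t" "t < T" for s t
  proof -
    have st': "0 \<le> s" "s \<le> T" "0 \<le> t" "t \<le> T" using st by auto
    let ?wc = "\<lambda>\<tau> x. indicator {s..t} \<tau> * wi \<tau> x"
    note wc = wi_LQ[OF st(1,3), of]
    define om where "om n \<tau> x = (\<Sum>k=n..N n. l n k * w k \<tau> x)" for n \<tau> x
    have om: "om n \<in> LQ" for n unfolding om_def by (intro LQ_sum LQ_scale w)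
    have om_wc: "L2_norm nu (\<lambda>x. tint (om n) s t x - tint ?wc s t x) \<le> sqrt (t - s) * ((1 / sqrt s) * L2_norm Q (case_prod (A n)))" for n
    proof -
      let ?d = "\<lambda>\<tau> x. (indicator {s..t} \<tau> / sqrt \<tau>) * A n \<tau> x"
      have dLQ: "?d \<in> LQ" by (rule wcut[OF A st(1)])
      have eq: "tint (\<lambda>\<tau> x. om n \<tau> x - ?wc \<tau> x) s t x = tint ?d s t x" for x
      proof (rule tint_cong)
        fix \<tau> assume \<tau>: "s < \<tau>" "\<tau> \<le> t"
        then have "comb n \<tau> x = sqrt \<tau> * om n \<tau> x"
          using st by (simp add: comb_def om_def sqw_def sum_distrib_left mult.left_commute)
        then show "om n \<tau> x - ?wc \<tau> x = ?d \<tau> x"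
          using \<tau> st by (simp add: A_def wi_def field_simps)
      qed
      have "L2_norm nu (\<lambda>x. tint (om n) s t x - tint ?wc s t x) = L2_norm nu (tint ?d s t)"
      proof (rule L2_norm_cong_AE)
        show "AE x in nu. tint (om n) s t x - tint ?wc s t x = tint ?d s t x"
          using tint_diff[OF om wc, of n s t] unfolding eq by eventually_elim simp
        show "tint ?d s t \<in> borel_measurable nu" by (rule L2D(1)[OF tint_L2(1)[OF dLQ st(2)]])
        show "(\<lambda>x. tint (om n) s t x - tint ?wc s t x) \<in> borel_measurable nu"
          by (intro L2D(1) L2_diff tint_L2 om wc st(2))
      qed
      also have "\<dots> \<le> sqrt (t - s) * L2_norm Q (case_prod ?d)" by (rule tint_norm_le[OF dLQ st(2)])
      also have "L2_norm Q (case_prod ?d) \<le> L2_norm Q (\<lambda>p. (1 / sqrt s) * case_prod (A n) p)"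
      proof (rule L2_norm_mono)
        show "(\<lambda>p. 1 / sqrt s * case_prod (A n) p) \<in> L2 Q" by (rule L2_scale) (use A in \<open>simp add: LQ_def\<close>)
        show "case_prod ?d \<in> borel_measurable Q" by (rule LQ_meas[OF dLQ])
        have "\<bar>?d \<tau> x\<bar> \<le> \<bar>1 / sqrt s * A n \<tau> x\<bar>" for \<tau> x
          unfolding abs_mult using st by (intro mult_right_mono) (auto simp: indicator_def intro!: divide_left_mono)
        then show "AE p in Q. \<bar>case_prod ?d p\<bar> \<le> \<bar>1 / sqrt s * case_prod (A n) p\<bar>" by (simp add: split_beta')
      qed
      also have "\<dots> = (1 / sqrt s) * L2_norm Q (case_prod (A n))" using st by (subst L2_norm_scale) simp
      finally show ?thesis using st by (simp add: mult_left_mono)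
    qed
    have comb_inc: "AE x in nu. (\<Sum>k=n..N n. l n k * ?u k t x) - (\<Sum>k=n..N n. l n k * ?u k s x) = tint F s t x - tint (om n) s t x" for n
    proof -
      have "AE x in nu. \<forall>k\<in>{n..N n}. ?u k t x = ?u k s x + tint F s t x - tint (w k) s t x"
        by (intro AE_finite_allI cur_inc F w st' st) simp
      moreover have "AE x in nu. tint (om n) s t x = (\<Sum>k=n..N n. l n k * tint (w k) s t x)"
        unfolding om_def[abs_def] by (intro tint_sum w) simp
      ultimately show ?thesis
      proof eventually_elim
        case (elim x)
        have "(\<Sum>k=n..N n. l n k * ?u k t x) - (\<Sum>k=n..N n. l n k * ?u k s x) = (\<Sum>k=n..N n. l n k * (?u k t x - ?u k s x))"
          by (simp add: sum_subtractf right_diff_distrib)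
        also have "\<dots> = (\<Sum>k=n..N n. l n k * (tint F s t x - tint (w k) s t x))"
          by (intro sum.cong refl) (use elim(1) in auto)
        also have "\<dots> = tint F s t x - (\<Sum>k=n..N n. l n k * tint (w k) s t x)"
          by (simp add: right_diff_distrib sum_subtractf sum_distrib_right[symmetric] l1)
        finally show ?case using elim(2) by simp
      qed
    qed
    let ?d = "\<lambda>x. (u t x - u s x) - (tint F s t x - tint ?wc s t x)"
    have dL: "?d \<in> L2 nu" by (intro L2_diff u tint_L2 F wc st' st)
    have "L2_norm nu ?d \<le> 2 * \<rho> n + sqrt (t - s) * ((1 / sqrt s) * L2_norm Q (case_prod (A n)))" for n
    proof -
      let ?ct = "\<lambda>x. (\<Sum>k=n..N n. l n k * ?u k t x)" and ?cs = "\<lambda>x. (\<Sum>k=n..N n. l n k * ?u k s x)"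
      have cL: "?ct \<in> L2 nu" "?cs \<in> L2 nu" by (intro L2_sum L2_scale uL st')+
      have ct: "L2_norm nu (\<lambda>x. ?ct x - u t x) \<le> \<rho> n" "L2_norm nu (\<lambda>x. ?cs x - u s x) \<le> \<rho> n"
        using st' by (auto intro!: L2_cvx_diff_le[OF l uL u] order_trans[OF unif decseqD[OF \<rho>(2)]])
      let ?e = "\<lambda>x. tint (om n) s t x - tint ?wc s t x"
      have eL: "?e \<in> L2 nu" by (intro L2_diff tint_L2 om wc st)
      have "L2_norm nu ?d = L2_norm nu (\<lambda>x. (?cs x - u s x) - (?ct x - u t x) - ?e x)"
      proof (rule L2_norm_cong_AE)
        show "AE x in nu. ?d x = (?cs x - u s x) - (?ct x - u t x) - ?e x"
          using comb_inc[of n] by eventually_elim simp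
      qed (use dL in \<open>auto intro!: L2D(1) L2_diff cL eL u st'\<close>)
      also have "\<dots> \<le> L2_norm nu (\<lambda>x. (?cs x - u s x) - (?ct x - u t x)) + L2_norm nu ?e"
        by (intro L2_norm_triangle_diff L2_diff cL u eL st')
      also have "L2_norm nu (\<lambda>x. (?cs x - u s x) - (?ct x - u t x)) \<le> L2_norm nu (\<lambda>x. ?cs x - u s x) + L2_norm nu (\<lambda>x. ?ct x - u t x)"
        by (intro L2_norm_triangle_diff L2_diff cL u st')
      finally show ?thesis using ct om_wc[of n] by linarith
    qed
    moreover have "(\<lambda>n. 2 * \<rho> n + sqrt (t - s) * ((1 / sqrt s) * L2_norm Q (case_prod (A n)))) \<longlonglongrightarrow> 2 * 0 + sqrt (t - s) * ((1 / sqrt s) * 0)"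
      by (intro tendsto_intros \<rho> Alim)
    ultimately have "L2_norm nu ?d \<le> 2 * 0 + sqrt (t - s) * ((1 / sqrt s) * 0)"
      by (intro tendsto_lowerbound[where f="\<lambda>n. 2 * \<rho> n + sqrt (t - s) * ((1 / sqrt s) * L2_norm Q (case_prod (A n)))"]) auto
    then have "L2_norm nu ?d = 0" by (simp add: order_antisym)
    then have "AE x in nu. ?d x = 0" by (rule L2_norm_zero_AE[OF dL])
    moreover have "AE x in nu. tint (\<lambda>\<tau> x. F \<tau> x - ?wc \<tau> x) s t x = tint F s t x - tint ?wc s t x"
      by (rule tint_diff[OF F wc])
    moreover have "tint (\<lambda>\<tau> x. F \<tau> x - ?wc \<tau> x) s t x = tint v s t x" for x
      by (rule tint_cong) (use st in \<open>auto simp: v_def\<close>)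
    ultimately show ?thesis by (auto elim: eventually_elim2)
  qed
  \<comment> \<open>Cost of testing at \<open>u \<tau>\<close> a subgradient that belongs to
    \<open>Ub\<close>, which lies within 2 \<rho> of it; the cost is averaged with the convex
    weights and carries the factor sqrt \<tau>.\<close>
  define R where "R n \<tau> = 2 * \<rho> n * (\<Sum>k=n..N n. l n k * L2_norm nu (sqw T (w k) \<tau>))" for n \<tau>
  have nL: "(\<lambda>\<tau>. L2_norm nu (sqw T (w k) \<tau>)) \<in> L2 lborel" for k by (intro LQ_norm_L2 sqw_LQ w)
  have RL: "R n \<in> L2 lborel" for n unfolding R_def[abs_def] by (intro L2_scale L2_sum nL)
  have R0: "0 \<le> R n \<tau>" for n \<tau> unfolding R_def using \<rho>0 l0 by (intro mult_nonneg_nonneg sum_nonneg) auto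
  have nC: "L2_norm lborel (\<lambda>\<tau>. L2_norm nu (h \<tau>)) = L2_norm Q (case_prod h)" if "h \<in> LQ" for h
    unfolding L2_norm_def[of lborel] using LQ_norm_sq[OF that] by simp
  have Rn: "L2_norm lborel (R n) \<le> 2 * \<rho> n * C" for n
  proof -
    have "L2_norm lborel (\<lambda>\<tau>. (\<Sum>k=n..N n. l n k * L2_norm nu (sqw T (w k) \<tau>)) - 0) \<le> C"
      by (rule L2_cvx_diff_le[OF l nL]) (use C nC[OF sqw_LQ[OF w]] in simp_all)
    then show ?thesis unfolding R_def[abs_def] L2_norm_scale using \<rho>0[of n] by (simp add: mult_left_mono)
  qed
  \<comment> \<open>The two errors together depend on \<tau> and n but not on the test function, so
    one subsequence and one null set of times serve all \<xi>.\<close>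
  define Z where "Z n \<tau> = L2_norm nu (A n \<tau>) + R n \<tau>" for n \<tau>
  have ZL: "Z n \<in> L2 lborel" for n unfolding Z_def[abs_def] by (intro L2_add LQ_norm_L2 A RL)
  have "(\<lambda>n. L2_norm lborel (\<lambda>\<tau>. Z n \<tau> - 0)) \<longlonglongrightarrow> 0"
  proof (rule Lim_null_comparison)
    show "\<forall>\<^sub>F n in sequentially. norm (L2_norm lborel (\<lambda>\<tau>. Z n \<tau> - 0)) \<le> L2_norm Q (case_prod (A n)) + 2 * \<rho> n * C"
    proof (intro always_eventually allI)
      fix n
      have "L2_norm lborel (Z n) \<le> L2_norm lborel (\<lambda>\<tau>. L2_norm nu (A n \<tau>)) + L2_norm lborel (R n)"
        unfolding Z_def[abs_def] by (intro L2_norm_triangle LQ_norm_L2 A RL)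
      then show "norm (L2_norm lborel (\<lambda>\<tau>. Z n \<tau> - 0)) \<le> L2_norm Q (case_prod (A n)) + 2 * \<rho> n * C"
        using Rn[of n] nC[OF A, of n] by simp
    qed
    have "(\<lambda>n. L2_norm Q (case_prod (A n)) + 2 * \<rho> n * C) \<longlonglongrightarrow> 0 + 2 * 0 * C"
      by (intro tendsto_intros Alim \<rho>)
    then show "(\<lambda>n. L2_norm Q (case_prod (A n)) + 2 * \<rho> n * C) \<longlonglongrightarrow> 0" by simp
  qed
  then obtain r :: "nat \<Rightarrow> nat" where r: "strict_mono r" and Zlim: "AE \<tau> in lborel. (\<lambda>n. Z (r n) \<tau>) \<longlonglongrightarrow> 0"
    using L2_AE_subseq[of Z lborel "\<lambda>_. 0", OF ZL] by auto
  have incl: "AE \<tau> in lborel. 0 < \<tau> \<longrightarrow> \<tau> < T \<longrightarrow> subdiff (u \<tau>) (wi \<tau>)"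
    using Zlim LQ_section[OF g]
  proof (eventually_elim, intro impI)
    fix \<tau> assume Z: "(\<lambda>n. Z (r n) \<tau>) \<longlonglongrightarrow> 0" and g\<tau>: "g \<tau> \<in> L2 nu" and \<tau>: "0 < \<tau>" "\<tau> < T"
    then have \<tau>': "0 \<le> \<tau>" "\<tau> \<le> T" by auto
    define s where "s = sqrt \<tau>"
    have s: "0 < s" using \<tau> by (simp add: s_def)
    have wi\<tau>: "wi \<tau> = (\<lambda>x. (1 / s) * g \<tau> x)" using \<tau> by (auto simp: wi_def s_def)
    have wiL: "wi \<tau> \<in> L2 nu" unfolding wi\<tau> by (rule L2_scale[OF g\<tau>])
    note sk = subdiffD[OF sub[OF \<tau>]]
    have u\<tau>: "u \<tau> \<in> L2 nu" by (rule u[OF \<tau>'])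
    have sqw\<tau>: "sqw T (w k) \<tau> x = s * w k \<tau> x" for k x using \<tau> by (simp add: sqw_def s_def)
    have close: "L2_norm nu (\<lambda>x. Ub k \<tau> x - u \<tau> x) \<le> 2 * \<rho> k" for k
      using L2_norm_triangle3[OF sk(2) uL[OF \<tau>'(1)] u\<tau>, of k k] Ub[OF \<tau>, of k] unif[OF \<tau>', of k]
        L2_norm_minus_commute[of nu "Ub k \<tau>" "?u k \<tau>"] by linarith
    \<comment> \<open>Averaging the subgradient inequalities replaces the single subgradients by
      their convergent combination; afterwards one index is chosen at which the averaged bound
      holds.\<close>
    have bound: "\<exists>k\<ge>n. phi (Ub k \<tau>) \<le> phi \<xi> - (\<integral>x. wi \<tau> x * (\<xi> x - u \<tau> x) \<partial>nu) + (1 / s) * (L2_norm nu (\<lambda>x. \<xi> x - u \<tau> x) + 1) * Z n \<tau>"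
      if \<xi>: "\<xi> \<in> dom" for n \<xi>
    proof (rule cvx_weights_exists_le[OF l])
      note \<xi>L = dom_L2[OF \<xi>]
      let ?x = "\<lambda>x. \<xi> x - u \<tau> x"
      have xL: "?x \<in> L2 nu" by (intro L2_diff \<xi>L u\<tau>)
      have iw: "integrable nu (\<lambda>x. w k \<tau> x * ?x x)" for k by (intro L2_mult_integrable sk xL)
      have each: "phi (Ub k \<tau>) \<le> phi \<xi> - (\<integral>x. w k \<tau> x * ?x x \<partial>nu) + (1 / s) * (2 * \<rho> n * L2_norm nu (sqw T (w k) \<tau>))" if "n \<le> k" for k
      proof -
        have "(\<integral>x. w k \<tau> x * (\<xi> x - Ub k \<tau> x) \<partial>nu) = (\<integral>x. w k \<tau> x * ?x x - w k \<tau> x * (Ub k \<tau> x - u \<tau> x) \<partial>nu)"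
          by (simp add: algebra_simps)
        also have "\<dots> = (\<integral>x. w k \<tau> x * ?x x \<partial>nu) - (\<integral>x. w k \<tau> x * (Ub k \<tau> x - u \<tau> x) \<partial>nu)"
          using iw L2_mult_integrable[OF sk(3) L2_diff[OF sk(2) u\<tau>]] by simp
        finally have 1: "phi (Ub k \<tau>) \<le> phi \<xi> - (\<integral>x. w k \<tau> x * ?x x \<partial>nu) + (\<integral>x. w k \<tau> x * (Ub k \<tau> x - u \<tau> x) \<partial>nu)"
          using sk(4)[OF \<xi>, of k] by simp
        have "(\<integral>x. w k \<tau> x * (Ub k \<tau> x - u \<tau> x) \<partial>nu) \<le> L2_norm nu (w k \<tau>) * L2_norm nu (\<lambda>x. Ub k \<tau> x - u \<tau> x)"
          using L2_Cauchy_Schwarz[OF sk(3) L2_diff[OF sk(2) u\<tau>], of k k] by simp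
        also have "\<dots> \<le> L2_norm nu (w k \<tau>) * (2 * \<rho> n)"
          using close[of k] decseqD[OF \<rho>(2) that] by (intro mult_left_mono) auto
        also have "L2_norm nu (w k \<tau>) = (1 / s) * L2_norm nu (sqw T (w k) \<tau>)"
          using s by (simp add: sqw\<tau>[abs_def] L2_norm_scale)
        finally show ?thesis using 1 by (simp add: mult.commute mult.left_commute)
      qed
      have comb\<tau>: "comb n \<tau> x = s * (\<Sum>k=n..N n. l n k * w k \<tau> x)" for x
        by (simp add: comb_def sqw\<tau> sum_distrib_left mult.left_commute)
      have "(\<Sum>k=n..N n. l n k * phi (Ub k \<tau>)) \<le> (\<Sum>k=n..N n. l n k * (phi \<xi> - (\<integral>x. w k \<tau> x * ?x x \<partial>nu) + (1 / s) * (2 * \<rho> n * L2_norm nu (sqw T (w k) \<tau>))))"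
        by (intro sum_mono mult_left_mono l0 each) simp
      also have "\<dots> = phi \<xi> - (\<Sum>k=n..N n. l n k * (\<integral>x. w k \<tau> x * ?x x \<partial>nu)) + (1 / s) * R n \<tau>"
      proof -
        have "(\<Sum>k=n..N n. l n k * phi \<xi>) = phi \<xi>" by (simp add: sum_distrib_right[symmetric] l1)
        moreover have "(\<Sum>k=n..N n. l n k * ((1 / s) * (2 * \<rho> n * L2_norm nu (sqw T (w k) \<tau>)))) = (1 / s) * R n \<tau>"
          unfolding R_def sum_distrib_left by (intro sum.cong refl) (simp add: mult.commute mult.left_commute)
        ultimately show ?thesis by (simp only: distrib_left right_diff_distrib sum.distrib sum_subtractf)
      qed
      also have "(\<Sum>k=n..N n. l n k * (\<integral>x. w k \<tau> x * ?x x \<partial>nu)) = (\<integral>x. (1 / s) * (comb n \<tau> x * ?x x) \<partial>nu)"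
      proof -
        have "(\<Sum>k=n..N n. l n k * (\<integral>x. w k \<tau> x * ?x x \<partial>nu)) = (\<integral>x. (\<Sum>k=n..N n. l n k * (w k \<tau> x * ?x x)) \<partial>nu)"
          by (subst Bochner_Integration.integral_sum) (use iw in simp_all)
        also have "\<dots> = (\<integral>x. (1 / s) * (comb n \<tau> x * ?x x) \<partial>nu)"
          using s by (simp add: comb\<tau> sum_distrib_right mult.assoc)
        finally show ?thesis .
      qed
      also have "\<dots> = (1 / s) * (\<integral>x. comb n \<tau> x * ?x x \<partial>nu)" by (rule integral_mult_right_zero)
      also have "(\<integral>x. comb n \<tau> x * ?x x \<partial>nu) = (\<integral>x. g \<tau> x * ?x x \<partial>nu) + (\<integral>x. A n \<tau> x * ?x x \<partial>nu)"
      proof -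
        have cL: "comb n \<tau> \<in> L2 nu" unfolding comb\<tau>[abs_def] by (intro L2_scale L2_sum sk)
        show ?thesis unfolding A_def
          using L2_mult_integrable[OF cL xL] L2_mult_integrable[OF g\<tau> xL] by (simp add: left_diff_distrib)
      qed
      also have "phi \<xi> - (1 / s) * ((\<integral>x. g \<tau> x * ?x x \<partial>nu) + (\<integral>x. A n \<tau> x * ?x x \<partial>nu)) + (1 / s) * R n \<tau>
        \<le> phi \<xi> - (1 / s) * (\<integral>x. g \<tau> x * ?x x \<partial>nu) + (1 / s) * ((L2_norm nu ?x + 1) * Z n \<tau>)"
      proof -
        have cL: "comb n \<tau> \<in> L2 nu" unfolding comb\<tau>[abs_def] by (intro L2_scale L2_sum sk)
        have AL: "A n \<tau> \<in> L2 nu" unfolding A_def by (intro L2_diff cL g\<tau>)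
        have "- (\<integral>x. A n \<tau> x * ?x x \<partial>nu) + R n \<tau> \<le> L2_norm nu (A n \<tau>) * L2_norm nu ?x + R n \<tau>"
          using L2_Cauchy_Schwarz[OF AL xL] by simp
        also have "\<dots> \<le> (L2_norm nu ?x + 1) * Z n \<tau>"
          unfolding Z_def using R0[of n \<tau>] by (simp add: algebra_simps)
        finally have "(1 / s) * (- (\<integral>x. A n \<tau> x * ?x x \<partial>nu) + R n \<tau>) \<le> (1 / s) * ((L2_norm nu ?x + 1) * Z n \<tau>)"
          using s by (intro mult_left_mono) auto
        then show ?thesis by (simp only: distrib_left mult_minus_right)
      qed
      also have "(1 / s) * (\<integral>x. g \<tau> x * ?x x \<partial>nu) = (\<integral>x. wi \<tau> x * ?x x \<partial>nu)"
        unfolding wi\<tau> mult.assoc by (rule integral_mult_right_zero[symmetric])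
      finally show "(\<Sum>k=n..N n. l n k * phi (Ub k \<tau>))
        \<le> phi \<xi> - (\<integral>x. wi \<tau> x * ?x x \<partial>nu) + (1 / s) * (L2_norm nu ?x + 1) * Z n \<tau>" by (simp only: mult.assoc)
    qed
    have lim: "u \<tau> \<in> dom \<and> phi (u \<tau>) \<le> phi \<xi> - (\<integral>x. wi \<tau> x * (\<xi> x - u \<tau> x) \<partial>nu)" if \<xi>: "\<xi> \<in> dom" for \<xi>
    proof -
      let ?c = "phi \<xi> - (\<integral>x. wi \<tau> x * (\<xi> x - u \<tau> x) \<partial>nu)" and ?m = "(1 / s) * (L2_norm nu (\<lambda>x. \<xi> x - u \<tau> x) + 1)"
      have "\<forall>n. \<exists>k. r n \<le> k \<and> phi (Ub k \<tau>) \<le> ?c + ?m * Z (r n) \<tau>"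
        using bound[OF \<xi>] by blast
      from choice[OF this] obtain \<kappa>
        where \<kappa>: "\<And>n. r n \<le> \<kappa> n" "\<And>n. phi (Ub (\<kappa> n) \<tau>) \<le> ?c + ?m * Z (r n) \<tau>" by blast
      have ge: "n \<le> \<kappa> n" for n using \<kappa>(1)[of n] seq_suble[OF r, of n] by simp
      have Ulim: "(\<lambda>n. L2_norm nu (\<lambda>x. Ub (\<kappa> n) \<tau> x - u \<tau> x)) \<longlonglongrightarrow> 0"
      proof (rule Lim_null_comparison)
        show "\<forall>\<^sub>F n in sequentially. norm (L2_norm nu (\<lambda>x. Ub (\<kappa> n) \<tau> x - u \<tau> x)) \<le> 2 * \<rho> n"
          using close decseqD[OF \<rho>(2) ge] by (intro always_eventually allI) (simp add: order_trans[OF close])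
        show "(\<lambda>n. 2 * \<rho> n) \<longlonglongrightarrow> 0" using tendsto_mult_left[OF \<rho>(1), of 2] by simp
      qed
      have climit: "(\<lambda>n. ?c + ?m * Z (r n) \<tau>) \<longlonglongrightarrow> ?c + ?m * 0" by (intro tendsto_intros Z)
      have res: "u \<tau> \<in> dom \<and> phi (u \<tau>) \<le> ?c + e" if "0 < e" for e
      proof -
        have "\<forall>\<^sub>F n in sequentially. ?c + ?m * Z (r n) \<tau> < ?c + e"
          by (rule order_tendstoD(2)[OF climit]) (use that in simp)
        then have "\<forall>\<^sub>F n in sequentially. phi (Ub (\<kappa> n) \<tau>) \<le> ?c + e"
          by eventually_elim (use \<kappa>(2) in \<open>meson less_imp_le order_trans\<close>)
        from phi_lsc[OF sk(1) u\<tau> Ulim this] show ?thesis by simp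
      qed
      have "phi (u \<tau>) \<le> ?c" by (rule field_le_epsilon) (use res in blast)
      then show ?thesis using res[of 1] by simp
    qed
    show "subdiff (u \<tau>) (wi \<tau>)"
      unfolding subdiff_def
    proof (intro conjI wiL ballI)
      show "u \<tau> \<in> dom" using lim[OF zero_dom] by simp
      show "phi (u \<tau>) + (\<integral>x. wi \<tau> x * (\<xi> x - u \<tau> x) \<partial>nu) \<le> phi \<xi>" if "\<xi> \<in> dom" for \<xi>
        using lim[OF that] by simp
    qed
  qed
  have cont: "((\<lambda>s. L2_norm nu (\<lambda>x. u s x - u t x)) \<longlongrightarrow> 0) (at t within {0..T})" if t: "0 \<le> t" "t \<le> T" for t
  proof (rule tendstoI)
    fix e :: real assume e: "0 < e"
    obtain j where j: "\<rho> j < e / 4" using \<rho>small[of "e/4"] e by auto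
    define D where "D = L2_norm Q (case_prod F) + L2_norm Q (case_prod (w j))"
    have M: "0 \<le> D" by (simp add: D_def)
    \<comment> \<open>With this \<open>d\<close> the modulus of the j-th curve contributes at most e
      / 4; two further contributions are distances below \<open>\<rho> j\<close>. The 1 in D + 1
      excludes division by zero.\<close>
    define d where "d = (e / (4 * (D + 1)))\<^sup>2"
    have D4: "0 < 4 * (D + 1)" using M by (intro mult_pos_pos add_nonneg_pos) simp_all
    have d: "0 < d" unfolding d_def by (intro zero_less_power divide_pos_pos e D4)
    show "\<forall>\<^sub>F s in at t within {0..T}. Real_Vector_Spaces.dist (L2_norm nu (\<lambda>x. u s x - u t x)) 0 < e"
      unfolding eventually_at
    proof (intro exI[of _ d] conjI d ballI impI)
      fix s assume "s \<in> {0..T}" and "s \<noteq> t \<and> Real_Vector_Spaces.dist s t < d"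
      then have s: "0 \<le> s" "s \<le> T" "\<bar>s - t\<bar> < d" by (auto simp: dist_real_def)
      have mod: "L2_norm nu (\<lambda>x. ?u j s x - ?u j t x) \<le> sqrt \<bar>s - t\<bar> * D"
      proof (cases "t \<le> s")
        case True
        then show ?thesis using cur_modulus[OF F w a t(1), of s j j] by (simp add: D_def)
      next
        case False
        then show ?thesis using cur_modulus[OF F w a s(1), of t j j] L2_norm_minus_commute[of nu "?u j s" "?u j t"] by (simp add: D_def)
      qed
      have "sqrt \<bar>s - t\<bar> \<le> e / (4 * (D + 1))"
      proof -
        have "0 \<le> e / (4 * (D + 1))" by (intro divide_nonneg_nonneg less_imp_le[OF e] less_imp_le[OF D4])
        then show ?thesis using real_sqrt_le_mono[OF less_imp_le[OF s(3)]] unfolding d_def real_sqrt_abs by linarith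
      qed
      then have "sqrt \<bar>s - t\<bar> * D \<le> e / (4 * (D + 1)) * D" using M by (rule mult_right_mono)
      also have "\<dots> \<le> e / (4 * (D + 1)) * (D + 1)" by (intro mult_left_mono divide_nonneg_nonneg less_imp_le[OF e] less_imp_le[OF D4]) simp
      also have "\<dots> = e / 4"
      proof -
        have "e / (4 * z) * z = e / 4" if "z \<noteq> 0" for z :: real using that by simp
        moreover have "D + 1 \<noteq> 0" using D4 by auto
        ultimately show ?thesis by blast
      qed
      finally have 1: "L2_norm nu (\<lambda>x. ?u j s x - ?u j t x) \<le> e / 4" using mod by simp
      have "L2_norm nu (\<lambda>x. u s x - u t x) \<le> L2_norm nu (\<lambda>x. u s x - ?u j s x) + L2_norm nu (\<lambda>x. ?u j s x - u t x)"
        by (intro L2_norm_triangle3 u uL s t)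
      moreover have "L2_norm nu (\<lambda>x. ?u j s x - u t x) \<le> L2_norm nu (\<lambda>x. ?u j s x - ?u j t x) + L2_norm nu (\<lambda>x. ?u j t x - u t x)"
        by (intro L2_norm_triangle3 u uL s t)
      ultimately have "L2_norm nu (\<lambda>x. u s x - u t x) < e"
        using 1 e unif[OF s(1,2), of j] unif[OF t, of j] j L2_norm_minus_commute[of nu "u s" "?u j s"] by linarith
      then show "Real_Vector_Spaces.dist (L2_norm nu (\<lambda>x. u s x - u t x)) 0 < e" by simp
    qed
  qed
  have init: "AE x in nu. u 0 x = u0 x"
  proof -
    have u0L: "u 0 \<in> L2 nu" using u[of 0] T by simp
    have "L2_norm nu (\<lambda>x. u 0 x - u0 x) \<le> L2_norm nu (\<lambda>x. a j x - u 0 x) + L2_norm nu (\<lambda>x. a j x - u0 x)" for j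
      using L2_norm_triangle3[OF u0L a u0, of j] L2_norm_minus_commute[of nu "u 0" "a j"] by simp
    moreover have "(\<lambda>j. L2_norm nu (\<lambda>x. a j x - u 0 x) + L2_norm nu (\<lambda>x. a j x - u0 x)) \<longlonglongrightarrow> 0"
      using tendsto_add[OF ulim[of 0] a_lim] T by simp
    ultimately have "L2_norm nu (\<lambda>x. u 0 x - u0 x) \<le> 0"
      by (intro tendsto_lowerbound[where f="\<lambda>j. L2_norm nu (\<lambda>x. a j x - u 0 x) + L2_norm nu (\<lambda>x. a j x - u0 x)"]) auto
    then have "L2_norm nu (\<lambda>x. u 0 x - u0 x) = 0" by (simp add: order_antisym)
    from L2_norm_zero_AE[OF L2_diff[OF u0L u0] this] show ?thesis by simp
  qed
  have "strong_solution nu subdiff T u0 f u"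
    unfolding strong_solution_def
  proof (intro conjI ballI exI[of _ v] allI impI init)
    show "case_prod v \<in> borel_measurable (restrict_space lborel {0<..<T} \<Otimes>\<^sub>M nu)"
      by (rule restrict_meas[OF v_meas])
  next
    fix s t assume st: "0 < s \<and> s \<le> t \<and> t < T"
    have "(\<integral>\<^sup>+\<tau>\<in>{s..t}. (\<integral>\<^sup>+x. ennreal ((v \<tau> x)\<^sup>2) \<partial>nu) \<partial>lborel) = (\<integral>\<^sup>+\<tau>. (\<integral>\<^sup>+x. ennreal ((indicator {s..t} \<tau> * v \<tau> x)\<^sup>2) \<partial>nu) \<partial>lborel)"
      by (intro nn_integral_cong) (auto simp: indicator_def)
    then show "(\<integral>\<^sup>+\<tau>\<in>{s..t}. (\<integral>\<^sup>+x. ennreal ((v \<tau> x)\<^sup>2) \<partial>nu) \<partial>lborel) < \<infinity>"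
      using LQ_nn_integral_finite[OF v_LQ[of s t]] st by simp
  next
    fix s t assume st: "0 < s \<and> s \<le> t \<and> t < T"
    then show "AE x in nu. u t x = u s x + (LBINT \<tau>=s..t. v \<tau> x)"
      using incr[of s t] tint_LBINT[of s t] by simp
  next
    show "AE \<tau> in lborel. \<tau> \<in> {0<..<T} \<longrightarrow> v \<tau> \<in> L2 nu \<and> subdiff (u \<tau>) (\<lambda>x. f \<tau> x - v \<tau> x)"
      using incl LQ_section[OF F]
    proof (eventually_elim, intro impI)
      fix \<tau> assume H: "0 < \<tau> \<longrightarrow> \<tau> < T \<longrightarrow> subdiff (u \<tau>) (wi \<tau>)" "F \<tau> \<in> L2 nu" "\<tau> \<in> {0<..<T}"
      then have s: "subdiff (u \<tau>) (wi \<tau>)" and eq: "F \<tau> = f \<tau>" using f[of \<tau>] by auto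
      have "(\<lambda>x. f \<tau> x - v \<tau> x) = wi \<tau>" by (simp add: v_def eq)
      moreover have "v \<tau> \<in> L2 nu" unfolding v_def by (intro L2_diff H subdiffD(3)[OF s])
      ultimately show "v \<tau> \<in> L2 nu \<and> subdiff (u \<tau>) (\<lambda>x. f \<tau> x - v \<tau> x)" using s by simp
    qed
  qed (use u cont in auto)
  then show ?thesis by blast
qed

text \<open>Initial values \<open>a j\<close> of finite energy approach \<open>u0\<close>, and each
  is approximated by Euler schemes with n + 1 steps. The bound \<open>c j\<close> on the
  subgradients may grow with j, so the number of steps has to depend on j, which is the role of
  \<open>M j\<close>.\<close>

theorem gradient_flow_exists:
  assumes u0: "u0 \<in> L2 nu" and f: "f \<in> L2_time nu T" and T: "0 < T"
  shows "\<exists>u. strong_solution nu subdiff T u0 f u"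
proof -
  define F where "F \<tau> x = indicator {0<..<T} \<tau> * f \<tau> x" for \<tau> x
  have F: "F \<in> LQ" unfolding F_def by (rule L2_time_LQ[OF f])
  have Ff: "F \<tau> = f \<tau>" if "0 < \<tau>" "\<tau> < T" for \<tau> using that by (auto simp: F_def)
  define E where "E = (L2_norm Q (case_prod F))\<^sup>2"
  have E: "0 \<le> E" by (simp add: E_def)
  obtain b where b: "\<And>n::nat. b n \<in> L2 nu \<and> Phi (b n) < \<infinity>" and blim: "(\<lambda>n. L2_norm nu (\<lambda>x. b n x - u0 x)) \<longlonglongrightarrow> 0"
    using Phi_dense[OF u0] by blast
  have "\<exists>a\<in>dom. L2_norm nu (\<lambda>x. a x - u0 x) < (1/2)^j" for j :: nat
  proof -
    have "\<forall>\<^sub>F n in sequentially. L2_norm nu (\<lambda>x. b n x - u0 x) < (1/2)^j" by (rule order_tendstoD(2)[OF blim]) simp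
    then show ?thesis using eventually_happens'[OF sequentially_bot] b by (fastforce simp: dom_def)
  qed
  then obtain a where a: "\<And>j. a j \<in> dom" and a_close: "\<And>j::nat. L2_norm nu (\<lambda>x. a j x - u0 x) < (1/2)^j" by metis
  note aL = dom_L2[OF a]
  let ?K = "\<lambda>y. y\<^sup>2 + (y + (T + E) / 2) * (T + E) + T * E"
  define \<delta> where "\<delta> j n = sqrt (T / real (Suc n)) * (sqrt E + sqrt (2 * phi (a j) + E))" for j n
  have ex: "\<exists>w Ub. w \<in> LQ \<and> (L2_norm Q (case_prod w))\<^sup>2 \<le> 2 * phi (a j) + E \<and>
    (L2_norm Q (case_prod (sqw T w)))\<^sup>2 \<le> 2 * (T / real (Suc n)) * phi (a j) + (L2_norm nu (a j))\<^sup>2 + (L2_norm nu (a j) + (T + E) / 2) * (T + E) + T * E \<and>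
    (\<forall>\<tau>. 0 < \<tau> \<longrightarrow> \<tau> < T \<longrightarrow> subdiff (Ub \<tau>) (w \<tau>) \<and> L2_norm nu (\<lambda>x. cur F (a j) w \<tau> x - Ub \<tau> x) \<le> \<delta> j n)"
    (is "\<exists>w Ub. ?R j n w Ub") for j n
    using euler_approximation[OF F a T, of "Suc n" j] unfolding E_def \<delta>_def by simp
  define w where "w j n = (SOME w. \<exists>Ub. ?R j n w Ub)" for j n
  have ex': "\<exists>Ub. ?R j n (w j n) Ub" for j n unfolding w_def by (rule someI_ex[OF ex])
  define Ub where "Ub j n = (SOME Ub. ?R j n (w j n) Ub)" for j n
  have R: "?R j n (w j n) (Ub j n)" for j n unfolding Ub_def by (rule someI_ex[OF ex'])
  have w: "w j n \<in> LQ" and wn: "(L2_norm Q (case_prod (w j n)))\<^sup>2 \<le> 2 * phi (a j) + E"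
    and ww: "(L2_norm Q (case_prod (sqw T (w j n))))\<^sup>2 \<le> 2 * (T / real (Suc n)) * phi (a j) + (L2_norm nu (a j))\<^sup>2 + (L2_norm nu (a j) + (T + E) / 2) * (T + E) + T * E" for j n
    using R[of j n] by blast+
  have ap: "subdiff (Ub j n \<tau>) (w j n \<tau>) \<and> L2_norm nu (\<lambda>x. cur F (a j) (w j n) \<tau> x - Ub j n \<tau> x) \<le> \<delta> j n"
    if "0 < \<tau>" "\<tau> < T" for j n \<tau>
    using R[of j n] that by blast
  define c where "c j = sqrt (2 * phi (a j) + E)" for j
  have c: "L2_norm Q (case_prod (w j n)) \<le> c j" "0 \<le> c j" for j n
    using wn[of j n] E by (auto simp: c_def real_le_rsqrt)
  have \<delta>0: "0 \<le> \<delta> j n" for j n using T E by (simp add: \<delta>_def)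
  have inv_lim: "(\<lambda>n. T / real (Suc n)) \<longlonglongrightarrow> 0"
    using LIMSEQ_Suc[OF lim_const_over_n[of T]] by simp
  have \<delta>lim: "\<delta> j \<longlonglongrightarrow> 0" for j
  proof -
    have "(\<lambda>n. sqrt (T / real (Suc n)) * (sqrt E + sqrt (2 * phi (a j) + E))) \<longlonglongrightarrow> sqrt 0 * (sqrt E + sqrt (2 * phi (a j) + E))"
      by (intro tendsto_intros inv_lim)
    then show ?thesis by (simp add: \<delta>_def[abs_def])
  qed
  let ?u = "\<lambda>j n. cur F (a j) (w j n)"
  have d: "(L2_norm nu (\<lambda>x. ?u j n t x - ?u i m t x))\<^sup>2 \<le> (L2_norm nu (\<lambda>x. a j x - a i x))\<^sup>2 + 2 * (sqrt T * (c j + c i) * (\<delta> j n + \<delta> i m))"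
    if t: "0 \<le> t" "t \<le> T" for i j n m t
  proof -
    have "sqrt T * (L2_norm Q (case_prod (w j n)) + L2_norm Q (case_prod (w i m))) * (\<delta> j n + \<delta> i m) \<le> sqrt T * (c j + c i) * (\<delta> j n + \<delta> i m)"
      using T \<delta>0 c by (intro mult_right_mono mult_left_mono add_mono) auto
    then show ?thesis
      using approximation_distance[OF F w w aL aL ap ap \<delta>0 \<delta>0 t, of j n i m] by linarith
  qed
  \<comment> \<open>Chosen so that replacing the scheme of level \<open>M j\<close> by any finer one
    moves the curve by at most (1/2)^j; in squared form this asks for 8 sqrt T c j \<kappa> j \<le>
    (1/4)^j.\<close>
  define \<kappa> where "\<kappa> j = (1/4)^j / (8 * (sqrt T * c j) + 1)" for j :: nat
  have \<kappa>: "0 < \<kappa> j" "8 * (sqrt T * c j) * \<kappa> j \<le> (1/4)^j" for j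
  proof -
    have x: "0 \<le> 8 * (sqrt T * c j)" using c T by simp
    then show "0 < \<kappa> j" unfolding \<kappa>_def by (intro divide_pos_pos) auto
    have "8 * (sqrt T * c j) * \<kappa> j = (1/4)^j * (8 * (sqrt T * c j) / (8 * (sqrt T * c j) + 1))" by (simp add: \<kappa>_def)
    also have "\<dots> \<le> (1/4)^j * 1" using x by (intro mult_left_mono) (auto simp: divide_le_eq)
    finally show "8 * (sqrt T * c j) * \<kappa> j \<le> (1/4)^j" by simp
  qed
  have "\<exists>M. \<forall>n\<ge>M. \<delta> j n < \<kappa> j \<and> \<delta> j n < (1/2)^j \<and> (T / real (Suc n)) * phi (a j) < 1" for j
  proof -
    have l: "(\<lambda>n. (T / real (Suc n)) * phi (a j)) \<longlonglongrightarrow> 0" using tendsto_mult_left_zero[OF inv_lim] .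
    have "\<forall>\<^sub>F n in sequentially. \<delta> j n < \<kappa> j \<and> \<delta> j n < (1/2)^j \<and> (T / real (Suc n)) * phi (a j) < 1"
      by (intro eventually_conj order_tendstoD(2)[OF \<delta>lim] order_tendstoD(2)[OF l] \<kappa>) simp_all
    then show ?thesis by (simp add: eventually_sequentially)
  qed
  then obtain M where M: "\<And>j n. M j \<le> n \<Longrightarrow> \<delta> j n < \<kappa> j" "\<And>j n. M j \<le> n \<Longrightarrow> \<delta> j n < (1/2)^j"
    "\<And>j n. M j \<le> n \<Longrightarrow> (T / real (Suc n)) * phi (a j) < 1" by metis
  have d1: "L2_norm nu (\<lambda>x. ?u j (M j) t x - ?u j n t x) \<le> (1/2)^j" if t: "0 \<le> t" "t \<le> T" and n: "M j \<le> n" for j n t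
  proof (rule power2_le_imp_le)
    have "sqrt T * (c j + c j) * (\<delta> j (M j) + \<delta> j n) \<le> sqrt T * (c j + c j) * (\<kappa> j + \<kappa> j)"
      using M(1)[of j] n T c by (intro mult_left_mono add_mono) (auto intro: less_imp_le)
    also have "\<dots> = (8 * (sqrt T * c j) * \<kappa> j) / 2" by (simp add: algebra_simps)
    finally have "(L2_norm nu (\<lambda>x. ?u j (M j) t x - ?u j n t x))\<^sup>2 \<le> (L2_norm nu (\<lambda>x. a j x - a j x))\<^sup>2 + (1/4)^j"
      using d[OF t, of j "M j" j n] \<kappa>(2)[of j] by linarith
    then show "(L2_norm nu (\<lambda>x. ?u j (M j) t x - ?u j n t x))\<^sup>2 \<le> ((1/2)^j)\<^sup>2"
      by (simp add: power2_eq_square power_mult_distrib[symmetric])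
  qed simp
  define \<rho> :: "nat \<Rightarrow> real" where "\<rho> j = 2 * (1/2)^j" for j
  have da: "L2_norm nu (\<lambda>x. a i x - a j x) \<le> (1/2)^i + (1/2)^j" for i j
    using L2_norm_triangle3[OF aL u0 aL, of i j] a_close[of i] a_close[of j] L2_norm_minus_commute[of nu u0 "a j"] by linarith
  \<comment> \<open>The bound for two schemes contains (c i + c j) times the step errors, a product
    that need not be small at the levels \<open>M i\<close> and \<open>M j\<close>. Both curves are
    therefore compared with finer ones of a common level n, and n tends to infinity.\<close>
  have dist: "L2_norm nu (\<lambda>x. ?u i (M i) t x - ?u j (M j) t x) \<le> \<rho> i + \<rho> j" if t: "0 \<le> t" "t \<le> T" for i j t
  proof (rule tendsto_lowerbound)
    have uL: "?u i n t \<in> L2 nu" for i n by (intro cur_L2 F w aL t)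
    let ?s = "\<lambda>n. (1/2)^i + (1/2)^j + sqrt ((L2_norm nu (\<lambda>x. a i x - a j x))\<^sup>2 + 2 * (sqrt T * (c i + c j) * (\<delta> i n + \<delta> j n)))"
    \<comment> \<open>The added constant is nonnegative by \<open>da\<close> and raises the limit to
      exactly \<open>\<rho> i + \<rho> j\<close>.\<close>
    have "(\<lambda>n. ?s n + (\<rho> i + \<rho> j - ((1/2)^i + (1/2)^j + L2_norm nu (\<lambda>x. a i x - a j x))))
      \<longlonglongrightarrow> ((1/2)^i + (1/2)^j + sqrt ((L2_norm nu (\<lambda>x. a i x - a j x))\<^sup>2 + 2 * (sqrt T * (c i + c j) * (0 + 0))))
        + (\<rho> i + \<rho> j - ((1/2)^i + (1/2)^j + L2_norm nu (\<lambda>x. a i x - a j x)))"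
      by (intro tendsto_intros \<delta>lim)
    then show "(\<lambda>n. ?s n + (\<rho> i + \<rho> j - ((1/2)^i + (1/2)^j + L2_norm nu (\<lambda>x. a i x - a j x)))) \<longlonglongrightarrow> \<rho> i + \<rho> j" by simp
    show "\<forall>\<^sub>F n in sequentially. L2_norm nu (\<lambda>x. ?u i (M i) t x - ?u j (M j) t x)
      \<le> ?s n + (\<rho> i + \<rho> j - ((1/2)^i + (1/2)^j + L2_norm nu (\<lambda>x. a i x - a j x)))"
      unfolding eventually_sequentially
    proof (intro exI[of _ "max (M i) (M j)"] allI impI)
      fix n assume n: "max (M i) (M j) \<le> n"
      have "L2_norm nu (\<lambda>x. ?u i (M i) t x - ?u j (M j) t x) \<le> L2_norm nu (\<lambda>x. ?u i (M i) t x - ?u i n t x) + L2_norm nu (\<lambda>x. ?u i n t x - ?u j (M j) t x)"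
        by (intro L2_norm_triangle3 uL)
      also have "L2_norm nu (\<lambda>x. ?u i n t x - ?u j (M j) t x) \<le> L2_norm nu (\<lambda>x. ?u i n t x - ?u j n t x) + L2_norm nu (\<lambda>x. ?u j n t x - ?u j (M j) t x)"
        by (intro L2_norm_triangle3 uL)
      also have "L2_norm nu (\<lambda>x. ?u i n t x - ?u j n t x) \<le> sqrt ((L2_norm nu (\<lambda>x. a i x - a j x))\<^sup>2 + 2 * (sqrt T * (c i + c j) * (\<delta> i n + \<delta> j n)))"
        by (intro real_le_rsqrt d t)
      finally show "L2_norm nu (\<lambda>x. ?u i (M i) t x - ?u j (M j) t x)
        \<le> ?s n + (\<rho> i + \<rho> j - ((1/2)^i + (1/2)^j + L2_norm nu (\<lambda>x. a i x - a j x)))"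
        using d1[OF t, of i n] d1[OF t, of j n] n L2_norm_minus_commute[of nu "?u j n t" "?u j (M j) t"] da[of i j]
        unfolding \<rho>_def by simp
    qed
  qed simp
  have geo: "(\<lambda>j. (1/2::real)^j) \<longlonglongrightarrow> 0" by (rule LIMSEQ_power_zero) simp
  define R where "R = L2_norm nu u0 + 1"
  \<comment> \<open>The 2 covers the term with \<open>phi (a j)\<close>, which the third condition
    on \<open>M j\<close> keeps below 2; \<open>R\<close> bounds the norms of all the
    \<open>a j\<close>.\<close>
  define C where "C = sqrt (2 + R\<^sup>2 + (R + (T + E) / 2) * (T + E) + T * E)"
  show ?thesis
  proof (rule approximation_limit[where F=F and w="\<lambda>j. w j (M j)" and a=a and Ub="\<lambda>j. Ub j (M j)" and \<rho>=\<rho> and C=C, OF F T u0 w aL])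
    show "(\<lambda>j. L2_norm nu (\<lambda>x. a j x - u0 x)) \<longlonglongrightarrow> 0"
      by (rule Lim_null_comparison[OF _ geo]) (use a_close in \<open>auto intro!: always_eventually less_imp_le\<close>)
    show "\<rho> \<longlonglongrightarrow> 0" using tendsto_mult_left[OF geo, of 2] by (simp add: \<rho>_def[abs_def])
    show "decseq \<rho>" unfolding decseq_def \<rho>_def by (auto intro!: power_decreasing)
    fix j :: nat
    show "subdiff (Ub j (M j) \<tau>) (w j (M j) \<tau>)" if "0 < \<tau>" "\<tau> < T" for \<tau> using ap[OF that] by blast
    show "L2_norm nu (\<lambda>x. ?u j (M j) \<tau> x - Ub j (M j) \<tau> x) \<le> \<rho> j" if "0 < \<tau>" "\<tau> < T" for \<tau>
    proof -
      have "0 \<le> (1/2::real)^j" by simp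
      then show ?thesis using ap[OF that, of j "M j"] M(2)[of j "M j"] unfolding \<rho>_def by linarith
    qed
    show "L2_norm Q (case_prod (sqw T (w j (M j)))) \<le> C"
      unfolding C_def
    proof (rule real_le_rsqrt)
      have aR: "L2_norm nu (a j) \<le> R"
      proof -
        have "L2_norm nu (a j) \<le> L2_norm nu (\<lambda>x. a j x - u0 x) + L2_norm nu u0"
          using L2_norm_triangle[OF L2_diff[OF aL u0] u0, of j] by simp
        moreover have "(1/2::real)^j \<le> 1" by (simp add: power_le_one)
        ultimately show ?thesis using a_close[of j] unfolding R_def by linarith
      qed
      have "(L2_norm nu (a j))\<^sup>2 \<le> R\<^sup>2" by (intro power_mono aR) simp
      moreover have "(L2_norm nu (a j) + (T + E) / 2) * (T + E) \<le> (R + (T + E) / 2) * (T + E)"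
        using aR T E by (intro mult_right_mono) auto
      ultimately show "(L2_norm Q (case_prod (sqw T (w j (M j)))))\<^sup>2 \<le> 2 + R\<^sup>2 + (R + (T + E) / 2) * (T + E) + T * E"
        using ww[of j "M j"] M(3)[of j "M j"] mult.assoc[of 2 "T / real (Suc (M j))" "phi (a j)"] by linarith
    qed
  qed (use dist Ff in auto)
qed

end

section \<open>Integration over pairs of neighbours\<close>

definition psi :: "real \<Rightarrow> real \<Rightarrow> real" where "psi p s = \<bar>s\<bar> powr (p - 2) * s"

lemma psi_mult: "psi p s * s = \<bar>s\<bar> powr p"
proof (cases "s = 0")
  case False
  then have "\<bar>s\<bar> powr (p - 2) * (s * s) = \<bar>s\<bar> powr (p - 2) * \<bar>s\<bar> powr 2"
    by (simp add: power2_eq_square powr_numeral)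
  also have "\<dots> = \<bar>s\<bar> powr p" unfolding powr_add[symmetric] by simp
  finally show ?thesis by (simp add: psi_def mult.assoc)
qed (simp add: psi_def)

lemma abs_psi: "\<bar>psi p s\<bar> = \<bar>s\<bar> powr (p - 1)"
proof (cases "s = 0")
  case False
  then have "\<bar>psi p s\<bar> = \<bar>s\<bar> powr (p - 2) * \<bar>s\<bar> powr 1" by (simp add: psi_def abs_mult)
  also have "\<dots> = \<bar>s\<bar> powr (p - 1)" unfolding powr_add[symmetric] by simp
  finally show ?thesis .
qed (simp add: psi_def)

lemma psi_minus: "psi p (- s) = - psi p s"
  by (simp add: psi_def)

text \<open>In this form continuity at 0 is visible also for p < 2, where |s|^(p-2) is
  singular.\<close>

lemma psi_split: "psi p s = (max s 0) powr (p - 1) - (max (- s) 0) powr (p - 1)"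
  using abs_psi[of p s] by (cases s "0::real" rule: linorder_cases) (auto simp: psi_def max_def abs_mult)

text \<open>Young's inequality with the exponents p and p / (p - 1) for the product of |b| and |psi
  p a|; differentiability at 0 never comes up.\<close>

lemma psi_subgradient:
  assumes p: "1 < p"
  shows "\<bar>a\<bar> powr p + p * psi p a * (b - a) \<le> \<bar>b\<bar> powr p"
proof -
  define q where "q = p / (p - 1)"
  have q: "1 < q" "1 / p + 1 / q = 1" "(p - 1) * q = p" using p by (auto simp: q_def field_simps)
  have "\<bar>b\<bar> * \<bar>psi p a\<bar> \<le> \<bar>b\<bar> powr p / p + \<bar>psi p a\<bar> powr q / q"
    by (rule Youngs_inequality[OF p q(1,2)]) simp_all
  also have "\<bar>psi p a\<bar> powr q = \<bar>a\<bar> powr p" unfolding abs_psi powr_powr q(3) ..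
  also have "1 / q = 1 - 1 / p" using q(2) by simp
  then have "\<bar>a\<bar> powr p / q = \<bar>a\<bar> powr p * (1 - 1 / p)" by (metis mult.commute mult.left_neutral times_divide_eq_left)
  finally have "p * (\<bar>b\<bar> * \<bar>psi p a\<bar>) \<le> p * (\<bar>b\<bar> powr p / p + \<bar>a\<bar> powr p * (1 - 1 / p))"
    using p by (intro mult_left_mono) auto
  also have "\<dots> = \<bar>b\<bar> powr p + \<bar>a\<bar> powr p * (p - 1)" using p by (simp add: field_simps)
  finally have 1: "p * (\<bar>b\<bar> * \<bar>psi p a\<bar>) \<le> \<bar>b\<bar> powr p + \<bar>a\<bar> powr p * (p - 1)" .
  have "psi p a * b \<le> \<bar>b\<bar> * \<bar>psi p a\<bar>" by (metis abs_ge_self abs_mult mult.commute)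
  then have "p * (psi p a * b) \<le> p * (\<bar>b\<bar> * \<bar>psi p a\<bar>)" using p by (intro mult_left_mono) auto
  moreover have "p * psi p a * (b - a) = p * (psi p a * b) - p * \<bar>a\<bar> powr p"
    using psi_mult[of p a] by (simp add: algebra_simps)
  moreover have "\<bar>a\<bar> powr p * (p - 1) = p * \<bar>a\<bar> powr p - \<bar>a\<bar> powr p" by (simp add: algebra_simps)
  ultimately show ?thesis using 1 by linarith
qed

lemma psi_monotone:
  assumes p: "1 < p"
  shows "0 \<le> (psi p a - psi p b) * (a - b)"
proof -
  have "p * ((psi p a - psi p b) * (a - b)) \<ge> 0"
    using psi_subgradient[OF p, of a b] psi_subgradient[OF p, of b a] by (simp add: algebra_simps)
  then show ?thesis using p by (simp add: zero_le_mult_iff)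
qed

text \<open>Average of the two supporting-line inequalities taken at the convex combination itself;
  the linear terms cancel.\<close>

lemma abs_powr_convex:
  fixes a b \<theta> :: real
  assumes p: "1 < p" and \<theta>: "0 \<le> \<theta>" "\<theta> \<le> 1"
  shows "\<bar>(1 - \<theta>) * a + \<theta> * b\<bar> powr p \<le> (1 - \<theta>) * \<bar>a\<bar> powr p + \<theta> * \<bar>b\<bar> powr p"
proof -
  let ?c = "(1 - \<theta>) * a + \<theta> * b"
  have "(1 - \<theta>) * (\<bar>?c\<bar> powr p + p * psi p ?c * (a - ?c)) + \<theta> * (\<bar>?c\<bar> powr p + p * psi p ?c * (b - ?c))
      \<le> (1 - \<theta>) * \<bar>a\<bar> powr p + \<theta> * \<bar>b\<bar> powr p"
    using \<theta> by (intro add_mono mult_left_mono psi_subgradient[OF p]) auto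
  also have "(1 - \<theta>) * (\<bar>?c\<bar> powr p + p * psi p ?c * (a - ?c)) + \<theta> * (\<bar>?c\<bar> powr p + p * psi p ?c * (b - ?c))
     = \<bar>?c\<bar> powr p + p * psi p ?c * ((1 - \<theta>) * (a - ?c) + \<theta> * (b - ?c))" by (simp add: algebra_simps)
  also have "(1 - \<theta>) * (a - ?c) + \<theta> * (b - ?c) = 0" by (simp add: algebra_simps)
  finally show ?thesis by simp
qed

lemma abs_powr_add_le:
  fixes a b :: real
  assumes p: "1 < p"
  shows "(\<bar>a\<bar> + \<bar>b\<bar>) powr p \<le> 2 powr p * (\<bar>a\<bar> powr p + \<bar>b\<bar> powr p)"
proof -
  have "(\<bar>a\<bar> + \<bar>b\<bar>) powr p = \<bar>(1 - 1/2) * (2 * \<bar>a\<bar>) + 1/2 * (2 * \<bar>b\<bar>)\<bar> powr p" by simp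
  also have "\<dots> \<le> (1 - 1/2) * \<bar>2 * \<bar>a\<bar>\<bar> powr p + 1/2 * \<bar>2 * \<bar>b\<bar>\<bar> powr p"
    by (rule abs_powr_convex[OF p]) auto
  also have "\<dots> = 2 powr p * (1/2) * (\<bar>a\<bar> powr p + \<bar>b\<bar> powr p)"
    by (simp add: abs_mult powr_mult algebra_simps)
  also have "\<dots> \<le> 2 powr p * 1 * (\<bar>a\<bar> powr p + \<bar>b\<bar> powr p)"
    by (intro mult_right_mono mult_left_mono) auto
  finally show ?thesis by simp
qed

text \<open>A majorant independent of \<theta>, for the dominated convergence that identifies the
  directional derivative in \<open>subdiff_directional\<close>.\<close>

lemma psi_perturbed_bound:
  assumes p: "1 < p" and \<theta>: "0 \<le> \<theta>" "\<theta> \<le> 1"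
  shows "\<bar>psi p (a + \<theta> * b) * b\<bar> \<le> 2 powr p * (\<bar>a\<bar> powr p + \<bar>b\<bar> powr p)"
proof -
  have "\<bar>\<theta> * b\<bar> \<le> \<bar>b\<bar>" using \<theta> mult_right_mono[of \<theta> 1 "\<bar>b\<bar>"] by (simp add: abs_mult)
  then have le: "\<bar>a + \<theta> * b\<bar> \<le> \<bar>a\<bar> + \<bar>b\<bar>" using abs_triangle_ineq[of a "\<theta> * b"] by linarith
  have "\<bar>psi p (a + \<theta> * b) * b\<bar> \<le> (\<bar>a\<bar> + \<bar>b\<bar>) powr (p - 1) * (\<bar>a\<bar> + \<bar>b\<bar>)"
    unfolding abs_mult abs_psi using p le by (intro mult_mono powr_mono2) auto
  also have "\<dots> = (\<bar>a\<bar> + \<bar>b\<bar>) powr p"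
    using powr_mult_base[of "\<bar>a\<bar> + \<bar>b\<bar>" "p - 1"] by (simp add: mult.commute)
  also have "\<dots> \<le> 2 powr p * (\<bar>a\<bar> powr p + \<bar>b\<bar> powr p)" by (rule abs_powr_add_le[OF p])
  finally show ?thesis .
qed

lemma tendsto_psi:
  assumes p: "1 < p" and f: "(f \<longlongrightarrow> a) F"
  shows "((\<lambda>x. psi p (f x)) \<longlongrightarrow> psi p a) F"
  unfolding psi_split using p
  by (intro tendsto_diff tendsto_powr2 tendsto_max tendsto_minus tendsto_const f) auto

lemma psi_meas [measurable]: "psi p \<in> borel_measurable borel"
  unfolding psi_def[abs_def] by measurable

text \<open>\<open>nonempty\<close> meets the side condition of the rule for the sigma-algebra of
  \<open>bind\<close>; the empty space is treated separately in \<open>theorem4p4\<close>.\<close>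

locale random_walk = time_space nu for nu :: "'a measure" +
  fixes m :: "'a \<Rightarrow> 'a measure" and A B :: "'a \<Rightarrow> 'a set" and p :: real
  assumes nonempty: "space nu \<noteq> {}"
    and m: "m \<in> nu \<rightarrow>\<^sub>M prob_algebra nu"
    and rev: "reversible nu m"
    and p: "1 < p"
    and A_meas: "{(x, y). x \<in> space nu \<and> y \<in> A x} \<in> sets (nu \<Otimes>\<^sub>M nu)"
    and B_meas: "{(x, y). x \<in> space nu \<and> y \<in> B x} \<in> sets (nu \<Otimes>\<^sub>M nu)"
    and finite_or: "emeasure nu (space nu) < \<infinity> \<or> 2 \<le> p"
begin

section \<open>The symmetric measure on pairs and its marginals\<close>

lemma m_prob: "x \<in> space nu \<Longrightarrow> prob_space (m x)" "x \<in> space nu \<Longrightarrow> sets (m x) = sets nu"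
  using measurable_space[OF m] by (auto simp: space_prob_algebra)

text \<open>The measure dm_x(y) dnu(x) on pairs. Double integrals become single ones, so the L2
  facts above apply to gradients, and reversibility becomes invariance under the swap of the
  coordinates.\<close>

definition M2 :: "('a \<times> 'a) measure" where
  "M2 = nu \<bind> (\<lambda>x. distr (m x) (nu \<Otimes>\<^sub>M nu) (\<lambda>y. (x, y)))"

lemma kernel_meas: "(\<lambda>x. distr (m x) (nu \<Otimes>\<^sub>M nu) (\<lambda>y. (x, y))) \<in> nu \<rightarrow>\<^sub>M subprob_algebra (nu \<Otimes>\<^sub>M nu)"
  by (rule measurable_distr2[OF _ measurable_prob_algebraD[OF m]]) simp

lemma sets_M2 [measurable_cong]: "sets M2 = sets (nu \<Otimes>\<^sub>M nu)"
  unfolding M2_def by (rule sets_bind[OF _ nonempty]) simp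

lemma meas_M2: "borel_measurable M2 = borel_measurable (nu \<Otimes>\<^sub>M nu)"
  by (rule measurable_cong_sets[OF sets_M2 refl])

lemma section_m: "x \<in> space nu \<Longrightarrow> (\<lambda>y. (x, y)) \<in> m x \<rightarrow>\<^sub>M nu \<Otimes>\<^sub>M nu"
  using measurable_Pair1'[of x nu nu] m_prob(2)[of x] by (simp cong: measurable_cong_sets)

lemma nn_integral_M2:
  assumes "h \<in> borel_measurable (nu \<Otimes>\<^sub>M nu)"
  shows "(\<integral>\<^sup>+w. h w \<partial>M2) = (\<integral>\<^sup>+x. \<integral>\<^sup>+y. h (x, y) \<partial>m x \<partial>nu)"
  unfolding M2_def nn_integral_bind[OF assms kernel_meas]
  by (intro nn_integral_cong nn_integral_distr section_m) (simp_all add: assms)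

lemma swap_M2: "distr M2 (nu \<Otimes>\<^sub>M nu) (\<lambda>(x, y). (y, x)) = M2"
proof (rule measure_eqI)
  show "sets (distr M2 (nu \<Otimes>\<^sub>M nu) (\<lambda>(x, y). (y, x))) = sets M2" by (simp add: sets_M2)
  fix C assume "C \<in> sets (distr M2 (nu \<Otimes>\<^sub>M nu) (\<lambda>(x, y). (y, x)))"
  then have C: "C \<in> sets (nu \<Otimes>\<^sub>M nu)" by simp
  have sw: "(\<lambda>(x, y). (y, x)) \<in> M2 \<rightarrow>\<^sub>M nu \<Otimes>\<^sub>M nu" by measurable
  have "emeasure (distr M2 (nu \<Otimes>\<^sub>M nu) (\<lambda>(x, y). (y, x))) C = (\<integral>\<^sup>+w. indicator C w \<partial>distr M2 (nu \<Otimes>\<^sub>M nu) (\<lambda>(x, y). (y, x)))"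
    using C by simp
  also have "\<dots> = (\<integral>\<^sup>+w. indicator C (case w of (x, y) \<Rightarrow> (y, x)) \<partial>M2)"
    using C by (intro nn_integral_distr[OF sw]) simp
  also have "\<dots> = (\<integral>\<^sup>+x. \<integral>\<^sup>+y. indicator C (y, x) \<partial>m x \<partial>nu)"
    using C by (subst nn_integral_M2) auto
  also have "\<dots> = (\<integral>\<^sup>+x. \<integral>\<^sup>+y. indicator C (x, y) \<partial>m x \<partial>nu)"
    using rev C by (simp add: reversible_def)
  also have "\<dots> = emeasure M2 C"
    using C by (subst nn_integral_M2[symmetric]) (simp_all add: sets_M2)
  finally show "emeasure (distr M2 (nu \<Otimes>\<^sub>M nu) (\<lambda>(x, y). (y, x))) C = emeasure M2 C" .
qed

lemma swap_meas: "(\<lambda>(x, y). (y, x)) \<in> M2 \<rightarrow>\<^sub>M nu \<Otimes>\<^sub>M nu" by measurable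

lemma fst_M2: "distr M2 nu fst = nu"
proof (rule measure_eqI)
  fix C assume "C \<in> sets (distr M2 nu fst)"
  then have C: "C \<in> sets nu" by simp
  have f: "fst \<in> M2 \<rightarrow>\<^sub>M nu" by measurable
  have "emeasure (distr M2 nu fst) C = (\<integral>\<^sup>+w. indicator C w \<partial>distr M2 nu fst)" using C by simp
  also have "\<dots> = (\<integral>\<^sup>+w. indicator C (fst w) \<partial>M2)" using C by (intro nn_integral_distr[OF f]) simp
  also have "\<dots> = (\<integral>\<^sup>+x. \<integral>\<^sup>+y. indicator C x \<partial>m x \<partial>nu)"
    using C by (subst nn_integral_M2) simp_all
  also have "\<dots> = (\<integral>\<^sup>+x. indicator C x \<partial>nu)"
    by (intro nn_integral_cong) (simp add: prob_space.emeasure_space_1[OF m_prob(1)])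
  finally show "emeasure (distr M2 nu fst) C = emeasure nu C" using C by simp
qed simp

text \<open>The swap carries the first marginal over to the second; this is the invariance of
  nu.\<close>

lemma snd_M2: "distr M2 nu snd = nu"
proof -
  have "distr M2 nu snd = distr (distr M2 (nu \<Otimes>\<^sub>M nu) (\<lambda>(x, y). (y, x))) nu fst"
    by (subst distr_distr) (auto simp: comp_def split_beta' intro!: distr_cong)
  then show ?thesis by (simp add: swap_M2 fst_M2)
qed

lemma proj_meas: "fst \<in> M2 \<rightarrow>\<^sub>M nu" "snd \<in> M2 \<rightarrow>\<^sub>M nu" by measurable

text \<open>Both marginals equal nu, so almost every pair has neither end point in a given null
  set.\<close>

lemma AE_M2:
  assumes "AE x in nu. P x"
  shows "AE w in M2. P (fst w) \<and> P (snd w)"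
proof -
  have "AE w in M2. P (fst w)" by (rule AE_distrD[OF proj_meas(1)]) (subst fst_M2, rule assms)
  moreover have "AE w in M2. P (snd w)" by (rule AE_distrD[OF proj_meas(2)]) (subst snd_M2, rule assms)
  ultimately show ?thesis by eventually_elim simp
qed

lemma integrable_fst_M2: "integrable nu f \<Longrightarrow> integrable M2 (\<lambda>w. f (fst w))" for f :: "'a \<Rightarrow> real"
  by (rule integrable_distr[OF proj_meas(1)]) (simp add: fst_M2)

lemma integrable_snd_M2: "integrable nu f \<Longrightarrow> integrable M2 (\<lambda>w. f (snd w))" for f :: "'a \<Rightarrow> real"
  by (rule integrable_distr[OF proj_meas(2)]) (simp add: snd_M2)

lemma nn_integral_fst_M2: "f \<in> borel_measurable nu \<Longrightarrow> (\<integral>\<^sup>+w. f (fst w) \<partial>M2) = (\<integral>\<^sup>+x. f x \<partial>nu)"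
  using nn_integral_distr[OF proj_meas(1), of f] by (simp add: fst_M2)

lemma L2_fst_M2: "u \<in> L2 nu \<Longrightarrow> (\<lambda>w. u (fst w)) \<in> L2 M2"
  and L2_snd_M2: "u \<in> L2 nu \<Longrightarrow> (\<lambda>w. u (snd w)) \<in> L2 M2"
  using measurable_compose[OF proj_meas(1)] measurable_compose[OF proj_meas(2)]
    integrable_fst_M2[of "\<lambda>x. (u x)\<^sup>2"] integrable_snd_M2[of "\<lambda>x. (u x)\<^sup>2"]
  by (auto simp: L2_def)

lemma integral_swap_M2:
  fixes h :: "'a \<times> 'a \<Rightarrow> real"
  assumes "h \<in> borel_measurable (nu \<Otimes>\<^sub>M nu)"
  shows "(\<integral>w. h (snd w, fst w) \<partial>M2) = (\<integral>w. h w \<partial>M2)"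
  using integral_distr[OF swap_meas assms] unfolding swap_M2 by (simp add: split_beta')

lemma integrable_swap_M2:
  fixes h :: "'a \<times> 'a \<Rightarrow> real"
  assumes "integrable M2 h"
  shows "integrable M2 (\<lambda>w. h (snd w, fst w))"
  using integrable_distr[OF swap_meas, of h] assms unfolding swap_M2 by (simp add: split_beta')

lemma kernel_integral_meas:
  fixes h :: "'a \<times> 'a \<Rightarrow> real"
  assumes h: "h \<in> borel_measurable (nu \<Otimes>\<^sub>M nu)"
  shows "(\<lambda>x. \<integral>y. h (x, y) \<partial>m x) \<in> borel_measurable nu"
proof -
  have "(\<lambda>x. integral\<^sup>L (distr (m x) (nu \<Otimes>\<^sub>M nu) (\<lambda>y. (x, y))) h) \<in> borel_measurable nu"
    by (rule measurable_compose[OF kernel_meas integral_measurable_subprob_algebra[OF h]])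
  then show ?thesis
    by (rule measurable_cong[THEN iffD1, rotated]) (simp add: integral_distr[OF section_m h])
qed

text \<open>\<open>M2\<close> comes from a kernel and is not a product measure. The claim is derived
  from \<open>nn_integral_M2\<close>, first for nonnegative functions and then by splitting into
  positive and negative parts.\<close>

lemma M2_Fubini:
  fixes h :: "'a \<times> 'a \<Rightarrow> real"
  assumes h: "integrable M2 h"
  shows "AE x in nu. integrable (m x) (\<lambda>y. h (x, y))"
    and "integrable nu (\<lambda>x. \<integral>y. h (x, y) \<partial>m x)"
    and "(\<integral>x. (\<integral>y. h (x, y) \<partial>m x) \<partial>nu) = (\<integral>w. h w \<partial>M2)"
proof -
  have hm: "h \<in> borel_measurable (nu \<Otimes>\<^sub>M nu)" using h by (simp add: meas_M2[symmetric])
  have nm: "(\<lambda>x. \<integral>\<^sup>+y. ennreal (k (x, y)) \<partial>m x) \<in> borel_measurable nu" if k: "k \<in> borel_measurable (nu \<Otimes>\<^sub>M nu)" for k :: "'a \<times> 'a \<Rightarrow> real"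
  proof -
    have "(\<lambda>(x, y). ennreal (k (x, y))) \<in> borel_measurable (nu \<Otimes>\<^sub>M nu)" using k by simp
    from nn_integral_measurable_subprob_algebra2[OF this measurable_prob_algebraD[OF m]] show ?thesis by simp
  qed
  have pos: "AE x in nu. integrable (m x) (\<lambda>y. k (x, y))" "integrable nu (\<lambda>x. \<integral>y. k (x, y) \<partial>m x)"
    "(\<integral>x. (\<integral>y. k (x, y) \<partial>m x) \<partial>nu) = (\<integral>w. k w \<partial>M2)"
    if k: "integrable M2 k" and k0: "\<And>w. 0 \<le> k w" for k :: "'a \<times> 'a \<Rightarrow> real"
  proof -
    have km: "k \<in> borel_measurable (nu \<Otimes>\<^sub>M nu)" using k by (simp add: meas_M2[symmetric])
    have ks: "(\<lambda>y. k (x, y)) \<in> borel_measurable (m x)" if "x \<in> space nu" for x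
      by (rule measurable_compose[OF section_m[OF that] km])
    let ?I = "\<lambda>x. \<integral>\<^sup>+y. ennreal (k (x, y)) \<partial>m x"
    have eq: "(\<integral>\<^sup>+x. ?I x \<partial>nu) = ennreal (\<integral>w. k w \<partial>M2)"
      using nn_integral_M2[of "\<lambda>w. ennreal (k w)"] km nn_integral_eq_integral[OF k] k0 by simp
    have fin: "AE x in nu. ?I x \<noteq> \<infinity>" by (rule nn_integral_PInf_AE[OF nm[OF km]]) (simp add: eq)
    show "AE x in nu. integrable (m x) (\<lambda>y. k (x, y))"
      using fin AE_space
    proof eventually_elim
      case (elim x)
      then show ?case using ks[of x] k0 by (intro integrableI_nonneg) (auto simp: less_top)
    qed
    have e2: "(\<integral>y. k (x, y) \<partial>m x) = enn2real (?I x)" if "x \<in> space nu" for x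
      by (rule integral_eq_nn_integral) (use ks[OF that] k0 in auto)
    have hb: "has_bochner_integral nu (\<lambda>x. enn2real (?I x)) (\<integral>w. k w \<partial>M2)"
    proof (rule has_bochner_integral_nn_integral)
      show "(\<lambda>x. enn2real (?I x)) \<in> borel_measurable nu" using nm[OF km] by simp
      have "(\<integral>\<^sup>+x. ennreal (enn2real (?I x)) \<partial>nu) = (\<integral>\<^sup>+x. ?I x \<partial>nu)"
        by (rule nn_integral_cong_AE) (use fin in \<open>eventually_elim, simp add: less_top\<close>)
      then show "(\<integral>\<^sup>+x. ennreal (enn2real (?I x)) \<partial>nu) = ennreal (\<integral>w. k w \<partial>M2)" using eq by simp
    qed (use k0 in auto)
    have "has_bochner_integral nu (\<lambda>x. \<integral>y. k (x, y) \<partial>m x) (\<integral>w. k w \<partial>M2)"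
      using hb by (rule has_bochner_integral_cong[THEN iffD1, rotated 3]) (simp_all add: e2)
    then show "integrable nu (\<lambda>x. \<integral>y. k (x, y) \<partial>m x)" "(\<integral>x. (\<integral>y. k (x, y) \<partial>m x) \<partial>nu) = (\<integral>w. k w \<partial>M2)"
      by (auto simp: has_bochner_integral_iff)
  qed
  let ?p = "\<lambda>w. max (h w) 0" and ?n = "\<lambda>w. max (- h w) 0"
  have ip: "integrable M2 ?p" and in_: "integrable M2 ?n" using h by auto
  note P = pos[OF ip max.cobounded2] and N = pos[OF in_ max.cobounded2]
  have split: "h w = ?p w - ?n w" for w by (simp add: max_def)
  have ae: "AE x in nu. integrable (m x) (\<lambda>y. h (x, y)) \<and> (\<integral>y. h (x, y) \<partial>m x) = (\<integral>y. ?p (x, y) \<partial>m x) - (\<integral>y. ?n (x, y) \<partial>m x)"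
    using P(1) N(1)
  proof eventually_elim
    case (elim x)
    have "integrable (m x) (\<lambda>y. ?p (x, y) - ?n (x, y))" using elim by (intro Bochner_Integration.integrable_diff) auto
    moreover have "(\<integral>y. ?p (x, y) - ?n (x, y) \<partial>m x) = (\<integral>y. ?p (x, y) \<partial>m x) - (\<integral>y. ?n (x, y) \<partial>m x)"
      using elim by (intro Bochner_Integration.integral_diff) auto
    ultimately show ?case unfolding split[symmetric] by simp
  qed
  then show "AE x in nu. integrable (m x) (\<lambda>y. h (x, y))" by eventually_elim simp
  note hmI = kernel_integral_meas[OF hm]
  have "has_bochner_integral nu (\<lambda>x. (\<integral>y. ?p (x, y) \<partial>m x) - (\<integral>y. ?n (x, y) \<partial>m x)) ((\<integral>w. ?p w \<partial>M2) - (\<integral>w. ?n w \<partial>M2))"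
    using P(2,3) N(2,3) by (intro has_bochner_integral_diff) (auto simp: has_bochner_integral_iff)
  then have "has_bochner_integral nu (\<lambda>x. \<integral>y. h (x, y) \<partial>m x) ((\<integral>w. ?p w \<partial>M2) - (\<integral>w. ?n w \<partial>M2))"
    by (rule has_bochner_integral_cong_AE[THEN iffD1, rotated 3]) (use ae hmI P(2) N(2) in auto)
  moreover have "(\<integral>w. ?p w \<partial>M2) - (\<integral>w. ?n w \<partial>M2) = (\<integral>w. h w \<partial>M2)"
    unfolding Bochner_Integration.integral_diff[OF ip in_, symmetric] split[symmetric] ..
  ultimately show "integrable nu (\<lambda>x. \<integral>y. h (x, y) \<partial>m x)" "(\<integral>x. (\<integral>y. h (x, y) \<partial>m x) \<partial>nu) = (\<integral>w. h w \<partial>M2)"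
    by (auto simp: has_bochner_integral_iff)
qed

section \<open>Kernels, gradients and the two energy functionals\<close>

definition ker :: "('a \<Rightarrow> 'a set) \<Rightarrow> 'a \<times> 'a \<Rightarrow> real" where "ker D w = Kset D (fst w) (snd w)"

lemma ker_bounds: "0 \<le> ker D w" "ker D w \<le> 1"
  by (auto simp: ker_def Kset_def indicator_def)

lemma ker_swap: "ker D (snd w, fst w) = ker D w"
  by (simp add: ker_def Kset_def add.commute)

lemma ker_meas:
  assumes "{(x, y). x \<in> space nu \<and> y \<in> D x} \<in> sets (nu \<Otimes>\<^sub>M nu)" (is "?S \<in> _")
  shows "ker D \<in> borel_measurable (nu \<Otimes>\<^sub>M nu)"
proof -
  have "(\<lambda>w. (indicator ?S w + indicator ?S (snd w, fst w)) / 2 :: real) \<in> borel_measurable (nu \<Otimes>\<^sub>M nu)"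
  proof -
    have 1: "indicat_real ?S \<in> borel_measurable (nu \<Otimes>\<^sub>M nu)" using assms by simp
    have "(\<lambda>w. (snd w, fst w)) \<in> nu \<Otimes>\<^sub>M nu \<rightarrow>\<^sub>M nu \<Otimes>\<^sub>M nu" by measurable
    from measurable_compose[OF this 1] 1 show ?thesis by simp
  qed
  moreover have "ker D w = (indicator ?S w + indicator ?S (snd w, fst w)) / 2" if "w \<in> space (nu \<Otimes>\<^sub>M nu)" for w
    using that by (cases w) (auto simp: ker_def Kset_def indicator_def space_pair_measure)
  ultimately show ?thesis by (subst measurable_cong) auto
qed

lemmas kerA_meas [measurable] = ker_meas[OF A_meas]
lemmas kerB_meas [measurable] = ker_meas[OF B_meas]

definition grad :: "('a \<Rightarrow> real) \<Rightarrow> 'a \<times> 'a \<Rightarrow> real" where "grad u w = u (snd w) - u (fst w)"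

lemma grad_meas:
  assumes [measurable]: "u \<in> borel_measurable nu"
  shows "grad u \<in> borel_measurable (nu \<Otimes>\<^sub>M nu)"
  unfolding grad_def[abs_def] by measurable

lemma grad_L2: "u \<in> L2 nu \<Longrightarrow> grad u \<in> L2 M2"
  unfolding grad_def[abs_def] by (intro L2_diff L2_fst_M2 L2_snd_M2)

lemma grad_swap: "grad u (snd w, fst w) = - grad u w"
  by (simp add: grad_def)

definition f1 :: "('a \<Rightarrow> real) \<Rightarrow> real" where "f1 u = (1/2) * (\<integral>w. ker A w * \<bar>grad u w\<bar> \<partial>M2)"

definition fin1 :: "('a \<Rightarrow> real) \<Rightarrow> bool" where "fin1 u \<longleftrightarrow> integrable M2 (\<lambda>w. ker A w * \<bar>grad u w\<bar>)"

definition finp :: "('a \<Rightarrow> real) \<Rightarrow> bool" where "finp u \<longleftrightarrow> integrable M2 (\<lambda>w. ker B w * \<bar>grad u w\<bar> powr p)"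

definition fp :: "('a \<Rightarrow> real) \<Rightarrow> real" where "fp u = (1 / (2 * p)) * (\<integral>w. ker B w * \<bar>grad u w\<bar> powr p \<partial>M2)"

lemma F1_M2:
  assumes "u \<in> borel_measurable nu"
  shows "F1 nu m A u = (1/2) * (\<integral>\<^sup>+w. ennreal (ker A w * \<bar>grad u w\<bar>) \<partial>M2)"
proof -
  have "(\<lambda>w. ennreal (ker A w * \<bar>grad u w\<bar>)) \<in> borel_measurable (nu \<Otimes>\<^sub>M nu)"
    using grad_meas[OF assms] by measurable
  from nn_integral_M2[OF this] show ?thesis unfolding F1_def by (simp add: ker_def grad_def mult.commute)
qed

lemma F1_fin1:
  assumes u: "u \<in> L2 nu"
  shows "F1 nu m A u < \<infinity> \<longleftrightarrow> fin1 u" "fin1 u \<Longrightarrow> enn2real (F1 nu m A u) = f1 u"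
proof -
  note um = L2D(1)[OF u]
  have gm: "(\<lambda>w. ker A w * \<bar>grad u w\<bar>) \<in> borel_measurable M2"
    unfolding meas_M2 using grad_meas[OF um] by measurable
  have half: "(1/2 :: ennreal) = ennreal (1/2)" by (simp add: divide_ennreal[symmetric] divide_ennreal_def)
  have nn: "0 \<le> ker A w * \<bar>grad u w\<bar>" for w using ker_bounds[of A w] by simp
  have fin: "F1 nu m A u = ennreal (f1 u)" if i: "integrable M2 (\<lambda>w. ker A w * \<bar>grad u w\<bar>)"
    unfolding F1_M2[OF um] half nn_integral_eq_integral[OF i AE_I2[OF nn]] f1_def
    by (rule ennreal_mult[symmetric]) (use nn in \<open>simp_all add: integral_nonneg_AE\<close>)
  show "F1 nu m A u < \<infinity> \<longleftrightarrow> fin1 u"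
  proof
    assume "F1 nu m A u < \<infinity>"
    then have "(\<integral>\<^sup>+w. ennreal (ker A w * \<bar>grad u w\<bar>) \<partial>M2) < \<infinity>"
      unfolding F1_M2[OF um] half by (auto simp: ennreal_mult_less_top)
    then show "fin1 u" unfolding fin1_def using gm nn by (intro integrableI_nonneg) auto
  next
    assume "fin1 u"
    then have i: "integrable M2 (\<lambda>w. ker A w * \<bar>grad u w\<bar>)" by (simp add: fin1_def)
    from fin[OF this] show "F1 nu m A u < \<infinity>" by simp
  qed
  show "enn2real (F1 nu m A u) = f1 u" if "fin1 u"
    using that fin nn by (simp add: fin1_def f1_def integral_nonneg_AE)
qed

lemma Deltap_finp:
  assumes u: "u \<in> L2 nu"
  shows "(\<integral>\<^sup>+x. \<integral>\<^sup>+y. ennreal (Kset B x y * \<bar>u y - u x\<bar> powr p) \<partial>m x \<partial>nu) < \<infinity> \<longleftrightarrow> finp u"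
proof -
  note um = L2D(1)[OF u]
  have gm: "(\<lambda>w. ker B w * \<bar>grad u w\<bar> powr p) \<in> borel_measurable (nu \<Otimes>\<^sub>M nu)"
    using grad_meas[OF um] by measurable
  have nn: "0 \<le> ker B w * \<bar>grad u w\<bar> powr p" for w using ker_bounds[of B w] by simp
  have "(\<integral>\<^sup>+x. \<integral>\<^sup>+y. ennreal (Kset B x y * \<bar>u y - u x\<bar> powr p) \<partial>m x \<partial>nu) = (\<integral>\<^sup>+w. ennreal (ker B w * \<bar>grad u w\<bar> powr p) \<partial>M2)"
    using nn_integral_M2[of "\<lambda>w. ennreal (ker B w * \<bar>grad u w\<bar> powr p)"] gm by (simp add: ker_def grad_def)
  also have "\<dots> < \<infinity> \<longleftrightarrow> finp u"
    unfolding finp_def integrable_iff_bounded using gm nn by (simp add: meas_M2)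
  finally show ?thesis .
qed

end

section \<open>The energy of a random walk\<close>

lemma integrable_bound_nonneg:
  fixes f g :: "'b \<Rightarrow> real"
  assumes g: "integrable M g" and f: "f \<in> borel_measurable M" and f0: "\<And>w. 0 \<le> f w" and le: "\<And>w. f w \<le> g w"
  shows "integrable M f"
  by (rule Bochner_Integration.integrable_bound[OF g f])
    (unfold real_norm_def abs_of_nonneg[OF f0], intro AE_I2 order_trans[OF le abs_ge_self])

context random_walk
begin

lemma f1_nonneg: "0 \<le> f1 u" and fp_nonneg: "0 \<le> fp u"
  using ker_bounds p by (auto simp: f1_def fp_def intro!: integral_nonneg_AE mult_nonneg_nonneg)

lemma fin1_lincomb:
  assumes u: "u \<in> L2 nu" "fin1 u" and v: "v \<in> L2 nu" "fin1 v"
  shows "fin1 (\<lambda>x. a * u x + b * v x)" "f1 (\<lambda>x. a * u x + b * v x) \<le> \<bar>a\<bar> * f1 u + \<bar>b\<bar> * f1 v"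
proof -
  let ?h = "\<lambda>x. a * u x + b * v x"
  let ?g = "\<lambda>w. \<bar>a\<bar> * (ker A w * \<bar>grad u w\<bar>) + \<bar>b\<bar> * (ker A w * \<bar>grad v w\<bar>)"
  have g: "integrable M2 ?g" using u(2) v(2) by (simp add: fin1_def)
  have le: "ker A w * \<bar>grad ?h w\<bar> \<le> ?g w" for w
  proof -
    have "grad ?h w = a * grad u w + b * grad v w" by (simp add: grad_def algebra_simps)
    then have "\<bar>grad ?h w\<bar> \<le> \<bar>a\<bar> * \<bar>grad u w\<bar> + \<bar>b\<bar> * \<bar>grad v w\<bar>"
      using abs_triangle_ineq[of "a * grad u w" "b * grad v w"] by (simp add: abs_mult)
    from mult_left_mono[OF this ker_bounds(1)[of A w]] show ?thesis by (simp add: algebra_simps)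
  qed
  have m: "(\<lambda>w. ker A w * \<bar>grad ?h w\<bar>) \<in> borel_measurable M2"
    unfolding meas_M2 using grad_meas[OF L2D(1)[OF L2_add[OF L2_scale[OF u(1)] L2_scale[OF v(1)]]], of a b] by measurable
  show f: "fin1 ?h" unfolding fin1_def
    by (rule integrable_bound_nonneg[OF g m _ le]) (simp add: ker_bounds)
  have "(\<integral>w. ker A w * \<bar>grad ?h w\<bar> \<partial>M2) \<le> (\<integral>w. ?g w \<partial>M2)"
    by (rule integral_mono[OF _ g le]) (use f in \<open>simp add: fin1_def\<close>)
  also have "\<dots> = \<bar>a\<bar> * (2 * f1 u) + \<bar>b\<bar> * (2 * f1 v)"
    using u(2) v(2) by (simp add: fin1_def f1_def)
  finally show "f1 ?h \<le> \<bar>a\<bar> * f1 u + \<bar>b\<bar> * f1 v" by (simp add: f1_def algebra_simps)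
qed

text \<open>Each marginal contributes the L1 norm once, and the factor 1/2 in \<open>f1\<close>
  compensates for the two; the resulting constant 1 is the bound on subgradients in
  \<open>subdiff_opA\<close>.\<close>

lemma fin1_L1:
  assumes u: "integrable nu u"
  shows "fin1 u" "f1 u \<le> (\<integral>x. \<bar>u x\<bar> \<partial>nu)"
proof -
  let ?g = "\<lambda>w. \<bar>u (fst w)\<bar> + \<bar>u (snd w)\<bar>"
  have i: "integrable M2 (\<lambda>w. \<bar>u (fst w)\<bar>)" "integrable M2 (\<lambda>w. \<bar>u (snd w)\<bar>)"
    using integrable_fst_M2[of "\<lambda>x. \<bar>u x\<bar>"] integrable_snd_M2[of "\<lambda>x. \<bar>u x\<bar>"] u by auto
  then have g: "integrable M2 ?g" by simp
  have le: "ker A w * \<bar>grad u w\<bar> \<le> ?g w" for w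
    using mult_mono[OF ker_bounds(2)[of A w] abs_triangle_ineq4[of "u (snd w)" "u (fst w)"]] by (simp add: grad_def)
  have m: "(\<lambda>w. ker A w * \<bar>grad u w\<bar>) \<in> borel_measurable M2"
    unfolding meas_M2 using grad_meas[of u] u by measurable
  show f: "fin1 u" unfolding fin1_def
    by (rule integrable_bound_nonneg[OF g m _ le]) (simp add: ker_bounds)
  have "(\<integral>w. ker A w * \<bar>grad u w\<bar> \<partial>M2) \<le> (\<integral>w. ?g w \<partial>M2)"
    by (rule integral_mono[OF _ g le]) (use f in \<open>simp add: fin1_def\<close>)
  also have "\<dots> = (\<integral>w. \<bar>u (fst w)\<bar> \<partial>M2) + (\<integral>w. \<bar>u (snd w)\<bar> \<partial>M2)" using i by simp
  also have "(\<integral>w. \<bar>u (fst w)\<bar> \<partial>M2) = (\<integral>x. \<bar>u x\<bar> \<partial>nu)"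
    using integral_distr[OF proj_meas(1), of "\<lambda>x. \<bar>u x\<bar>"] u by (simp add: fst_M2)
  also have "(\<integral>w. \<bar>u (snd w)\<bar> \<partial>M2) = (\<integral>x. \<bar>u x\<bar> \<partial>nu)"
    using integral_distr[OF proj_meas(2), of "\<lambda>x. \<bar>u x\<bar>"] u by (simp add: snd_M2)
  finally show "f1 u \<le> (\<integral>x. \<bar>u x\<bar> \<partial>nu)" by (simp add: f1_def)
qed

text \<open>This is where \<open>finite_or\<close> enters: a square integrable majorant of
  \<open>|\<nabla>u|\<^bsup>p-1\<^esup>\<close> where \<open>|\<nabla>u| \<le> 1\<close>.\<close>

definition kap :: "('a \<Rightarrow> real) \<Rightarrow> 'a \<times> 'a \<Rightarrow> real" where
  "kap u w = (if emeasure nu (space nu) < \<infinity> then 1 else \<bar>grad u w\<bar>)"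

lemma kap_L2:
  assumes "u \<in> L2 nu" shows "kap u \<in> L2 M2"
proof (cases "emeasure nu (space nu) < \<infinity>")
  case True
  have "(\<integral>\<^sup>+w. 1 \<partial>M2) = (\<integral>\<^sup>+x. 1 \<partial>nu)" using nn_integral_fst_M2[of "\<lambda>_. 1"] by simp
  then have "emeasure M2 (space M2) < \<infinity>" using True by simp
  then have "integrable M2 (\<lambda>_. 1::real)" by (intro integrableI_nonneg) auto
  then show ?thesis using True by (intro L2I) (simp_all add: kap_def[abs_def])
next
  case False
  then have "kap u = (\<lambda>w. \<bar>grad u w\<bar>)" by (auto simp: kap_def)
  then show ?thesis using L2_abs[OF grad_L2[OF assms]] by simp
qed

lemma kap_nonneg: "0 \<le> kap u w" by (simp add: kap_def)

text \<open>Where the gradient exceeds 1 the exponent p - 1 may be raised to p, a term that the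
  energy controls; elsewhere \<open>kap\<close> takes over.\<close>

lemma psi_kap: "\<bar>psi p (grad u w)\<bar> \<le> kap u w + \<bar>grad u w\<bar> powr p"
proof (cases "\<bar>grad u w\<bar> \<le> 1")
  case True
  have "\<bar>grad u w\<bar> powr (p - 1) \<le> kap u w"
  proof (cases "emeasure nu (space nu) < \<infinity>")
    case T: True
    then show ?thesis using True p powr_mono2[of "p - 1" "\<bar>grad u w\<bar>" 1] by (simp add: kap_def)
  next
    case False
    then have "2 \<le> p" using finite_or by simp
    then have "\<bar>grad u w\<bar> powr (p - 1) \<le> \<bar>grad u w\<bar> powr 1" using True by (intro powr_mono') auto
    then show ?thesis using False by (simp add: kap_def)
  qed
  then show ?thesis unfolding abs_psi by (simp add: add_increasing2)
next
  case False
  then have "\<bar>grad u w\<bar> powr (p - 1) \<le> \<bar>grad u w\<bar> powr p" by (intro powr_mono) auto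
  then show ?thesis unfolding abs_psi using kap_nonneg[of u w] by linarith
qed

text \<open>The gradient is at most 2 C. For p \<ge> 2 the surplus exponent p - 2 goes into the
  constant \<open>D\<close> and the square of the gradient remains; for finite measure the constant
  (2 C)^p is itself integrable.\<close>

lemma finp_bounded:
  assumes u: "u \<in> L2 nu" and C: "\<And>x. \<bar>u x\<bar> \<le> C"
  shows "finp u"
proof -
  have gC: "\<bar>grad u w\<bar> \<le> 2 * C" for w
    using abs_triangle_ineq4[of "u (snd w)" "u (fst w)"] C[of "fst w"] C[of "snd w"] unfolding grad_def by linarith
  have k2: "integrable M2 (\<lambda>w. (kap u w)\<^sup>2)" using L2D(2)[OF kap_L2[OF u]] .
  define D where "D = (if emeasure nu (space nu) < \<infinity> then (2 * C) powr p else (2 * C) powr (p - 2))"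
  have D0: "0 \<le> D" by (simp add: D_def)
  have le: "ker B w * \<bar>grad u w\<bar> powr p \<le> D * (kap u w)\<^sup>2" for w
  proof -
    have "\<bar>grad u w\<bar> powr p \<le> D * (kap u w)\<^sup>2"
    proof (cases "emeasure nu (space nu) < \<infinity>")
      case True
      then show ?thesis using powr_mono2[of p "\<bar>grad u w\<bar>" "2 * C"] gC[of w] p by (simp add: kap_def D_def)
    next
      case False
      then have p2: "2 \<le> p" using finite_or by simp
      have "\<bar>grad u w\<bar> powr p = \<bar>grad u w\<bar> powr (p - 2) * \<bar>grad u w\<bar> powr 2" unfolding powr_add[symmetric] by simp
      also have "\<bar>grad u w\<bar> powr 2 = (grad u w)\<^sup>2" by (cases "grad u w = 0") (simp_all add: powr_numeral)
      also have "\<bar>grad u w\<bar> powr (p - 2) * (grad u w)\<^sup>2 \<le> (2 * C) powr (p - 2) * (grad u w)\<^sup>2"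
        using p2 gC[of w] by (intro mult_right_mono powr_mono2) auto
      finally show ?thesis using False by (simp add: kap_def D_def)
    qed
    moreover have "ker B w * \<bar>grad u w\<bar> powr p \<le> 1 * \<bar>grad u w\<bar> powr p" by (intro mult_right_mono ker_bounds) simp
    ultimately show ?thesis by simp
  qed
  show ?thesis unfolding finp_def
  proof (rule Bochner_Integration.integrable_bound)
    show "integrable M2 (\<lambda>w. D * (kap u w)\<^sup>2)" using k2 by simp
    show "(\<lambda>w. ker B w * \<bar>grad u w\<bar> powr p) \<in> borel_measurable M2"
      unfolding meas_M2 using grad_meas[OF L2D(1)[OF u]] by measurable
    show "AE w in M2. norm (ker B w * \<bar>grad u w\<bar> powr p) \<le> norm (D * (kap u w)\<^sup>2)"
      using le ker_bounds(1)[of B] D0 by (auto simp: abs_mult)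
  qed
qed

lemma finp_dominated:
  assumes u: "u \<in> L2 nu" "finp u" and v: "v \<in> L2 nu" "finp v" and h: "h \<in> L2 nu"
    and le: "\<And>w. \<bar>grad h w\<bar> \<le> \<bar>grad u w\<bar> + \<bar>grad v w\<bar>"
  shows "finp h"
  unfolding finp_def
proof (rule Bochner_Integration.integrable_bound)
  let ?g = "\<lambda>w. 2 powr p * (ker B w * \<bar>grad u w\<bar> powr p + ker B w * \<bar>grad v w\<bar> powr p)"
  show "integrable M2 ?g" using u(2) v(2) by (simp add: finp_def)
  show "(\<lambda>w. ker B w * \<bar>grad h w\<bar> powr p) \<in> borel_measurable M2"
    unfolding meas_M2 using grad_meas[OF L2D(1)[OF h]] by measurable
  have "ker B w * \<bar>grad h w\<bar> powr p \<le> ?g w" for w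
  proof -
    have "\<bar>grad h w\<bar> powr p \<le> (\<bar>grad u w\<bar> + \<bar>grad v w\<bar>) powr p" using p le by (intro powr_mono2) auto
    also have "\<dots> \<le> 2 powr p * (\<bar>grad u w\<bar> powr p + \<bar>grad v w\<bar> powr p)" by (rule abs_powr_add_le[OF p])
    finally have "ker B w * \<bar>grad h w\<bar> powr p \<le> ker B w * (2 powr p * (\<bar>grad u w\<bar> powr p + \<bar>grad v w\<bar> powr p))"
      using ker_bounds(1) by (rule mult_left_mono)
    then show ?thesis by (simp add: algebra_simps)
  qed
  then show "AE w in M2. norm (ker B w * \<bar>grad h w\<bar> powr p) \<le> norm (?g w)"
    using ker_bounds(1)[of B] by (intro AE_I2) (auto simp: abs_mult intro: order_trans[OF _ abs_ge_self])
qed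

text \<open>The two parts share one integrand, so that convexity and lower semicontinuity are
  pointwise facts, carried over by monotonicity and Fatou's lemma.\<close>

definition energy :: "('a \<Rightarrow> real) \<Rightarrow> 'a \<times> 'a \<Rightarrow> real" where
  "energy u w = (1/2) * (ker A w * \<bar>grad u w\<bar>) + (1 / (2 * p)) * (ker B w * \<bar>grad u w\<bar> powr p)"

definition Phi :: "('a \<Rightarrow> real) \<Rightarrow> ennreal" where "Phi u = (\<integral>\<^sup>+w. ennreal (energy u w) \<partial>M2)"

lemma energy_parts: "0 \<le> (1/2) * (ker A w * \<bar>grad u w\<bar>)" "0 \<le> (1 / (2 * p)) * (ker B w * \<bar>grad u w\<bar> powr p)"
  using ker_bounds p by auto

lemma energy_nonneg: "0 \<le> energy u w"
  unfolding energy_def by (intro add_nonneg_nonneg energy_parts)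

lemma energy_meas:
  assumes "u \<in> borel_measurable nu"
  shows "energy u \<in> borel_measurable M2"
  unfolding meas_M2 energy_def[abs_def] using grad_meas[OF assms] by measurable

lemma Phi_finite:
  assumes u: "u \<in> L2 nu"
  shows "Phi u < \<infinity> \<longleftrightarrow> fin1 u \<and> finp u" "fin1 u \<Longrightarrow> finp u \<Longrightarrow> enn2real (Phi u) = f1 u + fp u"
proof -
  note em = energy_meas[OF L2D(1)[OF u]]
  have gm: "(\<lambda>w. ker A w * \<bar>grad u w\<bar>) \<in> borel_measurable M2" "(\<lambda>w. ker B w * \<bar>grad u w\<bar> powr p) \<in> borel_measurable M2"
    unfolding meas_M2 using grad_meas[OF L2D(1)[OF u]] by measurable
  have int: "integrable M2 (energy u)" if "fin1 u" "finp u"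
    unfolding energy_def[abs_def] using that by (simp add: fin1_def finp_def)
  have fin: "Phi u = ennreal (f1 u + fp u)" if "fin1 u" "finp u"
  proof -
    have "Phi u = ennreal (\<integral>w. energy u w \<partial>M2)"
      unfolding Phi_def by (rule nn_integral_eq_integral[OF int[OF that]]) (simp add: energy_nonneg)
    also have "(\<integral>w. energy u w \<partial>M2) = f1 u + fp u"
      unfolding energy_def f1_def fp_def using that by (simp add: fin1_def finp_def)
    finally show ?thesis .
  qed
  show "Phi u < \<infinity> \<longleftrightarrow> fin1 u \<and> finp u"
  proof
    assume "Phi u < \<infinity>"
    then have i: "integrable M2 (energy u)"
      unfolding Phi_def using em energy_nonneg by (intro integrableI_nonneg) auto
    have "integrable M2 (\<lambda>w. (1/2) * (ker A w * \<bar>grad u w\<bar>))"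
      by (rule integrable_bound_nonneg[OF i _ energy_parts(1)])
        (use gm energy_parts in \<open>simp_all add: energy_def\<close>)
    moreover have "integrable M2 (\<lambda>w. (1 / (2 * p)) * (ker B w * \<bar>grad u w\<bar> powr p))"
      by (rule integrable_bound_nonneg[OF i _ energy_parts(2)])
        (use gm energy_parts in \<open>simp_all add: energy_def\<close>)
    ultimately show "fin1 u \<and> finp u" using p unfolding fin1_def finp_def integrable_mult_left_iff by simp
  next
    assume "fin1 u \<and> finp u" then show "Phi u < \<infinity>" using fin by simp
  qed
  show "enn2real (Phi u) = f1 u + fp u" if "fin1 u" "finp u"
    using fin[OF that] f1_nonneg[of u] fp_nonneg[of u] by (simp del: ennreal_plus)
qed

section \<open>Truncation, and the energy as an instance of a convex functional\<close>

definition clamp :: "real \<Rightarrow> real \<Rightarrow> real" where "clamp k s = max (- k) (min s k)"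

lemma clamp_props:
  "0 \<le> k \<Longrightarrow> \<bar>clamp k s\<bar> \<le> k" "0 \<le> k \<Longrightarrow> \<bar>clamp k s\<bar> \<le> \<bar>s\<bar>" "\<bar>s\<bar> \<le> k \<Longrightarrow> clamp k s = s"
  "0 \<le> k \<Longrightarrow> \<bar>clamp k r - clamp k s\<bar> \<le> \<bar>r - s\<bar>" "0 \<le> k \<Longrightarrow> \<bar>s - clamp k s\<bar> \<le> \<bar>s\<bar>"
  by (auto simp: clamp_def)

lemma clamp_meas [measurable]: "clamp k \<in> borel_measurable borel"
  unfolding clamp_def[abs_def] by measurable

lemma clamp_tendsto: "(\<lambda>n. clamp (real n) s) \<longlonglongrightarrow> s"
proof (rule tendsto_eventually)
  obtain N :: nat where "\<bar>s\<bar> \<le> N" using real_arch_simple by blast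
  then show "\<forall>\<^sub>F n in sequentially. clamp (real n) s = s"
    unfolding eventually_sequentially by (intro exI[of _ N]) (auto intro!: clamp_props(3))
qed

sublocale convex_functional nu Phi
proof
  have "energy (\<lambda>_. 0) w = 0" for w by (simp add: energy_def grad_def)
  then show "Phi (\<lambda>_. 0) = 0" by (simp add: Phi_def)
next
  fix u v :: "'a \<Rightarrow> real" and \<theta> :: real
  assume u: "u \<in> L2 nu" and v: "v \<in> L2 nu" and \<theta>: "0 \<le> \<theta>" "\<theta> \<le> 1"
  let ?h = "\<lambda>x. (1 - \<theta>) * u x + \<theta> * v x"
  have le: "energy ?h w \<le> (1 - \<theta>) * energy u w + \<theta> * energy v w" for w
  proof -
    have g: "grad ?h w = (1 - \<theta>) * grad u w + \<theta> * grad v w" by (simp add: grad_def algebra_simps)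
    have "\<bar>grad ?h w\<bar> \<le> (1 - \<theta>) * \<bar>grad u w\<bar> + \<theta> * \<bar>grad v w\<bar>"
      using abs_triangle_ineq[of "(1 - \<theta>) * grad u w" "\<theta> * grad v w"] \<theta> unfolding g by (simp add: abs_mult)
    then have "(1/2) * (ker A w * \<bar>grad ?h w\<bar>) \<le> (1/2) * (ker A w * ((1 - \<theta>) * \<bar>grad u w\<bar> + \<theta> * \<bar>grad v w\<bar>))"
      using ker_bounds(1) by (intro mult_left_mono) auto
    moreover have "(1 / (2 * p)) * (ker B w * \<bar>grad ?h w\<bar> powr p) \<le> (1 / (2 * p)) * (ker B w * ((1 - \<theta>) * \<bar>grad u w\<bar> powr p + \<theta> * \<bar>grad v w\<bar> powr p))"
      unfolding g using ker_bounds(1) p by (intro mult_left_mono abs_powr_convex \<theta>) auto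
    ultimately have "energy ?h w \<le> (1/2) * (ker A w * ((1 - \<theta>) * \<bar>grad u w\<bar> + \<theta> * \<bar>grad v w\<bar>))
      + (1 / (2 * p)) * (ker B w * ((1 - \<theta>) * \<bar>grad u w\<bar> powr p + \<theta> * \<bar>grad v w\<bar> powr p))"
      unfolding energy_def by (rule add_mono)
    also have "\<dots> = (1 - \<theta>) * energy u w + \<theta> * energy v w" unfolding energy_def by (simp only: distrib_left) (simp add: mult.left_commute)
    finally show ?thesis .
  qed
  have "Phi ?h \<le> (\<integral>\<^sup>+w. ennreal (1 - \<theta>) * ennreal (energy u w) + ennreal \<theta> * ennreal (energy v w) \<partial>M2)"
    unfolding Phi_def
  proof (rule nn_integral_mono)
    fix w
    have "ennreal (energy ?h w) \<le> ennreal ((1 - \<theta>) * energy u w + \<theta> * energy v w)" by (rule ennreal_leI[OF le])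
    also have "\<dots> = ennreal (1 - \<theta>) * ennreal (energy u w) + ennreal \<theta> * ennreal (energy v w)"
      using \<theta> energy_nonneg by (simp add: ennreal_mult)
    finally show "ennreal (energy ?h w) \<le> ennreal (1 - \<theta>) * ennreal (energy u w) + ennreal \<theta> * ennreal (energy v w)" .
  qed
  also have "\<dots> = ennreal (1 - \<theta>) * Phi u + ennreal \<theta> * Phi v"
    unfolding Phi_def using energy_meas[OF L2D(1)[OF u]] energy_meas[OF L2D(1)[OF v]]
    by (simp add: nn_integral_add nn_integral_cmult)
  finally show "Phi ?h \<le> ennreal (1 - \<theta>) * Phi u + ennreal \<theta> * Phi v" .
next
  fix w :: "nat \<Rightarrow> 'a \<Rightarrow> real" and u
  assume w: "\<And>n. w n \<in> L2 nu" and u: "u \<in> L2 nu" and lim: "AE x in nu. (\<lambda>n. w n x) \<longlonglongrightarrow> u x"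
  have "AE z in M2. ennreal (energy u z) = liminf (\<lambda>n. ennreal (energy (w n) z))"
    using AE_M2[OF lim]
  proof eventually_elim
    case (elim z)
    then have g: "(\<lambda>n. \<bar>grad (w n) z\<bar>) \<longlonglongrightarrow> \<bar>grad u z\<bar>" unfolding grad_def by (intro tendsto_intros) auto
    have "(\<lambda>n. energy (w n) z) \<longlonglongrightarrow> energy u z"
      unfolding energy_def using p by (intro tendsto_intros g tendsto_powr2) auto
    then show ?case by (intro lim_imp_Liminf[OF sequentially_bot, symmetric] tendsto_ennrealI)
  qed
  then have "Phi u = (\<integral>\<^sup>+z. liminf (\<lambda>n. ennreal (energy (w n) z)) \<partial>M2)"
    unfolding Phi_def by (rule nn_integral_cong_AE)
  also have "\<dots> \<le> liminf (\<lambda>n. \<integral>\<^sup>+z. ennreal (energy (w n) z) \<partial>M2)"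
    by (rule nn_integral_liminf) (use energy_meas[OF L2D(1)[OF w]] in simp)
  finally show "Phi u \<le> liminf (\<lambda>n. Phi (w n))" unfolding Phi_def .
next
  fix u assume u: "u \<in> L2 nu"
  note [measurable] = L2D(1)[OF u]
  obtain C :: "nat \<Rightarrow> 'a set" where C: "range C \<subseteq> sets nu" "(\<Union>i. C i) = space nu" "\<And>i. emeasure nu (C i) \<noteq> \<infinity>" "incseq C"
    using sigma_finite_measure.sigma_finite_incseq[OF sigma_finite_nu] by blast
  have Cs[measurable]: "C i \<in> sets nu" for i using C(1) by auto
  \<comment> \<open>Cutting \<open>u\<close> at height n and restricting it to a set of finite
    measure makes it bounded and integrable, hence of finite energy by \<open>fin1_L1\<close> and
    \<open>finp_bounded\<close>.\<close>
  define w where "w n x = indicator (C n) x * clamp (real n) (u x)" for n x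
  have [measurable]: "w n \<in> borel_measurable nu" for n unfolding w_def by measurable
  have wb: "\<bar>w n x\<bar> \<le> real n" "\<bar>w n x\<bar> \<le> \<bar>u x\<bar>" "\<bar>w n x - u x\<bar> \<le> \<bar>u x\<bar>" for n x
    using clamp_props(1,2,5)[of "real n" "u x"] by (auto simp: w_def indicator_def abs_minus_commute)
  have wL: "w n \<in> L2 nu" for n by (rule L2_dominated[OF u]) (use wb in auto)
  have w1: "integrable nu (w n)" for n
  proof (rule Bochner_Integration.integrable_bound)
    show "integrable nu (\<lambda>x. real n * indicator (C n) x)" using C(3)[of n] by (simp add: less_top)
    have "norm (w n x) \<le> norm (real n * indicator (C n) x)" for x
      using wb(1)[of n x] by (cases "x \<in> C n") (simp_all add: w_def)
    then show "AE x in nu. norm (w n x) \<le> norm (real n * indicator (C n) x)" by (rule AE_I2)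
  qed simp
  have fin: "Phi (w n) < \<infinity>" for n
    using Phi_finite(1)[OF wL, of n] fin1_L1(1)[OF w1] finp_bounded[OF wL wb(1)] by blast
  have "(\<lambda>n. \<integral>x. (w n x - u x)\<^sup>2 \<partial>nu) \<longlonglongrightarrow> (\<integral>x. 0 \<partial>nu)"
  proof (rule integral_dominated_convergence[where w="\<lambda>x. (u x)\<^sup>2"])
    show "AE x in nu. (\<lambda>n. (w n x - u x)\<^sup>2) \<longlonglongrightarrow> 0"
    proof (rule AE_I2)
      fix x assume "x \<in> space nu"
      then obtain N where "x \<in> C N" using C(2) by auto
      then have "x \<in> C n" if "N \<le> n" for n using that C(4) by (auto simp: incseq_def)
      then have "\<forall>\<^sub>F n in sequentially. clamp (real n) (u x) = w n x"
        unfolding eventually_sequentially by (intro exI[of _ N]) (auto simp: w_def)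
      from Lim_transform_eventually[OF clamp_tendsto this] have "(\<lambda>n. w n x) \<longlonglongrightarrow> u x" .
      then have "(\<lambda>n. (w n x - u x)\<^sup>2) \<longlonglongrightarrow> (u x - u x)\<^sup>2" by (intro tendsto_intros)
      then show "(\<lambda>n. (w n x - u x)\<^sup>2) \<longlonglongrightarrow> 0" by simp
    qed
    show "AE x in nu. norm ((w n x - u x)\<^sup>2) \<le> (u x)\<^sup>2" for n
      using wb(3)[of n] by (auto simp: abs_le_square_iff)
  qed (use L2D(2)[OF u] in auto)
  then have "(\<lambda>n. sqrt (\<integral>x. (w n x - u x)\<^sup>2 \<partial>nu)) \<longlonglongrightarrow> sqrt 0" by (intro tendsto_intros) simp
  then have "(\<lambda>n. L2_norm nu (\<lambda>x. w n x - u x)) \<longlonglongrightarrow> 0" by (simp add: L2_norm_def)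
  then show "\<exists>w. (\<forall>n::nat. w n \<in> L2 nu \<and> Phi (w n) < \<infinity>) \<and> (\<lambda>n. L2_norm nu (\<lambda>x. w n x - u x)) \<longlonglongrightarrow> 0"
    using wL fin by blast
qed

lemma dom_iff: "u \<in> dom \<longleftrightarrow> u \<in> L2 nu \<and> fin1 u \<and> finp u"
  using Phi_finite(1)[of u] by (auto simp: dom_def)

lemma phi_eq: "u \<in> dom \<Longrightarrow> phi u = f1 u + fp u"
  using Phi_finite(2)[of u] by (simp add: dom_iff phi_def)

end

section \<open>The subdifferential of the energy\<close>

context random_walk
begin

definition Psi :: "('a \<Rightarrow> real) \<Rightarrow> 'a \<times> 'a \<Rightarrow> real" where
  "Psi u w = ker B w * psi p (grad u w)"

text \<open>The p-Laplacian of \<open>u\<close> as a total function; where the section is not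
  integrable its value is 0 by the convention of the integral.\<close>

definition v2 :: "('a \<Rightarrow> real) \<Rightarrow> 'a \<Rightarrow> real" where
  "v2 u x = (\<integral>y. Psi u (x, y) \<partial>m x)"

lemma Psi_meas:
  assumes "u \<in> borel_measurable nu"
  shows "Psi u \<in> borel_measurable (nu \<Otimes>\<^sub>M nu)"
  unfolding Psi_def[abs_def] using grad_meas[OF assms] by measurable

lemma Psi_swap: "Psi u (snd w, fst w) = - Psi u w"
  by (simp add: Psi_def ker_swap grad_swap psi_minus)

lemma v2_meas: "u \<in> borel_measurable nu \<Longrightarrow> v2 u \<in> borel_measurable nu"
  unfolding v2_def[abs_def] by (rule kernel_integral_meas[OF Psi_meas])

lemma Deltap_v2:
  "Deltap nu m p B u v \<longleftrightarrow> u \<in> L2 nu \<and> v \<in> L2 nu \<and> finp u \<and> (AE x in nu. v x = v2 u x)"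
proof -
  have "(\<integral>y. Kset B x y * \<bar>u y - u x\<bar> powr (p - 2) * (u y - u x) \<partial>m x) = v2 u x" for x
    by (simp add: v2_def Psi_def ker_def psi_def grad_def mult.assoc)
  then show ?thesis unfolding Deltap_def using Deltap_finp[of u] by auto
qed

lemma abs_Psi_le: "\<bar>Psi u w\<bar> \<le> kap u w + ker B w * \<bar>grad u w\<bar> powr p"
proof -
  have "\<bar>Psi u w\<bar> = ker B w * \<bar>psi p (grad u w)\<bar>" unfolding Psi_def abs_mult using ker_bounds(1)[of B w] by simp
  also have "\<dots> \<le> ker B w * (kap u w + \<bar>grad u w\<bar> powr p)" by (intro mult_left_mono psi_kap ker_bounds)
  also have "\<dots> \<le> kap u w + ker B w * \<bar>grad u w\<bar> powr p"
    using mult_right_mono[OF ker_bounds(2)[of B w] kap_nonneg[of u w]] by (simp add: distrib_left)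
  finally show ?thesis .
qed

text \<open>\<open>Psi u\<close> is antisymmetric and \<open>M2\<close> symmetric, so moving
  \<theta> from the first to the second variable flips the sign of the integral; this produces the
  factor - 1/2. Boundedness of \<theta> takes care of the part of \<open>Psi u\<close> that is
  merely integrable.\<close>

lemma Psi_pairing:
  assumes u: "u \<in> L2 nu" "finp u" and \<theta>: "\<theta> \<in> L2 nu" "\<And>x. \<bar>\<theta> x\<bar> \<le> C"
  shows "integrable M2 (\<lambda>w. grad \<theta> w * Psi u w)" "integrable nu (\<lambda>x. \<theta> x * v2 u x)"
    and "(\<integral>x. \<theta> x * v2 u x \<partial>nu) = - (1/2) * (\<integral>w. grad \<theta> w * Psi u w \<partial>M2)"
proof -
  let ?h = "\<lambda>w. \<theta> (fst w) * Psi u w"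
  have h: "integrable M2 ?h"
  proof (rule Bochner_Integration.integrable_bound)
    show "integrable M2 (\<lambda>w. \<bar>\<theta> (fst w)\<bar> * kap u w + C * (ker B w * \<bar>grad u w\<bar> powr p))"
      using L2_mult_integrable[OF L2_abs[OF L2_fst_M2[OF \<theta>(1)]] kap_L2[OF u(1)]] u(2) by (simp add: finp_def)
    show "?h \<in> borel_measurable M2"
      unfolding meas_M2
      by (intro borel_measurable_times measurable_compose[OF measurable_fst L2D(1)[OF \<theta>(1)]] Psi_meas L2D(1)[OF u(1)])
    have "\<bar>?h w\<bar> \<le> \<bar>\<theta> (fst w)\<bar> * kap u w + C * (ker B w * \<bar>grad u w\<bar> powr p)" for w
    proof -
      have "\<bar>?h w\<bar> \<le> \<bar>\<theta> (fst w)\<bar> * (kap u w + ker B w * \<bar>grad u w\<bar> powr p)"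
        unfolding abs_mult by (intro mult_left_mono abs_Psi_le) simp
      also have "\<dots> = \<bar>\<theta> (fst w)\<bar> * kap u w + \<bar>\<theta> (fst w)\<bar> * (ker B w * \<bar>grad u w\<bar> powr p)" by (rule distrib_left)
      also have "\<dots> \<le> \<bar>\<theta> (fst w)\<bar> * kap u w + C * (ker B w * \<bar>grad u w\<bar> powr p)"
        using ker_bounds(1) by (intro add_left_mono mult_right_mono \<theta>(2)) auto
      finally show ?thesis .
    qed
    then show "AE w in M2. norm (?h w) \<le> norm (\<bar>\<theta> (fst w)\<bar> * kap u w + C * (ker B w * \<bar>grad u w\<bar> powr p))"
      unfolding real_norm_def by (intro AE_I2 order_trans[OF _ abs_ge_self])
  qed
  let ?k = "\<lambda>w. \<theta> (snd w) * Psi u w"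
  have k_eq: "?h (snd w, fst w) = - ?k w" for w by (simp add: Psi_swap)
  have k: "integrable M2 ?k" using integrable_swap_M2[OF h] unfolding k_eq by simp
  have kI: "(\<integral>w. ?k w \<partial>M2) = - (\<integral>w. ?h w \<partial>M2)"
    using integral_swap_M2[of ?h] h unfolding k_eq by (simp add: meas_M2[symmetric])
  have g: "grad \<theta> w * Psi u w = ?k w - ?h w" for w by (simp add: grad_def left_diff_distrib)
  show "integrable M2 (\<lambda>w. grad \<theta> w * Psi u w)" unfolding g using k h by simp
  have sec: "(\<integral>y. ?h (x, y) \<partial>m x) = \<theta> x * v2 u x" for x by (simp add: v2_def)
  show "integrable nu (\<lambda>x. \<theta> x * v2 u x)" using M2_Fubini(2)[OF h] unfolding sec .
  have "(\<integral>x. \<theta> x * v2 u x \<partial>nu) = (\<integral>w. ?h w \<partial>M2)" using M2_Fubini(3)[OF h] unfolding sec .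
  then show "(\<integral>x. \<theta> x * v2 u x \<partial>nu) = - (1/2) * (\<integral>w. grad \<theta> w * Psi u w \<partial>M2)"
    unfolding g using k h kI by simp
qed

text \<open>Integration against the probability measure \<open>m x\<close> keeps the square
  integrable part \<open>kap u\<close> in L2, by Cauchy-Schwarz with the constant function 1, and
  keeps the energy density in L1.\<close>

lemma v2_bound:
  assumes u: "u \<in> L2 nu" "finp u"
  shows "\<exists>\<alpha> \<beta>. \<alpha> \<in> L2 nu \<and> integrable nu \<beta> \<and> (AE x in nu. 0 \<le> \<beta> x \<and> \<bar>v2 u x\<bar> \<le> \<alpha> x + \<beta> x)"
proof -
  let ?K = "kap u" and ?G = "\<lambda>w. ker B w * \<bar>grad u w\<bar> powr p"
  define \<alpha> where "\<alpha> x = (\<integral>y. ?K (x, y) \<partial>m x)" for x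
  define \<beta> where "\<beta> x = (\<integral>y. ?G (x, y) \<partial>m x)" for x
  have K2: "integrable M2 (\<lambda>w. (?K w)\<^sup>2)" by (rule L2D(2)[OF kap_L2[OF u(1)]])
  have Km: "?K \<in> borel_measurable (nu \<Otimes>\<^sub>M nu)" using L2D(1)[OF kap_L2[OF u(1)]] by (simp add: meas_M2)
  have G: "integrable M2 ?G" using u(2) by (simp add: finp_def)
  have slice: "AE x in nu. (\<lambda>y. ?K (x, y)) \<in> L2 (m x) \<and> (\<lambda>_. 1) \<in> L2 (m x) \<and> L2_norm (m x) (\<lambda>_. 1) = 1"
    using M2_Fubini(1)[OF K2] AE_space
  proof eventually_elim
    case (elim x)
    interpret P: prob_space "m x" by (rule m_prob(1)[OF elim(2)])
    have "(\<lambda>y. ?K (x, y)) \<in> borel_measurable (m x)" by (rule measurable_compose[OF section_m[OF elim(2)] Km])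
    then show ?case using elim by (auto simp: L2_def L2_norm_def P.prob_space)
  qed
  have \<alpha>: "\<alpha> \<in> L2 nu"
  proof (rule L2_bound)
    show "\<alpha> \<in> borel_measurable nu" unfolding \<alpha>_def[abs_def] by (rule kernel_integral_meas[OF Km])
    show "integrable nu (\<lambda>x. \<integral>y. (?K (x, y))\<^sup>2 \<partial>m x)" by (rule M2_Fubini(2)[OF K2])
    show "AE x in nu. (\<alpha> x)\<^sup>2 \<le> (\<integral>y. (?K (x, y))\<^sup>2 \<partial>m x)"
      using slice
    proof eventually_elim
      case (elim x)
      have "\<bar>\<integral>y. ?K (x, y) * 1 \<partial>m x\<bar> \<le> L2_norm (m x) (\<lambda>y. ?K (x, y)) * L2_norm (m x) (\<lambda>_. 1)"
        by (rule L2_Cauchy_Schwarz) (use elim in auto)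
      then have "\<bar>\<alpha> x\<bar> \<le> L2_norm (m x) (\<lambda>y. ?K (x, y))" using elim by (simp add: \<alpha>_def)
      then have "\<bar>\<alpha> x\<bar>\<^sup>2 \<le> (L2_norm (m x) (\<lambda>y. ?K (x, y)))\<^sup>2" by (rule power_mono) simp
      then show ?case by (simp add: L2_norm_sq)
    qed
  qed
  have \<beta>: "integrable nu \<beta>" unfolding \<beta>_def by (rule M2_Fubini(2)[OF G])
  have "AE x in nu. 0 \<le> \<beta> x \<and> \<bar>v2 u x\<bar> \<le> \<alpha> x + \<beta> x"
    using slice M2_Fubini(1)[OF G] AE_space
  proof eventually_elim
    case (elim x)
    have K1: "integrable (m x) (\<lambda>y. ?K (x, y))"
      using L2_mult_integrable[of "\<lambda>y. ?K (x, y)" "m x" "\<lambda>_. 1"] elim by simp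
    have KG: "integrable (m x) (\<lambda>y. ?K (x, y) + ?G (x, y))" using K1 elim(2) by (intro Bochner_Integration.integrable_add)
    have Pi: "integrable (m x) (\<lambda>y. Psi u (x, y))"
    proof (rule Bochner_Integration.integrable_bound[OF KG])
      show "(\<lambda>y. Psi u (x, y)) \<in> borel_measurable (m x)"
        by (rule measurable_compose[OF section_m[OF elim(3)] Psi_meas[OF L2D(1)[OF u(1)]]])
      show "AE y in m x. norm (Psi u (x, y)) \<le> norm (?K (x, y) + ?G (x, y))"
        unfolding real_norm_def by (intro AE_I2 order_trans[OF abs_Psi_le abs_ge_self])
    qed
    have "\<bar>v2 u x\<bar> \<le> (\<integral>y. \<bar>Psi u (x, y)\<bar> \<partial>m x)" unfolding v2_def by (rule integral_abs_bound)
    also have "\<dots> \<le> (\<integral>y. ?K (x, y) + ?G (x, y) \<partial>m x)"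
      by (intro Bochner_Integration.integral_mono integrable_abs Pi KG abs_Psi_le)
    also have "\<dots> = \<alpha> x + \<beta> x" unfolding \<alpha>_def \<beta>_def by (rule Bochner_Integration.integral_add[OF K1 elim(2)])
    finally have "\<bar>v2 u x\<bar> \<le> \<alpha> x + \<beta> x" .
    moreover have "0 \<le> \<beta> x" unfolding \<beta>_def using ker_bounds(1) by (intro integral_nonneg_AE) auto
    ultimately show ?case by simp
  qed
  with \<alpha> \<beta> show ?thesis by blast
qed

text \<open>At u + \<tau> \<theta> the total variation part is bounded by convexity and the p-part
  by its slope at that far point; dividing by \<tau> and letting it tend to 0 leaves the slope at u.
  The bound on \<theta> makes u + \<theta> admissible and permits the pairing with
  \<open>v2 u\<close>.\<close>

lemma subdiff_directional:
  assumes s: "subdiff u w" and \<theta>: "\<theta> \<in> L2 nu" "\<And>x. \<bar>\<theta> x\<bar> \<le> C" "fin1 \<theta>"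
  shows "f1 u + (\<integral>x. w x * \<theta> x \<partial>nu) + (\<integral>x. \<theta> x * v2 u x \<partial>nu) \<le> f1 (\<lambda>x. u x + \<theta> x)"
proof -
  note sd = subdiffD[OF s]
  have ud: "u \<in> L2 nu" "fin1 u" "finp u" using sd(1) by (auto simp: dom_iff)
  let ?v = "\<lambda>x. u x + \<theta> x"
  have fp\<theta>: "finp \<theta>" by (rule finp_bounded[OF \<theta>(1,2)])
  have vd: "?v \<in> dom"
    unfolding dom_iff
  proof (intro conjI)
    show L: "?v \<in> L2 nu" by (intro L2_add ud \<theta>)
    show "fin1 ?v" using fin1_lincomb(1)[OF ud(1,2) \<theta>(1,3), of 1 1] by simp
    show "finp ?v"
    proof (rule finp_dominated[OF ud(1,3) \<theta>(1) fp\<theta> L])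
      show "\<bar>grad ?v w\<bar> \<le> \<bar>grad u w\<bar> + \<bar>grad \<theta> w\<bar>" for w
        using abs_triangle_ineq[of "grad u w" "grad \<theta> w"] by (simp add: grad_def)
    qed
  qed
  \<comment> \<open>Twice the slope of the p-part \<open>fp\<close> at u + \<tau> \<theta> in the
    direction \<theta>. Its limit is taken along \<tau> = 1 / (n + 1).\<close>
  define I where "I \<tau> = (\<integral>w. ker B w * (psi p (grad u w + \<tau> * grad \<theta> w) * grad \<theta> w) \<partial>M2)" for \<tau>
  let ?D = "\<lambda>w. 2 powr p * (ker B w * \<bar>grad u w\<bar> powr p + ker B w * \<bar>grad \<theta> w\<bar> powr p)"
  have Dint: "integrable M2 ?D" using ud(3) fp\<theta> by (simp add: finp_def)
  have gm: "grad u \<in> borel_measurable (nu \<Otimes>\<^sub>M nu)" "grad \<theta> \<in> borel_measurable (nu \<Otimes>\<^sub>M nu)"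
    by (intro grad_meas L2D(1) ud \<theta>)+
  have Im: "(\<lambda>w. ker B w * (psi p (grad u w + \<tau> * grad \<theta> w) * grad \<theta> w)) \<in> borel_measurable M2" for \<tau>
    unfolding meas_M2 using gm by measurable
  have Ib: "\<bar>ker B w * (psi p (grad u w + \<tau> * grad \<theta> w) * grad \<theta> w)\<bar> \<le> ?D w" if "0 \<le> \<tau>" "\<tau> \<le> 1" for \<tau> w
  proof -
    have "\<bar>ker B w * (psi p (grad u w + \<tau> * grad \<theta> w) * grad \<theta> w)\<bar> = ker B w * \<bar>psi p (grad u w + \<tau> * grad \<theta> w) * grad \<theta> w\<bar>"
      using ker_bounds(1)[of B w] by (simp add: abs_mult)
    also have "\<dots> \<le> ker B w * (2 powr p * (\<bar>grad u w\<bar> powr p + \<bar>grad \<theta> w\<bar> powr p))"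
      by (intro mult_left_mono psi_perturbed_bound[OF p that] ker_bounds)
    finally show ?thesis by (simp add: algebra_simps)
  qed
  have Iint: "integrable M2 (\<lambda>w. ker B w * (psi p (grad u w + \<tau> * grad \<theta> w) * grad \<theta> w))" if "0 \<le> \<tau>" "\<tau> \<le> 1" for \<tau>
    by (rule Bochner_Integration.integrable_bound[OF Dint Im])
      (unfold real_norm_def, intro AE_I2 order_trans[OF Ib[OF that] abs_ge_self])
  have step: "(\<integral>x. w x * \<theta> x \<partial>nu) \<le> f1 ?v - f1 u + (1/2) * I \<tau>" if \<tau>: "0 < \<tau>" "\<tau> \<le> 1" for \<tau>
  proof -
    let ?\<xi> = "\<lambda>x. (1 - \<tau>) * u x + \<tau> * ?v x"
    have \<xi>: "?\<xi> x = u x + \<tau> * \<theta> x" for x by (simp add: algebra_simps)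
    have \<xi>d: "?\<xi> \<in> dom" by (rule phi_convex(1)[OF sd(1) vd]) (use \<tau> in auto)
    have "phi u + (\<integral>x. w x * (?\<xi> x - u x) \<partial>nu) \<le> phi ?\<xi>" by (rule sd(4)[OF \<xi>d])
    moreover have "(\<integral>x. w x * (?\<xi> x - u x) \<partial>nu) = \<tau> * (\<integral>x. w x * \<theta> x \<partial>nu)"
      unfolding \<xi> by (simp add: mult.left_commute)
    ultimately have 1: "f1 u + fp u + \<tau> * (\<integral>x. w x * \<theta> x \<partial>nu) \<le> f1 ?\<xi> + fp ?\<xi>"
      using phi_eq[OF sd(1)] phi_eq[OF \<xi>d] by simp
    have "f1 ?\<xi> \<le> \<bar>1 - \<tau>\<bar> * f1 u + \<bar>\<tau>\<bar> * f1 ?v"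
      by (rule fin1_lincomb(2)) (use ud vd in \<open>auto simp: dom_iff\<close>)
    then have 2: "f1 ?\<xi> \<le> (1 - \<tau>) * f1 u + \<tau> * f1 ?v" using \<tau> by simp
    have g\<xi>: "grad ?\<xi> w = grad u w + \<tau> * grad \<theta> w" for w unfolding \<xi> by (simp add: grad_def algebra_simps)
    have "(\<integral>w. ker B w * \<bar>grad ?\<xi> w\<bar> powr p \<partial>M2) - (\<integral>w. ker B w * \<bar>grad u w\<bar> powr p \<partial>M2)
      = (\<integral>w. ker B w * \<bar>grad ?\<xi> w\<bar> powr p - ker B w * \<bar>grad u w\<bar> powr p \<partial>M2)"
      using \<xi>d ud by (simp add: dom_iff finp_def)
    also have "\<dots> \<le> (\<integral>w. (p * \<tau>) * (ker B w * (psi p (grad u w + \<tau> * grad \<theta> w) * grad \<theta> w)) \<partial>M2)"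
    proof (rule integral_mono)
      show "integrable M2 (\<lambda>w. ker B w * \<bar>grad ?\<xi> w\<bar> powr p - ker B w * \<bar>grad u w\<bar> powr p)"
        using \<xi>d ud by (simp add: dom_iff finp_def)
      show "integrable M2 (\<lambda>w. (p * \<tau>) * (ker B w * (psi p (grad u w + \<tau> * grad \<theta> w) * grad \<theta> w)))"
        using Iint[of \<tau>] \<tau> by simp
      fix w
      have "\<bar>grad ?\<xi> w\<bar> powr p - \<bar>grad u w\<bar> powr p \<le> p * psi p (grad ?\<xi> w) * (grad ?\<xi> w - grad u w)"
        using psi_subgradient[OF p, of "grad ?\<xi> w" "grad u w"] by (simp add: algebra_simps)
      also have "\<dots> = p * \<tau> * (psi p (grad u w + \<tau> * grad \<theta> w) * grad \<theta> w)" unfolding g\<xi> by simp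
      finally have "ker B w * (\<bar>grad ?\<xi> w\<bar> powr p - \<bar>grad u w\<bar> powr p) \<le> ker B w * (p * \<tau> * (psi p (grad u w + \<tau> * grad \<theta> w) * grad \<theta> w))"
        using ker_bounds(1) by (rule mult_left_mono)
      then show "ker B w * \<bar>grad ?\<xi> w\<bar> powr p - ker B w * \<bar>grad u w\<bar> powr p
        \<le> (p * \<tau>) * (ker B w * (psi p (grad u w + \<tau> * grad \<theta> w) * grad \<theta> w))"
        unfolding right_diff_distrib by (simp only: mult.left_commute)
    qed
    also have "\<dots> = p * \<tau> * I \<tau>" unfolding I_def by (rule integral_mult_right_zero)
    finally have "(1 / (2 * p)) * ((\<integral>w. ker B w * \<bar>grad ?\<xi> w\<bar> powr p \<partial>M2) - (\<integral>w. ker B w * \<bar>grad u w\<bar> powr p \<partial>M2))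
      \<le> (1 / (2 * p)) * (p * \<tau> * I \<tau>)" using p by (intro mult_left_mono) auto
    then have 3: "fp ?\<xi> - fp u \<le> \<tau> * ((1/2) * I \<tau>)" unfolding fp_def right_diff_distrib using p by simp
    have "\<tau> * (\<integral>x. w x * \<theta> x \<partial>nu) \<le> \<tau> * (f1 ?v - f1 u + (1/2) * I \<tau>)"
      using 1 2 3 by (simp add: algebra_simps)
    then show ?thesis using \<tau> by simp
  qed
  have "(\<lambda>n. I (1 / real (Suc n))) \<longlonglongrightarrow> I 0"
    unfolding I_def
  proof (rule integral_dominated_convergence[OF Im Im Dint])
    have z: "(\<lambda>n. 1 / real (Suc n)) \<longlonglongrightarrow> 0" using LIMSEQ_Suc[OF lim_const_over_n[of "1::real"]] by simp
    have "(\<lambda>n. ker B w * (psi p (grad u w + 1 / real (Suc n) * grad \<theta> w) * grad \<theta> w)) \<longlonglongrightarrow> ker B w * (psi p (grad u w + 0 * grad \<theta> w) * grad \<theta> w)" for w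
      by (intro tendsto_mult tendsto_const tendsto_psi[OF p] tendsto_add z)
    then show "AE w in M2. (\<lambda>n. ker B w * (psi p (grad u w + 1 / real (Suc n) * grad \<theta> w) * grad \<theta> w)) \<longlonglongrightarrow> ker B w * (psi p (grad u w + 0 * grad \<theta> w) * grad \<theta> w)"
      by (intro AE_I2)
    show "AE w in M2. norm (ker B w * (psi p (grad u w + 1 / real (Suc n) * grad \<theta> w) * grad \<theta> w)) \<le> ?D w" for n
      unfolding real_norm_def by (intro AE_I2 Ib) auto
  qed
  then have "(\<lambda>n. f1 ?v - f1 u + (1/2) * I (1 / real (Suc n))) \<longlonglongrightarrow> f1 ?v - f1 u + (1/2) * I 0"
    by (intro tendsto_intros)
  moreover have "\<forall>\<^sub>F n in sequentially. (\<integral>x. w x * \<theta> x \<partial>nu) \<le> f1 ?v - f1 u + (1/2) * I (1 / real (Suc n))"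
    by (intro always_eventually allI step) auto
  ultimately have "(\<integral>x. w x * \<theta> x \<partial>nu) \<le> f1 ?v - f1 u + (1/2) * I 0" by (rule tendsto_lowerbound) simp
  moreover have "I 0 = (\<integral>w. grad \<theta> w * Psi u w \<partial>M2)"
    unfolding I_def Psi_def by (simp add: mult.commute mult.left_commute)
  ultimately show ?thesis using Psi_pairing(3)[OF ud(1,3) \<theta>(1,2)] by simp
qed

text \<open>Only bounded test functions can be paired with \<open>v2 u\<close> a priori.  Testing with signed indicators
  gives \<open>\<bar>w + v2 u\<bar> \<le> 1\<close>, and then \<open>v2 u\<close>, the sum of a square integrable and an
  integrable function, is itself square integrable.\<close>

lemma subdiff_opA:
  assumes s: "subdiff u w"
  shows "opA nu m p A B u w"
proof -
  note sd = subdiffD[OF s]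
  have ud: "u \<in> L2 nu" "fin1 u" "finp u" using sd(1) by (auto simp: dom_iff)
  note [measurable] = L2D(1)[OF ud(1)] L2D(1)[OF sd(3)] v2_meas[OF L2D(1)[OF ud(1)]]
  let ?s = "\<lambda>x. w x + v2 u x"
  obtain C :: "nat \<Rightarrow> 'a set" where C: "range C \<subseteq> sets nu" "(\<Union>i. C i) = space nu" "\<And>i. emeasure nu (C i) \<noteq> \<infinity>"
    using sigma_finite_measure.sigma_finite_incseq[OF sigma_finite_nu] by metis
  have Cs[measurable]: "C i \<in> sets nu" for i using C(1) by auto
  \<comment> \<open>\<sigma> is a sign. The test function is \<sigma> times the indicator of the set
    where the bound fails inside a piece of finite measure; \<open>fin1_L1\<close> bounds its
    variation by the measure of that set, which must therefore be null.\<close>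
  have half: "AE x in nu. \<sigma> * ?s x \<le> 1" if \<sigma>: "\<bar>\<sigma>\<bar> = 1" for \<sigma>
  proof -
    have "AE x in nu. x \<in> C n \<longrightarrow> \<sigma> * ?s x \<le> 1" for n
    proof -
      define E where "E = {x\<in>space nu. x \<in> C n \<and> 1 < \<sigma> * ?s x}"
      have E[measurable]: "E \<in> sets nu" unfolding E_def by measurable
      have fE: "emeasure nu E < \<infinity>"
      proof (rule le_less_trans)
        show "emeasure nu E \<le> emeasure nu (C n)" by (rule emeasure_mono) (auto simp: E_def)
      qed (use C(3)[of n] in \<open>simp add: less_top\<close>)
      let ?\<theta> = "\<lambda>x. \<sigma> * indicator E x :: real"
      have i1: "integrable nu (indicat_real E)" using fE by (intro integrable_real_indicator) auto
      have ab: "\<bar>?\<theta> x\<bar> = indicator E x" for x using \<sigma> by (simp add: abs_mult)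
      have th1: "integrable nu ?\<theta>" using i1 by simp
      have "(?\<theta> x)\<^sup>2 = indicator E x" for x using \<sigma> by (simp add: power_mult_distrib indicator_def abs_square_eq_1)
      then have thL: "?\<theta> \<in> L2 nu" using i1 by (intro L2I) auto
      have thb: "\<bar>?\<theta> x\<bar> \<le> 1" for x unfolding ab by (simp add: indicator_def)
      note f = fin1_L1[OF th1]
      have "f1 u + (\<integral>x. w x * ?\<theta> x \<partial>nu) + (\<integral>x. ?\<theta> x * v2 u x \<partial>nu) \<le> f1 (\<lambda>x. u x + ?\<theta> x)"
        by (rule subdiff_directional[OF s thL thb f(1)])
      also have "\<dots> \<le> f1 u + f1 ?\<theta>" using fin1_lincomb(2)[OF ud(1,2) thL f(1), of 1 1] by simp
      also have "f1 ?\<theta> \<le> (\<integral>x. indicator E x \<partial>nu)" using f(2) unfolding ab .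
      finally have 1: "(\<integral>x. w x * ?\<theta> x \<partial>nu) + (\<integral>x. ?\<theta> x * v2 u x \<partial>nu) \<le> (\<integral>x. indicator E x \<partial>nu)" by simp
      have iw: "integrable nu (\<lambda>x. w x * ?\<theta> x)" by (rule L2_mult_integrable[OF sd(3) thL])
      have iv: "integrable nu (\<lambda>x. ?\<theta> x * v2 u x)" by (rule Psi_pairing(2)[OF ud(1,3) thL thb])
      let ?k = "\<lambda>x. w x * ?\<theta> x + ?\<theta> x * v2 u x - indicator E x"
      have k_eq: "?k x = indicator E x * (\<sigma> * ?s x - 1)" for x by (simp add: algebra_simps)
      have k0: "0 \<le> ?k x" for x unfolding k_eq by (auto simp: indicator_def E_def)
      have ki: "integrable nu ?k" by (intro Bochner_Integration.integrable_diff Bochner_Integration.integrable_add iw iv i1)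
      have "(\<integral>x. ?k x \<partial>nu) = (\<integral>x. w x * ?\<theta> x \<partial>nu) + (\<integral>x. ?\<theta> x * v2 u x \<partial>nu) - (\<integral>x. indicator E x \<partial>nu)"
        unfolding Bochner_Integration.integral_diff[OF Bochner_Integration.integrable_add[OF iw iv] i1] Bochner_Integration.integral_add[OF iw iv] ..
      moreover have "0 \<le> (\<integral>x. ?k x \<partial>nu)" by (intro integral_nonneg_AE AE_I2 k0)
      ultimately have "(\<integral>x. ?k x \<partial>nu) = 0" using 1 by linarith
      then have "AE x in nu. ?k x = 0" using integral_nonneg_eq_0_iff_AE[OF ki] k0 by simp
      then show ?thesis using AE_space unfolding k_eq
        by eventually_elim (auto simp: E_def indicator_def)
    qed
    then have "AE x in nu. \<forall>n. x \<in> C n \<longrightarrow> \<sigma> * ?s x \<le> 1" by (intro AE_all_countable[THEN iffD2] allI)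
    then show ?thesis using AE_space
    proof eventually_elim
      case (elim x)
      then obtain n where "x \<in> C n" using C(2) by auto
      then show ?case using elim by blast
    qed
  qed
  have sb: "AE x in nu. \<bar>?s x\<bar> \<le> 1"
    using half[of 1] half[of "-1"] by (auto elim: eventually_elim2)
  obtain \<alpha> \<beta> where \<alpha>: "\<alpha> \<in> L2 nu" and \<beta>: "integrable nu \<beta>"
    and ab: "AE x in nu. 0 \<le> \<beta> x \<and> \<bar>v2 u x\<bar> \<le> \<alpha> x + \<beta> x"
    using v2_bound[OF ud(1,3)] by blast
  have v2L: "v2 u \<in> L2 nu"
  proof (rule L2_bound)
    \<comment> \<open>Where \<beta> \<le> 1 its square is at most \<beta>; where \<beta> > 1 the
      bound |v2 u| \<le> |w| + 1 applies and the constant 2 that it leaves is absorbed by 2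
      \<beta>.\<close>
    show "integrable nu (\<lambda>x. 2 * (\<alpha> x)\<^sup>2 + 2 * (w x)\<^sup>2 + 2 * \<beta> x)"
      using L2D(2)[OF \<alpha>] L2D(2)[OF sd(3)] \<beta> by simp
    show "AE x in nu. (v2 u x)\<^sup>2 \<le> 2 * (\<alpha> x)\<^sup>2 + 2 * (w x)\<^sup>2 + 2 * \<beta> x"
      using ab sb
    proof eventually_elim
      case (elim x)
      have sq: "(r + t)\<^sup>2 \<le> 2 * r\<^sup>2 + 2 * t\<^sup>2" for r t :: real
        using zero_le_power2[of "r - t"] by (simp add: power2_eq_square algebra_simps)
      show ?case
      proof (cases "\<beta> x \<le> 1")
        case True
        have "\<bar>v2 u x\<bar>\<^sup>2 \<le> (\<alpha> x + \<beta> x)\<^sup>2" using elim(1) by (intro power_mono) auto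
        also have "\<dots> \<le> 2 * (\<alpha> x)\<^sup>2 + 2 * (\<beta> x)\<^sup>2" by (rule sq)
        also have "(\<beta> x)\<^sup>2 \<le> \<beta> x" using True elim(1) mult_left_le[of "\<beta> x" "\<beta> x"] by (simp add: power2_eq_square)
        finally show ?thesis using zero_le_power2[of "w x"] unfolding power2_abs by linarith
      next
        case False
        have "\<bar>v2 u x\<bar> \<le> \<bar>w x\<bar> + 1" using elim(2) by linarith
        then have "\<bar>v2 u x\<bar>\<^sup>2 \<le> (\<bar>w x\<bar> + 1)\<^sup>2" by (intro power_mono) auto
        also have "\<dots> \<le> 2 * (w x)\<^sup>2 + 2" using sq[of "\<bar>w x\<bar>" 1] by simp
        finally show ?thesis using False zero_le_power2[of "\<alpha> x"] unfolding power2_abs by linarith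
      qed
    qed
  qed simp
  have sL: "?s \<in> L2 nu" by (intro L2_add sd v2L)
  have "Delta1 nu m A u (\<lambda>x. - ?s x)"
    unfolding Delta1_def
  proof (intro conjI ballI impI)
    show "(\<lambda>x. - ?s x) \<in> L2 nu" by (rule L2_uminus[OF sL])
    show "F1 nu m A u < \<infinity>" using F1_fin1(1)[OF ud(1)] ud(2) by simp
    fix \<xi> assume \<xi>L: "\<xi> \<in> L2 nu" and "F1 nu m A \<xi> < \<infinity>"
    then have \<xi>f: "fin1 \<xi>" using F1_fin1(1)[OF \<xi>L] by simp
    let ?d = "\<lambda>x. \<xi> x - u x"
    have dL: "?d \<in> L2 nu" by (intro L2_diff \<xi>L ud)
    have df: "fin1 ?d" using fin1_lincomb(1)[OF \<xi>L \<xi>f ud(1,2), of 1 "-1"] by simp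
    \<comment> \<open>The increment to \<xi> is truncated because the directional inequality is
      available for bounded directions. Clamping does not increase gradients, so dominated
      convergence removes the truncation on both sides.\<close>
    define t where "t n x = clamp (real n) (?d x)" for n x
    have tb: "\<bar>t n x\<bar> \<le> real n" "\<bar>t n x\<bar> \<le> \<bar>?d x\<bar>" for n x unfolding t_def by (rule clamp_props; simp)+
    have tm[measurable]: "t n \<in> borel_measurable nu" for n
      unfolding t_def[abs_def] by (rule measurable_compose[OF L2D(1)[OF dL] clamp_meas])
    have tL: "t n \<in> L2 nu" for n by (rule L2_dominated[OF dL tm]) (use tb in auto)
    have tg: "\<bar>grad (t n) z\<bar> \<le> \<bar>grad ?d z\<bar>" for n z
      unfolding grad_def t_def by (rule clamp_props(4)) simp
    have tf: "fin1 (t n)" for n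
      unfolding fin1_def
    proof (rule Bochner_Integration.integrable_bound)
      show "integrable M2 (\<lambda>z. ker A z * \<bar>grad ?d z\<bar>)" using df by (simp add: fin1_def)
      show "(\<lambda>z. ker A z * \<bar>grad (t n) z\<bar>) \<in> borel_measurable M2"
        unfolding meas_M2 using grad_meas[OF tm, of n] by measurable
      show "AE z in M2. norm (ker A z * \<bar>grad (t n) z\<bar>) \<le> norm (ker A z * \<bar>grad ?d z\<bar>)"
        using tg by (intro AE_I2) (simp add: abs_mult mult_left_mono)
    qed
    have ineq: "f1 u + (\<integral>x. ?s x * t n x \<partial>nu) \<le> f1 (\<lambda>x. u x + t n x)" for n
    proof -
      have "(\<integral>x. ?s x * t n x \<partial>nu) = (\<integral>x. w x * t n x \<partial>nu) + (\<integral>x. t n x * v2 u x \<partial>nu)"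
        using L2_mult_integrable[OF sd(3) tL, of n] L2_mult_integrable[OF tL v2L, of n]
        by (simp add: distrib_right mult.commute[of "v2 u _"])
      then show ?thesis using subdiff_directional[OF s tL tb(1) tf, of n] by simp
    qed
    have tlim: "(\<lambda>n. t n x) \<longlonglongrightarrow> ?d x" for x unfolding t_def by (rule clamp_tendsto)
    have lim1: "(\<lambda>n. \<integral>x. ?s x * t n x \<partial>nu) \<longlonglongrightarrow> (\<integral>x. ?s x * ?d x \<partial>nu)"
    proof (rule integral_dominated_convergence)
      show "integrable nu (\<lambda>x. \<bar>?s x\<bar> * \<bar>?d x\<bar>)" by (intro L2_mult_integrable L2_abs sL dL)
      show "AE x in nu. (\<lambda>n. ?s x * t n x) \<longlonglongrightarrow> ?s x * ?d x" by (intro AE_I2 tendsto_mult tendsto_const tlim)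
      show "AE x in nu. norm (?s x * t n x) \<le> \<bar>?s x\<bar> * \<bar>?d x\<bar>" for n
        unfolding real_norm_def abs_mult by (intro AE_I2 mult_left_mono tb) simp
    qed (use L2D(1)[OF sL] L2D(1)[OF dL] in measurable)
    have lim2: "(\<lambda>n. f1 (\<lambda>x. u x + t n x)) \<longlonglongrightarrow> f1 \<xi>"
      unfolding f1_def
    proof (rule tendsto_mult[OF tendsto_const], rule integral_dominated_convergence)
      show "integrable M2 (\<lambda>z. ker A z * \<bar>grad u z\<bar> + ker A z * \<bar>grad ?d z\<bar>)"
        using ud(2) df by (simp add: fin1_def)
      show "(\<lambda>z. ker A z * \<bar>grad \<xi> z\<bar>) \<in> borel_measurable M2"
        unfolding meas_M2 using grad_meas[OF L2D(1)[OF \<xi>L]] by measurable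
      show "(\<lambda>z. ker A z * \<bar>grad (\<lambda>x. u x + t n x) z\<bar>) \<in> borel_measurable M2" for n
        unfolding meas_M2 using grad_meas[OF L2D(1)[OF L2_add[OF ud(1) tL]], of n] by measurable
      show "AE z in M2. (\<lambda>n. ker A z * \<bar>grad (\<lambda>x. u x + t n x) z\<bar>) \<longlonglongrightarrow> ker A z * \<bar>grad \<xi> z\<bar>"
      proof (rule AE_I2)
        fix z
        have "(\<lambda>n. grad (\<lambda>x. u x + t n x) z) \<longlonglongrightarrow> (u (snd z) + ?d (snd z)) - (u (fst z) + ?d (fst z))"
          unfolding grad_def by (intro tendsto_intros tlim)
        then have "(\<lambda>n. grad (\<lambda>x. u x + t n x) z) \<longlonglongrightarrow> grad \<xi> z" by (simp add: grad_def)
        then show "(\<lambda>n. ker A z * \<bar>grad (\<lambda>x. u x + t n x) z\<bar>) \<longlonglongrightarrow> ker A z * \<bar>grad \<xi> z\<bar>"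
          by (intro tendsto_intros)
      qed
      show "AE z in M2. norm (ker A z * \<bar>grad (\<lambda>x. u x + t n x) z\<bar>) \<le> ker A z * \<bar>grad u z\<bar> + ker A z * \<bar>grad ?d z\<bar>" for n
      proof (rule AE_I2)
        fix z
        have "\<bar>grad (\<lambda>x. u x + t n x) z\<bar> \<le> \<bar>grad u z\<bar> + \<bar>grad (t n) z\<bar>"
          using abs_triangle_ineq[of "grad u z" "grad (t n) z"] by (simp add: grad_def)
        also have "\<dots> \<le> \<bar>grad u z\<bar> + \<bar>grad ?d z\<bar>" using tg[of n z] by simp
        finally have "ker A z * \<bar>grad (\<lambda>x. u x + t n x) z\<bar> \<le> ker A z * (\<bar>grad u z\<bar> + \<bar>grad ?d z\<bar>)"
          using ker_bounds(1) by (rule mult_left_mono)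
        then show "norm (ker A z * \<bar>grad (\<lambda>x. u x + t n x) z\<bar>) \<le> ker A z * \<bar>grad u z\<bar> + ker A z * \<bar>grad ?d z\<bar>"
          using ker_bounds(1)[of A z] by (simp add: distrib_left abs_mult)
      qed
    qed
    have "f1 u + (\<integral>x. ?s x * ?d x \<partial>nu) \<le> f1 \<xi>"
      by (rule LIMSEQ_le[OF tendsto_add[OF tendsto_const lim1] lim2]) (use ineq in blast)
    then show "(\<integral>x. - (- ?s x) * (\<xi> x - u x) \<partial>nu) \<le> enn2real (F1 nu m A \<xi>) - enn2real (F1 nu m A u)"
      unfolding minus_minus F1_fin1(2)[OF \<xi>L \<xi>f] F1_fin1(2)[OF ud(1,2)] by linarith
  qed (rule ud)
  moreover have "Deltap nu m p B u (v2 u)" using ud v2L by (simp add: Deltap_v2)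
  ultimately show ?thesis unfolding opA_def by (intro exI[of _ "\<lambda>x. - ?s x"] exI[of _ "v2 u"]) auto
qed

text \<open>The new points lie between the old ones and have the same sum, so convexity of the
  absolute value decides.\<close>

lemma abs_contract:
  fixes a b c :: real
  assumes "0 \<le> c \<and> c \<le> a - b \<or> a - b \<le> c \<and> c \<le> 0"
  shows "\<bar>a - c\<bar> + \<bar>b + c\<bar> \<le> \<bar>a\<bar> + \<bar>b\<bar>"
  using assms by (auto simp: abs_if)

text \<open>The subgradient inequalities are tested with u - l \<theta> and u' + l \<theta>, where
  \<theta> = q (u - u'). This moves the two gradients towards each other, which does not increase
  the sum of the two total variations.\<close>

lemma Delta1_accretive:
  assumes D: "Delta1 nu m A u v" and D': "Delta1 nu m A u' v'"
    and q: "\<And>r s. \<bar>q r - q s\<bar> \<le> L * \<bar>r - s\<bar>" "mono q" "q 0 = (0::real)"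
  shows "(\<integral>x. q (u x - u' x) * (v x - v' x) \<partial>nu) \<le> 0"
proof -
  have L: "0 \<le> L" using q(1)[of 1 0] by simp
  \<comment> \<open>Small enough for the gradient of l \<theta> to lie between 0 and the gradient of
    u - u', as \<open>abs_contract\<close> demands; the added 1 guards against L = 0.\<close>
  define l where "l = 1 / (L + 1)"
  have l: "0 < l" "l * L \<le> 1" using L by (auto simp: l_def field_simps)
  have uL: "u \<in> L2 nu" "u' \<in> L2 nu" "v \<in> L2 nu" "v' \<in> L2 nu"
    using D D' by (auto simp: Delta1_def)
  have uf: "fin1 u" "fin1 u'" using D D' F1_fin1(1) by (auto simp: Delta1_def)
  let ?\<theta> = "\<lambda>x. q (u x - u' x)"
  have \<theta>L: "?\<theta> \<in> L2 nu" by (rule L2_lipschitz(1)[OF q(1,3) L2_diff[OF uL(1,2)]])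
  let ?a = "\<lambda>x. u x - l * ?\<theta> x" and ?b = "\<lambda>x. u' x + l * ?\<theta> x"
  have abL: "?a \<in> L2 nu" "?b \<in> L2 nu" by (intro L2_diff L2_add L2_scale uL \<theta>L)+
  have gle: "\<bar>grad ?a w\<bar> + \<bar>grad ?b w\<bar> \<le> \<bar>grad u w\<bar> + \<bar>grad u' w\<bar>" for w
  proof -
    let ?c = "l * grad ?\<theta> w"
    let ?r = "u (snd w) - u' (snd w)" and ?s = "u (fst w) - u' (fst w)"
    have d: "grad u w - grad u' w = ?r - ?s" by (simp add: grad_def)
    have lq: "l * \<bar>q ?r - q ?s\<bar> \<le> \<bar>?r - ?s\<bar>"
    proof -
      have "l * \<bar>q ?r - q ?s\<bar> \<le> l * (L * \<bar>?r - ?s\<bar>)" using l by (intro mult_left_mono q) auto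
      also have "\<dots> \<le> 1 * \<bar>?r - ?s\<bar>" unfolding mult.assoc[symmetric] by (intro mult_right_mono l) simp
      finally show ?thesis by simp
    qed
    have "0 \<le> ?c \<and> ?c \<le> ?r - ?s \<or> ?r - ?s \<le> ?c \<and> ?c \<le> 0"
    proof (cases "?s \<le> ?r")
      case True
      then have "0 \<le> q ?r - q ?s" using monoD[OF q(2) True] by simp
      then have "0 \<le> l * (q ?r - q ?s)" "l * (q ?r - q ?s) \<le> ?r - ?s" using l lq True by auto
      then show ?thesis by (simp add: grad_def)
    next
      case False
      then have le: "?r \<le> ?s" by simp
      have n: "0 \<le> q ?s - q ?r" using monoD[OF q(2) le] by simp
      have "l * (q ?s - q ?r) \<le> ?s - ?r" using lq le n by (simp add: abs_minus_commute[of "q ?r"] abs_minus_commute[of ?r])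
      moreover have "0 \<le> l * (q ?s - q ?r)" using l n by simp
      moreover have "?c = - (l * (q ?s - q ?r))" by (simp add: grad_def algebra_simps)
      ultimately show ?thesis by linarith
    qed
    then have "\<bar>grad u w - ?c\<bar> + \<bar>grad u' w + ?c\<bar> \<le> \<bar>grad u w\<bar> + \<bar>grad u' w\<bar>"
      by (intro abs_contract) (simp only: d)
    moreover have "grad ?a w = grad u w - ?c" "grad ?b w = grad u' w + ?c" by (simp_all add: grad_def algebra_simps)
    ultimately show ?thesis by simp
  qed
  have I: "integrable M2 (\<lambda>w. ker A w * \<bar>grad u w\<bar> + ker A w * \<bar>grad u' w\<bar>)" using uf by (simp add: fin1_def)
  have le: "ker A w * \<bar>grad ?a w\<bar> + ker A w * \<bar>grad ?b w\<bar> \<le> ker A w * \<bar>grad u w\<bar> + ker A w * \<bar>grad u' w\<bar>" for w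
    using mult_left_mono[OF gle ker_bounds(1)[of A w]] by (simp add: distrib_left)
  have nn: "0 \<le> ker A w * \<bar>grad h w\<bar>" for h w using ker_bounds(1)[of A w] by simp
  have fab: "fin1 ?a" "fin1 ?b"
  proof -
    have bd: "fin1 h" if h: "h \<in> L2 nu" and le: "\<And>w. ker A w * \<bar>grad h w\<bar> \<le> ker A w * \<bar>grad u w\<bar> + ker A w * \<bar>grad u' w\<bar>" for h
      unfolding fin1_def
    proof (rule Bochner_Integration.integrable_bound[OF I])
      show "(\<lambda>w. ker A w * \<bar>grad h w\<bar>) \<in> borel_measurable M2" unfolding meas_M2 using grad_meas[OF L2D(1)[OF h]] by measurable
      show "AE w in M2. norm (ker A w * \<bar>grad h w\<bar>) \<le> norm (ker A w * \<bar>grad u w\<bar> + ker A w * \<bar>grad u' w\<bar>)"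
        using le nn by (intro AE_I2) (simp only: real_norm_def abs_of_nonneg add_nonneg_nonneg)
    qed
    show "fin1 ?a"
    proof (rule bd[OF abL(1)])
      show "ker A w * \<bar>grad ?a w\<bar> \<le> ker A w * \<bar>grad u w\<bar> + ker A w * \<bar>grad u' w\<bar>" for w
        using le[of w] nn[of w ?b] by linarith
    qed
    show "fin1 ?b"
    proof (rule bd[OF abL(2)])
      show "ker A w * \<bar>grad ?b w\<bar> \<le> ker A w * \<bar>grad u w\<bar> + ker A w * \<bar>grad u' w\<bar>" for w
        using le[of w] nn[of w ?a] by linarith
    qed
  qed
  have sum: "f1 ?a + f1 ?b \<le> f1 u + f1 u'"
  proof -
    have "(\<integral>w. ker A w * \<bar>grad ?a w\<bar> + ker A w * \<bar>grad ?b w\<bar> \<partial>M2) \<le> (\<integral>w. ker A w * \<bar>grad u w\<bar> + ker A w * \<bar>grad u' w\<bar> \<partial>M2)"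
      by (rule integral_mono[OF _ I le]) (use fab in \<open>simp add: fin1_def\<close>)
    then show ?thesis using fab uf unfolding f1_def by (simp add: fin1_def)
  qed
  have test: "(\<integral>x. - v x * (h x - u x) \<partial>nu) \<le> f1 h - f1 u"
    if "Delta1 nu m A u v" "fin1 u" "h \<in> L2 nu" "fin1 h" for u v h
  proof -
    have "u \<in> L2 nu" using that(1) by (simp add: Delta1_def)
    moreover have "F1 nu m A h < \<infinity>" using F1_fin1(1)[OF that(3)] that(4) by simp
    ultimately show ?thesis
      using that F1_fin1(2)[OF that(3,4)] F1_fin1(2)[of u] unfolding Delta1_def by force
  qed
  have tst: "(\<integral>x. - v x * (?a x - u x) \<partial>nu) \<le> f1 ?a - f1 u" "(\<integral>x. - v' x * (?b x - u' x) \<partial>nu) \<le> f1 ?b - f1 u'"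
    by (rule test[OF D uf(1) abL(1) fab(1)], rule test[OF D' uf(2) abL(2) fab(2)])
  have "(\<integral>x. - v x * (?a x - u x) \<partial>nu) = (\<integral>x. l * (?\<theta> x * v x) \<partial>nu)"
    by (intro Bochner_Integration.integral_cong refl) (simp add: algebra_simps)
  moreover have "(\<integral>x. - v' x * (?b x - u' x) \<partial>nu) = (\<integral>x. (- l) * (?\<theta> x * v' x) \<partial>nu)"
    by (intro Bochner_Integration.integral_cong refl) (simp add: algebra_simps)
  ultimately have "l * (\<integral>x. ?\<theta> x * v x \<partial>nu) - l * (\<integral>x. ?\<theta> x * v' x \<partial>nu) \<le> 0"
    using tst sum by (simp only: integral_mult_right_zero)
  then have "l * ((\<integral>x. ?\<theta> x * v x \<partial>nu) - (\<integral>x. ?\<theta> x * v' x \<partial>nu)) \<le> 0" by (simp add: right_diff_distrib)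
  moreover have "(\<integral>x. ?\<theta> x * (v x - v' x) \<partial>nu) = (\<integral>x. ?\<theta> x * v x \<partial>nu) - (\<integral>x. ?\<theta> x * v' x \<partial>nu)"
    using L2_mult_integrable[OF \<theta>L uL(3)] L2_mult_integrable[OF \<theta>L uL(4)] by (simp add: right_diff_distrib)
  ultimately show ?thesis using l by (simp add: mult_le_0_iff)
qed

text \<open>After symmetrization the integrand is \<open>ker B\<close> times two differences, of q
  (u - u') between the end points and of \<open>psi p\<close> between the two gradients. Wherever
  the gradient of u - u' is nonzero, neither difference can have the opposite sign to it.\<close>

lemma Deltap_accretive:
  assumes D: "Deltap nu m p B u v" and D': "Deltap nu m p B u' v'"
    and q: "\<And>r s. \<bar>q r - q s\<bar> \<le> L * \<bar>r - s\<bar>" "mono q" "q 0 = (0::real)" "\<And>r. \<bar>q r\<bar> \<le> C"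
  shows "(\<integral>x. q (u x - u' x) * (v x - v' x) \<partial>nu) \<le> 0"
proof -
  have u: "u \<in> L2 nu" "finp u" "v \<in> L2 nu" "AE x in nu. v x = v2 u x"
    and u': "u' \<in> L2 nu" "finp u'" "v' \<in> L2 nu" "AE x in nu. v' x = v2 u' x"
    using D D' by (auto simp: Deltap_v2)
  let ?\<theta> = "\<lambda>x. q (u x - u' x)"
  have \<theta>L: "?\<theta> \<in> L2 nu" by (rule L2_lipschitz(1)[OF q(1,3) L2_diff[OF u(1) u'(1)]])
  note P = Psi_pairing[OF u(1,2) \<theta>L q(4)] and P' = Psi_pairing[OF u'(1,2) \<theta>L q(4)]
  have "(\<integral>x. ?\<theta> x * (v x - v' x) \<partial>nu) = (\<integral>x. ?\<theta> x * v2 u x - ?\<theta> x * v2 u' x \<partial>nu)"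
  proof (rule integral_cong_AE)
    show "(\<lambda>x. ?\<theta> x * (v x - v' x)) \<in> borel_measurable nu"
      by (intro borel_measurable_times borel_measurable_diff L2D(1) \<theta>L u u')
    show "(\<lambda>x. ?\<theta> x * v2 u x - ?\<theta> x * v2 u' x) \<in> borel_measurable nu" using P(2) P'(2) by simp
    show "AE x in nu. ?\<theta> x * (v x - v' x) = ?\<theta> x * v2 u x - ?\<theta> x * v2 u' x"
      using u(4) u'(4) by eventually_elim (simp add: right_diff_distrib)
  qed
  also have "\<dots> = (\<integral>x. ?\<theta> x * v2 u x \<partial>nu) - (\<integral>x. ?\<theta> x * v2 u' x \<partial>nu)" using P(2) P'(2) by simp
  also have "\<dots> = - (1/2) * (\<integral>w. grad ?\<theta> w * Psi u w - grad ?\<theta> w * Psi u' w \<partial>M2)"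
    unfolding P(3) P'(3) Bochner_Integration.integral_diff[OF P(1) P'(1)] by (simp add: diff_divide_distrib)
  also have "\<dots> \<le> 0"
  proof -
    have "0 \<le> grad ?\<theta> w * Psi u w - grad ?\<theta> w * Psi u' w" for w
    proof -
      let ?r = "u (snd w) - u' (snd w)" and ?s = "u (fst w) - u' (fst w)"
      let ?a = "grad u w" and ?b = "grad u' w"
      have d: "?a - ?b = ?r - ?s" by (simp add: grad_def)
      have pm: "0 \<le> (psi p ?a - psi p ?b) * (?a - ?b)" by (rule psi_monotone[OF p])
      have "0 \<le> (q ?r - q ?s) * (psi p ?a - psi p ?b)"
      proof (cases ?r ?s rule: linorder_cases)
        case equal then show ?thesis by simp
      next
        case less
        then have "psi p ?a - psi p ?b \<le> 0" using pm d by (auto simp: zero_le_mult_iff)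
        moreover have "q ?r - q ?s \<le> 0" using monoD[OF q(2) less_imp_le[OF less]] by simp
        ultimately show ?thesis by (rule mult_nonpos_nonpos[rotated])
      next
        case greater
        then have "0 \<le> psi p ?a - psi p ?b" using pm d by (auto simp: zero_le_mult_iff)
        moreover have "0 \<le> q ?r - q ?s" using monoD[OF q(2) less_imp_le[OF greater]] by simp
        ultimately show ?thesis by simp
      qed
      then have "0 \<le> ker B w * ((q ?r - q ?s) * (psi p ?a - psi p ?b))" using ker_bounds(1) by simp
      also have "\<dots> = grad ?\<theta> w * Psi u w - grad ?\<theta> w * Psi u' w"
        by (simp add: Psi_def grad_def[of ?\<theta>] algebra_simps)
      finally show ?thesis .
    qed
    then show ?thesis by (simp add: integral_nonneg_AE)
  qed
  finally show ?thesis .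
qed

lemma opA_completely_accretive: "completely_accretive nu (opA nu m p A B)"
  unfolding completely_accretive_def
proof (intro allI impI)
  fix u w u' w' and q :: "real \<Rightarrow> real" and L C
  assume "opA nu m p A B u w" "opA nu m p A B u' w'" and q: "\<forall>r s. \<bar>q r - q s\<bar> \<le> L * \<bar>r - s\<bar>" "mono q" "\<forall>r. \<bar>q r\<bar> \<le> C" "q 0 = 0"
  then obtain a b a' b' where D: "Delta1 nu m A u a" "Deltap nu m p B u b" "AE x in nu. w x = - a x - b x"
    and D': "Delta1 nu m A u' a'" "Deltap nu m p B u' b'" "AE x in nu. w' x = - a' x - b' x"
    unfolding opA_def by blast
  have L2s: "u \<in> L2 nu" "u' \<in> L2 nu" "a \<in> L2 nu" "b \<in> L2 nu" "a' \<in> L2 nu" "b' \<in> L2 nu"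
    using D D' by (auto simp: Delta1_def Deltap_def)
  let ?\<theta> = "\<lambda>x. q (u x - u' x)"
  have \<theta>L: "?\<theta> \<in> L2 nu" using q by (intro L2_lipschitz(1)[of q L] L2_diff L2s) auto
  have ia: "integrable nu (\<lambda>x. ?\<theta> x * (a x - a' x))" and ib: "integrable nu (\<lambda>x. ?\<theta> x * (b x - b' x))"
    by (intro L2_mult_integrable \<theta>L L2_diff L2s)+
  have neg: "(\<integral>x. ?\<theta> x * (a x - a' x) \<partial>nu) \<le> 0" "(\<integral>x. ?\<theta> x * (b x - b' x) \<partial>nu) \<le> 0"
    using Delta1_accretive[OF D(1) D'(1), of q L] Deltap_accretive[OF D(2) D'(2), of q L C] q by auto
  have ae: "AE x in nu. ?\<theta> x * (w x - w' x) = - (?\<theta> x * (a x - a' x)) - ?\<theta> x * (b x - b' x)"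
    using D(3) D'(3)
  proof eventually_elim
    case (elim x)
    show ?case unfolding elim by (simp add: algebra_simps)
  qed
  have R: "0 \<le> (\<integral>x. - (?\<theta> x * (a x - a' x)) - ?\<theta> x * (b x - b' x) \<partial>nu)" using ia ib neg by simp
  \<comment> \<open>\<open>opA\<close> fixes \<open>w\<close> only almost everywhere, so the
    integrand may fail to be measurable; the integral is then 0 by convention and the claim still
    holds.\<close>
  show "0 \<le> (\<integral>x. ?\<theta> x * (w x - w' x) \<partial>nu)"
  proof (cases "(\<lambda>x. ?\<theta> x * (w x - w' x)) \<in> borel_measurable nu")
    case True
    have "(\<integral>x. ?\<theta> x * (w x - w' x) \<partial>nu) = (\<integral>x. - (?\<theta> x * (a x - a' x)) - ?\<theta> x * (b x - b' x) \<partial>nu)"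
      by (rule integral_cong_AE[OF True _ ae]) (use ia ib in auto)
    then show ?thesis using R by simp
  next
    case False
    then have "\<not> integrable nu (\<lambda>x. ?\<theta> x * (w x - w' x))" by auto
    then show ?thesis by (simp add: not_integrable_integral_eq)
  qed
qed

end

section \<open>Strong solutions\<close>

lemma strong_solution_mono:
  assumes s: "strong_solution nu A1 T u0 f u" and le: "\<And>u w. A1 u w \<Longrightarrow> A2 u w"
  shows "strong_solution nu A2 T u0 f u"
proof -
  have "AE t in lborel. t \<in> {0<..<T} \<longrightarrow> v t \<in> L2 nu \<and> A2 (u t) (\<lambda>x. f t x - v t x)"
    if "AE t in lborel. t \<in> {0<..<T} \<longrightarrow> v t \<in> L2 nu \<and> A1 (u t) (\<lambda>x. f t x - v t x)" for v
    using that by eventually_elim (use le in blast)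
  then show ?thesis using s unfolding strong_solution_def by blast
qed

section \<open>Uniqueness of strong solutions\<close>

lemma Lr_norm_zero: "Lr_norm M 1 (pos_part (\<lambda>x. 0)) = 0"
  by (simp add: Lr_norm_def pos_part_def one_ereal_def)

lemma Lr_norm_one_zero_AE:
  assumes h: "h \<in> borel_measurable M" and zero: "Lr_norm M 1 (pos_part h) = 0"
  shows "AE x in M. h x \<le> 0"
proof -
  let ?I = "\<integral>\<^sup>+x. ennreal (max (h x) 0) \<partial>M"
  have "Lr_norm M 1 (pos_part h) = (if ?I = \<infinity> then \<infinity> else ennreal (enn2real ?I))"
    by (simp add: Lr_norm_def pos_part_def one_ereal_def Let_def)
  with zero have "?I = 0" by (auto simp: enn2real_eq_0_iff split: if_splits)
  then have "AE x in M. ennreal (max (h x) 0) = 0"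
    using nn_integral_0_iff_AE[of "\<lambda>x. ennreal (max (h x) 0)" M] h by simp
  then show ?thesis by eventually_elim (auto simp: ennreal_eq_0_iff)
qed

text \<open>The estimate with r = 1 is used with the two solutions in both orders; both positive
  parts have norm zero, which gives equality almost everywhere.\<close>

lemma (in time_space) strong_solution_unique:
  assumes acc: "completely_accretive nu Aop"
    and sol: "strong_solution nu Aop T u0 f u" "strong_solution nu Aop T u0 f u'"
    and f: "f \<in> L2_time nu T" and u0: "u0 \<in> L2 nu" and t: "0 \<le> t" "t \<le> T"
  shows "AE x in nu. u' t x = u t x"
proof -
  have zero: "AE x in nu. u t x - u' t x \<le> 0"
    if "strong_solution nu Aop T u0 f u" "strong_solution nu Aop T u0 f u'" for u u'
  proof (rule Lr_norm_one_zero_AE)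
    have "u t \<in> L2 nu" "u' t \<in> L2 nu" using that t by (auto simp: strong_solution_def)
    then show "(\<lambda>x. u t x - u' t x) \<in> borel_measurable nu" by (intro L2D(1) L2_diff)
    show "Lr_norm nu 1 (pos_part (\<lambda>x. u t x - u' t x)) = 0"
      using Lr_contraction[OF acc that f f u0 u0 t, of 1] by (simp add: Lr_norm_zero)
  qed
  show ?thesis using zero[OF sol] zero[OF sol(2,1)] by eventually_elim simp
qed

text \<open>Every property holds almost everywhere and every integral vanishes, so the operator
  relates \<open>u\<close> to all functions; the constant curve then solves every problem on an
  empty space.\<close>

lemma opA_empty_space:
  assumes e: "space nu = {}" and u: "u \<in> L2 nu"
  shows "opA nu m p A B u w"
proof -
  have AE: "AE x in nu. P x" for P by (rule AE_I2) (simp add: e)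
  have F1: "F1 nu m A v = 0" for v by (simp add: F1_def nn_integral_empty[OF e])
  have int: "(\<integral>x. h x \<partial>nu) = 0" for h :: "'a \<Rightarrow> real" by (rule integral_eq_zero_AE[OF AE])
  have z: "(\<lambda>_. 0) \<in> L2 nu" by (simp add: L2_def)
  have "Delta1 nu m A u (\<lambda>_. 0)" using u z by (simp add: Delta1_def F1)
  moreover have "Deltap nu m p B u (\<lambda>_. 0)" using u z AE by (simp add: Deltap_def nn_integral_empty[OF e])
  ultimately show ?thesis unfolding opA_def using AE by blast
qed

lemma strong_solution_empty_space:
  assumes e: "space nu = {}" and u0: "u0 \<in> L2 nu"
  shows "strong_solution nu (opA nu m p A B) T u0 f (\<lambda>_. u0)"
  unfolding strong_solution_def
proof (intro conjI exI[of _ "\<lambda>_ _. 0"])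
  show "AE t in lborel. t \<in> {0<..<T} \<longrightarrow> (\<lambda>_. 0) \<in> L2 nu \<and> opA nu m p A B u0 (\<lambda>x. f t x - 0)"
    using opA_empty_space[OF e u0] by (simp add: L2_def)
qed (use u0 in \<open>auto simp: L2_norm_def\<close>)

theorem theorem4p4:
  fixes nu :: "'a measure" and m :: "'a \<Rightarrow> 'a measure"
    and S A B :: "'a \<Rightarrow> 'a set" and p T :: real
  assumes rws: "random_walk_space nu m" and rev: "reversible nu m"
    and p: "p > 1"
    and supp: "\<And>x. x \<in> space nu \<Longrightarrow> S x \<in> sets nu \<and> emeasure (m x) (space nu - S x) = 0"
    and A_meas: "{(x, y). x \<in> space nu \<and> y \<in> A x} \<in> sets (nu \<Otimes>\<^sub>M nu)"
    and B_meas: "{(x, y). x \<in> space nu \<and> y \<in> B x} \<in> sets (nu \<Otimes>\<^sub>M nu)"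
    and AB: "\<And>x. x \<in> space nu \<Longrightarrow>
        A x \<in> sets nu \<and> B x \<in> sets nu \<and> A x \<subseteq> S x \<and> B x \<subseteq> S x \<and> A x \<union> B x = S x \<and>
        emeasure (m x) (A x) > 0 \<and> emeasure (m x) (B x) > 0"
    and finite_or: "emeasure nu (space nu) < \<infinity> \<or> (emeasure nu (space nu) = \<infinity> \<and> p \<ge> 2)"
    and T: "T > 0"
  shows "(\<forall>u0 f. u0 \<in> L2 nu \<and> f \<in> L2_time nu T \<longrightarrow>
            (\<exists>u. strong_solution nu (opA nu m p A B) T u0 f u \<and>
               (\<forall>u'. strong_solution nu (opA nu m p A B) T u0 f u' \<longrightarrow>
                  (\<forall>t\<in>{0..T}. AE x in nu. u' t x = u t x)))) \<and>
         (\<forall>u0 u0' f f' u u'.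
            u0 \<in> L2 nu \<and> u0' \<in> L2 nu \<and> f \<in> L2_time nu T \<and> f' \<in> L2_time nu T \<and>
            strong_solution nu (opA nu m p A B) T u0 f u \<and>
            strong_solution nu (opA nu m p A B) T u0' f' u' \<longrightarrow>
            (\<forall>t\<in>{0..T}. \<forall>r::ereal. 1 \<le> r \<longrightarrow>
               Lr_norm nu r (pos_part (\<lambda>x. u t x - u' t x))
                 \<le> Lr_norm nu r (pos_part (\<lambda>x. u0 x - u0' x))
                   + (\<integral>\<^sup>+s\<in>{0..t}. Lr_norm nu r (pos_part (\<lambda>x. f s x - f' s x)) \<partial>lborel)))"
proof -
  let ?A = "opA nu m p A B"
  have ker: "m \<in> nu \<rightarrow>\<^sub>M prob_algebra nu" and "sigma_finite_measure nu"
    using rws by (auto simp: random_walk_space_def)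
  then interpret time_space nu by (simp add: time_space_def)
  have acc: "completely_accretive nu ?A"
    and ex: "\<exists>u. strong_solution nu ?A T u0 f u" if "u0 \<in> L2 nu" "f \<in> L2_time nu T" for u0 f
  proof -
    have "completely_accretive nu ?A \<and> (\<forall>u0\<in>L2 nu. \<forall>f\<in>L2_time nu T. \<exists>u. strong_solution nu ?A T u0 f u)"
    proof (cases "space nu = {}")
      case True
      have "(\<integral>x. h x \<partial>nu) = 0" for h :: "'a \<Rightarrow> real"
        by (rule integral_eq_zero_AE[OF AE_I2]) (simp add: True)
      then have "completely_accretive nu ?A" by (simp add: completely_accretive_def)
      then show ?thesis using strong_solution_empty_space[OF True] by blast
    next
      case False
      interpret random_walk nu m A B p
        by unfold_locales (use False ker rev p A_meas B_meas finite_or in auto)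
      show ?thesis
        using opA_completely_accretive gradient_flow_exists[OF _ _ T] subdiff_opA
        by (blast intro: strong_solution_mono)
    qed
    then show "completely_accretive nu ?A" "\<exists>u. strong_solution nu ?A T u0 f u" using that by blast+
  qed
  show ?thesis
  proof (intro conjI allI impI)
    fix u0 f assume H: "u0 \<in> L2 nu \<and> f \<in> L2_time nu T"
    then obtain u where u: "strong_solution nu ?A T u0 f u" using ex by blast
    moreover have "AE x in nu. u' t x = u t x" if "strong_solution nu ?A T u0 f u'" "t \<in> {0..T}" for u' t
      by (rule strong_solution_unique[OF acc u that(1)]) (use H that(2) in auto)
    ultimately show "\<exists>u. strong_solution nu ?A T u0 f u \<and>
        (\<forall>u'. strong_solution nu ?A T u0 f u' \<longrightarrow> (\<forall>t\<in>{0..T}. AE x in nu. u' t x = u t x))" by blast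
  qed (rule ballI, rule allI, rule impI, rule Lr_contraction[OF acc], auto)
qed

end
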